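(* The ring $\mathrm{Gr}^{\mathrm{st}_B}(D(B))$ is generated by $\mathbf{v}_\zeta^{\mathrm{st}_B}$ and $\mathbf{m}_2^{\mathrm{st}_B}$. Moreover, $$\mathrm{Gr}^{\mathrm{st}_B}(D(B))=\bigoplus_{\lambda\in[\Lambda^\#(d)/\iota]}\mathbb{Z}\,\mathbf{m}_\lambda^{\mathrm{st}_B},$$ and $\mathrm{Gr}^{\mathrm{st}_B}(D(B))$ is a free $\mathbb{Z}$-module of rank $d(d-1)/2$.
   Context: Fix an integer $d\ge 2$ and a primitive $d$-th root of unity $\zeta\in\mathbb{C}$; $(n)_\xi=1+\xi+\cdots+\xi^{n-1}$. $D(B)$ (the Drinfeld double of the Taft algebra $B$) is the $\mathbb{C}$-algebra with generators $E,F,K,z$ and relations $K^d=z^d=1$, $E^d=F^d=0$, $z$ central, $KE=\zeta EK$, $KF=\zeta^{-1}FK$, $[E,F]=K-zK^{-1}$. It is a (braided) Hopf algebra with $\Delta(K)=K\otimes K$, $\Delta(z)=z\otimes z$, $\Delta(E)=1\otimes E+E\otimes K$, $\Delta(F)=F\otimes 1+zK^{-1}\otimes F$, $\varepsilon(K)=\varepsilon(z)=1$, $\varepsilon(E)=\varepsilon(F)=0$. $B$ is the Hopf subalgebra generated by $E,K$. Modules are finite-dimensional left modules. For $1\le l\le d$, $p\in\mathbb{Z}/d\mathbb{Z}$, $M_{l,p}$ is the simple module with basis $e_1,\dots,e_l$, $z=\zeta^{2p+l-1}\mathrm{Id}$, $Ke_i=\zeta^{p+l-i}e_i$, $Fe_i=e_{i+1}$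 ($Fe_l=0$), $Ee_1=0$, $Ee_{i+1}=\zeta^p(i)_\zeta(\zeta^{l-i}-1)e_i$. These are all the simple $D(B)$-modules, without repetition. $\Lambda(d)=\mathbb{Z}/d\mathbb{Z}\times\mathbb{Z}/d\mathbb{Z}$ is identified with $\{1,\dots,d\}\times\mathbb{Z}/d\mathbb{Z}$, so $M_\lambda$ is defined for $\lambda\in\Lambda(d)$; $\Lambda^\#(d)=\{(l,p)\in\Lambda(d):l\neq0\}$; $\iota(l,p)=(-l,p+l)$ is an involution; $[\Lambda^\#(d)/\iota]$ is a set of representatives of $\iota$-orbits in $\Lambda^\#(d)$. $D(B)\text{-stab}$ is the stable category of $D(B)$ (finite-dimensional modules modulo projectives), a triangulated monoidal category. $D(B)\text{-proj}_B$ is the full subcategory of $D(B)$-modules whose restriction to $B$ is projective; its image in $D(B)\text{-stab}$ is a thick triangulated subcategory and a tensor ideal. $D(B)\text{-stab}_B$ is the (Verdier) quotient of $D(B)\text{-stab}$ by this image, a triangulated category with a compatible monoidal structure, and $\mathrm{Gr}^{\mathrm{st}_B}(D(B))$ is its Grothendieck ring as a triangulated category. There is a surjective ring morphism $\mathrm{Gr}(D(B))\to\mathrm{Gr}^{\mathrm{st}_B}(D(B))$, $\mathbf{m}\mapsto\mathbf{m}^{\mathrm{st}_B}$, from the Grothendieck ring of finite-dimensional $D(B)$-modules. Put $\mathbf{m}_\lambda=[M_\lambda]$, $\mathbf{m}_2=[M_{2,0}]$, and $\mathbf{v}_\zeta=[M_{1,1}]$ (the class of the one-dimensional module on which $K\mapsto\zeta$,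 $z\mapsto\zeta^2$, $E,F\mapsto0$). *)

theory Defs
  imports
    "HOL-Algebra.Free_Abelian_Groups"
    "HOL-Algebra.Generated_Rings"
    "HOL-Algebra.Generated_Groups"
    "HOL-Algebra.QuotRing"
    "Jordan_Normal_Form.Matrix_Kernel"
begin

section \<open>Categories with shift, triangles, Verdier quotients\<close>

text \<open>\<open>cmp T X Y Z g f\<close> is the composite of \<open>f : X \<rightarrow> Y\<close> and \<open>g : Y \<rightarrow> Z\<close>.  The record carries only
  the data used below; the additive structure plays no role in the Verdier quotient or
  in the Grothendieck group.\<close>

record ('o, 'm) shift_cat =
  ob :: "'o set"
  arr :: "'o \<Rightarrow> 'o \<Rightarrow> 'm set"
  idt :: "'o \<Rightarrow> 'm"
  cmp :: "'o \<Rightarrow> 'o \<Rightarrow> 'o \<Rightarrow> 'm \<Rightarrow> 'm \<Rightarrow> 'm"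
  sh :: "'o \<Rightarrow> 'o"
  shm :: "'o \<Rightarrow> 'o \<Rightarrow> 'm \<Rightarrow> 'm"

type_synonym ('o, 'm) triangle = "'o \<times> 'o \<times> 'o \<times> 'm \<times> 'm \<times> 'm"

record ('o, 'm) tri_cat = "('o, 'm) shift_cat" +
  tri :: "('o, 'm) triangle set"

definition iso_arr :: "('o, 'm, 'z) shift_cat_scheme \<Rightarrow> 'o \<Rightarrow> 'o \<Rightarrow> 'm \<Rightarrow> bool" where
  "iso_arr T X Y f \<longleftrightarrow> f \<in> arr T X Y \<and>
     (\<exists>g\<in>arr T Y X. cmp T X Y X g f = idt T X \<and> cmp T Y X Y f g = idt T Y)"

fun candidate_triangle :: "('o, 'm, 'z) shift_cat_scheme \<Rightarrow> ('o, 'm) triangle \<Rightarrow> bool" where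
  "candidate_triangle T (X, Y, Z, u, v, w) \<longleftrightarrow>
     X \<in> ob T \<and> Y \<in> ob T \<and> Z \<in> ob T \<and>
     u \<in> arr T X Y \<and> v \<in> arr T Y Z \<and> w \<in> arr T Z (sh T X)"

fun triangle_iso :: "('o, 'm, 'z) shift_cat_scheme \<Rightarrow> ('o, 'm) triangle \<Rightarrow> ('o, 'm) triangle \<Rightarrow> bool" where
  "triangle_iso T (X, Y, Z, u, v, w) (X', Y', Z', u', v', w') \<longleftrightarrow>
     (\<exists>a b c. iso_arr T X X' a \<and> iso_arr T Y Y' b \<and> iso_arr T Z Z' c \<and>
        cmp T X Y Y' b u = cmp T X X' Y' u' a \<and>
        cmp T Y Z Z' c v = cmp T Y Y' Z' v' b \<and>
        cmp T Z (sh T X) (sh T X') (shm T X X' a) w = cmp T Z Z' (sh T X') w' c)"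

text \<open>The distinguished triangles are those isomorphic to a member of \<open>D\<close>.\<close>

definition with_triangles :: "('o, 'm) shift_cat \<Rightarrow> ('o, 'm) triangle set \<Rightarrow> ('o, 'm) tri_cat" where
  "with_triangles S D =
     shift_cat.extend S (tri_cat.fields
       {t. candidate_triangle S t \<and> (\<exists>t'\<in>D. candidate_triangle S t' \<and> triangle_iso S t t')})"

text \<open>Verdier quotient of \<open>T\<close> by the triangulated subcategory on the set of objects \<open>N\<close>.
  The inverted arrows are those with a cone in \<open>N\<close>; an arrow \<open>X \<rightarrow> Y\<close> of the quotient is an
  equivalence class of roofs \<open>(W, s, f)\<close>, standing for \<open>X \<leftarrow>s\<midarrow> W \<midarrow>f\<rightarrow> Y\<close> with \<open>s\<close> inverted.\<close>

definition cone_in :: "('o, 'm) tri_cat \<Rightarrow> 'o set \<Rightarrow> 'o \<Rightarrow> 'o \<Rightarrow> 'm \<Rightarrow> bool" where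
  "cone_in T N X Y s \<longleftrightarrow> s \<in> arr T X Y \<and> (\<exists>C v w. C \<in> N \<and> (X, Y, C, s, v, w) \<in> tri T)"

type_synonym ('o, 'm) roof = "'o \<times> 'm \<times> 'm"

fun is_roof :: "('o, 'm) tri_cat \<Rightarrow> 'o set \<Rightarrow> 'o \<Rightarrow> 'o \<Rightarrow> ('o, 'm) roof \<Rightarrow> bool" where
  "is_roof T N X Y (W, s, f) \<longleftrightarrow> W \<in> ob T \<and> cone_in T N W X s \<and> f \<in> arr T W Y"

fun roof_equiv :: "('o, 'm) tri_cat \<Rightarrow> 'o set \<Rightarrow> 'o \<Rightarrow> 'o \<Rightarrow> ('o, 'm) roof \<Rightarrow> ('o, 'm) roof \<Rightarrow> bool" where
  "roof_equiv T N X Y (W, s, f) (W', s', f') \<longleftrightarrow>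
     (\<exists>V\<in>ob T. \<exists>u\<in>arr T V W. \<exists>u'\<in>arr T V W'.
        cone_in T N V X (cmp T V W X s u) \<and>
        cmp T V W X s u = cmp T V W' X s' u' \<and>
        cmp T V W Y f u = cmp T V W' Y f' u')"

definition roof_class ::
  "('o, 'm) tri_cat \<Rightarrow> 'o set \<Rightarrow> 'o \<Rightarrow> 'o \<Rightarrow> ('o, 'm) roof \<Rightarrow> ('o, 'm) roof set" where
  "roof_class T N X Y r = {r'. is_roof T N X Y r' \<and> roof_equiv T N X Y r r'}"

text \<open>The composite of \<open>X \<leftarrow>s\<midarrow> W \<midarrow>f\<rightarrow> Y\<close> and \<open>Y \<leftarrow>t\<midarrow> V \<midarrow>g\<rightarrow> Z\<close> is represented by
  \<open>(U, s t', g f')\<close> for any completion \<open>W \<leftarrow>t'\<midarrow> U \<midarrow>f'\<rightarrow> V\<close> with \<open>t'\<close> inverted and \<open>f t' = t f'\<close>.\<close>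

definition roof_comp ::
  "('o, 'm) tri_cat \<Rightarrow> 'o set \<Rightarrow> 'o \<Rightarrow> 'o \<Rightarrow> 'o
     \<Rightarrow> ('o, 'm) roof set \<Rightarrow> ('o, 'm) roof set \<Rightarrow> ('o, 'm) roof set" where
  "roof_comp T N X Y Z G F = {r. is_roof T N X Z r \<and>
     (\<exists>W s f V t g U t' f'. (W, s, f) \<in> F \<and> (V, t, g) \<in> G \<and> U \<in> ob T \<and>
        cone_in T N U W t' \<and> f' \<in> arr T U V \<and>
        cmp T U W Y f t' = cmp T U V Y t f' \<and>
        roof_equiv T N X Z (U, cmp T U W X s t', cmp T U V Z g f') r)}"

definition loc_arr :: "('o, 'm) tri_cat \<Rightarrow> 'o set \<Rightarrow> 'o \<Rightarrow> 'o \<Rightarrow> 'm \<Rightarrow> ('o, 'm) roof set" where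
  "loc_arr T N X Y f = roof_class T N X Y (X, idt T X, f)"

definition verdier_shift_cat ::
  "('o, 'm) tri_cat \<Rightarrow> 'o set \<Rightarrow> ('o, ('o, 'm) roof set) shift_cat" where
  "verdier_shift_cat T N =
     \<lparr> ob = ob T,
       arr = (\<lambda>X Y. roof_class T N X Y ` Collect (is_roof T N X Y)),
       idt = (\<lambda>X. loc_arr T N X X (idt T X)),
       cmp = roof_comp T N,
       sh = sh T,
       shm = (\<lambda>X Y F. {r. is_roof T N (sh T X) (sh T Y) r \<and>
          (\<exists>W s f. (W, s, f) \<in> F \<and>
             roof_equiv T N (sh T X) (sh T Y) (sh T W, shm T W X s, shm T W Y f) r)}) \<rparr>"

definition verdier_quotient ::
  "('o, 'm) tri_cat \<Rightarrow> 'o set \<Rightarrow> ('o, ('o, 'm) roof set) tri_cat" where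
  "verdier_quotient T N = with_triangles (verdier_shift_cat T N)
     {(X, Y, Z, loc_arr T N X Y u, loc_arr T N Y Z v, loc_arr T N Z (sh T X) w) | X Y Z u v w.
        (X, Y, Z, u, v, w) \<in> tri T}"

section \<open>The Grothendieck ring of a triangulated monoidal category\<close>

text \<open>The Grothendieck group is the free abelian group on the objects modulo
  \<open>[Y] = [X] + [Z]\<close> for all distinguished triangles \<open>X \<rightarrow> Y \<rightarrow> Z \<rightarrow> \<Sigma>X\<close>; its product is induced
  by the tensor product \<open>tens\<close> of objects.\<close>

definition object_ring :: "'o set \<Rightarrow> ('o \<Rightarrow> 'o \<Rightarrow> 'o) \<Rightarrow> 'o \<Rightarrow> ('o \<Rightarrow>\<^sub>0 int) ring" where
  "object_ring A tens unit =
     \<lparr> carrier = carrier (free_Abelian_group A),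
       monoid.mult = (\<lambda>a b. frag_extend (\<lambda>x. frag_extend (\<lambda>y. frag_of (tens x y)) b) a),
       one = frag_of unit, zero = 0, add = (+) \<rparr>"

definition triangle_relations :: "('o, 'm) tri_cat \<Rightarrow> ('o \<Rightarrow>\<^sub>0 int) set" where
  "triangle_relations T = generate (free_Abelian_group (ob T))
     {frag_of Y - frag_of X - frag_of Z | X Y Z. \<exists>u v w. (X, Y, Z, u, v, w) \<in> tri T}"

definition groth_ring ::
  "('o, 'm) tri_cat \<Rightarrow> ('o \<Rightarrow> 'o \<Rightarrow> 'o) \<Rightarrow> 'o \<Rightarrow> ('o \<Rightarrow>\<^sub>0 int) set ring" where
  "groth_ring T tens unit = object_ring (ob T) tens unit Quot triangle_relations T"

definition groth_class ::
  "('o, 'm) tri_cat \<Rightarrow> ('o \<Rightarrow> 'o \<Rightarrow> 'o) \<Rightarrow> 'o \<Rightarrow> 'o \<Rightarrow> ('o \<Rightarrow>\<^sub>0 int) set" where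
  "groth_class T tens unit X =
     triangle_relations T +>\<^bsub>object_ring (ob T) tens unit\<^esub> frag_of X"

section \<open>Matrix representations and the stable category\<close>

text \<open>A finite-dimensional module over an algebra presented by generators \<open>'g\<close> is given, up to
  isomorphism, by matrices on \<open>\<complex>\<^sup>n\<close> satisfying the defining relations.  The module category is
  specified by the set \<open>C\<close> of these.\<close>

datatype 'g rep = Rep (rdim: nat) (ract: "'g \<Rightarrow> complex mat")

definition rep_homs :: "'g rep \<Rightarrow> 'g rep \<Rightarrow> complex mat set" where
  "rep_homs M N = {f \<in> carrier_mat (rdim N) (rdim M). \<forall>g. f * ract M g = ract N g * f}"

definition rep_mono :: "'g rep \<Rightarrow> 'g rep \<Rightarrow> complex mat \<Rightarrow> bool" where
  "rep_mono M N f \<longleftrightarrow> f \<in> rep_homs M N \<and> inj_on (\<lambda>v. f *\<^sub>v v) (carrier_vec (rdim M))"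

definition rep_epi :: "'g rep \<Rightarrow> 'g rep \<Rightarrow> complex mat \<Rightarrow> bool" where
  "rep_epi M N f \<longleftrightarrow> f \<in> rep_homs M N \<and> (\<lambda>v. f *\<^sub>v v) ` carrier_vec (rdim M) = carrier_vec (rdim N)"

definition short_exact :: "'g rep \<Rightarrow> complex mat \<Rightarrow> 'g rep \<Rightarrow> complex mat \<Rightarrow> 'g rep \<Rightarrow> bool" where
  "short_exact X i Y p Z \<longleftrightarrow> rep_mono X Y i \<and> rep_epi Y Z p \<and>
     (\<lambda>v. i *\<^sub>v v) ` carrier_vec (rdim X) = mat_kernel p"

definition projectives :: "'g rep set \<Rightarrow> 'g rep set" where
  "projectives C = {P \<in> C. \<forall>X\<in>C. \<forall>Y\<in>C. \<forall>p f. rep_epi X Y p \<and> f \<in> rep_homs P Y \<longrightarrow>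
     (\<exists>h\<in>rep_homs P X. p * h = f)}"

definition injectives :: "'g rep set \<Rightarrow> 'g rep set" where
  "injectives C = {I \<in> C. \<forall>X\<in>C. \<forall>Y\<in>C. \<forall>i f. rep_mono X Y i \<and> f \<in> rep_homs X I \<longrightarrow>
     (\<exists>h\<in>rep_homs Y I. h * i = f)}"

text \<open>From here on \<open>C\<close> is meant to be the module category of a self-injective algebra
  (injective = projective); the triangulated structure is Happel's.  The shift of \<open>X\<close> is the cokernel
  of a chosen embedding of \<open>X\<close> into an injective module.\<close>

definition chosen_embedding ::
  "'g rep set \<Rightarrow> 'g rep \<Rightarrow> 'g rep \<times> complex mat \<times> 'g rep \<times> complex mat" where
  "chosen_embedding C X =
     (SOME (I, i, Q, p). I \<in> injectives C \<and> Q \<in> C \<and> short_exact X i I p Q)"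

definition inj_obj :: "'g rep set \<Rightarrow> 'g rep \<Rightarrow> 'g rep" where
  "inj_obj C X = fst (chosen_embedding C X)"

definition inj_map :: "'g rep set \<Rightarrow> 'g rep \<Rightarrow> complex mat" where
  "inj_map C X = fst (snd (chosen_embedding C X))"

definition cosyz :: "'g rep set \<Rightarrow> 'g rep \<Rightarrow> 'g rep" where
  "cosyz C X = fst (snd (snd (chosen_embedding C X)))"

definition cosyz_map :: "'g rep set \<Rightarrow> 'g rep \<Rightarrow> complex mat" where
  "cosyz_map C X = snd (snd (snd (chosen_embedding C X)))"

definition stable_class :: "'g rep set \<Rightarrow> 'g rep \<Rightarrow> 'g rep \<Rightarrow> complex mat \<Rightarrow> complex mat set" where
  "stable_class C X Y f = {g \<in> rep_homs X Y.
     \<exists>P\<in>projectives C. \<exists>a\<in>rep_homs X P. \<exists>b\<in>rep_homs P Y. g - f = b * a}"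

definition stable_shift_cat :: "'g rep set \<Rightarrow> ('g rep, complex mat set) shift_cat" where
  "stable_shift_cat C =
     \<lparr> ob = C,
       arr = (\<lambda>X Y. stable_class C X Y ` rep_homs X Y),
       idt = (\<lambda>X. stable_class C X X (1\<^sub>m (rdim X))),
       cmp = (\<lambda>X Y Z G F. \<Union>g\<in>G. \<Union>f\<in>F. stable_class C X Z (g * f)),
       sh = cosyz C,
       shm = (\<lambda>X Y F. \<Union>f\<in>F. \<Union>{stable_class C (cosyz C X) (cosyz C Y) g | g h.
          h \<in> rep_homs (inj_obj C X) (inj_obj C Y) \<and> h * inj_map C X = inj_map C Y * f \<and>
          g \<in> rep_homs (cosyz C X) (cosyz C Y) \<and> g * cosyz_map C X = cosyz_map C Y * h}) \<rparr>"

text \<open>For \<open>u : X \<rightarrow> Y\<close> the module \<open>Z\<close> below is the pushout of \<open>u\<close> and \<open>X \<rightarrow> I(X)\<close>: the condition says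
  that \<open>(u, j, id)\<close> is a morphism of short exact sequences from
  \<open>0 \<rightarrow> X \<rightarrow> I(X) \<rightarrow> \<Sigma>X \<rightarrow> 0\<close> to \<open>0 \<rightarrow> Y \<rightarrow> Z \<rightarrow> \<Sigma>X \<rightarrow> 0\<close>.\<close>

definition stable_category :: "'g rep set \<Rightarrow> ('g rep, complex mat set) tri_cat" where
  "stable_category C = with_triangles (stable_shift_cat C)
     {(X, Y, Z, stable_class C X Y u, stable_class C Y Z v, stable_class C Z (cosyz C X) w)
        | X Y Z u v w. X \<in> C \<and> Y \<in> C \<and> Z \<in> C \<and> u \<in> rep_homs X Y \<and>
        short_exact Y v Z w (cosyz C X) \<and>
        (\<exists>j\<in>rep_homs (inj_obj C X) Z. j * inj_map C X = v * u \<and> w * j = cosyz_map C X)}"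

section \<open>The Drinfeld double of the Taft algebra\<close>

definition primitive_unity_root :: "nat \<Rightarrow> complex \<Rightarrow> bool" where
  "primitive_unity_root d \<zeta> \<longleftrightarrow> \<zeta> ^ d = 1 \<and> (\<forall>k. 0 < k \<and> k < d \<longrightarrow> \<zeta> ^ k \<noteq> 1)"

definition qnum :: "complex \<Rightarrow> nat \<Rightarrow> complex" where
  "qnum \<xi> n = (\<Sum>j<n. \<xi> ^ j)"

datatype dgen = GE | GF | GK | GZ
datatype bgen = BE | BK

definition D_modules :: "nat \<Rightarrow> complex \<Rightarrow> dgen rep set" where
  "D_modules d \<zeta> = {M. let n = rdim M; E = ract M GE; F = ract M GF; K = ract M GK; z = ract M GZ in
     (\<forall>g. ract M g \<in> carrier_mat n n) \<and>
     K ^\<^sub>m d = 1\<^sub>m n \<and> z ^\<^sub>m d = 1\<^sub>m n \<and> E ^\<^sub>m d = 0\<^sub>m n n \<and> F ^\<^sub>m d = 0\<^sub>m n n \<and>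
     z * E = E * z \<and> z * F = F * z \<and> z * K = K * z \<and>
     K * E = \<zeta> \<cdot>\<^sub>m (E * K) \<and> K * F = inverse \<zeta> \<cdot>\<^sub>m (F * K) \<and>
     E * F - F * E = K - z * K ^\<^sub>m (d - 1)}"   (* K^(d-1) is the inverse of K *)

text \<open>The subalgebra \<open>B\<close> generated by \<open>E\<close> and \<open>K\<close> is the Taft algebra, presented by the relations below.\<close>

definition B_modules :: "nat \<Rightarrow> complex \<Rightarrow> bgen rep set" where
  "B_modules d \<zeta> = {M. let n = rdim M; E = ract M BE; K = ract M BK in
     (\<forall>g. ract M g \<in> carrier_mat n n) \<and>
     K ^\<^sub>m d = 1\<^sub>m n \<and> E ^\<^sub>m d = 0\<^sub>m n n \<and> K * E = \<zeta> \<cdot>\<^sub>m (E * K)}"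

definition restrict_B :: "dgen rep \<Rightarrow> bgen rep" where
  "restrict_B M = Rep (rdim M) (\<lambda>g. case g of BE \<Rightarrow> ract M GE | BK \<Rightarrow> ract M GK)"

definition D_proj_B :: "nat \<Rightarrow> complex \<Rightarrow> dgen rep set" where
  "D_proj_B d \<zeta> = {M \<in> D_modules d \<zeta>. restrict_B M \<in> projectives (B_modules d \<zeta>)}"

text \<open>Matrix of the tensor product of two linear maps, with \<open>e\<^sub>i \<otimes> e\<^sub>j\<close> in position \<open>i * n + j\<close>, where
  \<open>n\<close> is the dimension of the second factor.\<close>

definition kron :: "complex mat \<Rightarrow> complex mat \<Rightarrow> complex mat" where
  "kron A B = mat (dim_row A * dim_row B) (dim_col A * dim_col B)
     (\<lambda>(i, j). A $$ (i div dim_row B, j div dim_col B) * B $$ (i mod dim_row B, j mod dim_col B))"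

definition D_tensor :: "nat \<Rightarrow> dgen rep \<Rightarrow> dgen rep \<Rightarrow> dgen rep" where
  "D_tensor d M N = Rep (rdim M * rdim N) (\<lambda>g. case g of
       GE \<Rightarrow> kron (1\<^sub>m (rdim M)) (ract N GE) + kron (ract M GE) (ract N GK)
     | GF \<Rightarrow> kron (ract M GF) (1\<^sub>m (rdim N)) + kron (ract M GZ * ract M GK ^\<^sub>m (d - 1)) (ract N GF)
     | GK \<Rightarrow> kron (ract M GK) (ract N GK)
     | GZ \<Rightarrow> kron (ract M GZ) (ract N GZ))"

definition D_unit :: "dgen rep" where
  "D_unit = Rep 1 (\<lambda>g. case g of GE \<Rightarrow> 0\<^sub>m 1 1 | GF \<Rightarrow> 0\<^sub>m 1 1 | GK \<Rightarrow> 1\<^sub>m 1 | GZ \<Rightarrow> 1\<^sub>m 1)"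

text \<open>The module \<open>M\<^bsub>l,p\<^esub>\<close>; its basis vector \<open>e\<^sub>i\<close> has matrix index \<open>i - 1\<close>.\<close>

definition D_simple :: "complex \<Rightarrow> nat \<times> nat \<Rightarrow> dgen rep" where
  "D_simple \<zeta> = (\<lambda>(l, p). Rep l (\<lambda>g. case g of
       GE \<Rightarrow> mat l l (\<lambda>(i, j). if j = i + 1 then \<zeta> ^ p * qnum \<zeta> j * (\<zeta> ^ (l - j) - 1) else 0)
     | GF \<Rightarrow> mat l l (\<lambda>(i, j). if i = j + 1 then 1 else 0)
     | GK \<Rightarrow> mat l l (\<lambda>(i, j). if i = j then \<zeta> ^ (p + l - (i + 1)) else 0)
     | GZ \<Rightarrow> \<zeta> ^ (2 * p + l - 1) \<cdot>\<^sub>m 1\<^sub>m l))"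

text \<open>\<open>\<Lambda>(d)\<close> is \<open>{1..d} \<times> {0..<d}\<close>: the first coordinate of \<open>\<int>/d \<times> \<int>/d\<close> is represented
  in \<open>{1..d}\<close>, so that \<open>l = 0\<close> in \<open>\<int>/d\<close> becomes \<open>l = d\<close>, and the second one in \<open>{0..<d}\<close>.\<close>

definition Lambda_sharp :: "nat \<Rightarrow> (nat \<times> nat) set" where
  "Lambda_sharp d = {(l, p) \<in> {1..d} \<times> {0..<d}. l \<noteq> d}"

definition iota :: "nat \<Rightarrow> nat \<times> nat \<Rightarrow> nat \<times> nat" where
  "iota d = (\<lambda>(l, p). (if l = d then d else d - l, (p + l) mod d))"

definition iota_orbit_representatives :: "nat \<Rightarrow> (nat \<times> nat) set \<Rightarrow> bool" where
  "iota_orbit_representatives d S \<longleftrightarrow>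
     S \<subseteq> Lambda_sharp d \<and> (\<forall>x\<in>Lambda_sharp d. \<exists>!y. y \<in> S \<and> y \<in> {x, iota d x})"

definition D_stab :: "nat \<Rightarrow> complex \<Rightarrow> (dgen rep, complex mat set) tri_cat" where
  "D_stab d \<zeta> = stable_category (D_modules d \<zeta>)"

text \<open>The image of \<open>D(B)-proj\<^sub>B\<close> in the stable category has the same objects as \<open>D(B)-proj\<^sub>B\<close>.\<close>

definition D_stab_B ::
  "nat \<Rightarrow> complex \<Rightarrow> (dgen rep, (dgen rep, complex mat set) roof set) tri_cat" where
  "D_stab_B d \<zeta> = verdier_quotient (D_stab d \<zeta>) (D_proj_B d \<zeta>)"

definition Gr_st_B :: "nat \<Rightarrow> complex \<Rightarrow> (dgen rep \<Rightarrow>\<^sub>0 int) set ring" where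
  "Gr_st_B d \<zeta> = groth_ring (D_stab_B d \<zeta>) (D_tensor d) D_unit"

definition m_st_B :: "nat \<Rightarrow> complex \<Rightarrow> nat \<times> nat \<Rightarrow> (dgen rep \<Rightarrow>\<^sub>0 int) set" where
  "m_st_B d \<zeta> x = groth_class (D_stab_B d \<zeta>) (D_tensor d) D_unit (D_simple \<zeta> x)"

end

theory Submission
  imports Defs
begin

text \<open>An arrow of the stable category becomes invertible in the quotient if and only if it is invertible modulo the
  maps of the form \<open>E\<^sup>d\<^sup>-\<^sup>1 s + E\<^sup>d\<^sup>-\<^sup>2 s E + \<dots> + s E\<^sup>d\<^sup>-\<^sup>1\<close> (\<open>s\<close> linear).  For \<open>0 < a < d\<close> the operator
  \<open>K\<^sup>a z\<^sup>b\<close> commutes with \<open>E\<close> up to the factor \<open>\<zeta>\<^sup>a \<noteq> 1\<close>, hence it is orthogonal to these maps under the trace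
  form, and the graded traces \<open>\<theta>\<^sub>M(a, b) = tr(K\<^sup>a z\<^sup>b)\<close> are invariants of the quotient, additive on triangles and
  multiplicative on tensor products.  Conversely every module is filtered by the modules \<open>M\<^bsub>l,p\<^esub>\<close>; among their
  classes \<open>M\<^bsub>d,p\<^esub>\<close> vanishes and \<open>M\<^sub>\<lambda>\<close> is opposite to \<open>M\<^bsub>\<iota>\<lambda>\<^esub>\<close>, because the two are the factors of a module on which
  \<open>E\<close> is a single Jordan block of size \<open>d\<close>.  By orthogonality of the characters of \<open>(\<int>/d)\<^sup>2\<close> the traces separate
  the remaining classes, so the Grothendieck ring is the ring of graded traces, and the identity
  \<open>M\<^bsub>2,0\<^esub> M\<^bsub>l,p\<^esub> = M\<^bsub>l+1,p\<^esub> + M\<^bsub>l-1,p+1\<^esub>\<close> of traces yields the generators.\<close>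

section \<open>Linear operators\<close>

text \<open>The obstacle is that arrows of the quotient are classes of roofs and its triangles are
  known only up to isomorphism in the quotient, so an invariant has to be read off without ever
  making a roof explicit. For this the action of F, K and z is forgotten: averaging over the powers
  of K shows that projectivity over B is the same as freeness over C[E]/(E^d), and every quotient
  arrow acts in the stable category of that small algebra. The exponent a = 0 has to be excluded
  because the trace for a = b = 0 is the dimension, which does not vanish on E-free modules. The
  triangles of the stable category presuppose that projectives and injectives coincide; this is
  proved with modules that are induced and coinduced at once. That the relations are compatible with
  the product is not derived from exactness of the tensor product: once the relations are known to
  be exactly the common kernel of the traces, this compatibility and the ring axioms reduce to
  identities between complex numbers.\<close>

text \<open>All matrices, whatever their size, are embedded into one ring of linear operators, so that the
  equations between them can be handled by the automation for noncommutative rings.\<close>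

typedef lop = "{f :: (nat \<Rightarrow> complex) \<Rightarrow> nat \<Rightarrow> complex.
    (\<forall>u v. f (\<lambda>i. u i + v i) = (\<lambda>i. f u i + f v i)) \<and> (\<forall>c u. f (\<lambda>i. c * u i) = (\<lambda>i. c * f u i))}"
  morphisms app Lop
  by (rule exI[of _ "\<lambda>v i. 0"]) simp

setup_lifting type_definition_lop

lemma app_add: "app f (\<lambda>i. u i + v i) = (\<lambda>i. app f u i + app f v i)"
  using app[of f] by auto

lemma app_cmult: "app f (\<lambda>i. c * u i) = (\<lambda>i. c * app f u i)"
  using app[of f] by auto

lemma app_zero: "app f (\<lambda>i. 0) = (\<lambda>i. 0)"
  using app_cmult[of f 0 "\<lambda>i. 0"] by simp

lemma app_sum: "app f (\<lambda>i. \<Sum>j\<in>A. u j i) = (\<lambda>i. \<Sum>j\<in>A. app f (u j) i)"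
  by (induction A rule: infinite_finite_induct) (simp_all add: app_zero app_add)

instantiation lop :: ring_1
begin

lift_definition zero_lop :: lop is "\<lambda>v i. 0" by simp
lift_definition one_lop :: lop is "\<lambda>v. v" by simp
lift_definition plus_lop :: "lop \<Rightarrow> lop \<Rightarrow> lop" is "\<lambda>f g v i. f v i + g v i"
  by (auto simp: algebra_simps)
lift_definition minus_lop :: "lop \<Rightarrow> lop \<Rightarrow> lop" is "\<lambda>f g v i. f v i - g v i"
  by (auto simp: algebra_simps)
lift_definition uminus_lop :: "lop \<Rightarrow> lop" is "\<lambda>f v i. - f v i"
  by (auto simp: algebra_simps)
lift_definition times_lop :: "lop \<Rightarrow> lop \<Rightarrow> lop" is "\<lambda>f g v. f (g v)"
  by auto

lemma app_ops: "app (f * g) v = app f (app g v)" "app (f + g) v = (\<lambda>i. app f v i + app g v i)"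
  "app (f - g) v = (\<lambda>i. app f v i - app g v i)" "app (- f) v = (\<lambda>i. - app f v i)"
  "app 0 v = (\<lambda>i. 0)" "app 1 v = v"
  by (transfer; simp)+

lemma lop_eqI: "(\<And>v i. app f v i = app g v i) \<Longrightarrow> f = g"
  by (metis app_inject ext)

instance
proof
  show "(0::lop) \<noteq> 1"
  proof
    assume "(0::lop) = 1"
    from arg_cong[OF this, of "\<lambda>f. app f (\<lambda>i. 1) 0"] show False by (simp add: app_ops)
  qed
qed (rule lop_eqI, simp add: app_ops app_add algebra_simps)+

end

lift_definition scal :: "complex \<Rightarrow> lop \<Rightarrow> lop" (infixr "*\<^sub>s" 75) is "\<lambda>c f v i. c * f v i"
  by (auto simp: algebra_simps)

declare app_ops [simp]

lemma app_scal [simp]: "app (c *\<^sub>s f) v = (\<lambda>i. c * app f v i)"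
  by transfer simp

lemma scal_simps [simp]:
  "c *\<^sub>s (a *\<^sub>s x) = (c * a) *\<^sub>s x" "(c *\<^sub>s x) * y = c *\<^sub>s (x * y)" "x * (c *\<^sub>s y) = c *\<^sub>s (x * y)"
  "0 *\<^sub>s x = 0" "1 *\<^sub>s x = x" "c *\<^sub>s 0 = 0" "- (c *\<^sub>s x) = (- c) *\<^sub>s x"
  by (rule lop_eqI, simp add: app_cmult mult.assoc)+

lemma scal_add_right: "c *\<^sub>s (x + y) = c *\<^sub>s x + c *\<^sub>s y"
  and scal_diff_right: "c *\<^sub>s (x - y) = c *\<^sub>s x - c *\<^sub>s y"
  and scal_add_left: "(c + a) *\<^sub>s x = c *\<^sub>s x + a *\<^sub>s x"
  and scal_diff_left: "(c - a) *\<^sub>s x = c *\<^sub>s x - a *\<^sub>s x"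
  by (rule lop_eqI, simp add: algebra_simps)+

lemma scal_sum_right: "c *\<^sub>s (\<Sum>i\<in>A. f i) = (\<Sum>i\<in>A. c *\<^sub>s f i)"
  by (induction A rule: infinite_finite_induct) (simp_all add: scal_add_right)

lemma scal_sum_left: "(\<Sum>i\<in>A. f i) *\<^sub>s x = (\<Sum>i\<in>A. f i *\<^sub>s x)"
  by (induction A rule: infinite_finite_induct) (simp_all add: scal_add_left)

lemma scal_cancel: "c *\<^sub>s x = c *\<^sub>s y \<Longrightarrow> c \<noteq> 0 \<Longrightarrow> x = y"
  by (drule arg_cong[where f = "scal (inverse c)"]) simp

lemma app_lsum [simp]: "app (\<Sum>j\<in>A. f j) v i = (\<Sum>j\<in>A. app (f j) v i)"
  by (induction A rule: infinite_finite_induct) auto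

text \<open>\<open>ofs\<close> and \<open>pofs\<close> are the inclusion of a range of coordinates
  and the projection onto it, \<open>eij\<close> is the matrix unit and \<open>idn\<close> the
  coordinate idempotent of a given size; direct sums and block matrices are assembled from
  these.\<close>

lift_definition ofs :: "nat \<Rightarrow> nat \<Rightarrow> lop" is "\<lambda>a n v i. if a \<le> i \<and> i < a + n then v (i - a) else 0"
  by (auto simp: fun_eq_iff)
lift_definition pofs :: "nat \<Rightarrow> nat \<Rightarrow> lop" is "\<lambda>a n v i. if i < n then v (a + i) else 0"
  by (auto simp: fun_eq_iff)
lift_definition eij :: "nat \<Rightarrow> nat \<Rightarrow> lop" is "\<lambda>r s v i. if i = r then v s else 0"
  by (auto simp: fun_eq_iff)
lift_definition idn :: "nat \<Rightarrow> lop" is "\<lambda>n v i. if i < n then v i else 0"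
  by (auto simp: fun_eq_iff)
lift_definition op_mat :: "complex mat \<Rightarrow> lop" is
  "\<lambda>A v i. if i < dim_row A then \<Sum>j<dim_col A. A $$ (i, j) * v j else 0"
  by (auto simp: fun_eq_iff sum.distrib distrib_left sum_distrib_left mult.left_commute)

lemma app_ofs [simp]: "app (ofs a n) v i = (if a \<le> i \<and> i < a + n then v (i - a) else 0)"
  and app_pofs [simp]: "app (pofs a n) v i = (if i < n then v (a + i) else 0)"
  and app_eij [simp]: "app (eij r s) v i = (if i = r then v s else 0)"
  and app_idn [simp]: "app (idn n) v i = (if i < n then v i else 0)"
  and app_op_mat: "app (op_mat A) v i = (if i < dim_row A then \<Sum>j<dim_col A. A $$ (i, j) * v j else 0)"
  by (simp_all add: ofs.rep_eq pofs.rep_eq eij.rep_eq idn.rep_eq op_mat.rep_eq)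

definition delta :: "nat \<Rightarrow> nat \<Rightarrow> complex" where "delta j = (\<lambda>i. if i = j then 1 else 0)"

text \<open>The size of a matrix is encoded by absorption of coordinate idempotents, so all sizes
  live in one ring. The zeroth power of an operator is the global identity and not
  \<open>idn n\<close>; this is why statements about powers carry a factor \<open>idn n\<close> or a
  positive exponent.\<close>

definition lin :: "nat \<Rightarrow> nat \<Rightarrow> lop \<Rightarrow> bool" where
  "lin m n f \<longleftrightarrow> idn m * f = f \<and> f * idn n = f"

lemma idn_idn [simp]: "idn n * idn n = idn n"
  by (rule lop_eqI) simp

lemma lin_left: "lin m n f \<Longrightarrow> idn m * f = f" and lin_right: "lin m n f \<Longrightarrow> f * idn n = f"
  by (simp_all add: lin_def)

lemma lin_left': "lin m n f \<Longrightarrow> idn m * (f * x) = f * x"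
  and lin_right': "lin m n f \<Longrightarrow> f * (idn n * x) = f * x"
  by (simp_all add: lin_def flip: mult.assoc)

lemma lin_idn [intro, simp]: "lin n n (idn n)" by (simp add: lin_def)
lemma lin_0 [intro, simp]: "lin m n 0" by (simp add: lin_def)
lemma lin_mult [intro]: "lin m k f \<Longrightarrow> lin k n g \<Longrightarrow> lin m n (f * g)"
  unfolding lin_def by (metis mult.assoc)
lemma lin_add [intro]: "lin m n f \<Longrightarrow> lin m n g \<Longrightarrow> lin m n (f + g)"
  and lin_diff [intro]: "lin m n f \<Longrightarrow> lin m n g \<Longrightarrow> lin m n (f - g)"
  and lin_uminus [intro]: "lin m n f \<Longrightarrow> lin m n (- f)"
  and lin_scal [intro]: "lin m n f \<Longrightarrow> lin m n (c *\<^sub>s f)"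
  by (auto simp: lin_def algebra_simps scal_simps)
lemma lin_sum [intro]: "(\<And>i. i \<in> A \<Longrightarrow> lin m n (f i)) \<Longrightarrow> lin m n (sum f A)"
  by (induction A rule: infinite_finite_induct) auto

lemma lin_power: "lin n n f \<Longrightarrow> k > 0 \<Longrightarrow> lin n n (f ^ k)"
proof (induction k)
  case (Suc k)
  then show ?case by (cases "k = 0") (auto intro: lin_mult)
qed simp

lemma idn_power_commute: "lin n n f \<Longrightarrow> idn n * f ^ k = f ^ k * idn n"
  by (cases k) (simp, metis lin_left lin_right lin_power zero_less_Suc)

lemma lin_idn_power [intro]: "lin n n f \<Longrightarrow> lin n n (idn n * f ^ k)"
  by (cases "k = 0") (auto intro: lin_mult lin_power)

lemma app_lin_support: "lin m n f \<Longrightarrow> app f (\<lambda>i. if i < n then v i else 0) = app f v"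
proof -
  assume "lin m n f"
  then have "app f v = app (f * idn n) v" by (simp add: lin_def)
  also have "\<dots> = app f (\<lambda>i. if i < n then v i else 0)"
    by (simp, rule arg_cong[where f = "app f"], simp add: fun_eq_iff)
  finally show ?thesis by simp
qed

lemma app_lin_eq_sum:
  assumes "lin m n f" shows "app f v i = (\<Sum>j<n. v j * app f (delta j) i)"
proof -
  have "app f v = app f (\<lambda>i. \<Sum>j<n. v j * delta j i)"
    unfolding app_lin_support[OF assms, of v, symmetric]
    by (rule arg_cong[where f = "app f"]) (auto simp: delta_def fun_eq_iff if_distrib cong: if_cong)
  then show ?thesis by (simp add: app_sum app_cmult)
qed

lemma app_lin_outside: "lin m n f \<Longrightarrow> i \<ge> m \<Longrightarrow> app f v i = 0"
  by (metis app_idn app_ops(1) leD lin_left)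

lemma lin_eqI:
  assumes "lin m n f" "lin m n g" "\<And>i j. i < m \<Longrightarrow> j < n \<Longrightarrow> app f (delta j) i = app g (delta j) i"
  shows "f = g"
proof (rule lop_eqI)
  fix v i
  show "app f v i = app g v i"
  proof (cases "i < m")
    case True
    then show ?thesis
      unfolding app_lin_eq_sum[OF assms(1), of v i] app_lin_eq_sum[OF assms(2), of v i]
      by (intro sum.cong) (simp_all add: assms(3))
  qed (simp add: app_lin_outside[OF assms(1)] app_lin_outside[OF assms(2)])
qed

lemma delta_app [simp]: "delta j i = (if i = j then 1 else 0)"
  by (simp add: delta_def)

subsection \<open>Matrices as operators\<close>

definition mat_op :: "nat \<Rightarrow> nat \<Rightarrow> lop \<Rightarrow> complex mat" where
  "mat_op m n f = mat m n (\<lambda>(i, j). app f (delta j) i)"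

lemma mat_op_carrier [simp, intro]: "mat_op m n f \<in> carrier_mat m n"
  by (simp add: mat_op_def)

lemma app_op_mat_delta: "j < dim_col A \<Longrightarrow> i < dim_row A \<Longrightarrow> app (op_mat A) (delta j) i = A $$ (i, j)"
  by (simp add: app_op_mat if_distrib cong: if_cong)

lemma lin_op_mat [intro]: "A \<in> carrier_mat m n \<Longrightarrow> lin m n (op_mat A)"
  unfolding lin_def by (auto intro!: lop_eqI simp: app_op_mat)

lemma mat_op_op_mat [simp]: "A \<in> carrier_mat m n \<Longrightarrow> mat_op m n (op_mat A) = A"
  by (rule eq_matI) (auto simp: mat_op_def app_op_mat_delta)

lemma op_mat_mat_op [simp]: "lin m n f \<Longrightarrow> op_mat (mat_op m n f) = f"
  by (rule lin_eqI[of m n]) (auto simp: app_op_mat_delta mat_op_def)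

lemma op_mat_inj: "A \<in> carrier_mat m n \<Longrightarrow> B \<in> carrier_mat m n \<Longrightarrow> op_mat A = op_mat B \<longleftrightarrow> A = B"
  by (metis mat_op_op_mat)

lemma op_mat_one [simp]: "op_mat (1\<^sub>m n) = idn n"
  by (rule lin_eqI[of n n]) (auto simp: app_op_mat_delta)

lemma op_mat_zero [simp]: "op_mat (0\<^sub>m m n) = 0"
  by (rule lop_eqI) (auto simp: app_op_mat)

lemma op_mat_mult: 
  assumes "A \<in> carrier_mat m k" "B \<in> carrier_mat k n" shows "op_mat (A * B) = op_mat A * op_mat B"
proof (rule lin_eqI[of m n])
  fix i j assume "i < m" "j < n"
  then show "app (op_mat (A * B)) (delta j) i = app (op_mat A * op_mat B) (delta j) i"
    using assms by (simp add: app_op_mat_delta scalar_prod_def app_op_mat[of A] atLeast0LessThan)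
qed (use assms in auto)

lemma op_mat_add:
  assumes "A \<in> carrier_mat m n" "B \<in> carrier_mat m n" shows "op_mat (A + B) = op_mat A + op_mat B"
  using assms by (intro lop_eqI) (auto simp: app_op_mat sum.distrib algebra_simps)

lemma op_mat_diff:
  assumes "A \<in> carrier_mat m n" "B \<in> carrier_mat m n" shows "op_mat (A - B) = op_mat A - op_mat B"
  using assms by (intro lop_eqI) (auto simp: app_op_mat sum_subtractf algebra_simps)

lemma op_mat_smult: "op_mat (c \<cdot>\<^sub>m A) = c *\<^sub>s op_mat A"
  by (intro lop_eqI) (auto simp: app_op_mat sum_distrib_left mult.assoc intro!: sum.cong)

lemma op_mat_pow: "A \<in> carrier_mat n n \<Longrightarrow> op_mat (A ^\<^sub>m k) = idn n * op_mat A ^ k"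
proof (induction k)
  case (Suc k)
  then show ?case
    by (simp add: op_mat_mult[of _ n n] power_Suc2 mult.assoc del: power_Suc)
qed simp

lemma mat_op_mult: "lin m k f \<Longrightarrow> lin k n g \<Longrightarrow> mat_op m k f * mat_op k n g = mat_op m n (f * g)"
  by (subst op_mat_inj[of _ m n, symmetric]) (auto simp: op_mat_mult[of _ m k _ n] lin_mult intro: mult_carrier_mat)

subsection \<open>Traces\<close>

definition trc :: "nat \<Rightarrow> lop \<Rightarrow> complex" where "trc n f = (\<Sum>i<n. app f (delta i) i)"

lemma trc_add: "trc n (f + g) = trc n f + trc n g"
  and trc_diff: "trc n (f - g) = trc n f - trc n g"
  and trc_scal: "trc n (c *\<^sub>s f) = c * trc n f"
  and trc_0 [simp]: "trc n 0 = 0"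
  by (simp_all add: trc_def sum.distrib sum_subtractf sum_distrib_left)

lemma trc_idn: "trc n (idn n) = of_nat n"
  by (simp add: trc_def)

lemma trc_commute:
  assumes "lin m n f" "lin n m g" shows "trc m (f * g) = trc n (g * f)"
proof -
  have "trc m (f * g) = (\<Sum>i<m. \<Sum>j<n. app g (delta i) j * app f (delta j) i)"
    unfolding trc_def app_ops(1) by (intro sum.cong refl) (rule app_lin_eq_sum[OF assms(1)])
  also have "\<dots> = (\<Sum>j<n. \<Sum>i<m. app f (delta j) i * app g (delta i) j)"
    by (subst sum.swap) (simp add: mult.commute)
  also have "\<dots> = trc n (g * f)"
    unfolding trc_def app_ops(1) by (intro sum.cong refl) (rule app_lin_eq_sum[OF assms(2), symmetric])
  finally show ?thesis .
qed

subsection \<open>Block decompositions and rank factorisation\<close>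

lemma lin_ofs [intro]: "a + n \<le> m \<Longrightarrow> lin m n (ofs a n)"
  and lin_pofs [intro]: "a + n \<le> m \<Longrightarrow> lin n m (pofs a n)"
  and lin_eij [intro]: "i < m \<Longrightarrow> j < n \<Longrightarrow> lin m n (eij i j)"
  unfolding lin_def by (auto intro!: lop_eqI)

lemma pofs_ofs [simp]: "pofs a n * ofs a n = idn n"
  by (rule lop_eqI) auto

lemma pofs_ofs_disjoint: "a + n \<le> b \<or> b + m \<le> a \<Longrightarrow> pofs a n * ofs b m = 0"
  by (rule lop_eqI) auto

lemma ofs_pofs_sum2: "ofs 0 m * pofs 0 m + ofs m n * pofs m n = idn (m + n)"
  by (rule lop_eqI) auto

definition blk :: "nat \<Rightarrow> nat \<Rightarrow> lop" where "blk n j = ofs (j * n) n"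
definition pblk :: "nat \<Rightarrow> nat \<Rightarrow> lop" where "pblk n j = pofs (j * n) n"

lemma lin_blk [intro]: "j < d \<Longrightarrow> lin (d * n) n (blk n j)"
  and lin_pblk [intro]: "j < d \<Longrightarrow> lin n (d * n) (pblk n j)"
proof -
  assume "j < d"
  then have "j * n + n \<le> d * n"
    using mult_le_mono1[of "Suc j" d n] by simp
  then show "lin (d * n) n (blk n j)" "lin n (d * n) (pblk n j)" by (auto simp: blk_def pblk_def)
qed

lemma pblk_blk: "pblk n i * blk n j = (if i = j then idn n else 0)"
proof (cases i j rule: linorder_cases)
  case less
  then have "i * n + n \<le> j * n" using mult_le_mono1[of "Suc i" j n] by simp
  with less show ?thesis by (simp add: blk_def pblk_def pofs_ofs_disjoint)
next
  case greater
  then have "j * n + n \<le> i * n" using mult_le_mono1[of "Suc j" i n] by simp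
  with greater show ?thesis by (simp add: blk_def pblk_def pofs_ofs_disjoint)
qed (simp add: blk_def pblk_def)

lemma blk_pblk_sum: "(\<Sum>j<d. blk n j * pblk n j) = idn (d * n)"
proof (induction d)
  case (Suc d)
  have "idn (d * n) + ofs (d * n) n * pofs (d * n) n = idn (d * n + n)"
    by (rule lop_eqI) auto
  with Suc show ?case by (simp add: blk_def pblk_def add.commute)
qed (auto intro!: lop_eqI)

lemma eij_mult: "eij i j * eij k l = (if j = k then eij i l else 0)"
  by (auto intro!: lop_eqI)

lemma eij_mult': "eij i j * (eij k l * x) = (if j = k then eij i l * x else 0)"
  by (simp add: eij_mult flip: mult.assoc)

lemma idn_Suc: "idn (Suc k) = idn k + eij k k"
  by (auto intro!: lop_eqI)

lemma idn_eij: "i < n \<Longrightarrow> idn n * eij i j = eij i j" "j < n \<Longrightarrow> eij i j * idn n = eij i j"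
  "i \<ge> n \<Longrightarrow> idn n * eij i j = 0" "j \<ge> n \<Longrightarrow> eij i j * idn n = 0"
  by (auto intro!: lop_eqI)

text \<open>Compression between matrix units isolates a single entry, which allows elimination to be
  carried out by ring identities alone.\<close>

lemma eij_sandwich: "lin m n f \<Longrightarrow> eij a i * f * eij j b = app f (delta j) i *\<^sub>s eij a b"
proof (rule lop_eqI)
  fix v r
  have *: "app (eij j b) v = (\<lambda>i. v b * delta j i)" by (auto simp: fun_eq_iff)
  show "app (eij a i * f * eij j b) v r = app (app f (delta j) i *\<^sub>s eij a b) v r"
    unfolding app_ops(1) * app_cmult by simp
qed

text \<open>Gaussian elimination: subtracting the rank one operator through a nonzero entry kills a row.\<close>

lemma rank_factorisation:
  assumes "lin m n f"
  shows "\<exists>k a b a' b'. lin m k a \<and> lin k n b \<and> lin k m a' \<and> lin n k b' \<and> f = a * b \<and>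
    a' * a = idn k \<and> b * b' = idn k"
  using assms
proof (induction "card {i. i < m \<and> eij i i * f \<noteq> 0}" arbitrary: f rule: less_induct)
  case less
  note f = less.prems
  show ?case
  proof (cases "f = 0")
    case True
    have "idn 0 = 0" by (auto intro!: lop_eqI)
    with True show ?thesis by (intro exI[of _ 0]) auto
  next
    case False
    then obtain p q where pq: "p < m" "q < n" and nz: "app f (delta q) p \<noteq> 0"
      using lin_eqI[OF f lin_0] by auto
    define c where "c = app f (delta q) p"
    have c: "c \<noteq> 0" using nz by (simp add: c_def)
    have sw: "eij a p * (f * eij q b) = c *\<^sub>s eij a b" for a b
      using eij_sandwich[OF f] by (simp add: c_def mult.assoc)
    have sw': "eij a p * (f * (eij q b * x)) = c *\<^sub>s (eij a b * x)" for a b x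
      using arg_cong[OF sw, of "\<lambda>y. y * x" a b] by (simp add: mult.assoc)
    \<comment> \<open>With pivot c the product \<open>u * w\<close> agrees with f on row p and on
      column q, so \<open>f'\<close> is the Schur complement and has that row and column
      cleared.\<close>
    define u where "u = (1 / c) *\<^sub>s (f * eij q 0)"
    define w where "w = eij 0 p * f"
    define f' where "f' = f - u * w"
    have u: "lin m 1 u" and w: "lin 1 n w" using f pq by (auto simp: u_def w_def)
    have f': "lin m n f'" using u w f by (auto simp: f'_def)
    have row: "eij a p * f' = 0" for a
      using c by (simp add: f'_def u_def w_def algebra_simps sw sw' eij_mult')
    have col: "f' * eij q a = 0" for a
      using c by (simp add: f'_def u_def w_def algebra_simps sw sw' eij_mult)
    have "{i. i < m \<and> eij i i * f' \<noteq> 0} \<subset> {i. i < m \<and> eij i i * f \<noteq> 0}"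
    proof
      show "{i. i < m \<and> eij i i * f' \<noteq> 0} \<subseteq> {i. i < m \<and> eij i i * f \<noteq> 0}"
        by (auto simp: f'_def u_def right_diff_distrib) (simp flip: mult.assoc)
      have "eij p p * f \<noteq> 0"
      proof
        assume "eij p p * f = 0"
        then have "eij p p * (f * eij q q) = 0" by (simp flip: mult.assoc)
        with c have "eij p q = 0" by (simp add: sw) (metis scal_cancel scal_simps(6))
        from arg_cong[OF this, of "\<lambda>g. app g (delta q) p"] show False by simp
      qed
      then have "p \<in> {i. i < m \<and> eij i i * f \<noteq> 0}" using pq by simp
      moreover have "p \<notin> {i. i < m \<and> eij i i * f' \<noteq> 0}" by (simp add: row)
      ultimately show "{i. i < m \<and> eij i i * f' \<noteq> 0} \<noteq> {i. i < m \<and> eij i i * f \<noteq> 0}" by metis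
    qed
    then have "card {i. i < m \<and> eij i i * f' \<noteq> 0} < card {i. i < m \<and> eij i i * f \<noteq> 0}"
      by (intro psubset_card_mono) auto
    from less.hyps[OF this f'] obtain k a b a' b' where
      ab: "lin m k a" "lin k n b" "lin k m a'" "lin n k b'" "f' = a * b" "a' * a = idn k" "b * b' = idn k"
      by blast
    \<comment> \<open>Since \<open>a = f' * b'\<close> and \<open>b = a' * f'\<close>, the cleared
      row and column of \<open>f'\<close> are inherited by the two factors.\<close>
    have a0: "eij i p * a = 0" for i
      using arg_cong[OF row, of "\<lambda>y. y * b'" i] ab by (simp add: mult.assoc lin_right)
    have b0: "b * eij q i = 0" for i
      using arg_cong[OF col, of "\<lambda>y. a' * y" i] ab
      by (simp flip: mult.assoc) (simp add: lin_left mult.assoc lin_left')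
    have ae: "a * eij k i = 0" for i
      using lin_right'[OF ab(1), of "eij k i"] by (simp add: idn_eij(3))
    have eb: "eij i k * b = 0" for i
      using lin_left[OF ab(2)] by (metis idn_eij(4) mult.assoc mult_zero_left order_refl)
    have a0': "eij i p * (a * x) = 0" and b0': "b * (eij q i * x) = 0" and ae': "a * (eij k i * x) = 0"
      and eb': "eij i k * (b * x) = 0" for i x
      using arg_cong[OF a0, of "\<lambda>y. y * x" i] arg_cong[OF b0, of "\<lambda>y. y * x" i]
        arg_cong[OF ae, of "\<lambda>y. y * x" i] arg_cong[OF eb, of "\<lambda>y. y * x" i] by (simp_all add: mult.assoc)
    have eu: "eij i p * u = eij i 0" "eij i p * (u * x) = eij i 0 * x" for i x
      using c by (simp_all add: u_def sw sw' mult.assoc)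
    have we: "w * eij q i = c *\<^sub>s eij 0 i" "w * (eij q i * x) = c *\<^sub>s (eij 0 i * x)" for i x
      using c by (simp_all add: w_def sw sw' mult.assoc)
    have u0: "u * eij 0 0 = u" and w0: "eij 0 0 * w = w"
      by (simp_all add: u_def w_def eij_mult mult.assoc) (simp flip: mult.assoc add: eij_mult)
    have u0': "u * (eij 0 0 * x) = u * x" for x using u0 by (simp flip: mult.assoc)
    have bb: "b * (b' * x) = idn k * x" and aa: "a' * (a * x) = idn k * x" for x
      using ab by (simp_all flip: mult.assoc)
    \<comment> \<open>The factors receive u as new column k and w as new row k. The correction terms
      in \<open>A'\<close> and \<open>B'\<close> remove the overlap of the new column and row with
      the old one-sided inverses.\<close>
    define A where "A = a + u * eij 0 k"
    define B where "B = b + eij k 0 * w"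
    define A' where "A' = a' - a' * u * eij 0 p + eij k p"
    define B' where "B' = b' + (1 / c) *\<^sub>s (eij q k - eij q 0 * w * b')"
    have k: "lin m (Suc k) f" if "lin m k f" for f m
      using that idn_eij(3)[of k k k] lin_right'[OF that, of "eij k k"]
      by (simp add: lin_def idn_Suc distrib_left)
    have k': "lin (Suc k) m f" if "lin k m f" for f m
      using that idn_eij(4)[of k k k] by (simp add: lin_def idn_Suc distrib_right)
        (metis mult.assoc mult_zero_left)
    show ?thesis
    proof (rule exI[of _ "Suc k"], rule exI[of _ A], rule exI[of _ B], rule exI[of _ A'], rule exI[of _ B'], intro conjI)
      have e: "lin 1 (Suc k) (eij 0 k)" "lin (Suc k) 1 (eij k 0)" "lin 1 m (eij 0 p)" "lin (Suc k) m (eij k p)"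
        "lin n (Suc k) (eij q k)" "lin n 1 (eij q 0)" using pq by auto
      show "lin m (Suc k) A" unfolding A_def by (rule lin_add[OF k[OF ab(1)] lin_mult[OF u e(1)]])
      show "lin (Suc k) n B" unfolding B_def by (rule lin_add[OF k'[OF ab(2)] lin_mult[OF e(2) w]])
      show "lin (Suc k) m A'" unfolding A'_def
        by (rule lin_add[OF lin_diff[OF k'[OF ab(3)] lin_mult[OF lin_mult[OF k'[OF ab(3)] u] e(3)]] e(4)])
      show "lin n (Suc k) B'" unfolding B'_def
        by (rule lin_add[OF k[OF ab(4)] lin_scal[OF lin_diff[OF e(5) lin_mult[OF lin_mult[OF e(6) w] k[OF ab(4)]]]]])
      show "f = A * B"
        using ab(5) by (simp add: A_def B_def algebra_simps ae ae' eb eb' eij_mult' u0' f'_def)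
      show "A' * A = idn (Suc k)"
        by (simp add: A_def A'_def idn_Suc algebra_simps a0 a0' eu eij_mult' eij_mult ab)
      show "B * B' = idn (Suc k)" using c
        by (simp add: B_def B'_def idn_Suc algebra_simps scal_diff_right scal_add_right b0 b0' we eij_mult' eij_mult ab bb
            w0 lin_left[OF ab(2)])
    qed
  qed
qed

text \<open>In a full rank factorisation e = a b the equation e e = e can be cancelled on both
  sides, which leaves b a = 1.\<close>

lemma idempotent_splits:
  assumes "lin n n e" "e * e = e"
  obtains k j l where "lin n k j" "lin k n l" "e = j * l" "l * j = idn k"
proof -
  obtain k a b a' b' where ab: "lin n k a" "lin k n b" "lin k n a'" "lin n k b'" "e = a * b"
    "a' * a = idn k" "b * b' = idn k"
    using rank_factorisation[OF assms(1)] by blast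
  have "a' * (e * e) * b' = a' * e * b'" using assms by simp
  then have "(a' * a) * (b * a) * (b * b') = (a' * a) * (b * b')" by (simp add: ab(5) mult.assoc)
  then have "b * a = idn k" using ab by (simp add: lin_left' lin_right mult.assoc)
  with ab that show ?thesis by blast
qed

text \<open>If f = a b is a full rank factorisation and b b' = 1, then \<open>idn n - b' * b\<close>
  is a projection onto the kernel of f. Splitting it gives the inclusion j and the retraction l, and
  r is a generalised inverse of f.\<close>

lemma kernel_splits:
  assumes "lin m n f"
  obtains k j l r where "lin n k j" "lin k n l" "lin n m r" "l * j = idn k" "f * j = 0" "j * l + r * f = idn n"
proof -
  obtain k a b a' b' where ab: "lin m k a" "lin k n b" "lin k m a'" "lin n k b'" "f = a * b"
    "a' * a = idn k" "b * b' = idn k"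
    using rank_factorisation[OF assms] by blast
  have bb: "b * (b' * x) = idn k * x" and aa: "a' * (a * x) = idn k * x" for x
    using ab by (simp_all flip: mult.assoc)
  have r: "b' * a' * f = b' * b" using ab by (simp add: mult.assoc aa lin_left)
  have "lin n n (idn n - b' * b)" using ab by auto
  moreover have "(idn n - b' * b) * (idn n - b' * b) = idn n - b' * b"
    using ab by (simp add: algebra_simps bb lin_left lin_right lin_left' lin_right')
  ultimately obtain k' j l where jl: "lin n k' j" "lin k' n l" "idn n - b' * b = j * l" "l * j = idn k'"
    by (rule idempotent_splits)
  have "f * (idn n - b' * b) = 0"
    using ab by (simp add: algebra_simps bb lin_left lin_right lin_left' lin_right')
  then have "f * (j * l) * j = 0" by (simp add: jl)
  then have "f * j = 0" using jl by (simp add: mult.assoc lin_right)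
  moreover have "j * l + b' * a' * f = idn n" using jl(3) r by (simp add: algebra_simps)
  ultimately show ?thesis using that jl ab by blast
qed

text \<open>Injectivity enters as cancellability against square operators; the projection onto the
  kernel is itself such an operator and therefore vanishes.\<close>

lemma left_inverse_exists:
  assumes "lin m n f" "\<And>g. lin n n g \<Longrightarrow> f * g = 0 \<Longrightarrow> g = 0"
  obtains l where "lin n m l" "l * f = idn n"
proof -
  obtain k j l r where j: "lin n k j" "lin k n l" "lin n m r" "l * j = idn k" "f * j = 0" "j * l + r * f = idn n"
    using kernel_splits[OF assms(1)] .
  have "f * (j * l) = 0" using j(5) by (simp flip: mult.assoc)
  then have "j * l = 0" using assms(2) j by blast
  with j that show ?thesis by simp
qed

lemma right_inverse_exists:
  assumes "lin m n f" "\<And>g. lin m m g \<Longrightarrow> g * f = 0 \<Longrightarrow> g = 0"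
  obtains r where "lin n m r" "f * r = idn m"
proof -
  obtain k a b a' b' where ab: "lin m k a" "lin k n b" "lin k m a'" "lin n k b'" "f = a * b"
    "a' * a = idn k" "b * b' = idn k"
    using rank_factorisation[OF assms(1)] by blast
  have bb: "b * (b' * x) = idn k * x" and aa: "a' * (a * x) = idn k * x" for x
    using ab by (simp_all flip: mult.assoc)
  have "lin m m (idn m - a * a')" using ab by auto
  moreover have "(idn m - a * a') * f = 0"
    using ab by (simp add: algebra_simps aa lin_left lin_right lin_left' lin_right')
  ultimately have "idn m - a * a' = 0" using assms(2) by blast
  moreover have "f * (b' * a') = a * a'" using ab by (simp add: mult.assoc bb lin_left)
  ultimately show ?thesis using that[of "b' * a'"] ab by auto
qed

section \<open>Representations as operators\<close>

definition act :: "'g rep \<Rightarrow> 'g \<Rightarrow> lop" where "act M g = op_mat (ract M g)"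

definition wf_rep :: "'g rep \<Rightarrow> bool" where
  "wf_rep M \<longleftrightarrow> (\<forall>g. ract M g \<in> carrier_mat (rdim M) (rdim M))"

definition mk_rep :: "nat \<Rightarrow> ('g \<Rightarrow> lop) \<Rightarrow> 'g rep" where
  "mk_rep n A = Rep n (\<lambda>g. mat_op n n (A g))"

abbreviation ide :: "'g rep \<Rightarrow> lop" where "ide M \<equiv> idn (rdim M)"

definition rhom :: "'g rep \<Rightarrow> 'g rep \<Rightarrow> lop \<Rightarrow> bool" where
  "rhom M N f \<longleftrightarrow> lin (rdim N) (rdim M) f \<and> (\<forall>g. f * act M g = act N g * f)"

lemma rdim_mk_rep [simp]: "rdim (mk_rep n A) = n" by (simp add: mk_rep_def)
lemma wf_mk_rep [simp]: "wf_rep (mk_rep n A)" by (simp add: mk_rep_def wf_rep_def)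
lemma act_mk_rep: "lin n n (A g) \<Longrightarrow> act (mk_rep n A) g = A g"
  by (simp add: mk_rep_def act_def)

lemma lin_act [intro, simp]: "wf_rep M \<Longrightarrow> lin (rdim M) (rdim M) (act M g)"
  by (auto simp: wf_rep_def act_def)

lemma rhom_lin: "rhom M N f \<Longrightarrow> lin (rdim N) (rdim M) f" by (simp add: rhom_def)
lemma rhom_act: "rhom M N f \<Longrightarrow> f * act M g = act N g * f" by (simp add: rhom_def)
lemma rhom_act': "rhom M N f \<Longrightarrow> f * (act M g * x) = act N g * (f * x)"
  by (simp add: rhom_def flip: mult.assoc)
lemma rhomI: "lin (rdim N) (rdim M) f \<Longrightarrow> (\<And>g. f * act M g = act N g * f) \<Longrightarrow> rhom M N f"
  by (simp add: rhom_def)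

lemma rhom_mult [intro]: "rhom M N f \<Longrightarrow> rhom L M g \<Longrightarrow> rhom L N (f * g)"
  by (auto simp: rhom_def lin_mult mult.assoc) (simp flip: mult.assoc)
lemma rhom_0 [intro, simp]: "rhom M N 0" by (simp add: rhom_def)
lemma rhom_ide [intro, simp]: "wf_rep M \<Longrightarrow> rhom M M (ide M)"
  by (simp add: rhom_def lin_left[OF lin_act] lin_right[OF lin_act])
lemma rhom_add [intro]: "rhom M N f \<Longrightarrow> rhom M N g \<Longrightarrow> rhom M N (f + g)"
  and rhom_diff [intro]: "rhom M N f \<Longrightarrow> rhom M N g \<Longrightarrow> rhom M N (f - g)"
  and rhom_uminus [intro]: "rhom M N f \<Longrightarrow> rhom M N (- f)"
  by (auto simp: rhom_def algebra_simps lin_add lin_diff lin_uminus)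

lemma rep_homs_iff:
  assumes "wf_rep M" "wf_rep N"
  shows "f \<in> rep_homs M N \<longleftrightarrow> f \<in> carrier_mat (rdim N) (rdim M) \<and> rhom M N (op_mat f)"
proof (cases "f \<in> carrier_mat (rdim N) (rdim M)")
  case True
  have c: "ract M g \<in> carrier_mat (rdim M) (rdim M)" "ract N g \<in> carrier_mat (rdim N) (rdim N)" for g
    using assms by (auto simp: wf_rep_def)
  have "f * ract M g = ract N g * f \<longleftrightarrow> op_mat f * act M g = act N g * op_mat f" for g
    using op_mat_mult[OF True c(1)[of g]] op_mat_mult[OF c(2)[of g] True]
      op_mat_inj[of "f * ract M g" "rdim N" "rdim M" "ract N g * f"] mult_carrier_mat[OF True c(1)[of g]]
      mult_carrier_mat[OF c(2)[of g] True]
    by (simp add: act_def)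
  with True show ?thesis by (auto simp: rep_homs_def rhom_def)
qed (simp add: rep_homs_def)

lemma mult_unit_vec: "(A :: complex mat) \<in> carrier_mat m n \<Longrightarrow> j < n \<Longrightarrow> A *\<^sub>v unit_vec n j = col A j"
  by (intro eq_vecI) (auto simp: scalar_prod_right_unit)

lemma mult_zero_vecs: "(A :: complex mat) \<in> carrier_mat m n \<Longrightarrow> A *\<^sub>v 0\<^sub>v n = 0\<^sub>v m"
  "v \<in> carrier_vec n \<Longrightarrow> 0\<^sub>m m n *\<^sub>v v = (0\<^sub>v m :: complex vec)"
  by (auto intro!: eq_vecI)

text \<open>Over a field injectivity amounts to the existence of a retraction that is merely linear.
  From here on monomorphisms and epimorphisms carry such a linear one-sided inverse, so that diagram
  chases become calculations.\<close>

lemma rep_mono_iff: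
  assumes "wf_rep M" "wf_rep N"
  shows "rep_mono M N f \<longleftrightarrow> f \<in> rep_homs M N \<and> (\<exists>l. lin (rdim M) (rdim N) l \<and> l * op_mat f = ide M)"
proof (cases "f \<in> rep_homs M N")
  case True
  define m n where "m = rdim N" and "n = rdim M"
  have f: "f \<in> carrier_mat m n" using True by (simp add: rep_homs_def m_def n_def)
  have "inj_on (\<lambda>v. f *\<^sub>v v) (carrier_vec n) \<longleftrightarrow> (\<exists>l. lin n m l \<and> l * op_mat f = idn n)"
  proof
    assume inj: "inj_on (\<lambda>v. f *\<^sub>v v) (carrier_vec n)"
    show "\<exists>l. lin n m l \<and> l * op_mat f = idn n"
    proof (rule left_inverse_exists[of m n "op_mat f"])
      fix g assume g: "lin n n g" "op_mat f * g = 0"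
      define G where "G = mat_op n n g"
      have G: "G \<in> carrier_mat n n" "op_mat G = g" using g by (auto simp: G_def)
      have "op_mat (f * G) = op_mat (0\<^sub>m m n)" using op_mat_mult[OF f G(1)] G g by simp
      then have fG: "f * G = 0\<^sub>m m n" using f G by (subst (asm) op_mat_inj[of _ m n]) auto
      have "col G j = 0\<^sub>v n" if "j < n" for j
      proof -
        have "f *\<^sub>v col G j = f *\<^sub>v 0\<^sub>v n"
          using fG f G that col_mult2[OF f G(1) that] mult_zero_vecs(1)[OF f] by simp
        then show ?thesis using inj G that by (auto dest!: inj_onD)
      qed
      then have "G = 0\<^sub>m n n" using G(1) by (intro mat_col_eqI) auto
      then show "g = 0" using G(2) by simp
    qed (use f in auto)
  next
    assume "\<exists>l. lin n m l \<and> l * op_mat f = idn n"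
    then obtain l where l: "lin n m l" "l * op_mat f = idn n" by blast
    define L where "L = mat_op n m l"
    have L: "L \<in> carrier_mat n m" by (simp add: L_def)
    have "op_mat (L * f) = op_mat (1\<^sub>m n)" using op_mat_mult[OF L f] l by (simp add: L_def)
    then have "L * f = 1\<^sub>m n" using L f by (subst (asm) op_mat_inj[of _ n n]) auto
    then have "L *\<^sub>v (f *\<^sub>v v) = v" if "v \<in> carrier_vec n" for v
      using assoc_mult_mat_vec[OF L f that] that by simp
    then show "inj_on (\<lambda>v. f *\<^sub>v v) (carrier_vec n)" by (metis inj_onI)
  qed
  with True show ?thesis by (simp add: rep_mono_def m_def n_def)
qed (simp add: rep_mono_def)

lemma rep_epi_iff:
  assumes "wf_rep M" "wf_rep N"
  shows "rep_epi M N f \<longleftrightarrow> f \<in> rep_homs M N \<and> (\<exists>r. lin (rdim M) (rdim N) r \<and> op_mat f * r = ide N)"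
proof (cases "f \<in> rep_homs M N")
  case True
  define m n where "m = rdim N" and "n = rdim M"
  have f: "f \<in> carrier_mat m n" using True by (simp add: rep_homs_def m_def n_def)
  have "(\<lambda>v. f *\<^sub>v v) ` carrier_vec n = carrier_vec m \<longleftrightarrow> (\<exists>r. lin n m r \<and> op_mat f * r = idn m)"
  proof
    assume surj: "(\<lambda>v. f *\<^sub>v v) ` carrier_vec n = carrier_vec m"
    show "\<exists>r. lin n m r \<and> op_mat f * r = idn m"
    proof (rule right_inverse_exists[of m n "op_mat f"])
      fix g assume g: "lin m m g" "g * op_mat f = 0"
      define G where "G = mat_op m m g"
      have G: "G \<in> carrier_mat m m" "op_mat G = g" using g by (auto simp: G_def)
      have "op_mat (G * f) = op_mat (0\<^sub>m m n)" using op_mat_mult[OF G(1) f] G g by simp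
      then have Gf: "G * f = 0\<^sub>m m n" using f G by (subst (asm) op_mat_inj[of _ m n]) auto
      have "G *\<^sub>v unit_vec m j = 0\<^sub>v m" if "j < m" for j
      proof -
        obtain x :: "complex vec" where "x \<in> carrier_vec n" "unit_vec m j = f *\<^sub>v x"
          using surj by (metis (no_types, lifting) imageE unit_vec_carrier)
        then show ?thesis using assoc_mult_mat_vec[OF G(1) f] Gf mult_zero_vecs(2)[of x n m] by auto
      qed
      then have "col G j = 0\<^sub>v m" if "j < m" for j using mult_unit_vec[OF G(1) that] that by simp
      then have "G = 0\<^sub>m m m" using G(1) by (intro mat_col_eqI) auto
      then show "g = 0" using G(2) by simp
    qed (use f in auto)
  next
    assume "\<exists>r. lin n m r \<and> op_mat f * r = idn m"
    then obtain r where r: "lin n m r" "op_mat f * r = idn m" by blast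
    define R where "R = mat_op n m r"
    have R: "R \<in> carrier_mat n m" by (simp add: R_def)
    have "op_mat (f * R) = op_mat (1\<^sub>m m)" using op_mat_mult[OF f R] r by (simp add: R_def)
    then have "f * R = 1\<^sub>m m" using R f by (subst (asm) op_mat_inj[of _ m m]) auto
    then have "f *\<^sub>v (R *\<^sub>v v) = v" if "v \<in> carrier_vec m" for v
      using assoc_mult_mat_vec[OF f R that] that by simp
    moreover have "R *\<^sub>v v \<in> carrier_vec n" if "v \<in> carrier_vec m" for v using R that by auto
    moreover have "f *\<^sub>v v \<in> carrier_vec m" if "v \<in> carrier_vec n" for v using f that by auto
    ultimately show "(\<lambda>v. f *\<^sub>v v) ` carrier_vec n = carrier_vec m"
      by (metis (no_types, lifting) equalityI image_subsetI rev_image_eqI subsetI)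
  qed
  with True show ?thesis by (simp add: rep_epi_def m_def n_def)
qed (simp add: rep_epi_def)

text \<open>Exactness in equational form: i and p are module maps, whereas l and r form a splitting
  of vector spaces only, so the sequence need not split over the algebra.\<close>

definition ses :: "'g rep \<Rightarrow> lop \<Rightarrow> 'g rep \<Rightarrow> lop \<Rightarrow> 'g rep \<Rightarrow> lop \<Rightarrow> lop \<Rightarrow> bool" where
  "ses X i Y p Z l r \<longleftrightarrow> rhom X Y i \<and> rhom Y Z p \<and> lin (rdim X) (rdim Y) l \<and> lin (rdim Y) (rdim Z) r \<and>
     l * i = ide X \<and> p * r = ide Z \<and> p * i = 0 \<and> l * r = 0 \<and> i * l + r * p = ide Y"

lemma short_exact_iff:
  assumes wf: "wf_rep X" "wf_rep Y" "wf_rep Z"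
  shows "short_exact X i Y p Z \<longleftrightarrow> i \<in> carrier_mat (rdim Y) (rdim X) \<and> p \<in> carrier_mat (rdim Z) (rdim Y) \<and>
    (\<exists>l r. ses X (op_mat i) Y (op_mat p) Z l r)"
proof
  assume se: "short_exact X i Y p Z"
  then have ip: "i \<in> rep_homs X Y" "p \<in> rep_homs Y Z"
    by (auto simp: short_exact_def rep_mono_def rep_epi_def)
  then have c: "i \<in> carrier_mat (rdim Y) (rdim X)" "p \<in> carrier_mat (rdim Z) (rdim Y)"
    by (auto simp: rep_homs_def)
  from se obtain l r0 where l: "lin (rdim X) (rdim Y) l" "l * op_mat i = ide X"
    and r0: "lin (rdim Y) (rdim Z) r0" "op_mat p * r0 = ide Z"
    using wf by (auto simp: short_exact_def rep_mono_iff rep_epi_iff)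
  have ker: "(\<lambda>v. i *\<^sub>v v) ` carrier_vec (rdim X) = mat_kernel p"
    using se by (simp add: short_exact_def)
  have hi: "rhom X Y (op_mat i)" and hp: "rhom Y Z (op_mat p)" using ip wf by (auto simp: rep_homs_iff)
  note lins = rhom_lin[OF hi] rhom_lin[OF hp]
  have pi: "op_mat p * op_mat i = 0"
  proof -
    have "p * i = 0\<^sub>m (rdim Z) (rdim X)"
    proof (rule mat_col_eqI)
      fix j assume "j < dim_col (0\<^sub>m (rdim Z) (rdim X))"
      then have j: "j < rdim X" by simp
      have "i *\<^sub>v unit_vec (rdim X) j \<in> mat_kernel p" using ker by auto
      then show "col (p * i) j = col (0\<^sub>m (rdim Z) (rdim X)) j"
        using j mult_unit_vec[OF c(1) j] c by (subst col_mult2[OF c(2,1) j]) (auto simp: mat_kernel_def)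
    qed (use c in auto)
    then show ?thesis using op_mat_mult[OF c(2,1)] by simp
  qed
  \<comment> \<open>Equality of image and kernel, applied column by column: an operator killed by p
    factors through i and is then fixed by the projection i l.\<close>
  have il: "op_mat i * (l * g) = g" if g: "lin (rdim Y) k g" "op_mat p * g = 0" for g k
  proof -
    define G where "G = mat_op (rdim Y) k g"
    define L where "L = mat_op (rdim X) (rdim Y) l"
    have L: "L \<in> carrier_mat (rdim X) (rdim Y)" "op_mat L = l" using l by (auto simp: L_def)
    have G: "G \<in> carrier_mat (rdim Y) k" "op_mat G = g" using g by (auto simp: G_def)
    have pG: "p * G = 0\<^sub>m (rdim Z) k"
      using op_mat_mult[OF c(2) G(1)] op_mat_inj[of "p * G" "rdim Z" k "0\<^sub>m (rdim Z) k"] G g c by simp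
    have Li: "L * i = 1\<^sub>m (rdim X)"
      using op_mat_mult[OF L(1) c(1)] op_mat_inj[of "L * i" "rdim X" "rdim X" "1\<^sub>m (rdim X)"] L l c by simp
    have "i * (L * G) = G"
    proof (rule mat_col_eqI)
      fix j assume "j < dim_col G"
      then have j: "j < k" using G by simp
      have "col G j \<in> mat_kernel p" using pG j G c col_mult2[OF c(2) G(1) j] by (simp add: mat_kernel_def)
      then obtain x where x: "x \<in> carrier_vec (rdim X)" "col G j = i *\<^sub>v x" using ker by (metis (no_types, lifting) imageE)
      have "L *\<^sub>v col G j = x" using x assoc_mult_mat_vec[OF L(1) c(1) x(1)] Li by simp
      then show "col (i * (L * G)) j = col G j"
        using x col_mult2[OF c(1) _ j, of "L * G"] col_mult2[OF L(1) G(1) j] L G by auto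
    qed (use c L G in auto)
    then show ?thesis using op_mat_mult[OF c(1), of "L * G" k] op_mat_mult[OF L(1) G(1)] L G by simp
  qed
  \<comment> \<open>Removing the component of the section along the image of i achieves
    \<open>l * r = 0\<close>.\<close>
  define r where "r = r0 - op_mat i * (l * r0)"
  have li: "l * (op_mat i * x) = ide X * x" for x using l by (simp flip: mult.assoc)
  have pr: "op_mat p * (r0 * x) = ide Z * x" for x using r0 by (simp flip: mult.assoc)
  have pi': "op_mat p * (op_mat i * x) = 0" for x using pi by (simp flip: mult.assoc)
  have "op_mat i * (l * (ide Y - r0 * op_mat p)) = ide Y - r0 * op_mat p"
    using lins r0 by (intro il[of "rdim Y"]) (auto simp: algebra_simps pr lin_right lin_left)
  then have "op_mat i * l + r * op_mat p = ide Y"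
    using l by (simp add: r_def algebra_simps lin_right)
  moreover have "op_mat p * r = ide Z" "l * r = 0"
    using l r0 by (simp_all add: r_def algebra_simps pi' li lin_left')
  moreover have "lin (rdim Y) (rdim Z) r" using r0 l lins unfolding r_def by blast
  ultimately have "ses X (op_mat i) Y (op_mat p) Z l r" using hi hp l pi by (simp add: ses_def)
  with c show "i \<in> carrier_mat (rdim Y) (rdim X) \<and> p \<in> carrier_mat (rdim Z) (rdim Y) \<and>
    (\<exists>l r. ses X (op_mat i) Y (op_mat p) Z l r)" by blast
next
  assume "i \<in> carrier_mat (rdim Y) (rdim X) \<and> p \<in> carrier_mat (rdim Z) (rdim Y) \<and>
    (\<exists>l r. ses X (op_mat i) Y (op_mat p) Z l r)"
  then obtain l r where c: "i \<in> carrier_mat (rdim Y) (rdim X)" "p \<in> carrier_mat (rdim Z) (rdim Y)"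
    and s: "ses X (op_mat i) Y (op_mat p) Z l r" by blast
  then have "rep_mono X Y i" "rep_epi Y Z p"
    using wf by (auto simp: rep_mono_iff rep_epi_iff rep_homs_iff ses_def)
  moreover have "(\<lambda>v. i *\<^sub>v v) ` carrier_vec (rdim X) = mat_kernel p"
  proof -
    have "op_mat (p * i) = op_mat (0\<^sub>m (rdim Z) (rdim X))" using op_mat_mult[OF c(2,1)] s by (simp add: ses_def)
    then have pi: "p * i = 0\<^sub>m (rdim Z) (rdim X)" using c by (subst (asm) op_mat_inj[of _ "rdim Z" "rdim X"]) auto
    define L where "L = mat_op (rdim X) (rdim Y) l"
    define R where "R = mat_op (rdim Y) (rdim Z) r"
    have L: "L \<in> carrier_mat (rdim X) (rdim Y)" "op_mat L = l" using s by (auto simp: L_def ses_def)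
    have R: "R \<in> carrier_mat (rdim Y) (rdim Z)" "op_mat R = r" using s by (auto simp: R_def ses_def)
    have cc: "i * L \<in> carrier_mat (rdim Y) (rdim Y)" "R * p \<in> carrier_mat (rdim Y) (rdim Y)" using c L R by auto
    have "op_mat (i * L + R * p) = op_mat (1\<^sub>m (rdim Y))"
      using op_mat_mult[OF c(1) L(1)] op_mat_mult[OF R(1) c(2)] op_mat_add[OF cc] L R s by (simp add: ses_def)
    then have one: "i * L + R * p = 1\<^sub>m (rdim Y)"
      by (subst (asm) op_mat_inj[of _ "rdim Y" "rdim Y"]) (use cc in auto)
    have "i *\<^sub>v x \<in> mat_kernel p" if "x \<in> carrier_vec (rdim X)" for x
      using assoc_mult_mat_vec[OF c(2,1) that] pi c that mult_zero_vecs(2)[OF that, of "rdim Z"] by (auto simp: mat_kernel_def)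
    moreover have "y = i *\<^sub>v (L *\<^sub>v y) \<and> L *\<^sub>v y \<in> carrier_vec (rdim X)" if "y \<in> mat_kernel p" for y
    proof -
      have y: "y \<in> carrier_vec (rdim Y)" "p *\<^sub>v y = 0\<^sub>v (rdim Z)" using that c by (auto simp: mat_kernel_def)
      have "y = (i * L + R * p) *\<^sub>v y" using one y by simp
      also have "\<dots> = i *\<^sub>v (L *\<^sub>v y) + R *\<^sub>v (p *\<^sub>v y)"
        using add_mult_distrib_mat_vec[OF cc y(1)] assoc_mult_mat_vec[OF c(1) L(1) y(1)]
          assoc_mult_mat_vec[OF R(1) c(2) y(1)] by simp
      also have "\<dots> = i *\<^sub>v (L *\<^sub>v y)" using y c L R by auto
      finally show ?thesis using L y by auto
    qed
    ultimately show ?thesis by blast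
  qed
  ultimately show "short_exact X i Y p Z" by (simp add: short_exact_def)
qed

text \<open>Turns a relation into a rewrite rule for right-nested products, the normal form used
  throughout.\<close>

lemma assoc_ext: "a * b = c \<Longrightarrow> a * (b * x) = c * (x :: 'a :: semigroup_mult)"
  by (simp flip: mult.assoc)

section \<open>The defining relations of D(B) as identities between operators\<close>

locale taft =
  fixes d :: nat and \<zeta> :: complex
  assumes d2: "d \<ge> 2" and prim: "primitive_unity_root d \<zeta>"
begin

abbreviation DD :: "dgen rep set" where "DD \<equiv> D_modules d \<zeta>"
abbreviation EE :: "dgen rep \<Rightarrow> lop" where "EE M \<equiv> act M GE"
abbreviation FF :: "dgen rep \<Rightarrow> lop" where "FF M \<equiv> act M GF"
abbreviation KK :: "dgen rep \<Rightarrow> lop" where "KK M \<equiv> act M GK"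
abbreviation ZZ :: "dgen rep \<Rightarrow> lop" where "ZZ M \<equiv> act M GZ"

definition rels :: "nat \<Rightarrow> (dgen \<Rightarrow> lop) \<Rightarrow> bool" where
  "rels n A \<longleftrightarrow> (\<forall>g. lin n n (A g)) \<and> A GK ^ d = idn n \<and> A GZ ^ d = idn n \<and> A GE ^ d = 0 \<and> A GF ^ d = 0 \<and>
     A GZ * A GE = A GE * A GZ \<and> A GZ * A GF = A GF * A GZ \<and> A GZ * A GK = A GK * A GZ \<and>
     A GK * A GE = \<zeta> *\<^sub>s (A GE * A GK) \<and> A GK * A GF = inverse \<zeta> *\<^sub>s (A GF * A GK) \<and>
     A GE * A GF - A GF * A GE = A GK - A GZ * A GK ^ (d - 1)"

lemma d0: "d > 0" "d - 1 > 0" using d2 by auto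

lemma zeta_pow_d: "\<zeta> ^ d = 1" using prim by (simp add: primitive_unity_root_def)
lemma zeta_nz: "\<zeta> \<noteq> 0" using zeta_pow_d d2 by (metis power_0_left not_numeral_le_zero zero_neq_one)

lemma D_modules_iff: "M \<in> DD \<longleftrightarrow> wf_rep M \<and> rels (rdim M) (act M)"
proof (cases "wf_rep M")
  case True
  define n where "n = rdim M"
  have c: "ract M g \<in> carrier_mat n n" for g using True by (simp add: wf_rep_def n_def)
  have l: "lin n n (act M g)" for g using True by (simp add: n_def)
  have eq: "A = B \<longleftrightarrow> op_mat A = op_mat B" if "A \<in> carrier_mat n n" "B \<in> carrier_mat n n" for A B
    using op_mat_inj[OF that] by simp
  have cp: "ract M g ^\<^sub>m k \<in> carrier_mat n n" for g k using c by simp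
  have mc: "A * B \<in> carrier_mat n n" if "A \<in> carrier_mat n n" "B \<in> carrier_mat n n" for A B :: "complex mat"
    using that by simp
  have p: "op_mat (ract M g ^\<^sub>m k) = act M g ^ k" if "k > 0" for g k
    using op_mat_pow[OF c] lin_left[OF lin_power[OF l that]] by (simp add: act_def)
  note om = op_mat_mult[of _ n n _ n, OF c c] op_mat_mult[of _ n n _ n, OF c cp]
  have 1: "ract M GK ^\<^sub>m d = 1\<^sub>m n \<longleftrightarrow> KK M ^ d = idn n" using eq[OF cp one_carrier_mat] p d2 by simp
  have 2: "ract M GZ ^\<^sub>m d = 1\<^sub>m n \<longleftrightarrow> ZZ M ^ d = idn n" using eq[OF cp one_carrier_mat] p d2 by simp
  have 3: "ract M GE ^\<^sub>m d = 0\<^sub>m n n \<longleftrightarrow> EE M ^ d = 0" using eq[OF cp zero_carrier_mat] p d2 by simp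
  have 4: "ract M GF ^\<^sub>m d = 0\<^sub>m n n \<longleftrightarrow> FF M ^ d = 0" using eq[OF cp zero_carrier_mat] p d2 by simp
  have 5: "ract M g * ract M h = ract M h * ract M g \<longleftrightarrow> act M g * act M h = act M h * act M g" for g h
    by (subst eq[OF mc mc]) (simp_all add: c om act_def)
  have 6: "ract M g * ract M h = x \<cdot>\<^sub>m (ract M h * ract M g) \<longleftrightarrow> act M g * act M h = x *\<^sub>s (act M h * act M g)" for g h x
    by (subst eq[OF mc smult_carrier_mat[OF mc]]) (simp_all add: c om op_mat_smult act_def)
  have 7: "ract M GE * ract M GF - ract M GF * ract M GE = ract M GK - ract M GZ * ract M GK ^\<^sub>m (d - 1) \<longleftrightarrow>
    EE M * FF M - FF M * EE M = KK M - ZZ M * KK M ^ (d - 1)"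
    using d2 by (subst eq[OF minus_carrier_mat[OF mc] minus_carrier_mat[OF mc]])
      (simp_all add: c cp mc op_mat_diff[OF mc mc] op_mat_diff[OF c mc] om p act_def[symmetric] del: One_nat_def)
  show ?thesis using True l
    by (simp add: D_modules_def Let_def rels_def n_def[symmetric] c 1 2 3 4 5 6 7 del: One_nat_def)
qed (auto simp: D_modules_def wf_rep_def Let_def)

lemma D_wf [intro, simp]: "M \<in> DD \<Longrightarrow> wf_rep M" by (simp add: D_modules_iff)
lemma D_lin [intro, simp]: "M \<in> DD \<Longrightarrow> lin (rdim M) (rdim M) (act M g)" by simp
lemma D_rels: "M \<in> DD \<Longrightarrow> rels (rdim M) (act M)" by (simp add: D_modules_iff)

lemma D_comm:
  assumes "M \<in> DD"
  shows "ZZ M * EE M = EE M * ZZ M" "ZZ M * FF M = FF M * ZZ M" "ZZ M * KK M = KK M * ZZ M"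
    "KK M * EE M = \<zeta> *\<^sub>s (EE M * KK M)" "KK M * FF M = inverse \<zeta> *\<^sub>s (FF M * KK M)"
  using D_rels[OF assms] by (simp_all add: rels_def)

lemma D_comm':
  assumes "M \<in> DD"
  shows "ZZ M * (EE M * x) = EE M * (ZZ M * x)" "ZZ M * (FF M * x) = FF M * (ZZ M * x)"
    "ZZ M * (KK M * x) = KK M * (ZZ M * x)" "KK M * (EE M * x) = \<zeta> *\<^sub>s (EE M * (KK M * x))"
    "KK M * (FF M * x) = inverse \<zeta> *\<^sub>s (FF M * (KK M * x))"
  using D_comm[OF assms, THEN assoc_ext, of x] by (simp_all add: mult.assoc)

lemma D_EF: "M \<in> DD \<Longrightarrow> EE M * FF M = FF M * EE M + (KK M - ZZ M * KK M ^ (d - 1))"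
  using D_rels[of M] by (simp add: rels_def algebra_simps)

lemma D_EF': "M \<in> DD \<Longrightarrow> EE M * (FF M * x) = FF M * (EE M * x) + (KK M * x - ZZ M * (KK M ^ (d - 1) * x))"
  using assoc_ext[OF D_EF, of M x] by (simp add: distrib_right left_diff_distrib mult.assoc)

lemma mk_rep_D:
  assumes "rels n A" shows "mk_rep n A \<in> DD" "act (mk_rep n A) = A"
proof -
  show *: "act (mk_rep n A) = A" using assms by (auto simp: rels_def act_mk_rep)
  show "mk_rep n A \<in> DD" unfolding D_modules_iff * using assms by simp
qed

lemma power_intertwine:
  assumes "f * a = b * f" shows "f * a ^ k = b ^ k * (f :: lop)"
proof (induction k)
  case (Suc k)
  have "f * a ^ Suc k = b * (f * a ^ k)" using assms by (simp flip: mult.assoc)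
  then show ?case using Suc by (simp add: mult.assoc)
qed simp

text \<open>The equation \<open>one\<close> makes f and h jointly surjective, so a relation that
  holds on M and on N holds on the common target. This equips quotients, direct sums and pushouts
  with their module structure.\<close>

lemma rels_jointly_epi:
  assumes M: "M \<in> DD" "N \<in> DD" and A: "\<And>g. lin n n (A g)"
    and lf: "lin n (rdim M) f" and lh: "lin n (rdim N) h"
    and f: "\<And>g. f * act M g = A g * f" and h: "\<And>g. h * act N g = A g * h"
    and one: "f * a + h * b = idn n"
  shows "rels n A"
proof -
  have key: "P = Q" if "P * f = Q * f" "P * h = Q * h" "P * idn n = P" "Q * idn n = Q" for P Q
  proof -
    have "P * (f * a + h * b) = Q * (f * a + h * b)"
      using that by (simp add: distrib_left flip: mult.assoc)
    then show ?thesis using that one by simp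
  qed
  have fx: "A g * f = f * act M g" "A g ^ k * f = f * act M g ^ k"
    and hx: "A g * h = h * act N g" "A g ^ k * h = h * act N g ^ k" for g k
    using f h power_intertwine[OF f[of g], of k] power_intertwine[OF h[of g], of k] by simp_all
  have fx': "A g * (f * x) = f * (act M g * x)" and hx': "A g * (h * x) = h * (act N g * x)" for g x
    by (simp_all add: fx hx flip: mult.assoc)
  have p: "A g ^ k * idn n = A g ^ k" if "k > 0" for g k using lin_right[OF lin_power[OF A that]] .
  note R = D_rels[OF M(1), unfolded rels_def] D_rels[OF M(2), unfolded rels_def]
  note s = mult.assoc fx hx fx' hx' R(1) R(2) p p[OF d0(2)] d0 lin_right[OF A] lin_right[OF lf] lin_right[OF lh] lin_left[OF lf] lin_left[OF lh]
  show ?thesis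
    unfolding rels_def
  proof (intro conjI allI)
    show "A GK ^ d = idn n" "A GZ ^ d = idn n" "A GE ^ d = 0" "A GF ^ d = 0"
      "A GZ * A GE = A GE * A GZ" "A GZ * A GF = A GF * A GZ" "A GZ * A GK = A GK * A GZ"
      "A GK * A GE = \<zeta> *\<^sub>s (A GE * A GK)" "A GK * A GF = inverse \<zeta> *\<^sub>s (A GF * A GK)"
      by (rule key; simp add: s)+
    show "A GE * A GF - A GF * A GE = A GK - A GZ * A GK ^ (d - 1)"
      by (rule key) (simp_all add: s left_diff_distrib D_EF[OF M(1)] D_EF[OF M(2)] distrib_left right_diff_distrib del: One_nat_def)
  qed (rule A)
qed

text \<open>The dual principle: f and h are jointly injective, so the relations can be tested after
  mapping to M and N. It serves for submodules and pullbacks.\<close>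

lemma rels_jointly_mono:
  assumes M: "M \<in> DD" "N \<in> DD" and A: "\<And>g. lin n n (A g)"
    and lf: "lin (rdim M) n f" and lh: "lin (rdim N) n h"
    and f: "\<And>g. f * A g = act M g * f" and h: "\<And>g. h * A g = act N g * h"
    and one: "a * f + b * h = idn n"
  shows "rels n A"
proof -
  have key: "P = Q" if "f * P = f * Q" "h * P = h * Q" "idn n * P = P" "idn n * Q = Q" for P Q
  proof -
    have "(a * f + b * h) * P = (a * f + b * h) * Q"
      using that by (simp add: distrib_right mult.assoc)
    then show ?thesis using that one by simp
  qed
  have fx: "f * A g = act M g * f" "f * A g ^ k = act M g ^ k * f"
    and hx: "h * A g = act N g * h" "h * A g ^ k = act N g ^ k * h" for g k
    using f h power_intertwine[OF f[of g], of k] power_intertwine[OF h[of g], of k] by simp_all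
  have fx': "f * (A g * x) = act M g * (f * x)" "f * (A g ^ k * x) = act M g ^ k * (f * x)"
    and hx': "h * (A g * x) = act N g * (h * x)" "h * (A g ^ k * x) = act N g ^ k * (h * x)" for g x k
    by (simp_all add: fx hx flip: mult.assoc)
  have p: "idn n * A g ^ k = A g ^ k" if "k > 0" for g k using lin_left[OF lin_power[OF A that]] .
  note R = D_rels[OF M(1), unfolded rels_def] D_rels[OF M(2), unfolded rels_def]
  note Rx = D_comm'[OF M(1)] D_comm'[OF M(2)] D_EF'[OF M(1)] D_EF'[OF M(2)] D_comm[OF M(1)] D_comm[OF M(2)] D_EF[OF M(1)] D_EF[OF M(2)]
  note s = mult.assoc fx hx fx' hx' p p[OF d0(2)] d0 lin_left[OF A] lin_right[OF lf] lin_right[OF lh] lin_left[OF lf] lin_left[OF lh] Rx R(1) R(2)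
    lin_left'[OF A]
  show ?thesis
    unfolding rels_def
  proof (intro conjI allI)
    show "A GK ^ d = idn n" "A GZ ^ d = idn n" "A GE ^ d = 0" "A GF ^ d = 0"
      "A GZ * A GE = A GE * A GZ" "A GZ * A GF = A GF * A GZ" "A GZ * A GK = A GK * A GZ"
      "A GK * A GE = \<zeta> *\<^sub>s (A GE * A GK)" "A GK * A GF = inverse \<zeta> *\<^sub>s (A GF * A GK)"
      by (rule key; simp add: s)+
    show "A GE * A GF - A GF * A GE = A GK - A GZ * A GK ^ (d - 1)"
      by (rule key) (simp_all add: s right_diff_distrib del: One_nat_def)
  qed (rule A)
qed

subsection \<open>The stable category of modules over the subalgebra generated by E\<close>

text \<open>\<open>trE k\<close> sends \<open>s\<close> to the sum of the \<open>EA\<^sup>i s EB\<^sup>j\<close> over \<open>i + j = k - 1\<close>.  By Higman's criterion, the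
  maps of the form \<open>trE d s\<close> are those that factor through a free module over \<open>\<complex>[E]/(E\<^sup>d)\<close>.\<close>

primrec trE :: "lop \<Rightarrow> lop \<Rightarrow> nat \<Rightarrow> lop \<Rightarrow> lop" where
  "trE EA EB 0 s = 0"
| "trE EA EB (Suc k) s = EA * trE EA EB k s + s * EB ^ k"

text \<open>The defining recursion peels off E on the left, this one on the right. Comparing both at
  exponent d + 1, where E^d = 0, shows that \<open>trE d s\<close> commutes with E.\<close>

lemma trE_alt: "trE EA EB (Suc k) s = trE EA EB k s * EB + EA ^ k * s"
proof (induction k)
  case (Suc k)
  have "trE EA EB (Suc (Suc k)) s = EA * (trE EA EB k s * EB + EA ^ k * s) + s * EB ^ Suc k"
    using Suc by simp
  also have "\<dots> = trE EA EB (Suc k) s * EB + EA ^ Suc k * s"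
    by (simp add: distrib_left distrib_right mult.assoc add.assoc power_commutes)
  finally show ?case .
qed simp

lemma trE_left: "f * EA = EC * f \<Longrightarrow> f * trE EA EB k s = trE EC EB k (f * s)"
proof (induction k)
  case (Suc k)
  have "f * (EA * x) = EC * (f * x)" for x using Suc.prems by (simp flip: mult.assoc)
  with Suc show ?case by (simp add: distrib_left mult.assoc)
qed simp

lemma trE_right: "EB * f = f * ED \<Longrightarrow> trE EA EB k s * f = trE EA ED k (s * f)"
proof (induction k)
  case (Suc k)
  then show ?case using power_intertwine[of f ED EB k] by (simp add: distrib_right mult.assoc)
qed simp

lemma trE_add: "trE EA EB k (s + t) = trE EA EB k s + trE EA EB k t"
  and trE_uminus: "trE EA EB k (- s) = - trE EA EB k s"
  and trE_zero: "trE EA EB k 0 = 0"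
  by (induction k) (simp_all add: algebra_simps)

lemma trE_diff: "trE EA EB k (s - t) = trE EA EB k s - trE EA EB k t"
  using trE_add[of EA EB k s "- t"] by (simp add: trE_uminus)

lemma lin_trE [intro]: "lin m m EA \<Longrightarrow> lin n n EB \<Longrightarrow> lin m n s \<Longrightarrow> lin m n (trE EA EB k s)"
proof (induction k)
  case (Suc k)
  have "s * EB ^ k = s * (idn n * EB ^ k)" using Suc.prems by (simp add: lin_right')
  moreover have "lin m n (s * (idn n * EB ^ k))" using Suc.prems by blast
  ultimately have "lin m n (s * EB ^ k)" by simp
  with Suc show ?case by auto
qed simp

text \<open>As \<open>\<kappa> E = c E \<kappa>\<close>, cyclicity of the trace turns all summands into multiples of the same number.\<close>

lemma trc_trE:
  assumes "lin n n E" "lin n n \<kappa>" "\<kappa> * E = c *\<^sub>s (E * \<kappa>)"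
  shows "lin n n s \<Longrightarrow> trc n (trE E E k s * \<kappa>) = (\<Sum>i<k. c ^ i) * trc n (s * (E ^ (k - 1) * \<kappa>))"
proof (induction k arbitrary: s)
  case (Suc k)
  have l: "lin n n (trE E E k s)" using Suc.prems assms by auto
  have "trc n (trE E E (Suc k) s * \<kappa>) = trc n (E * (trE E E k s * \<kappa>)) + trc n (s * (E ^ k * \<kappa>))"
    by (simp add: distrib_right mult.assoc trc_add)
  also have "trc n (E * (trE E E k s * \<kappa>)) = trc n (trE E E k s * \<kappa> * E)"
    using assms l by (intro trc_commute[symmetric, of n n, symmetric]) auto
  also have "\<dots> = c * trc n (trE E E k (s * E) * \<kappa>)"
  proof -
    have "trE E E k s * (E * x) = trE E E k (s * E) * x" for x
      using trE_right[of E E E E k s] by (simp flip: mult.assoc)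
    then show ?thesis by (simp add: mult.assoc assms(3) trc_scal)
  qed
  also have "\<dots> = c * ((\<Sum>i<k. c ^ i) * trc n (s * E * (E ^ (k - 1) * \<kappa>)))"
    using Suc assms by (subst Suc.IH) auto
  also have "\<dots> = (\<Sum>i<k. c ^ Suc i) * trc n (s * (E ^ k * \<kappa>))"
    by (cases k) (simp_all add: mult.assoc sum_distrib_left distrib_left)
  finally show ?case
    by (simp add: sum.lessThan_Suc_shift distrib_right del: sum.lessThan_Suc)
qed simp

definition elin :: "dgen rep \<Rightarrow> dgen rep \<Rightarrow> lop \<Rightarrow> bool" where
  "elin M N f \<longleftrightarrow> lin (rdim N) (rdim M) f \<and> f * EE M = EE N * f"

definition enull :: "dgen rep \<Rightarrow> dgen rep \<Rightarrow> lop \<Rightarrow> bool" where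
  "enull M N f \<longleftrightarrow> (\<exists>s. lin (rdim N) (rdim M) s \<and> f = trE (EE N) (EE M) d s)"

text \<open>By Higman's criterion this says that M is free over C[E]/(E^d); such modules are the
  zero objects of the E-linear stable category.\<close>

definition ctr :: "dgen rep \<Rightarrow> bool" where
  "ctr M \<longleftrightarrow> enull M M (ide M)"

definition einv :: "dgen rep \<Rightarrow> dgen rep \<Rightarrow> lop \<Rightarrow> lop \<Rightarrow> bool" where
  "einv M N f g \<longleftrightarrow> elin M N f \<and> elin N M g \<and> enull M M (ide M - g * f) \<and> enull N N (ide N - f * g)"

text \<open>Invertibility in the stable category over C[E]/(E^d); the inverse is only required to
  commute with E.\<close>

definition eiso :: "dgen rep \<Rightarrow> dgen rep \<Rightarrow> lop \<Rightarrow> bool" where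
  "eiso M N f \<longleftrightarrow> (\<exists>g. einv M N f g)"

lemma rhom_elin [intro]: "rhom M N f \<Longrightarrow> elin M N f" by (simp add: rhom_def elin_def)
lemma elin_lin: "elin M N f \<Longrightarrow> lin (rdim N) (rdim M) f" by (simp add: elin_def)
lemma elin_act: "elin M N f \<Longrightarrow> f * EE M = EE N * f" by (simp add: elin_def)
lemma elin_mult [intro]: "elin M N f \<Longrightarrow> elin L M g \<Longrightarrow> elin L N (f * g)"
  by (auto simp: elin_def lin_mult mult.assoc) (simp flip: mult.assoc)
lemma elin_add [intro]: "elin M N f \<Longrightarrow> elin M N g \<Longrightarrow> elin M N (f + g)"
  and elin_diff [intro]: "elin M N f \<Longrightarrow> elin M N g \<Longrightarrow> elin M N (f - g)"
  by (auto simp: elin_def algebra_simps lin_add lin_diff)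
lemma elin_ide [intro, simp]: "M \<in> DD \<Longrightarrow> elin M M (ide M)" by auto

lemma EE_nilp: "M \<in> DD \<Longrightarrow> EE M ^ d = 0" using D_rels by (simp add: rels_def)

lemma elin_trE [intro]:
  assumes "M \<in> DD" "N \<in> DD" "lin (rdim N) (rdim M) s"
  shows "elin M N (trE (EE N) (EE M) d s)"
proof -
  have "trE (EE N) (EE M) (Suc d) s = trE (EE N) (EE M) d s * EE M" by (subst trE_alt) (simp add: EE_nilp assms)
  then show ?thesis using assms by (auto simp: elin_def EE_nilp)
qed

lemma enull_elin: "M \<in> DD \<Longrightarrow> N \<in> DD \<Longrightarrow> enull M N f \<Longrightarrow> elin M N f"
  by (auto simp: enull_def)

lemma enull_0 [simp, intro]: "enull M N 0"
  unfolding enull_def by (intro exI[of _ 0]) (simp add: trE_zero)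
lemma enullI: "lin (rdim N) (rdim M) s \<Longrightarrow> f = trE (EE N) (EE M) d s \<Longrightarrow> enull M N f"
  by (auto simp: enull_def)
lemma enullE: "enull M N f \<Longrightarrow> (\<And>s. lin (rdim N) (rdim M) s \<Longrightarrow> f = trE (EE N) (EE M) d s \<Longrightarrow> thesis) \<Longrightarrow> thesis"
  by (auto simp: enull_def)
lemma enull_add [intro]: "enull M N f \<Longrightarrow> enull M N g \<Longrightarrow> enull M N (f + g)"
  by (elim enullE) (rule enullI[OF lin_add], auto simp: trE_add)
lemma enull_diff [intro]: "enull M N f \<Longrightarrow> enull M N g \<Longrightarrow> enull M N (f - g)"
  by (elim enullE) (rule enullI[OF lin_diff], auto simp: trE_diff)
lemma enull_uminus [intro]: "enull M N f \<Longrightarrow> enull M N (- f)"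
  by (elim enullE) (rule enullI[OF lin_uminus], auto simp: trE_uminus)
lemma enull_left [intro]: "elin N L g \<Longrightarrow> enull M N f \<Longrightarrow> enull M L (g * f)"
  by (elim enullE) (rule enullI[OF lin_mult], auto simp: elin_def trE_left)
lemma enull_right [intro]: "enull M N f \<Longrightarrow> elin L M g \<Longrightarrow> enull L N (f * g)"
  by (elim enullE) (rule enullI[OF lin_mult], auto simp: elin_def trE_right)

lemma ctr_enull:
  assumes "ctr P" "elin P N b" "elin M P a" shows "enull M N (b * a)"
proof -
  have "enull M N (b * (ide P * a))" using assms unfolding ctr_def by blast
  then show ?thesis using elin_lin[OF assms(3)] by (simp add: lin_left)
qed

lemma einv_sym: "einv M N f g \<Longrightarrow> einv N M g f" by (simp add: einv_def)

lemma einv_mult: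
  assumes "einv M N f f'" "einv L M g g'" shows "einv L N (f * g) (g' * f')"
proof -
  note a = assms[unfolded einv_def]
  have l: "lin (rdim N) (rdim M) f" "lin (rdim M) (rdim L) g" "lin (rdim L) (rdim M) g'" "lin (rdim M) (rdim N) f'"
    using a by (auto dest: elin_lin)
  have e1: "ide L - g' * f' * (f * g) = (ide L - g' * g) + g' * ((ide M - f' * f) * g)"
    using l by (simp add: algebra_simps lin_left)
  have e2: "ide N - f * g * (g' * f') = (ide N - f * f') + f * ((ide M - g * g') * f')"
    using l by (simp add: algebra_simps lin_left)
  show ?thesis unfolding einv_def e1 e2 using a by (intro conjI elin_mult enull_add enull_left enull_right) auto
qed

lemma eiso_mult: "eiso M N f \<Longrightarrow> eiso L M g \<Longrightarrow> eiso L N (f * g)"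
  unfolding eiso_def by (meson einv_mult)

lemma eiso_ide: "M \<in> DD \<Longrightarrow> eiso M M (ide M)"
  unfolding eiso_def einv_def by (rule exI[of _ "ide M"]) (simp add: enull_0)

lemma einv_perturb:
  assumes "einv M N f g" "elin M N h" "enull M N (f - h)" shows "einv M N h g"
proof -
  note a = assms(1)[unfolded einv_def]
  have e: "ide M - g * h = (ide M - g * f) + g * (f - h)" "ide N - h * g = (ide N - f * g) + (f - h) * g"
    by (simp_all add: algebra_simps)
  show ?thesis unfolding einv_def e using a assms(2,3) by (intro conjI enull_add enull_left enull_right) auto
qed

lemma eiso_perturb: "eiso M N f \<Longrightarrow> elin M N h \<Longrightarrow> enull M N (f - h) \<Longrightarrow> eiso M N h"
  unfolding eiso_def by (meson einv_perturb)

lemma eiso_cancel_left: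
  assumes "eiso M N f" "eiso L N (f * g)" "elin L M g" shows "eiso L M g"
proof -
  obtain f' where f': "einv M N f f'" using assms by (auto simp: eiso_def)
  then have "eiso L M (f' * (f * g))" using assms by (meson eiso_def einv_sym eiso_mult)
  moreover have "f' * (f * g) - g = - ((ide M - f' * f) * g)"
    using elin_lin[OF assms(3)] by (simp add: algebra_simps lin_left)
  ultimately show ?thesis using f' assms(3) by (metis eiso_perturb einv_def enull_right enull_uminus)
qed

subsection \<open>Graded traces\<close>

definition theta :: "dgen rep \<Rightarrow> nat \<Rightarrow> nat \<Rightarrow> complex" where
  "theta M a b = trc (rdim M) (KK M ^ a * ZZ M ^ b)"

lemma zeta_pow_eq_1: "\<zeta> ^ a = 1 \<Longrightarrow> d dvd a"
proof -
  assume "\<zeta> ^ a = 1"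
  have "\<zeta> ^ a = \<zeta> ^ (d * (a div d) + a mod d)" by simp
  also have "\<dots> = \<zeta> ^ (a mod d)" by (simp only: power_add power_mult zeta_pow_d) simp
  finally have "\<zeta> ^ (a mod d) = 1" using \<open>\<zeta> ^ a = 1\<close> by simp
  then have "\<not> 0 < a mod d" using prim d2 unfolding primitive_unity_root_def by auto
  then show ?thesis by (simp add: dvd_eq_mod_eq_0)
qed

lemma geometric_sum_zero: "x ^ d = 1 \<Longrightarrow> x \<noteq> 1 \<Longrightarrow> (\<Sum>i<d. x ^ i) = (0 :: complex)"
  by (simp add: geometric_sum)

lemma zeta_pow_neq_1: "a \<in> {1..<d} \<Longrightarrow> \<zeta> ^ a \<noteq> 1"
  using zeta_pow_eq_1[of a] dvd_imp_le[of d a] by auto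

lemma zeta_sum_zero: "a \<in> {1..<d} \<Longrightarrow> (\<Sum>i<d. (\<zeta> ^ a) ^ i) = 0"
proof (rule geometric_sum_zero)
  have "(\<zeta> ^ a) ^ d = (\<zeta> ^ d) ^ a" by (simp add: mult.commute flip: power_mult)
  then show "(\<zeta> ^ a) ^ d = 1" by (simp add: zeta_pow_d)
qed (rule zeta_pow_neq_1)

lemma act_pow_lin: "M \<in> DD \<Longrightarrow> k > 0 \<Longrightarrow> lin (rdim M) (rdim M) (act M g ^ k)"
  by (auto intro: lin_power)

lemma weight_lin:
  assumes "M \<in> DD" "a > 0" shows "lin (rdim M) (rdim M) (KK M ^ a * ZZ M ^ b)"
proof -
  have "KK M ^ a * ZZ M ^ b = KK M ^ a * (ide M * ZZ M ^ b)"
    using act_pow_lin[OF assms(1,2), of GK] by (simp add: lin_right')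
  also have "lin (rdim M) (rdim M) \<dots>" using act_pow_lin[OF assms] assms by blast
  finally show ?thesis .
qed

lemma weight_E:
  assumes "M \<in> DD" shows "KK M ^ a * ZZ M ^ b * EE M = (\<zeta> ^ a) *\<^sub>s (EE M * (KK M ^ a * ZZ M ^ b))"
proof -
  note R = D_rels[OF assms, unfolded rels_def]
  have 1: "ZZ M ^ b * EE M = EE M * ZZ M ^ b" using power_intertwine[of "EE M" "ZZ M" "ZZ M" b] R by simp
  have 2: "KK M ^ a * EE M = (\<zeta> ^ a) *\<^sub>s (EE M * KK M ^ a)"
    by (induction a) (use R in \<open>simp_all add: mult.assoc assoc_ext[of "KK M" "EE M"] mult.commute\<close>)
  show ?thesis by (simp add: mult.assoc 1) (simp add: 2 flip: mult.assoc)
qed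

text \<open>The factor common to all terms is the sum of the powers of \<zeta>^a over a full period,
  which is zero because \<zeta>^a is a root of unity different from 1.\<close>

lemma trc_enull:
  assumes "M \<in> DD" "enull M M f" "a \<in> {1..<d}" shows "trc (rdim M) (f * (KK M ^ a * ZZ M ^ b)) = 0"
proof -
  obtain s where s: "lin (rdim M) (rdim M) s" "f = trE (EE M) (EE M) d s" using assms by (auto simp: enull_def)
  have "trc (rdim M) (f * (KK M ^ a * ZZ M ^ b)) =
    (\<Sum>i<d. (\<zeta> ^ a) ^ i) * trc (rdim M) (s * (EE M ^ (d - 1) * (KK M ^ a * ZZ M ^ b)))"
    unfolding s(2) by (rule trc_trE) (use assms s weight_lin weight_E in auto)
  then show ?thesis using zeta_sum_zero[OF assms(3)] by simp
qed

lemma weight_hom: "rhom M N f \<Longrightarrow> f * (KK M ^ a * ZZ M ^ b) = KK N ^ a * ZZ N ^ b * f"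
  using power_intertwine[OF rhom_act, of M N f GK a] power_intertwine[OF rhom_act, of M N f GZ b]
  by (metis mult.assoc)

text \<open>Cyclicity identifies the traces of g f w and f g w, and the errors 1 - g f and 1 - f g
  are orthogonal to the weight operators. The weight operator has to be moved across f, hence f is a
  D(B)-map while its inverse g may be E-linear only.\<close>

lemma theta_eiso:
  assumes "M \<in> DD" "N \<in> DD" "rhom M N f" "eiso M N f" "a \<in> {1..<d}"
  shows "theta M a b = theta N a b"
proof -
  obtain g where g: "elin N M g" "enull M M (ide M - g * f)" "enull N N (ide N - f * g)"
    using assms by (auto simp: eiso_def einv_def)
  define wM wN where "wM = KK M ^ a * ZZ M ^ b" and "wN = KK N ^ a * ZZ N ^ b"
  have w: "lin (rdim M) (rdim M) wM" "lin (rdim N) (rdim N) wN"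
    using weight_lin assms by (auto simp: wM_def wN_def)
  have "trc (rdim M) ((ide M - g * f) * wM) = 0" "trc (rdim N) ((ide N - f * g) * wN) = 0"
    using trc_enull[OF _ _ assms(5)] assms g by (auto simp: wM_def wN_def)
  then have "trc (rdim M) wM = trc (rdim M) (g * (f * wM))" "trc (rdim N) wN = trc (rdim N) (f * (g * wN))"
    using w by (simp_all add: left_diff_distrib trc_diff lin_left mult.assoc)
  moreover have "trc (rdim M) (g * (f * wM)) = trc (rdim M) (g * wN * f)"
    using weight_hom[OF assms(3), of a b] by (simp add: wM_def wN_def mult.assoc)
  moreover have "trc (rdim M) (g * wN * f) = trc (rdim N) (f * (g * wN))"
    using w g(1) rhom_lin[OF assms(3)] by (intro trc_commute) (auto dest: elin_lin)
  ultimately show ?thesis by (simp add: theta_def wM_def wN_def)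
qed

lemma theta_ctr: "M \<in> DD \<Longrightarrow> ctr M \<Longrightarrow> a \<in> {1..<d} \<Longrightarrow> theta M a b = 0"
  using trc_enull[of M "ide M" a b] weight_lin[of M a b] by (simp add: ctr_def theta_def lin_left)

lemma theta_ses:
  assumes "ses X i Y p Z l r" "X \<in> DD" "Y \<in> DD" "Z \<in> DD" "a > 0"
  shows "theta Y a b = theta X a b + theta Z a b"
proof -
  note s = assms(1)[unfolded ses_def]
  define w where "w M = KK M ^ a * ZZ M ^ b" for M
  have lw: "lin (rdim M) (rdim M) (w M)" if "M \<in> DD" for M using weight_lin[OF that assms(5)] by (simp add: w_def)
  have wh: "f * w M = w N * f" if "rhom M N f" for M N f using weight_hom[OF that] by (simp add: w_def)
  have "w Y = i * (l * w Y) + r * (p * w Y)"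
    using s lin_left[OF lw[OF assms(3)]] by (metis distrib_right mult.assoc)
  then have "trc (rdim Y) (w Y) = trc (rdim Y) (i * (l * w Y)) + trc (rdim Y) (r * (p * w Y))" by (metis trc_add)
  also have "trc (rdim Y) (i * (l * w Y)) = trc (rdim X) (l * w Y * i)"
    using s lw assms by (intro trc_commute) (auto dest: rhom_lin)
  also have "l * w Y * i = w X"
    using s wh[of X Y i] lin_left[OF lw[OF assms(2)]] by (metis mult.assoc)
  also have "trc (rdim Y) (r * (p * w Y)) = trc (rdim Z) (p * w Y * r)"
    using s lw assms by (intro trc_commute) (auto dest: rhom_lin)
  also have "p * w Y * r = w Z"
    using s wh[of Y Z p] lin_right[OF lw[OF assms(4)]] by (metis mult.assoc)
  finally show ?thesis by (simp add: theta_def w_def)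
qed

subsection \<open>Constructions with short exact sequences\<close>

lemma elin_mono_cancel:
  assumes "elin X Y i" "l * i = ide X" "elin W Y (i * g)" "lin (rdim X) (rdim W) g" "X \<in> DD"
  shows "elin W X g"
proof -
  have "i * (g * EE W) = i * (EE X * g)"
    using elin_act[OF assms(1)] elin_act[OF assms(3)] by (simp flip: mult.assoc)
  then have "(l * i) * (g * EE W) = (l * i) * (EE X * g)" by (simp add: mult.assoc)
  then show ?thesis using assms by (simp add: elin_def lin_left' lin_left'[OF D_lin])
qed

lemma elin_epi_cancel:
  assumes "elin Y Z p" "p * r = ide Z" "elin Y T (g * p)" "lin (rdim T) (rdim Z) g" "Z \<in> DD"
  shows "elin Z T g"
proof -
  have "g * EE Z * p = EE T * g * p"
    using elin_act[OF assms(1)] elin_act[OF assms(3)] by (simp add: mult.assoc)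
  then have "g * EE Z * (p * r) = EE T * g * (p * r)" by (simp flip: mult.assoc)
  then show ?thesis using assms lin_right[OF D_lin[OF assms(5), of GE]]
    by (simp add: elin_def lin_right mult.assoc)
qed

lemma rhom_epi_cancel:
  assumes "rhom Y Z p" "p * r = ide Z" "rhom Y T (g * p)" "lin (rdim T) (rdim Z) g" "Z \<in> DD"
  shows "rhom Z T g"
proof (rule rhomI)
  fix a
  have "g * act Z a * p = act T a * g * p"
    using rhom_act[OF assms(1), of a] rhom_act[OF assms(3), of a] by (simp add: mult.assoc)
  then have "g * act Z a * (p * r) = act T a * g * (p * r)" by (simp flip: mult.assoc)
  then show "g * act Z a = act T a * g" using assms lin_right[OF D_lin[OF assms(5), of a]]
    by (simp add: lin_right mult.assoc)
qed (rule assms)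

lemma sesD:
  assumes "ses X i Y p Z l r"
  shows "rhom X Y i" "rhom Y Z p" "lin (rdim Y) (rdim X) i" "lin (rdim Z) (rdim Y) p"
    "lin (rdim X) (rdim Y) l" "lin (rdim Y) (rdim Z) r"
    "l * i = ide X" "p * r = ide Z" "p * i = 0" "l * r = 0" "i * l = ide Y - r * p"
    "l * (i * x) = ide X * x" "p * (r * x) = ide Z * x" "p * (i * x) = 0" "l * (r * x) = 0"
    "i * (l * x) = ide Y * x - r * (p * x)"
proof -
  note s = assms[unfolded ses_def]
  show "rhom X Y i" "rhom Y Z p" "lin (rdim Y) (rdim X) i" "lin (rdim Z) (rdim Y) p"
    "lin (rdim X) (rdim Y) l" "lin (rdim Y) (rdim Z) r"
    "l * i = ide X" "p * r = ide Z" "p * i = 0" "l * r = 0" using s by (auto dest: rhom_lin)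
  show il: "i * l = ide Y - r * p" using s by (auto simp: eq_diff_eq)
  show "l * (i * x) = ide X * x" "p * (r * x) = ide Z * x" "p * (i * x) = 0" "l * (r * x) = 0"
    using s by (simp_all flip: mult.assoc)
  show "i * (l * x) = ide Y * x - r * (p * x)"
    using assoc_ext[OF il, of x] by (simp add: left_diff_distrib mult.assoc)
qed

lemma kernel_exists:
  assumes D: "Q \<in> DD" "Y \<in> DD" and q: "rhom Q Y q" and epi: "lin (rdim Q) (rdim Y) r1" "q * r1 = ide Y"
  obtains K i l r where "K \<in> DD" "ses K i Q q Y l r"
proof -
  obtain k j l r where j: "lin (rdim Q) k j" "lin k (rdim Q) l" "lin (rdim Q) (rdim Y) r" "l * j = idn k"
    "q * j = 0" "j * l + r * q = ide Q"
    using kernel_splits[OF rhom_lin[OF q]] .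
  note lq = rhom_lin[OF q]
  have qj: "q * (j * x) = 0" for x using j(5) by (simp flip: mult.assoc)
  \<comment> \<open>So far r is only a generalised inverse of q; surjectivity, in the form of the
    section r1, makes it a genuine section.\<close>
  have "q * (j * l + r * q) * r1 = q * r1" unfolding j(6) using lq epi by (simp add: lin_right lin_right')
  then have qr: "q * r = ide Y" using epi(2) j(3) lq
    by (simp add: distrib_left distrib_right mult.assoc qj) (metis lin_right lin_mult mult.assoc)
  have "l * (j * l + r * q) = l" unfolding j(6) using j by (simp add: lin_right)
  then have "l * (r * q) = 0" using j(2) assoc_ext[OF j(4)] by (simp add: distrib_left lin_left)
  then have "l * (r * (q * r1)) = 0" by (simp flip: mult.assoc)
  then have lr: "l * r = 0" using epi(2) j(3) by (simp add: lin_right)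
  \<comment> \<open>The action is compressed to the kernel. The identity \<open>jA\<close> below
    expresses that the kernel is invariant, so nothing is lost by the compression.\<close>
  define A where "A g = l * (act Q g * j)" for g
  have lA: "lin k k (A g)" for g unfolding A_def using j D by auto
  have jl: "j * (l * x) = ide Q * x - r * (q * x)" for x
    using arg_cong[OF j(6), of "\<lambda>y. y * x"] by (simp add: distrib_right mult.assoc eq_diff_eq)
  have jA: "j * A g = act Q g * j" for g
    using rhom_act'[OF q, of g j] lin_left'[OF D_lin[OF D(1)], of g j] by (simp add: A_def jl j(5))
  have "rels k A"
    by (rule rels_jointly_mono[of Q Q k A j j l 0]) (use D lA jA j in auto)
  note mk = mk_rep_D[OF this]
  have "rhom (mk_rep k A) Q j" by (rule rhomI) (use j mk jA in auto)
  then have "ses (mk_rep k A) j Q q Y l r" using j q qr lr by (simp add: ses_def)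
  with mk(1) that show ?thesis by blast
qed

lemma cokernel_exists:
  assumes D: "X \<in> DD" "Y \<in> DD" and i: "rhom X Y i" and mono: "lin (rdim X) (rdim Y) l" "l * i = ide X"
  obtains Z p r where "Z \<in> DD" "ses X i Y p Z l r"
proof -
  note li = rhom_lin[OF i]
  have lix: "l * (i * x) = ide X * x" for x using mono by (simp flip: mult.assoc)
  have "lin (rdim Y) (rdim Y) (ide Y - i * l)" using li mono by auto
  moreover have "(ide Y - i * l) * (ide Y - i * l) = ide Y - i * l"
    using li mono(1) by (simp add: algebra_simps lix lin_left lin_right lin_left' lin_right')
  ultimately obtain k r p where rp: "lin (rdim Y) k r" "lin k (rdim Y) p" "ide Y - i * l = r * p" "p * r = idn k"
    by (rule idempotent_splits)
  have rp': "r * p = ide Y - i * l" using rp by simp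
  have prx: "p * (r * x) = idn k * x" for x using rp by (simp flip: mult.assoc)
  have "p * ((ide Y - i * l) * i) = 0" using li by (simp add: left_diff_distrib mult.assoc mono lin_left lin_right)
  then have pi: "p * i = 0" unfolding rp(3) using rp by (simp add: mult.assoc prx lin_left')
  have "l * (ide Y - i * l) * r = 0" using mono(1) by (simp add: right_diff_distrib lix lin_right lin_left)
  then have lr: "l * r = 0" unfolding rp(3) using rp by (simp add: mult.assoc lin_right)
  define A where "A g = p * (act Y g * r)" for g
  have lA: "lin k k (A g)" for g unfolding A_def using rp D by auto
  have pix: "p * (i * x) = 0" for x using pi by (simp flip: mult.assoc)
  have Ap: "p * act Y g = A g * p" for g
  proof -
    have "A g * p = p * (act Y g * (ide Y - i * l))" by (simp add: A_def mult.assoc rp')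
    also have "\<dots> = p * act Y g" using rhom_act'[OF i, of g l] lin_right[OF D_lin[OF D(2), of g]]
      by (simp add: right_diff_distrib pix flip: rhom_act'[OF i])
    finally show ?thesis by simp
  qed
  have "rels k A"
    by (rule rels_jointly_epi[of Y Y k A p p r 0]) (use D lA Ap rp in auto)
  note mk = mk_rep_D[OF this]
  have "rhom Y (mk_rep k A) p" by (rule rhomI) (use rp mk Ap in auto)
  then have "ses X i Y p (mk_rep k A) l r" using rp i mono pi lr by (simp add: ses_def) (metis add_diff_cancel_left' diff_add_cancel add.commute)
  with mk(1) that show ?thesis by blast
qed

lemma direct_sum_exists:
  assumes D: "M \<in> DD" "N \<in> DD"
  obtains S i1 p1 i2 p2 where "S \<in> DD" "rhom M S i1" "rhom S M p1" "rhom N S i2" "rhom S N p2"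
    "p1 * i1 = ide M" "p2 * i2 = ide N" "p1 * i2 = 0" "p2 * i1 = 0" "i1 * p1 + i2 * p2 = ide S"
proof -
  define m n where "m = rdim M" and "n = rdim N"
  define i1 p1 i2 p2 where "i1 = ofs 0 m" and "p1 = pofs 0 m" and "i2 = ofs m n" and "p2 = pofs m n"
  have l: "lin (m + n) m i1" "lin m (m + n) p1" "lin (m + n) n i2" "lin n (m + n) p2"
    unfolding i1_def p1_def i2_def p2_def by auto
  have e: "p1 * i1 = idn m" "p2 * i2 = idn n" "p1 * i2 = 0" "p2 * i1 = 0" "i1 * p1 + i2 * p2 = idn (m + n)"
    by (simp_all add: i1_def p1_def i2_def p2_def pofs_ofs_disjoint ofs_pofs_sum2)
  note e' = e(1-4)[THEN assoc_ext]
  define A where "A g = i1 * (act M g * p1) + i2 * (act N g * p2)" for g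
  have ld: "lin m m (act M g)" "lin n n (act N g)" for g using D by (auto simp: m_def n_def)
  have lA: "lin (m + n) (m + n) (A g)" for g unfolding A_def using l ld by blast
  have A: "A g * i1 = i1 * act M g" "A g * i2 = i2 * act N g" "p1 * A g = act M g * p1" "p2 * A g = act N g * p2" for g
    using l ld[of g] by (simp_all add: A_def algebra_simps e e' lin_left' lin_right)
  have "rels (m + n) A"
    by (rule rels_jointly_epi[of M N _ A i1 i2 p1 p2]) (use D lA A l e in \<open>auto simp: m_def n_def\<close>)
  note mk = mk_rep_D[OF this]
  have "rhom M (mk_rep (m + n) A) i1" "rhom (mk_rep (m + n) A) M p1" "rhom N (mk_rep (m + n) A) i2" "rhom (mk_rep (m + n) A) N p2"
    using l A by (auto intro!: rhomI simp: mk(2)[unfolded m_def n_def] m_def n_def)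
  with that[of "mk_rep (m + n) A"] mk e show ?thesis by (simp add: m_def n_def)
qed

text \<open>The linear splitting of the given sequence identifies the pushout, as a vector space,
  with the sum of Y and S, so no quotient has to be formed. A vector of S is acted on by lifting it
  to I with r, acting there and mapping down by j.\<close>

lemma pushout_exists:
  assumes D: "X \<in> DD" "Y \<in> DD" "I \<in> DD" "S \<in> DD" and s: "ses X i I p S l r" and u: "rhom X Y u"
  obtains Z v w j l2 r2 where "Z \<in> DD" "ses Y v Z w S l2 r2" "rhom I Z j" "j * i = v * u" "w * j = p"
proof -
  note s = sesD[OF s]
  define y n where "y = rdim Y" and "n = rdim S"
  define v pv r2 w where "v = ofs 0 y" and "pv = pofs 0 y" and "r2 = ofs y n" and "w = pofs y n"
  have l: "lin (y + n) y v" "lin y (y + n) pv" "lin (y + n) n r2" "lin n (y + n) w"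
    unfolding v_def pv_def r2_def w_def by auto
  have e: "pv * v = idn y" "w * r2 = idn n" "pv * r2 = 0" "w * v = 0" "v * pv + r2 * w = idn (y + n)"
    by (simp_all add: v_def pv_def r2_def w_def pofs_ofs_disjoint ofs_pofs_sum2)
  note e' = e(1-4)[THEN assoc_ext]
  define j where "j = v * (u * l) + r2 * p"
  have lu: "lin y (rdim X) u" using rhom_lin[OF u] by (simp add: y_def)
  note ls = s(3-6)[folded n_def]
  have lj: "lin (y + n) (rdim I) j" unfolding j_def using l lu ls by blast
  have ji: "j * i = v * u" and wj: "w * j = p" and jr: "j * r = r2" 
    using l ls lu s(7-10) by (simp_all add: j_def algebra_simps e e' lin_right lin_left n_def y_def)
  have wj': "w * (j * x) = p * x" and ji': "j * (i * x) = v * (u * x)" and jr': "j * (r * x) = r2 * x" for x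
    using assoc_ext[OF wj] assoc_ext[OF ji] assoc_ext[OF jr] by (simp_all add: mult.assoc)
  define A where "A g = v * (act Y g * pv) + j * (act I g * (r * w))" for g
  have ld: "lin y y (act Y g)" "lin (rdim I) (rdim I) (act I g)" "lin n n (act S g)" for g
    using D by (auto simp: y_def n_def)
  have lA: "lin (y + n) (y + n) (A g)" for g unfolding A_def using l ld ls lj by blast
  have Av: "A g * v = v * act Y g" for g
    using l ld[of g] by (simp add: A_def algebra_simps e e' lin_right)
  have Aj: "A g * j = j * act I g" for g
  proof -
    have "A g * j = v * (act Y g * (pv * j)) + j * (act I g * (r * p))" by (simp add: A_def distrib_right mult.assoc wj)
    also have "pv * j = u * l" using lu by (simp add: j_def distrib_left e e' lin_left')
    also have "act Y g * (u * l) = u * (act X g * l)" using rhom_act'[OF u] by simp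
    also have "r * p = ide I - i * l" by (simp add: s(11))
    also have "j * (act I g * (ide I - i * l)) = j * act I g - j * (i * (act X g * l))"
      using lin_right[OF ld(2), of g] rhom_act'[OF s(1), of g l] by (simp add: right_diff_distrib)
    finally show ?thesis by (simp add: ji')
  qed
  have wA: "w * A g = act S g * w" for g
    using ls l ld[of g] rhom_act'[OF s(2), of g "r * w"] 
    by (simp add: A_def distrib_left e' wj' s(13) lin_left lin_left' flip: n_def)
  have "rels (y + n) A"
    by (rule rels_jointly_epi[of Y I _ A v j pv "r * w"]) (use D lA Av Aj l lj e jr' in \<open>auto simp: y_def n_def\<close>)
  note mk = mk_rep_D[OF this]
  define Z where "Z = mk_rep (y + n) A"
  have "rhom Y Z v" "rhom Z S w" "rhom I Z j"
    using l lj Av Aj wA by (auto intro!: rhomI simp: Z_def mk(2)[unfolded y_def n_def] y_def n_def)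
  moreover from this have "ses Y v Z w S pv r2" using e l by (simp add: ses_def Z_def y_def n_def)
  ultimately show ?thesis using that[of Z v w pv r2 j] mk ji wj unfolding Z_def by blast
qed

text \<open>Dually, the pullback is realised on the sum of W and K. The h-component of a vector is
  recovered from f t and the K-coordinate by means of the linear splitting.\<close>

lemma pullback_exists:
  assumes D: "K \<in> DD" "Q \<in> DD" "Y \<in> DD" "W \<in> DD" and s: "ses K i Q q Y l r" and f: "rhom W Y f"
  obtains U t h i2 l2 r2 where "U \<in> DD" "ses K i2 U t W l2 r2" "rhom U Q h" "f * t = q * h"
proof -
  note s = sesD[OF s]
  define m n where "m = rdim W" and "n = rdim K"
  define j t i2 l2 where "j = ofs 0 m" and "t = pofs 0 m" and "i2 = ofs m n" and "l2 = pofs m n"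
  have lm: "lin (m + n) m j" "lin m (m + n) t" "lin (m + n) n i2" "lin n (m + n) l2"
    unfolding j_def t_def i2_def l2_def by auto
  have e: "t * j = idn m" "l2 * i2 = idn n" "t * i2 = 0" "l2 * j = 0" "j * t + i2 * l2 = idn (m + n)"
    by (simp_all add: j_def t_def i2_def l2_def pofs_ofs_disjoint ofs_pofs_sum2)
  note e' = e(1-4)[THEN assoc_ext]
  define h where "h = r * (f * t) + i * l2"
  have lf: "lin (rdim Y) m f" using rhom_lin[OF f] by (simp add: m_def)
  note ls = s(3-6)[folded n_def]
  have lh: "lin (rdim Q) (m + n) h" unfolding h_def using lm lf ls by blast
  have qh: "q * h = f * t" and lh': "l * h = l2" and hi: "h * i2 = i" and hj: "h * j = r * f"
    using lm ls lf s(7-16) by (simp_all add: h_def algebra_simps e e' lin_right lin_left lin_left' flip: n_def)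
  have qh': "q * (h * x) = f * (t * x)" and lh'': "l * (h * x) = l2 * x" and hi': "h * (i2 * x) = i * x"
    and hj': "h * (j * x) = r * (f * x)" for x
    using assoc_ext[OF qh] assoc_ext[OF lh'] assoc_ext[OF hi] assoc_ext[OF hj] by (simp_all add: mult.assoc)
  define A where "A g = j * (act W g * t) + i2 * (l * (act Q g * h))" for g
  have ld: "lin m m (act W g)" "lin (rdim Q) (rdim Q) (act Q g)" "lin n n (act K g)" for g
    using D by (auto simp: m_def n_def)
  have lA: "lin (m + n) (m + n) (A g)" for g unfolding A_def using lm ld ls lh by blast
  have tA: "t * A g = act W g * t" for g
    using lm ld[of g] by (simp add: A_def algebra_simps e e' lin_left')
  have hA: "h * A g = act Q g * h" for g
  proof -
    have "h * A g = r * (f * (act W g * t)) + (act Q g * h - r * (q * (act Q g * h)))"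
      using lin_left'[OF ld(2), of g h] by (simp add: A_def distrib_left hj' hi' s(16))
    also have "f * (act W g * t) = act Y g * (f * t)" using rhom_act'[OF f] by simp
    also have "q * (act Q g * h) = act Y g * (f * t)" using rhom_act'[OF s(2), of g h] by (simp add: qh)
    finally show ?thesis by simp
  qed
  have Ai: "A g * i2 = i2 * act K g" for g
    using lm ld[of g] rhom_act[OF s(1), of g] 
    by (simp add: A_def distrib_right mult.assoc e' e hi flip: rhom_act[OF s(1)]) (simp add: s(12) lin_left flip: n_def)
  have "rels (m + n) A"
    by (rule rels_jointly_mono[of W Q _ A t h j "i2 * l"]) (use D lA tA hA lm lh e lh' in \<open>auto simp: m_def n_def mult.assoc\<close>)
  note mk = mk_rep_D[OF this]
  define U where "U = mk_rep (m + n) A"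
  have "rhom K U i2" "rhom U W t" "rhom U Q h"
    using lm lh tA hA Ai by (auto intro!: rhomI simp: U_def mk(2)[unfolded m_def n_def] m_def n_def)
  moreover from this have "ses K i2 U t W l2 j" using e lm by (simp add: ses_def U_def m_def n_def add.commute)
  ultimately show ?thesis using that[of U i2 t l2 j h] mk qh unfolding U_def by simp
qed

subsection \<open>Stable isomorphisms and cones\<close>

lemma linsD:
  assumes "lin m n f"
  shows "idn m * f = f" "f * idn n = f" "idn m * (f * x) = f * x" "f * (idn n * x) = f * x"
  using assms by (simp_all add: lin_left lin_right lin_left' lin_right')

lemma trE_ctr: "ctr P \<Longrightarrow> \<exists>s. lin (rdim P) (rdim P) s \<and> ide P = trE (EE P) (EE P) d s"
  by (simp add: ctr_def enull_def)

context
  fixes X Y I S Z i p l' r' v w l r u j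
  assumes D: "X \<in> DD" "Y \<in> DD" "I \<in> DD" "S \<in> DD" "Z \<in> DD"
    and s1: "ses X i I p S l' r'" and s2: "ses Y v Z w S l r"
    and u: "elin X Y u" and j: "elin I Z j" and ji: "j * i = v * u" and wj: "w * j = p" and I: "ctr I"
begin

private lemmas A1 = sesD[OF s1] and A2 = sesD[OF s2]
private lemmas lu = elin_lin[OF u] and lj = elin_lin[OF j]
private lemmas L = linsD[OF A1(3)] linsD[OF A1(4)] linsD[OF A1(5)] linsD[OF A1(6)]
  linsD[OF A2(3)] linsD[OF A2(4)] linsD[OF A2(5)] linsD[OF A2(6)] linsD[OF lu] linsD[OF lj]
private lemmas ji' = assoc_ext[OF ji, unfolded mult.assoc] and wj' = assoc_ext[OF wj]

text \<open>The pair (a0, b0) is a linear section of the surjection (v, j) from the sum of Y and I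
  onto Z; both directions below start from it.\<close>

private definition "a0 = l - l * (j * (r' * w))"
private definition "b0 = r' * w"

private lemma lin_a0: "lin (rdim Y) (rdim Z) a0" and lin_b0: "lin (rdim I) (rdim Z) b0"
  unfolding a0_def b0_def using A1(6) A2(4,5) lj by blast+

private lemma section0: "v * a0 + j * b0 = ide Z"
  by (simp add: a0_def b0_def right_diff_distrib distrib_left A1 A2 wj' L)

text \<open>Freeness of Z over C[E]/(E^d) converts the linear section of (v, j) into an E-linear
  one. From it an inverse g of u is read off, with 1 - u g factoring through Z and 1 - g u through
  I, both of which are E-free.\<close>

lemma eiso_of_ctr_cone: assumes "ctr Z" shows "eiso X Y u"
proof -
  obtain s where s: "lin (rdim Z) (rdim Z) s" "ide Z = trE (EE Z) (EE Z) d s" using trE_ctr[OF assms] by blast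
  define a b where "a = trE (EE Y) (EE Z) d (a0 * s)" and "b = trE (EE I) (EE Z) d (b0 * s)"
  have ea: "elin Z Y a" and eb: "elin Z I b"
    unfolding a_def b_def using lin_a0 lin_b0 s D by blast+
  have ev: "elin Y Z v" using A2(1) by blast
  have "v * a + j * b = trE (EE Z) (EE Z) d ((v * a0 + j * b0) * s)"
    using trE_left[OF elin_act[OF ev], of "EE Z" d "a0 * s"] trE_left[OF elin_act[OF j], of "EE Z" d "b0 * s"]
    by (simp add: a_def b_def trE_add[symmetric] distrib_right mult.assoc)
  then have vajb: "v * a + j * b = ide Z" using s(1) section0 by (simp add: lin_left flip: s(2))
  then have va: "v * a = ide Z - j * b" by (simp add: eq_diff_eq)
  have jb: "j * b = ide Z - v * a" using vajb by (simp add: eq_diff_eq add.commute)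
  have va': "v * (a * x) = ide Z * x - j * (b * x)" for x
    using assoc_ext[OF va, of x] by (simp add: left_diff_distrib mult.assoc)
  have pb: "p * (b * x) = w * x - w * (v * (a * x))" for x
  proof -
    have "p * (b * x) = w * ((j * b) * x)" by (simp add: wj'[symmetric] mult.assoc)
    then show ?thesis unfolding jb by (simp add: left_diff_distrib right_diff_distrib mult.assoc L)
  qed
  \<comment> \<open>The map b v is annihilated by p, hence takes values in the image of i; g is its
    X-coordinate.\<close>
  define g where "g = l' * (b * v)"
  have lg: "lin (rdim X) (rdim Y) g" unfolding g_def using A1 A2 elin_lin[OF eb] by blast
  have Lb: "ide I * b = b" "ide I * (b * x) = b * x" for x using elin_lin[OF eb] by (simp_all add: linsD)
  have ig: "i * g = b * v" unfolding g_def by (simp add: A1 pb A2 Lb)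
  have ig': "i * (g * x) = b * (v * x)" for x using assoc_ext[OF ig] by (simp add: mult.assoc)
  have "elin Y I (i * g)" unfolding ig using eb ev by blast
  then have eg: "elin Y X g" using elin_mono_cancel[of X I i l' Y g] A1 lg D by blast
  have "v * (ide Y - u * g) = v * (a * v)"
    by (simp add: right_diff_distrib ji'[symmetric] ig va' L)
  then have "l * (v * (ide Y - u * g)) = l * (v * (a * v))" by simp
  then have 1: "ide Y - u * g = a * v"
    using elin_lin[OF ea] by (simp add: A2 right_diff_distrib L linsD)
  define c where "c = l' * (ide I - b * j)"
  have ic: "i * c = ide I - b * j"
    by (simp add: c_def right_diff_distrib A1 pb A2 wj Lb L)
  have "elin I I (i * c)" unfolding ic using eb j D by blast
  then have ec: "elin I X c" using elin_mono_cancel[of X I i l' I c] A1 D elin_lin[OF eb] lj unfolding c_def by blast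
  have "i * (ide X - g * u) = i * (c * i)"
    using assoc_ext[OF ic, of i] by (simp add: right_diff_distrib left_diff_distrib ig' ji mult.assoc L)
  then have "l' * (i * (ide X - g * u)) = l' * (i * (c * i))" by simp
  then have 2: "ide X - g * u = c * i"
    using elin_lin[OF ec] lg by (simp add: A1 right_diff_distrib L linsD)
  have "einv X Y u g" unfolding einv_def 1 2 using u eg ctr_enull[OF assms ea ev] ctr_enull[OF I ec] A1(1) by blast
  then show ?thesis by (auto simp: eiso_def)
qed

text \<open>The map 1 - g u is a trace map, so it extends along i to an E-linear map c on I. With g
  and c the linear section of (v, j) is corrected to an E-linear one, which writes the identity of Z
  as a sum of trace maps.\<close>

lemma ctr_cone_of_eiso: assumes "eiso X Y u" shows "ctr Z"
proof -
  obtain g where g: "elin Y X g" "enull X X (ide X - g * u)" "enull Y Y (ide Y - u * g)"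
    using assms by (auto simp: eiso_def einv_def)
  obtain s where s: "lin (rdim X) (rdim X) s" "ide X - g * u = trE (EE X) (EE X) d s" using g(2) by (rule enullE)
  define c where "c = trE (EE X) (EE I) d (s * l')"
  have ec: "elin I X c" unfolding c_def using D s A1(5) by blast
  have ev: "elin Y Z v" and ei: "elin X I i" using A2(1) A1(1) by blast+
  have "c * i = trE (EE X) (EE X) d (s * l' * i)"
    unfolding c_def using elin_act[OF ei] by (intro trE_right) simp
  then have ci: "c * i = ide X - g * u" using s by (simp add: mult.assoc A1 lin_right)
  have ci': "c * (i * x) = ide X * x - g * (u * x)" for x
    using assoc_ext[OF ci, of x] by (simp add: left_diff_distrib mult.assoc)
  note Lg = linsD[OF elin_lin[OF g(1)]] and Lc = linsD[OF elin_lin[OF ec]]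
  \<comment> \<open>With x = c b0 - g a0 this is the pair (a0 + u x, b0 - i x), which is again a
    section because v u = j i.\<close>
  define a b where "a = (ide Y - u * g) * a0 + u * (c * b0)" and "b = i * (g * a0) + (ide I - i * c) * b0"
  have la: "lin (rdim Y) (rdim Z) a" and lb: "lin (rdim I) (rdim Z) b"
    unfolding a_def b_def using lin_a0 lin_b0 lu elin_lin[OF g(1)] elin_lin[OF ec] A1(3) by blast+
  have one: "v * a + j * b = ide Z"
    unfolding section0[symmetric]
    by (simp add: a_def b_def algebra_simps ji' linsD[OF lin_a0] linsD[OF lin_b0])
  have a0v: "a0 * v = ide Y" and b0v: "b0 * v = 0" and b0j: "b0 * j = ide I - i * l'"
    by (simp_all add: a0_def b0_def left_diff_distrib mult.assoc A2 wj A1)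
  have a0j: "a0 * j = u * l'"
  proof -
    have "a0 * j = l * (j * (ide I - r' * p))" by (simp add: a0_def algebra_simps wj L)
    also have "\<dots> = u * l'" by (simp flip: A1(11) add: ji' A2 L)
    finally show ?thesis .
  qed
  have av: "a * v = ide Y - u * g" and bv: "b * v = i * g"
    using elin_lin[OF g(1)] by (simp_all add: a_def b_def distrib_right mult.assoc a0v b0v right_diff_distrib left_diff_distrib L Lg)
  have aj: "a * j = u * c" and bj: "b * j = ide I - i * c"
    by (simp_all add: a_def b_def distrib_right mult.assoc a0j b0j right_diff_distrib left_diff_distrib L Lg Lc ci' distrib_left)
  have epi: "f = f'" if "f * v = f' * v" "f * j = f' * j" "f * ide Z = f" "f' * ide Z = f'" for f f'
  proof -
    have "f * (v * a0 + j * b0) = f' * (v * a0 + j * b0)"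
      using that(1,2) by (simp add: distrib_left flip: mult.assoc)
    then show ?thesis using that(3,4) section0 by simp
  qed
  have comm: "f * EE Z = EE T * f" if "elin Y T (f * v)" "elin I T (f * j)" "lin (rdim T) (rdim Z) f" "T \<in> DD" for f T
  proof (rule epi)
    show "f * EE Z * v = EE T * f * v"
      using elin_act[OF that(1)] elin_act[OF ev] by (simp add: mult.assoc)
    show "f * EE Z * j = EE T * f * j"
      using elin_act[OF that(2)] elin_act[OF j] by (simp add: mult.assoc)
  qed (use D that in \<open>simp_all add: mult.assoc lin_right[OF D_lin] lin_right\<close>)
  have "elin Y Y (a * v)" "elin I Y (a * j)" "elin Y I (b * v)" "elin I I (b * j)"
    unfolding av aj bv bj using u g ec ei D by blast+
  then have ea: "elin Z Y a" and eb: "elin Z I b"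
    using comm[of Y a] comm[of I b] la lb D by (auto simp: elin_def)
  have e: "ide Z = (j * (i * (g * a)) + v * ((ide Y - u * g) * a)) + j * b"
    by (subst one[symmetric]) (simp add: ji' algebra_simps linsD[OF la])
  have "enull Z Z (j * (i * (g * a)))" "enull Z Z (j * b)"
    using ctr_enull[OF I j] ei g ea eb by blast+
  moreover have "enull Z Z (v * ((ide Y - u * g) * a))" using ev g ea by blast
  ultimately show ?thesis unfolding ctr_def by (subst e) blast
qed

end

text \<open>Freeness of K turns the linear retraction of i into an E-linear one, so the sequence
  splits over C[E] and the projection is invertible up to a map through K.\<close>

lemma eiso_of_ctr_kernel:
  assumes D: "K \<in> DD" "U \<in> DD" "W \<in> DD" and s: "ses K i U p W l r" and K: "ctr K"
  shows "eiso U W p"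
proof -
  note A = sesD[OF s]
  note L = linsD[OF A(3)] linsD[OF A(4)] linsD[OF A(5)] linsD[OF A(6)]
  obtain s where s: "lin (rdim K) (rdim K) s" "ide K = trE (EE K) (EE K) d s" using trE_ctr[OF K] by blast
  have ei: "elin K U i" and ep: "elin U W p" using A by blast+
  define q where "q = trE (EE K) (EE U) d (s * l)"
  have eq: "elin U K q" unfolding q_def using D s A(5) by blast
  have "q * i = trE (EE K) (EE K) d (s * l * i)"
    unfolding q_def using elin_act[OF ei] by (intro trE_right) simp
  then have qi: "q * i = ide K" using s(1) by (simp add: mult.assoc A lin_right flip: s(2))
  note Lq = linsD[OF elin_lin[OF eq]]
  define t where "t = (ide U - i * q) * r"
  have tp: "t * p = ide U - i * q"
  proof -
    have "t * p = (ide U - i * q) * (ide U - i * l)" unfolding t_def A(11) by (simp add: mult.assoc)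
    also have "\<dots> = ide U - i * q"
      using assoc_ext[OF qi] by (simp add: algebra_simps L Lq)
    finally show ?thesis .
  qed
  have et: "elin W U t"
  proof (rule elin_epi_cancel[OF ep A(8)])
    show "elin U U (t * p)" unfolding tp using ei eq D by blast
    show "lin (rdim U) (rdim W) t" unfolding t_def using A elin_lin[OF eq] by blast
  qed (use D in auto)
  have "p * t = ide W" by (simp add: t_def algebra_simps A L)
  moreover have "ide U - t * p = i * q" by (simp add: tp)
  ultimately have "einv U W p t" unfolding einv_def using ep et ctr_enull[OF K ei eq] by simp
  then show ?thesis by (auto simp: eiso_def)
qed

text \<open>The stable inverse k becomes an honest section k + m of q after adding a trace map m.
  Then f = 1 - (k + m) q is a trace map that restricts to the identity on the kernel.\<close>

lemma ctr_kernel_of_eiso: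
  assumes D: "K \<in> DD" "Q \<in> DD" "Y \<in> DD" and s: "ses K i Q q Y l r" and q: "eiso Q Y q"
  shows "ctr K"
proof -
  note A = sesD[OF s]
  note L = linsD[OF A(3)] linsD[OF A(4)] linsD[OF A(5)] linsD[OF A(6)]
  have ei: "elin K Q i" and eq: "elin Q Y q" using A by blast+
  obtain k where k: "elin Y Q k" "enull Q Q (ide Q - k * q)" "enull Y Y (ide Y - q * k)"
    using q by (auto simp: eiso_def einv_def)
  obtain s where s: "lin (rdim Y) (rdim Y) s" "ide Y - q * k = trE (EE Y) (EE Y) d s" using k(3) by (rule enullE)
  define m where "m = trE (EE Q) (EE Y) d (r * s)"
  have em: "elin Y Q m" unfolding m_def using D s A(6) by blast
  have "q * m = trE (EE Y) (EE Y) d (q * (r * s))"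
    unfolding m_def using elin_act[OF eq] by (intro trE_left) simp
  then have qm: "q * m = ide Y - q * k" using s by (simp add: A lin_left)
  have qm': "q * (m * x) = ide Y * x - q * (k * x)" for x
    using assoc_ext[OF qm, of x] by (simp add: left_diff_distrib mult.assoc)
  note Lk = linsD[OF elin_lin[OF k(1)]] and Lm = linsD[OF elin_lin[OF em]]
  define f where "f = ide Q - (k + m) * q"
  have qf: "q * f = 0" by (simp add: f_def algebra_simps qm' L)
  have nf: "enull Q Q f"
  proof -
    have "enull Y Q m" unfolding m_def using A(6) s by (auto simp: enull_def)
    then have "enull Q Q ((ide Q - k * q) - m * q)" using k eq by blast
    then show ?thesis by (simp add: f_def algebra_simps)
  qed
  have lf: "lin (rdim Q) (rdim Q) f" using enull_elin[OF _ _ nf] D by (auto dest: elin_lin)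
  have ilf: "i * (l * f) = f" using lf by (simp add: A qf linsD)
  have "elin Q K (l * f)"
  proof (rule elin_mono_cancel[OF ei A(7)])
    show "elin Q Q (i * (l * f))" unfolding ilf using enull_elin nf D by blast
  qed (use A lf D in auto)
  moreover have "ide K = l * f * (i * 1)"
    using L by (simp add: f_def algebra_simps A)
  moreover have "ide K = (l * f) * ((i * l) * f) * i"
  proof -
    have "f * i = i" by (simp add: f_def algebra_simps A L)
    then have "(l * f) * ((i * l) * f) * i = l * (f * (i * (l * i)))" by (simp add: mult.assoc)
    also have "\<dots> = ide K" using \<open>f * i = i\<close> A L by (simp add: assoc_ext[OF \<open>f * i = i\<close>])
    finally show ?thesis by simp
  qed
  moreover have "(l * f) * ((i * l) * f) * i = (l * f) * (f * i)"
    using ilf by (simp add: mult.assoc)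
  ultimately show ?thesis unfolding ctr_def using nf ei by (metis enull_left enull_right)
qed

subsection \<open>Induced maps on cosyzygies\<close>

text \<open>A trace map f extends along i to an E-linear map k on I. The difference h - i' k
  vanishes on X, descends to S, and exhibits g as a map through the E-free module I'.\<close>

lemma enull_cosyzygy:
  assumes D: "X \<in> DD" "I \<in> DD" "S \<in> DD" "Y \<in> DD" "I' \<in> DD" "S' \<in> DD"
    and s1: "ses X i I p S l r" and s2: "ses Y i' I' p' S' l' r'" and I': "ctr I'"
    and f: "enull X Y f" and h: "elin I I' h" "h * i = i' * f" and g: "elin S S' g" "g * p = p' * h"
  shows "enull S S' g"
proof -
  note A = sesD[OF s1] and B = sesD[OF s2]
  note L = linsD[OF A(3)] linsD[OF A(4)] linsD[OF A(5)] linsD[OF A(6)]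
    linsD[OF B(3)] linsD[OF B(4)] linsD[OF B(5)] linsD[OF B(6)]
    linsD[OF elin_lin[OF h(1)]] linsD[OF elin_lin[OF g(1)]]
  obtain s where s: "lin (rdim Y) (rdim X) s" "f = trE (EE Y) (EE X) d s" using f by (rule enullE)
  have ei: "elin X I i" and ei': "elin Y I' i'" and ep: "elin I S p" and ep': "elin I' S' p'" using A B by blast+
  define k where "k = trE (EE Y) (EE I) d (s * l)"
  have ek: "elin I Y k" unfolding k_def using D s A(5) by blast
  note Lk = linsD[OF elin_lin[OF ek]]
  have "k * i = trE (EE Y) (EE X) d (s * l * i)"
    unfolding k_def using elin_act[OF ei] by (intro trE_right) simp
  then have ki: "k * i = f" using s by (simp add: mult.assoc A lin_right)
  define m where "m = (h - i' * k) * r"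
  have hi': "h * (i * x) = i' * (f * x)" and ki': "k * (i * x) = f * x" for x
    using assoc_ext[OF h(2)] assoc_ext[OF ki] by (simp_all add: mult.assoc)
  have mp: "m * p = h - i' * k"
  proof -
    have "m * p = (h - i' * k) * (ide I - i * l)" unfolding m_def A(11) by (simp add: mult.assoc)
    also have "\<dots> = h - i' * k" by (simp add: algebra_simps L Lk hi' ki')
    finally show ?thesis .
  qed
  have em: "elin S I' m"
  proof (rule elin_epi_cancel[OF ep A(8)])
    show "elin I I' (m * p)" unfolding mp using h ei' ek by blast
    show "lin (rdim I') (rdim S) m" unfolding m_def using A B elin_lin[OF h(1)] elin_lin[OF ek] by blast
  qed (use D in auto)
  have "g * p = p' * m * p" using B by (simp add: mult.assoc mp g right_diff_distrib)
  then have "g * (p * r) = p' * m * (p * r)" by (simp flip: mult.assoc)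
  then have "g = p' * m" using L elin_lin[OF em] by (simp add: A linsD mult.assoc)
  then show ?thesis using ctr_enull[OF I' ep' em] by simp
qed

text \<open>The inverse t of u is only E-linear, so injectivity over D(B) cannot extend it to the
  hulls. An extension k is instead obtained as the trace of a linear one, using that I is
  E-free.\<close>

lemma eiso_cosyzygy:
  assumes D: "X \<in> DD" "I \<in> DD" "S \<in> DD" "Y \<in> DD" "I' \<in> DD" "S' \<in> DD"
    and s1: "ses X i I p S l r" and s2: "ses Y i' I' p' S' l' r'" and I: "ctr I" and I': "ctr I'"
    and u: "eiso X Y u" and h: "elin I I' h" "h * i = i' * u" and g: "elin S S' g" "g * p = p' * h"
  shows "eiso S S' g"
proof -
  note A = sesD[OF s1] and B = sesD[OF s2]
  note L = linsD[OF A(3)] linsD[OF A(4)] linsD[OF A(5)] linsD[OF A(6)]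
    linsD[OF B(3)] linsD[OF B(4)] linsD[OF B(5)] linsD[OF B(6)]
    linsD[OF elin_lin[OF h(1)]] linsD[OF elin_lin[OF g(1)]]
  have ei: "elin X I i" and ei': "elin Y I' i'" and ep: "elin I S p" and ep': "elin I' S' p'" using A B by blast+
  obtain t where t: "elin Y X t" "enull X X (ide X - t * u)" "enull Y Y (ide Y - u * t)"
    using u by (auto simp: eiso_def einv_def)
  note Lt = linsD[OF elin_lin[OF t(1)]]
  obtain s where s: "lin (rdim I) (rdim I) s" "ide I = trE (EE I) (EE I) d s" using trE_ctr[OF I] by blast
  define k where "k = trE (EE I) (EE I') d (s * (i * (t * l')))"
  have ek: "elin I' I k" unfolding k_def using D s A(3) B(5) elin_lin[OF t(1)] by (intro elin_trE) blast+
  note Lk = linsD[OF elin_lin[OF ek]]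
  have "k * i' = trE (EE I) (EE Y) d (s * (i * (t * l')) * i')"
    unfolding k_def using elin_act[OF ei'] by (intro trE_right) simp
  also have "\<dots> = trE (EE I) (EE I) d s * (i * t)"
    using elin_act[OF elin_mult[OF ei t(1)]] by (subst trE_right) (simp_all add: mult.assoc B Lt)
  also have "\<dots> = i * t" using L(3)[of t] by (simp only: s(2)[symmetric])
  finally have ki: "k * i' = i * t" .
  define q where "q = p * (k * r')"
  have ki': "k * (i' * x) = i * (t * x)" for x using assoc_ext[OF ki] by (simp add: mult.assoc)
  have qp: "q * p' = p * k"
  proof -
    have "q * p' = p * (k * (ide I' - i' * l'))" by (simp add: q_def B mult.assoc)
    also have "\<dots> = p * k" by (simp add: right_diff_distrib ki' A Lk)
    finally show ?thesis .
  qed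
  have eq: "elin S' S q"
  proof (rule elin_epi_cancel[OF ep' B(8)])
    show "elin I' S (q * p')" unfolding qp using ep ek by blast
    show "lin (rdim S) (rdim S') q" unfolding q_def using A B elin_lin[OF ek] by blast
  qed (use D in auto)
  have hi': "h * (i * x) = i' * (u * x)" and gp': "g * (p * x) = p' * (h * x)" for x
    using assoc_ext[OF h(2)] assoc_ext[OF g(2)] by (simp_all add: mult.assoc)
  have qp': "q * (p' * x) = p * (k * x)" for x using assoc_ext[OF qp] by (simp add: mult.assoc)
  have "enull S S (ide S - q * g)"
  proof (rule enull_cosyzygy[OF D(1-3) D(1-3) s1 s1 I t(2)])
    show "(ide I - k * h) * i = i * (ide X - t * u)" by (simp add: algebra_simps h ki' L)
    show "(ide S - q * g) * p = p * (ide I - k * h)" by (simp add: algebra_simps g qp' L)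
  qed (use D ek h eq g in blast)+
  moreover have "enull S' S' (ide S' - g * q)"
  proof (rule enull_cosyzygy[OF D(4-6) D(4-6) s2 s2 I' t(3)])
    show "(ide I' - h * k) * i' = i' * (ide Y - u * t)" by (simp add: algebra_simps ki hi' L)
    show "(ide S' - g * q) * p' = p' * (ide I' - h * k)" by (simp add: algebra_simps qp gp' L)
  qed (use D ek h eq g in blast)+
  ultimately show ?thesis unfolding eiso_def einv_def using g eq by blast
qed

subsection \<open>Induced modules\<close>

lemma qnum_Suc: "qnum \<xi> (Suc k) = qnum \<xi> k + \<xi> ^ k" by (simp add: qnum_def)
lemma qnum_Suc': "qnum \<xi> (Suc k) = 1 + \<xi> * qnum \<xi> k"
  by (simp add: qnum_def sum.lessThan_Suc_shift sum_distrib_left del: sum.lessThan_Suc)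
lemma qnum_0 [simp]: "qnum \<xi> 0 = 0" by (simp add: qnum_def)
lemma qnum_add: "qnum \<xi> (a + b) = qnum \<xi> a + \<xi> ^ a * qnum \<xi> b"
  by (induction b) (simp_all add: qnum_Suc algebra_simps power_add)

lemma zeta_neq_1: "\<zeta> \<noteq> 1" using zeta_pow_neq_1[of 1] d2 by simp
lemma inv_zeta_pow_d: "inverse \<zeta> ^ d = 1" by (simp add: power_inverse zeta_pow_d)
lemma qnum_d: "qnum \<zeta> d = 0" "qnum (inverse \<zeta>) d = 0"
  using zeta_neq_1 geometric_sum_zero[of \<zeta>] geometric_sum_zero[of "inverse \<zeta>"]
  by (simp_all add: qnum_def zeta_pow_d inv_zeta_pow_d del: power_inverse)
lemma zeta_pow_pred: "\<zeta> ^ (d - 1) = inverse \<zeta>"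
  using zeta_pow_d d0 zeta_nz by (cases d) (auto simp: field_simps)
lemma inv_zeta_pow_pred: "inverse \<zeta> ^ (d - 1) = \<zeta>"
  using zeta_pow_pred by (simp add: power_inverse)
lemma qnum_compl:
  "k \<le> d \<Longrightarrow> \<zeta> ^ k * qnum \<zeta> (d - k) = - qnum \<zeta> k"
  "k \<le> d \<Longrightarrow> inverse \<zeta> ^ k * qnum (inverse \<zeta>) (d - k) = - qnum (inverse \<zeta>) k"
  using qnum_add[of \<zeta> k "d - k"] qnum_add[of "inverse \<zeta>" k "d - k"]
  by (simp_all add: qnum_d eq_neg_iff_add_eq_0 add.commute)

text \<open>Inclusions and projections are extended by zero beyond the last block, so shift
  identities hold without a case distinction. \<open>cl\<close> counts the blocks from the top: this
  is the numbering in which the same module appears as coinduced.\<close>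

definition bl :: "nat \<Rightarrow> nat \<Rightarrow> lop" where "bl n j = (if j < d then blk n j else 0)"
definition cl :: "nat \<Rightarrow> nat \<Rightarrow> lop" where "cl n j = (if j < d then pblk n (d - 1 - j) else 0)"
definition bop :: "nat \<Rightarrow> (nat \<Rightarrow> lop) \<Rightarrow> lop" where "bop n G = (\<Sum>j<d. G j * pblk n j)"
definition rop :: "nat \<Rightarrow> (nat \<Rightarrow> lop) \<Rightarrow> lop" where "rop n H = (\<Sum>j<d. blk n (d - 1 - j) * H j)"

lemma lin_bl [intro, simp]: "lin (d * n) n (bl n j)" and lin_cl [intro, simp]: "lin n (d * n) (cl n j)"
  by (auto simp: bl_def cl_def intro!: lin_blk lin_pblk)

lemmas Lbl = linsD[OF lin_bl] and Lcl = linsD[OF lin_cl]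

lemma bop_bl: "(\<And>j. j < d \<Longrightarrow> G j * idn n = G j) \<Longrightarrow> bop n G * bl n j = (if j < d then G j else 0)"
  by (auto simp: bop_def bl_def sum_distrib_right mult.assoc pblk_blk if_distrib cong: if_cong)

lemma lin_bop: "(\<And>j. j < d \<Longrightarrow> lin m n (G j)) \<Longrightarrow> lin m (d * n) (bop n G)"
  unfolding bop_def by (intro lin_sum lin_mult[where k = n]) auto

lemma bl_ext:
  assumes "lin m (d * n) f" "lin m (d * n) g" "\<And>j. j < d \<Longrightarrow> f * bl n j = g * bl n j"
  shows "f = g"
proof -
  have "f * blk n j * pblk n j = g * blk n j * pblk n j" if "j < d" for j
    using assms(3)[OF that] that by (simp add: bl_def)
  then have "f * (\<Sum>j<d. blk n j * pblk n j) = g * (\<Sum>j<d. blk n j * pblk n j)"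
    unfolding sum_distrib_left by (intro sum.cong) (auto simp: mult.assoc)
  then show ?thesis using assms by (simp add: blk_pblk_sum lin_right)
qed

lemma cl_rop: "(\<And>j. j < d \<Longrightarrow> idn n * H j = H j) \<Longrightarrow> cl n j * rop n H = (if j < d then H j else 0)"
proof (cases "j < d")
  case True
  assume H: "\<And>j. j < d \<Longrightarrow> idn n * H j = H j"
  have "d - Suc j = d - Suc i \<longleftrightarrow> j = i" if "i < d" for i using True that by auto
  then have "cl n j * rop n H = (\<Sum>i<d. (if j = i then H i else 0))"
    unfolding rop_def sum_distrib_left using True H
    by (intro sum.cong) (auto simp: cl_def pblk_blk simp flip: mult.assoc)
  with True show ?thesis by simp
qed (simp add: cl_def)

lemma lin_rop: "(\<And>j. j < d \<Longrightarrow> lin n m (H j)) \<Longrightarrow> lin (d * n) m (rop n H)"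
  unfolding rop_def using d0 by (intro lin_sum lin_mult[where k = n]) (auto intro!: lin_blk)

lemma cl_ext:
  assumes "lin (d * n) m f" "lin (d * n) m g" "\<And>j. j < d \<Longrightarrow> cl n j * f = cl n j * g"
  shows "f = g"
proof -
  have "pblk n j * f = pblk n j * g" if "j < d" for j
    using assms(3)[of "d - 1 - j"] that by (simp add: cl_def)
  then have "(\<Sum>j<d. blk n j * pblk n j) * f = (\<Sum>j<d. blk n j * pblk n j) * g"
    unfolding sum_distrib_right by (intro sum.cong) (auto simp: mult.assoc)
  then show ?thesis using assms by (simp add: blk_pblk_sum lin_left)
qed

lemma cl_bl: "cl n i * bl n j = (if i + j = d - 1 then idn n else 0)"
  using d0 by (auto simp: cl_def bl_def pblk_blk)

text \<open>For a shift e the summand e^i s e^(d-1-i), with s mapping the top block to the bottom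
  one, is the projection to block i. The sum over all i is the identity, which is Higman's criterion
  for a free module.\<close>

lemma trE_shift:
  assumes "\<And>j. e * bl n j = bl n (Suc j)" "\<And>j. cl n j * e = cl n (Suc j)"
  shows "trE e e d (bl n 0 * cl n 0) = idn (d * n)"
proof -
  have c: "cl n 0 * e ^ k = cl n k" for k
    by (induction k) (simp_all add: power_Suc2 assms(2) del: power_Suc flip: mult.assoc)
  have "trE e e k (bl n 0 * cl n 0) = (\<Sum>i<k. bl n i * cl n (k - 1 - i))" for k
  proof (induction k)
    case (Suc k)
    have "e * (\<Sum>i<k. bl n i * cl n (k - 1 - i)) = (\<Sum>i<k. bl n (Suc i) * cl n (k - Suc i))"
      unfolding sum_distrib_left by (intro sum.cong) (auto simp: assms(1) simp flip: mult.assoc)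
    then show ?case by (simp add: Suc sum.lessThan_Suc_shift c mult.assoc del: sum.lessThan_Suc)
  qed simp
  also have "(\<Sum>i<d. bl n i * cl n (d - 1 - i)) = (\<Sum>j<d. blk n j * pblk n j)"
    by (intro sum.cong) (auto simp: bl_def cl_def)
  finally show ?thesis by (simp add: blk_pblk_sum)
qed

text \<open>The commutation formula known from quantum sl(2), with \<open>Ki\<close> standing for z
  K^(-1). Two kinds of q-numbers occur because K and \<open>Ki\<close> are scaled by mutually
  inverse factors when moved past F; both vanish at exponent d.\<close>

lemma commute_EF_pow:
  fixes E F K Ki :: lop
  assumes "K * F = inverse \<zeta> *\<^sub>s (F * K)" "Ki * F = \<zeta> *\<^sub>s (F * Ki)" "E * F = F * E + (K - Ki)"
  shows "E * F ^ k = F ^ k * E + F ^ (k - 1) * (qnum (inverse \<zeta>) k *\<^sub>s K - qnum \<zeta> k *\<^sub>s Ki)"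
proof (induction k)
  case (Suc k)
  show ?case
  proof (cases k)
    case (Suc m)
    have "E * F ^ Suc k = (E * F ^ k) * F" by (simp only: power_Suc2 mult.assoc)
    also have "\<dots> = (F ^ k * E + F ^ (k - 1) * (qnum (inverse \<zeta>) k *\<^sub>s K - qnum \<zeta> k *\<^sub>s Ki)) * F"
      by (simp only: Suc.IH)
    also have "\<dots> = F ^ k * (E * F) + F ^ m * (qnum (inverse \<zeta>) k *\<^sub>s (K * F) - qnum \<zeta> k *\<^sub>s (Ki * F))"
      by (simp add: \<open>k = Suc m\<close> distrib_right left_diff_distrib mult.assoc)
    also have "\<dots> = F ^ Suc k * E + F ^ k * ((1 + inverse \<zeta> * qnum (inverse \<zeta>) k) *\<^sub>s K - (1 + \<zeta> * qnum \<zeta> k) *\<^sub>s Ki)"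
      by (simp add: assms \<open>k = Suc m\<close> distrib_left right_diff_distrib scal_add_left mult.assoc power_commutes mult.commute[of _ \<zeta>]
          mult.commute[of _ "inverse \<zeta>"]) (simp add: power_Suc2 mult.assoc del: power_Suc flip: mult.assoc[of F "F ^ m"] power_Suc)
    finally show ?thesis by (simp add: qnum_Suc')
  qed (simp add: assms qnum_def)
qed simp

lemma commute_E_pow_F:
  fixes E F K Ki :: lop
  assumes "K * E = \<zeta> *\<^sub>s (E * K)" "Ki * E = inverse \<zeta> *\<^sub>s (E * Ki)" "E * F = F * E + (K - Ki)"
  shows "E ^ k * F = F * E ^ k + E ^ (k - 1) * (qnum \<zeta> k *\<^sub>s K - qnum (inverse \<zeta>) k *\<^sub>s Ki)"
proof (induction k)
  case (Suc k)
  have K: "K * E ^ k = \<zeta> ^ k *\<^sub>s (E ^ k * K)" "Ki * E ^ k = inverse \<zeta> ^ k *\<^sub>s (E ^ k * Ki)" for k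
    by (induction k) (simp_all add: assoc_ext[OF assms(1)] assoc_ext[OF assms(2)] mult.assoc mult.commute)
  have "E ^ Suc k * F = E * (E ^ k * F)" by (simp add: mult.assoc)
  also have "\<dots> = (E * F) * E ^ k + E * (E ^ (k - 1) * (qnum \<zeta> k *\<^sub>s K - qnum (inverse \<zeta>) k *\<^sub>s Ki))"
    by (simp add: Suc.IH distrib_left mult.assoc)
  also have "E * (E ^ (k - 1) * (qnum \<zeta> k *\<^sub>s K - qnum (inverse \<zeta>) k *\<^sub>s Ki)) =
      E ^ k * (qnum \<zeta> k *\<^sub>s K - qnum (inverse \<zeta>) k *\<^sub>s Ki)"
    by (cases k) (simp_all add: mult.assoc)
  finally show ?case
    by (simp add: assms(3) distrib_right left_diff_distrib right_diff_distrib K qnum_Suc scal_add_left mult.assoc algebra_simps)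
qed simp

lemma D_Ki:
  assumes "M \<in> DD"
  defines "Ki \<equiv> ZZ M * KK M ^ (d - 1)"
  shows "Ki * EE M = inverse \<zeta> *\<^sub>s (EE M * Ki)" "Ki * FF M = \<zeta> *\<^sub>s (FF M * Ki)" "EE M * FF M = FF M * EE M + (KK M - Ki)"
proof -
  have "KK M ^ k * EE M = \<zeta> ^ k *\<^sub>s (EE M * KK M ^ k)" "KK M ^ k * FF M = inverse \<zeta> ^ k *\<^sub>s (FF M * KK M ^ k)" for k
    by (induction k) (simp_all add: D_comm'[OF assms(1)] mult.assoc mult.commute)
  from this[of "d - 1"] show "Ki * EE M = inverse \<zeta> *\<^sub>s (EE M * Ki)" "Ki * FF M = \<zeta> *\<^sub>s (FF M * Ki)"
    by (simp_all only: Ki_def zeta_pow_pred inv_zeta_pow_pred mult.assoc scal_simps D_comm'[OF assms(1)])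
qed (simp add: Ki_def D_EF[OF assms(1)])

lemma D_EF_pow: "M \<in> DD \<Longrightarrow> EE M ^ k * FF M = FF M * EE M ^ k + EE M ^ (k - 1) *
    (qnum \<zeta> k *\<^sub>s KK M - qnum (inverse \<zeta>) k *\<^sub>s (ZZ M * KK M ^ (d - 1)))"
  by (intro commute_E_pow_F D_Ki D_comm)

section \<open>Induction in two steps: powers of F, then powers of E\<close>

definition wlin :: "dgen rep \<Rightarrow> dgen rep \<Rightarrow> lop \<Rightarrow> bool" where
  "wlin M N f \<longleftrightarrow> lin (rdim N) (rdim M) f \<and> f * KK M = KK N * f \<and> f * ZZ M = ZZ N * f"

text \<open>The data of a module over the subalgebra generated by F, K and z.\<close>

definition frels :: "nat \<Rightarrow> lop \<Rightarrow> lop \<Rightarrow> lop \<Rightarrow> bool" where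
  "frels m F K z \<longleftrightarrow> lin m m F \<and> lin m m K \<and> lin m m z \<and> K ^ d = idn m \<and> z ^ d = idn m \<and> F ^ d = 0 \<and>
     z * F = F * z \<and> z * K = K * z \<and> K * F = inverse \<zeta> *\<^sub>s (F * K)"

text \<open>In the inner step block i stands for F^i \<otimes> M, in the outer step block j stands
  for E^j \<otimes> N with N the result of the inner step. \<open>indF\<close> is the shift and
  serves for F in the first step and for E in the second; \<open>indEF\<close> rewrites F E^j as E^j
  F minus its commutator term.\<close>

definition indF :: "nat \<Rightarrow> lop" where "indF n = bop n (\<lambda>i. bl n (Suc i))"
definition indFK :: "nat \<Rightarrow> lop \<Rightarrow> lop" where "indFK n K = bop n (\<lambda>i. inverse \<zeta> ^ i *\<^sub>s (bl n i * K))"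
definition indZ :: "nat \<Rightarrow> lop \<Rightarrow> lop" where "indZ n z = bop n (\<lambda>i. bl n i * z)"
definition indEK :: "nat \<Rightarrow> lop \<Rightarrow> lop" where "indEK n K = bop n (\<lambda>i. \<zeta> ^ i *\<^sub>s (bl n i * K))"
definition indEF :: "nat \<Rightarrow> lop \<Rightarrow> lop \<Rightarrow> lop \<Rightarrow> lop" where
  "indEF n F K z = bop n (\<lambda>j. bl n j * F - bl n (j - 1) * (qnum \<zeta> j *\<^sub>s K - qnum (inverse \<zeta>) j *\<^sub>s (z * K ^ (d - 1))))"

lemma bl_ge: "j \<ge> d \<Longrightarrow> bl n j = 0" and cl_ge: "j \<ge> d \<Longrightarrow> cl n j = 0" by (simp_all add: bl_def cl_def)

lemma indF_bl: "indF n * bl n i = bl n (Suc i)"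
  by (simp add: indF_def bop_bl Lbl bl_ge)
lemma indFK_bl: "lin n n K \<Longrightarrow> indFK n K * bl n i = inverse \<zeta> ^ i *\<^sub>s (bl n i * K)"
  and indEK_bl: "lin n n K \<Longrightarrow> indEK n K * bl n i = \<zeta> ^ i *\<^sub>s (bl n i * K)"
  and indZ_bl: "lin n n K \<Longrightarrow> indZ n K * bl n i = bl n i * K"
  by (simp_all add: indFK_def indEK_def indZ_def bop_bl linsD bl_ge mult.assoc)

lemma lin_ind: "lin (d * n) (d * n) (indF n)" "lin n n K \<Longrightarrow> lin (d * n) (d * n) (indFK n K)"
  "lin n n K \<Longrightarrow> lin (d * n) (d * n) (indEK n K)" "lin n n K \<Longrightarrow> lin (d * n) (d * n) (indZ n K)"
  unfolding indF_def indFK_def indEK_def indZ_def by (intro lin_bop; blast)+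

lemma cl_indF: "cl n i * indF n = cl n (Suc i)"
  by (rule bl_ext[of n n]) (use lin_ind in \<open>auto simp: mult.assoc indF_bl cl_bl intro!: lin_mult[OF lin_cl]\<close>)
lemma cl_indZ: "lin n n K \<Longrightarrow> cl n i * indZ n K = K * cl n i"
  by (rule bl_ext[of n n]) (use lin_ind in \<open>auto simp: mult.assoc indZ_bl cl_bl linsD assoc_ext[OF cl_bl] intro!: lin_mult[OF lin_cl] lin_mult[OF _ lin_cl]\<close>)
lemma zeta_pow_compl: "i + j = d - 1 \<Longrightarrow> inverse \<zeta> ^ j = \<zeta> ^ Suc i" "i + j = d - 1 \<Longrightarrow> \<zeta> ^ j = inverse \<zeta> ^ Suc i"
proof -
  assume "i + j = d - 1"
  then have "Suc i + j = d" using d0 by simp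
  then have "\<zeta> ^ Suc i * \<zeta> ^ j = 1" by (metis power_add zeta_pow_d)
  then show "inverse \<zeta> ^ j = \<zeta> ^ Suc i" "\<zeta> ^ j = inverse \<zeta> ^ Suc i"
    by (metis inverse_unique power_inverse mult.commute)+
qed
lemma cl_indFK: "lin n n K \<Longrightarrow> cl n i * indFK n K = \<zeta> ^ Suc i *\<^sub>s (K * cl n i)"
  by (rule bl_ext[of n n])
    (use lin_ind in \<open>auto simp: mult.assoc indFK_bl cl_bl linsD assoc_ext[OF cl_bl] zeta_pow_compl simp del: power_Suc
      intro!: lin_mult[OF lin_cl] lin_mult[OF _ lin_cl] lin_scal\<close>)
lemma cl_indEK: "lin n n K \<Longrightarrow> cl n i * indEK n K = inverse \<zeta> ^ Suc i *\<^sub>s (K * cl n i)"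
  by (rule bl_ext[of n n])
    (use lin_ind in \<open>auto simp: mult.assoc indEK_bl cl_bl linsD assoc_ext[OF cl_bl] zeta_pow_compl simp del: power_Suc
      intro!: lin_mult[OF lin_cl] lin_mult[OF _ lin_cl] lin_scal\<close>)

lemma frels_ind:
  assumes "lin n n K" "lin n n z" "K ^ d = idn n" "z ^ d = idn n" "z * K = K * z"
  shows "frels (d * n) (indF n) (indFK n K) (indZ n z)"
proof -
  note l = lin_ind(1) lin_ind(2)[OF assms(1)] lin_ind(4)[OF assms(2)]
  note r = indF_bl indFK_bl[OF assms(1)] indZ_bl[OF assms(2)]
    indF_bl[THEN assoc_ext, unfolded mult.assoc] indFK_bl[OF assms(1), THEN assoc_ext, unfolded mult.assoc] 
    indZ_bl[OF assms(2), THEN assoc_ext, unfolded mult.assoc]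
  have F: "indF n ^ k * bl n i = bl n (i + k)" for k i
    by (induction k) (simp_all add: mult.assoc r)
  have K: "indFK n K ^ k * bl n i = (inverse \<zeta> ^ i) ^ k *\<^sub>s (bl n i * K ^ k)" for k i
    by (induction k) (simp_all add: mult.assoc r mult.commute power_commutes)
  have z: "indZ n z ^ k * bl n i = bl n i * z ^ k" for k i
    by (induction k) (simp_all add: mult.assoc r power_commutes)
  have i: "(inverse \<zeta> ^ i) ^ d = 1" for i by (metis inv_zeta_pow_d power_commuting_commutes power_mult mult.commute power_one)
  have lp: "lin (d * n) (d * n) (f ^ d)" if "lin (d * n) (d * n) f" for f using lin_power[OF that d0(1)] .
  show ?thesis unfolding frels_def
  proof (intro conjI l)
    show "indFK n K ^ d = idn (d * n)" "indZ n z ^ d = idn (d * n)" "indF n ^ d = 0"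
      by (rule bl_ext[of "d * n" n]; (intro lp l lin_idn lin_0)?; simp add: F K z i assms bl_ge Lbl)+
    show "indZ n z * indF n = indF n * indZ n z" "indZ n z * indFK n K = indFK n K * indZ n z"
      by (rule bl_ext[of "d * n" n]; (intro lin_mult[where k = "d * n"] l)?; simp add: r assms mult.assoc)+
    show "indFK n K * indF n = inverse \<zeta> *\<^sub>s (indF n * indFK n K)"
      by (rule bl_ext[of "d * n" n]; (intro lin_mult[where k = "d * n"] lin_scal l)?; simp add: r assms mult.assoc)
  qed
qed

lemma qcomm_pow: "K * F = c *\<^sub>s (F * K) \<Longrightarrow> K * F ^ i = c ^ i *\<^sub>s (F ^ i * K)"
proof (induction i)
  case (Suc i)
  then show ?case by (simp add: assoc_ext[OF Suc.prems] mult.assoc mult.commute)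
qed simp

lemma qcomm_pow': "K * F = c *\<^sub>s (F * K) \<Longrightarrow> K ^ i * F = c ^ i *\<^sub>s (F * K ^ i)"
proof (induction i)
  case (Suc i)
  then show ?case by (simp add: assoc_ext[OF Suc.prems] mult.assoc mult.commute)
qed simp

lemma nilp_ge: "x ^ d = 0 \<Longrightarrow> i \<ge> d \<Longrightarrow> (x :: lop) ^ i = 0"
  by (metis le_add_diff_inverse mult_zero_left power_add)

context
  fixes m F K z assumes fr: "frels m F K z"
begin

private lemmas frD = fr[unfolded frels_def]
private lemma lF: "lin m m F" and lK: "lin m m K" and lz: "lin m m z" using frD by auto
private lemma lKi: "lin m m (z * K ^ (d - 1))" using lz lin_power[OF lK d0(2)] by blast

lemma indEF_bl: "indEF m F K z * bl m j =
    bl m j * F - bl m (j - 1) * (qnum \<zeta> j *\<^sub>s K - qnum (inverse \<zeta>) j *\<^sub>s (z * K ^ (d - 1)))"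
proof -
  have "indEF m F K z * bl m j = (if j < d then
    bl m j * F - bl m (j - 1) * (qnum \<zeta> j *\<^sub>s K - qnum (inverse \<zeta>) j *\<^sub>s (z * K ^ (d - 1))) else 0)"
    unfolding indEF_def using lin_right[OF lF] lin_right[OF lK] lin_right[OF lKi]
    by (intro bop_bl) (simp add: left_diff_distrib mult.assoc del: One_nat_def)
  \<comment> \<open>At j = d the subtracted term still involves the existing block d - 1; it
    disappears because the q-numbers of d vanish.\<close>
  moreover have "j = d \<or> j - 1 \<ge> d" if "\<not> j < d" using that by auto
  ultimately show ?thesis by (auto simp: bl_ge qnum_d)
qed

lemma lin_indEF: "lin (d * m) (d * m) (indEF m F K z)"
  unfolding indEF_def using lF lK lKi by (intro lin_bop lin_diff lin_mult[OF lin_bl] lin_scal)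

lemma cl_indEF: "j < d \<Longrightarrow> cl m j * indEF m F K z =
    F * cl m j - (qnum \<zeta> (d - j) *\<^sub>s K - qnum (inverse \<zeta>) (d - j) *\<^sub>s (z * K ^ (d - 1))) * cl m (j - 1)"
proof (rule bl_ext[of m m])
  fix k assume jk: "j < d" "k < d"
  have *: "j + (k - 1) = d - 1 \<longleftrightarrow> k = d - j" if "k > 0" "j > 0" using jk that by auto
  consider "k = 0" | "k > 0" "j = 0" | "k > 0" "j > 0" by auto
  then show "cl m j * indEF m F K z * bl m k = (F * cl m j -
    (qnum \<zeta> (d - j) *\<^sub>s K - qnum (inverse \<zeta>) (d - j) *\<^sub>s (z * K ^ (d - 1))) * cl m (j - 1)) * bl m k"
  proof cases
    case 1
    then show ?thesis using jk lF d2
      by (auto simp: mult.assoc indEF_bl left_diff_distrib cl_bl assoc_ext[OF cl_bl] linsD qnum_d)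
  next
    case 2
    then show ?thesis using jk lF
      by (auto simp: mult.assoc indEF_bl left_diff_distrib right_diff_distrib cl_bl assoc_ext[OF cl_bl] linsD qnum_d)
  next
    case 3
    then show ?thesis using jk * linsD[OF lF] linsD[OF lK] linsD[OF lKi] 
      by (auto simp: mult.assoc indEF_bl left_diff_distrib right_diff_distrib cl_bl assoc_ext[OF cl_bl])
  qed
qed (use lin_indEF lF lK lKi in \<open>blast intro: lin_mult lin_diff lin_scal lin_cl\<close>)+

definition ind_act :: "dgen \<Rightarrow> lop" where
  "ind_act g = (case g of GE \<Rightarrow> indF m | GF \<Rightarrow> indEF m F K z | GK \<Rightarrow> indEK m K | GZ \<Rightarrow> indZ m z)"

lemma rels_ind_act: "rels (d * m) ind_act"
proof -
  note l = lin_ind(1)[of m] lin_ind(3)[OF lK] lin_ind(4)[OF lz] lin_indEF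
  note r = indF_bl[of m] indEK_bl[OF lK] indZ_bl[OF lz] indEF_bl
  note r' = r[THEN assoc_ext, unfolded mult.assoc left_diff_distrib scal_simps]
  note R = frD[THEN conjunct2, THEN conjunct2, THEN conjunct2]
  have R': "K ^ d = idn m" "z ^ d = idn m" "F ^ d = 0" "z * F = F * z" "z * K = K * z" "K * F = inverse \<zeta> *\<^sub>s (F * K)"
    using frD by auto
  note R'' = R'(4-6)[THEN assoc_ext, unfolded mult.assoc scal_simps]
  have zk: "z * K ^ (d - 1) = K ^ (d - 1) * z" by (rule power_intertwine) (rule R')
  have zKi: "z * (z * K ^ (d - 1)) = z * K ^ (d - 1) * z" by (simp only: mult.assoc zk assoc_ext[OF zk])
  have KKi: "K * (z * K ^ (d - 1)) = z * K ^ (d - 1) * K"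
    by (simp add: R''(2)[symmetric] power_commutes mult.assoc)
  have E: "indF m ^ k * bl m i = bl m (i + k)" for k i
    by (induction k) (simp_all add: mult.assoc r)
  have Kp: "indEK m K ^ k * bl m i = (\<zeta> ^ i) ^ k *\<^sub>s (bl m i * K ^ k)" for k i
    by (induction k) (simp_all add: mult.assoc r r' mult.commute power_commutes)
  have zp: "indZ m z ^ k * bl m i = bl m i * z ^ k" for k i
    by (induction k) (simp_all add: mult.assoc r r' power_commutes)
  have Fp: "indEF m F K z ^ k * bl m 0 = bl m 0 * F ^ k" for k
    by (induction k) (simp_all add: mult.assoc r r' power_commutes)
  have i: "(\<zeta> ^ i) ^ d = 1" for i by (metis zeta_pow_d power_commuting_commutes power_mult mult.commute power_one)
  have lp: "lin (d * m) (d * m) (f ^ k)" if "lin (d * m) (d * m) f" "k > 0" for f k using lin_power[OF that] .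
  have zF: "indZ m z * indEF m F K z = indEF m F K z * indZ m z"
    by (rule bl_ext[of "d * m" m]; (intro lin_mult[where k = "d * m"] l)?)
      (simp add: mult.assoc r r' right_diff_distrib left_diff_distrib R'(4,5) zKi[unfolded mult.assoc] del: One_nat_def)
  have KF: "indEK m K * indEF m F K z = inverse \<zeta> *\<^sub>s (indEF m F K z * indEK m K)"
  proof (rule bl_ext[of "d * m" m])
    fix j assume "j < d"
    show "indEK m K * indEF m F K z * bl m j = inverse \<zeta> *\<^sub>s (indEF m F K z * indEK m K) * bl m j"
      using zeta_nz by (cases j) (simp_all add: mult.assoc r r' right_diff_distrib left_diff_distrib scal_diff_right R'(6)
          KKi[unfolded mult.assoc] field_simps scal_add_right del: One_nat_def)
  qed (intro lin_mult[where k = "d * m"] lin_scal l)+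
  have EF: "indF m * indEF m F K z - indEF m F K z * indF m = indEK m K - indZ m z * indEK m K ^ (d - 1)"
  proof (rule bl_ext[of "d * m" m])
    fix j assume "j < d"
    have p: "(\<zeta> ^ j) ^ (d - 1) = inverse \<zeta> ^ j" for j
      by (metis power_commuting_commutes power_mult mult.commute zeta_pow_pred)
    show "(indF m * indEF m F K z - indEF m F K z * indF m) * bl m j =
       (indEK m K - indZ m z * indEK m K ^ (d - 1)) * bl m j"
      by (cases j) (simp_all add: mult.assoc r r' right_diff_distrib left_diff_distrib Kp p zeta_pow_pred qnum_Suc scal_add_left scal_diff_left algebra_simps
          del: One_nat_def)
  next
    show "lin (d * m) (d * m) (indF m * indEF m F K z - indEF m F K z * indF m)"
      "lin (d * m) (d * m) (indEK m K - indZ m z * indEK m K ^ (d - 1))"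
      using d0 by (intro lin_diff lin_mult[where k = "d * m"] l lp; simp)+
  qed
  \<comment> \<open>F^d cannot be computed block by block. As the q-numbers of d vanish, F^d
    commutes with the shift E, so its vanishing on block 0 propagates to all blocks.\<close>
  have Fd: "indEF m F K z ^ d = 0"
  proof -
    define X where "X = indEF m F K z"
    define Ki where "Ki = indZ m z * indEK m K ^ (d - 1)"
    have "Ki * X = \<zeta> *\<^sub>s (X * Ki)"
    proof -
      have "indEK m K ^ (d - 1) * X = \<zeta> *\<^sub>s (X * indEK m K ^ (d - 1))"
        using qcomm_pow'[of "indEK m K" X "inverse \<zeta>" "d - 1"] KF unfolding inv_zeta_pow_pred X_def by blast
      then show ?thesis using zF by (simp add: Ki_def mult.assoc X_def) (simp add: assoc_ext[OF zF] mult.assoc)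
    qed
    then have "indF m * X ^ d = X ^ d * indF m + X ^ (d - 1) * (qnum (inverse \<zeta>) d *\<^sub>s indEK m K - qnum \<zeta> d *\<^sub>s Ki)"
      using KF EF by (intro commute_EF_pow) (auto simp: X_def Ki_def algebra_simps)
    then have c: "indF m * X ^ d = X ^ d * indF m" by (simp add: qnum_d)
    have Xb: "X ^ d * bl m j = 0" for j
    proof (induction j)
      case 0
      then show ?case by (simp add: X_def Fp R')
    next
      case (Suc j)
      have "X ^ d * bl m (Suc j) = X ^ d * indF m * bl m j" by (simp add: mult.assoc r)
      also have "\<dots> = 0" by (simp add: c[symmetric] mult.assoc Suc)
      finally show ?case .
    qed
    have "lin (d * m) (d * m) (X ^ d)" unfolding X_def by (rule lp[OF l(4) d0(1)])
    then have "X ^ d = 0" by (rule bl_ext[OF _ lin_0]) (simp add: Xb)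
    then show ?thesis by (simp add: X_def)
  qed
  have Kd: "indEK m K ^ d = idn (d * m)" "indZ m z ^ d = idn (d * m)" "indF m ^ d = 0"
    by (rule bl_ext[of "d * m" m]; (intro lp l lin_idn lin_0 d0)?; simp add: E Kp zp i R' bl_ge Lbl)+
  have c: "indZ m z * indF m = indF m * indZ m z" "indZ m z * indEK m K = indEK m K * indZ m z"
    by (rule bl_ext[of "d * m" m]; (intro lin_mult[where k = "d * m"] l)?; simp add: r r' R' mult.assoc)+
  have KE: "indEK m K * indF m = \<zeta> *\<^sub>s (indF m * indEK m K)"
    by (rule bl_ext[of "d * m" m]; (intro lin_mult[where k = "d * m"] lin_scal l)?; simp add: r r' R' mult.assoc)
  have "lin (d * m) (d * m) (ind_act g)" for g by (cases g) (simp_all add: ind_act_def l)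
  then show ?thesis by (simp add: rels_def ind_act_def Kd c KE KF EF Fd zF del: One_nat_def)
qed

end

text \<open>The module induced from the commutative subalgebra generated by K and z: its blocks are the
  \<open>E\<^sup>j F\<^sup>i \<otimes> M\<close> with \<open>i, j < d\<close>.  It is both induced and coinduced, by way of the coefficient of
  \<open>E\<^sup>d\<^sup>-\<^sup>1 F\<^sup>d\<^sup>-\<^sup>1\<close>, and therefore projective and injective.\<close>

definition Ind :: "dgen rep \<Rightarrow> dgen rep" where
  "Ind M = (let n = rdim M in
     mk_rep (d * (d * n)) (ind_act (d * n) (indF n) (indFK n (KK M)) (indZ n (ZZ M))))"

definition ind_in :: "dgen rep \<Rightarrow> lop" where "ind_in M = bl (d * rdim M) 0 * bl (rdim M) 0"
definition ind_out :: "dgen rep \<Rightarrow> lop" where "ind_out M = cl (rdim M) 0 * cl (d * rdim M) 0"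

context
  fixes M assumes M: "M \<in> DD"
begin

private definition "n = rdim M"
private definition "m = d * n"
private definition "FN = indF n"
private definition "KN = indFK n (KK M)"
private definition "zN = indZ n (ZZ M)"

private lemma RM: "lin n n (KK M)" "lin n n (ZZ M)" "KK M ^ d = idn n" "ZZ M ^ d = idn n" "ZZ M * KK M = KK M * ZZ M"
  using D_rels[OF M] by (simp_all add: n_def rels_def)

private lemma frN: "frels m FN KN zN"
  unfolding m_def FN_def KN_def zN_def by (rule frels_ind) (fact RM)+

private lemma act_Ind: "act (Ind M) = ind_act m FN KN zN" and rdim_Ind: "rdim (Ind M) = d * m"
  and Ind_in_D: "Ind M \<in> DD"
  using mk_rep_D[OF rels_ind_act[OF frN]] by (simp_all add: Ind_def Let_def m_def FN_def KN_def zN_def n_def)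

lemma Ind_D: "Ind M \<in> DD" by (rule Ind_in_D)

private lemma lN: "lin m m FN" "lin m m KN" "lin m m zN" using frN by (auto simp: frels_def)

private lemma acts: "EE (Ind M) = indF m" "FF (Ind M) = indEF m FN KN zN" "KK (Ind M) = indEK m KN" "ZZ (Ind M) = indZ m zN"
  by (simp_all add: act_Ind ind_act_def[OF frN])

private lemmas Nbl = indF_bl[of n, folded FN_def] indFK_bl[OF RM(1), folded KN_def] indZ_bl[OF RM(2), folded zN_def]
private lemmas Ncl = cl_indF[of n, folded FN_def] cl_indFK[OF RM(1), folded KN_def] cl_indZ[OF RM(2), folded zN_def]
private lemmas Obl = indF_bl[of m] indEF_bl[OF frN] indEK_bl[OF lN(2)] indZ_bl[OF lN(3)]
private lemmas Ocl = cl_indF[of m] cl_indEF[OF frN] cl_indEK[OF lN(2)] cl_indZ[OF lN(3)]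

private lemma in_eq: "ind_in M = bl m 0 * bl n 0" and out_eq: "ind_out M = cl n 0 * cl m 0"
  by (simp_all add: ind_in_def ind_out_def m_def n_def)

lemma ctr_Ind: "ctr (Ind M)"
proof -
  have "trE (EE (Ind M)) (EE (Ind M)) d (bl m 0 * cl m 0) = idn (d * m)"
    unfolding acts by (rule trE_shift) (simp_all add: indF_bl cl_indF)
  then show ?thesis unfolding ctr_def enull_def rdim_Ind by (intro exI[of _ "bl m 0 * cl m 0"]) (auto intro: lin_mult)
qed

lemma wlin_ind_in: "wlin M (Ind M) (ind_in M)"
  using Nbl Obl Obl[THEN assoc_ext, unfolded mult.assoc] lin_mult[OF lin_bl[of m 0] lin_bl[of n 0, folded m_def]]
  by (simp add: wlin_def rdim_Ind in_eq acts mult.assoc n_def[symmetric])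

text \<open>On the top block K picks up \<zeta>^(-1) from the powers of E and \<zeta> from the
  powers of F. These cancel, which is why the coefficient of E^(d-1) F^(d-1) preserves
  weights.\<close>

lemma wlin_ind_out: "wlin (Ind M) M (ind_out M)"
proof -
  have "cl n 0 * (cl m 0 * indEK m KN) = KK M * (cl n 0 * cl m 0)"
    using zeta_nz by (simp add: Ocl assoc_ext[OF Ncl(2)] mult.assoc)
  moreover have "cl n 0 * (cl m 0 * indZ m zN) = ZZ M * (cl n 0 * cl m 0)"
    by (simp add: Ocl) (simp add: assoc_ext[OF Ncl(3)] mult.assoc)
  moreover have "lin n (d * m) (cl n 0 * cl m 0)" unfolding m_def by blast
  ultimately show ?thesis by (simp add: wlin_def rdim_Ind out_eq acts mult.assoc n_def[symmetric])
qed

lemma Ind_hom_ext: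
  assumes "rhom (Ind M) Y f" "rhom (Ind M) Y g" "f * ind_in M = g * ind_in M"
  shows "f = g"
proof -
  have E: "indF m ^ j * bl m 0 = bl m j" for j by (induction j) (simp_all add: mult.assoc Obl)
  have F: "indEF m FN KN zN ^ j * bl m 0 = bl m 0 * FN ^ j" for j
    by (induction j) (simp_all add: mult.assoc Obl Obl[THEN assoc_ext, unfolded mult.assoc] power_commutes)
  have FN: "FN ^ j * bl n 0 = bl n j" for j by (induction j) (simp_all add: mult.assoc Nbl)
  have *: "h * bl m j * bl n i = EE Y ^ j * FF Y ^ i * (h * ind_in M)" if "rhom (Ind M) Y h" for h i j
  proof -
    have "h * bl m j * bl n i = h * indF m ^ j * (bl m 0 * FN ^ i) * bl n 0" by (simp add: mult.assoc E FN assoc_ext[OF E])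
    also have "\<dots> = (h * indF m ^ j) * indEF m FN KN zN ^ i * ind_in M" by (simp add: F[symmetric] mult.assoc in_eq)
    also have "h * indF m ^ j = EE Y ^ j * h"
      using power_intertwine[OF rhom_act[OF that, of GE]] by (simp add: acts)
    also have "EE Y ^ j * h * indEF m FN KN zN ^ i = EE Y ^ j * (FF Y ^ i * h)"
      using power_intertwine[OF rhom_act[OF that, of GF]] by (simp add: acts mult.assoc)
    finally show ?thesis by (simp add: mult.assoc)
  qed
  have lh: "lin (rdim Y) (d * m) h" if "rhom (Ind M) Y h" for h using rhom_lin[OF that] by (simp add: rdim_Ind)
  show ?thesis
  proof (rule bl_ext[OF lh[OF assms(1)] lh[OF assms(2)]])
    fix j
    show "f * bl m j = g * bl m j"
    proof (rule bl_ext[of "rdim Y" n])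
      show "lin (rdim Y) (d * n) (f * bl m j)" "lin (rdim Y) (d * n) (g * bl m j)"
        using lh assms by (auto simp: m_def[symmetric] intro: lin_mult)
    qed (simp add: * assms)
  qed
qed

text \<open>Frobenius reciprocity: E^j F^i \<otimes> v is sent to E^j F^i g0(v), one stage at a
  time. Only compatibility with F in the outer stage is not immediate; it is the commutation formula
  for E^j F.\<close>

lemma Ind_hom_exists:
  assumes Y: "Y \<in> DD" and g0: "wlin M Y g0"
  shows "\<exists>h. rhom (Ind M) Y h \<and> h * ind_in M = g0"
proof -
  define y where "y = rdim Y"
  have lg0: "lin y n g0" and wg0: "g0 * KK M = KK Y * g0" "g0 * ZZ M = ZZ Y * g0"
    using g0 by (simp_all add: wlin_def y_def n_def)
  have lY: "lin y y (act Y a)" for a using Y by (simp add: y_def)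
  have nil: "FF Y ^ d = 0" "EE Y ^ d = 0" using D_rels[OF Y] by (simp_all add: rels_def)
  have lpow: "lin y k (act Y a ^ j * f)" if "lin y k f" for a j f k
  proof -
    have "act Y a ^ j * f = (idn y * act Y a ^ j) * f" using linsD[OF that] idn_power_commute[OF lY, of a j] by (simp add: mult.assoc)
    then show ?thesis using lin_mult[OF lin_idn_power[OF lY] that] by simp
  qed
  define g where "g = bop n (\<lambda>i. FF Y ^ i * g0)"
  have gbl: "g * bl n i = FF Y ^ i * g0" for i
    unfolding g_def using lg0 by (subst bop_bl) (auto simp: mult.assoc linsD nilp_ge[OF nil(1)])
  have lg: "lin y m g" unfolding g_def m_def by (intro lin_bop lpow lg0)
  have gF: "g * FN = FF Y * g" 
    by (rule bl_ext[of y n]; (fold m_def, intro lin_mult[OF lg] lin_mult[OF lY lg] lN)?)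
      (simp add: mult.assoc Nbl gbl)
  have gK: "g * KN = KK Y * g"
  proof (rule bl_ext[of y n]; (fold m_def, intro lin_mult[OF lg] lin_mult[OF lY lg] lN)?)
    fix i
    have "KK Y * FF Y ^ i = inverse \<zeta> ^ i *\<^sub>s (FF Y ^ i * KK Y)" by (rule qcomm_pow) (rule D_comm[OF Y])
    from assoc_ext[OF this, of g0] show "g * KN * bl n i = KK Y * g * bl n i"
      by (simp add: mult.assoc Nbl gbl wg0 assoc_ext[OF gbl])
  qed
  have gz: "g * zN = ZZ Y * g"
  proof (rule bl_ext[of y n]; (fold m_def, intro lin_mult[OF lg] lin_mult[OF lY lg] lN)?)
    fix i
    have "ZZ Y * FF Y ^ i = FF Y ^ i * ZZ Y" using power_intertwine[of "ZZ Y" "FF Y" "FF Y" i] D_comm[OF Y] by simp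
    from assoc_ext[OF this, of g0] show "g * zN * bl n i = ZZ Y * g * bl n i"
      by (simp add: mult.assoc Nbl gbl wg0 assoc_ext[OF gbl])
  qed
  define h where "h = bop m (\<lambda>j. EE Y ^ j * g)"
  have hbl: "h * bl m j = EE Y ^ j * g" for j
    unfolding h_def using lg by (subst bop_bl) (auto simp: mult.assoc linsD nilp_ge[OF nil(2)])
  have hbl': "h * (bl m j * x) = EE Y ^ j * (g * x)" for j x using assoc_ext[OF hbl] by (simp add: mult.assoc)
  have lh: "lin y (d * m) h" unfolding h_def by (intro lin_bop lpow lg)
  have lI: "lin (d * m) (d * m) (act (Ind M) a)" for a using D_lin[OF Ind_in_D] by (simp add: rdim_Ind)
  have "h * act (Ind M) a * bl m j = act Y a * h * bl m j" for a j
  proof (cases a)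
    case GE
    then show ?thesis by (simp add: acts mult.assoc Obl hbl)
  next
    case GF
    have c: "EE Y ^ j * (FF Y * g) = FF Y * (EE Y ^ j * g) + EE Y ^ (j - 1) *
      (qnum \<zeta> j *\<^sub>s (KK Y * g) - qnum (inverse \<zeta>) j *\<^sub>s (ZZ Y * (KK Y ^ (d - 1) * g)))"
      using assoc_ext[OF D_EF_pow[OF Y, of j], of g] by (simp add: distrib_right left_diff_distrib mult.assoc del: One_nat_def)
    have gKi: "g * (zN * KN ^ (d - 1)) = ZZ Y * (KK Y ^ (d - 1) * g)"
      using power_intertwine[OF gK, of "d - 1"] by (simp add: mult.assoc assoc_ext[OF gz])
    show ?thesis unfolding GF acts mult.assoc Obl(2) hbl
      by (simp add: right_diff_distrib hbl' gF gK gKi c distrib_left del: One_nat_def)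
  next
    case GK
    have "KK Y * EE Y ^ j = \<zeta> ^ j *\<^sub>s (EE Y ^ j * KK Y)" by (rule qcomm_pow) (rule D_comm[OF Y])
    from assoc_ext[OF this, of g] show ?thesis by (simp add: GK acts mult.assoc Obl hbl hbl' gK)
  next
    case GZ
    have "ZZ Y * EE Y ^ j = EE Y ^ j * ZZ Y" using power_intertwine[of "ZZ Y" "EE Y" "EE Y" j] D_comm[OF Y] by simp
    from assoc_ext[OF this, of g] show ?thesis by (simp add: GZ acts mult.assoc Obl hbl hbl' gz)
  qed
  then have "h * act (Ind M) a = act Y a * h" for a
    by (intro bl_ext[OF lin_mult[OF lh lI] lin_mult[OF lY lh]])
  moreover have "h * ind_in M = g0" using lg0 lg gbl[of 0] by (simp add: in_eq hbl')
  ultimately show ?thesis using lh by (auto intro!: exI[of _ h] rhomI simp: rdim_Ind y_def)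
qed

lemma Ind_cohom_ext:
  assumes "rhom Y (Ind M) f" "rhom Y (Ind M) g" "ind_out M * f = ind_out M * g"
  shows "f = g"
proof -
  have E: "cl m 0 * indF m ^ j = cl m j" for j
    by (induction j) (simp_all add: power_Suc2 Ocl del: power_Suc flip: mult.assoc)
  have F0: "cl m 0 * indEF m FN KN zN = FN * cl m 0" using Ocl(2)[of 0] d0 by (simp add: qnum_d)
  have F: "cl m 0 * indEF m FN KN zN ^ j = FN ^ j * cl m 0" for j using power_intertwine[OF F0] .
  have FN: "cl n 0 * FN ^ j = cl n j" for j
    by (induction j) (simp_all add: power_Suc2 Ncl del: power_Suc flip: mult.assoc)
  have *: "cl n i * (cl m j * h) = ind_out M * h * (FF Y ^ i * EE Y ^ j)" if "rhom Y (Ind M) h" for h i j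
  proof -
    have "cl n i * (cl m j * h) = cl n 0 * (FN ^ i * cl m 0) * indF m ^ j * h"
      by (simp add: mult.assoc assoc_ext[OF E] assoc_ext[OF FN])
    also have "\<dots> = ind_out M * (indEF m FN KN zN ^ i * (indF m ^ j * h))" by (simp add: mult.assoc out_eq assoc_ext[OF F])
    also have "indF m ^ j * h = h * EE Y ^ j"
      using power_intertwine[OF rhom_act[OF that, of GE]] by (simp add: acts)
    also have "indEF m FN KN zN ^ i * (h * EE Y ^ j) = h * FF Y ^ i * EE Y ^ j"
      using power_intertwine[OF rhom_act[OF that, of GF], of i] by (simp add: acts flip: mult.assoc)
    finally show ?thesis by (simp add: mult.assoc)
  qed
  have lh: "lin (d * m) (rdim Y) h" if "rhom Y (Ind M) h" for h using rhom_lin[OF that] by (simp add: rdim_Ind)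
  show ?thesis
  proof (rule cl_ext[OF lh[OF assms(1)] lh[OF assms(2)]])
    fix j
    show "cl m j * f = cl m j * g"
    proof (rule cl_ext[of n "rdim Y"])
      show "lin (d * n) (rdim Y) (cl m j * f)" "lin (d * n) (rdim Y) (cl m j * g)"
        using lh assms by (auto simp: m_def[symmetric] intro: lin_mult)
    qed (simp add: * assms)
  qed
qed

text \<open>Reciprocity for coinduction: the coordinates of h(y), counted from the top, are g0(F^i
  E^j y). The intermediate map g is compatible with K only up to the factor \<zeta> of the inner top
  block, and the outer stage removes that factor.\<close>

lemma Ind_cohom_exists:
  assumes Y: "Y \<in> DD" and g0: "wlin Y M g0"
  shows "\<exists>h. rhom Y (Ind M) h \<and> ind_out M * h = g0"
proof -
  define y where "y = rdim Y"
  have lg0: "lin n y g0" and wg0: "g0 * KK Y = KK M * g0" "g0 * ZZ Y = ZZ M * g0"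
    using g0 by (simp_all add: wlin_def y_def n_def)
  have lY: "lin y y (act Y a)" for a using Y by (simp add: y_def)
  have nil: "FF Y ^ d = 0" "EE Y ^ d = 0" using D_rels[OF Y] by (simp_all add: rels_def)
  have lpow: "lin k y (f * act Y a ^ j)" if "lin k y f" for a j f k
  proof -
    have "f * act Y a ^ j = f * (idn y * act Y a ^ j)" using linsD[OF that] by simp
    then show ?thesis using lin_mult[OF that lin_idn_power[OF lY]] by simp
  qed
  define g where "g = rop n (\<lambda>i. g0 * FF Y ^ i)"
  have gcl: "cl n i * g = g0 * FF Y ^ i" for i
    unfolding g_def using lg0 by (subst cl_rop) (auto simp: linsD nilp_ge[OF nil(1)])
  have gcl': "cl n i * (g * x) = g0 * (FF Y ^ i * x)" for i x using assoc_ext[OF gcl] by (simp add: mult.assoc)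
  have lg: "lin m y g" unfolding g_def m_def by (intro lin_rop lpow lg0)
  note ncl' = Ncl[THEN assoc_ext, unfolded mult.assoc]
  have gF: "FN * g = g * FF Y"
    by (rule cl_ext[of n y]; (fold m_def, intro lin_mult[OF lg lY] lin_mult[OF lN(1) lg])?)
      (simp add: ncl' gcl gcl' power_commutes)
  have gK: "KN * g = \<zeta> *\<^sub>s (g * KK Y)"
  proof (rule cl_ext[of n y]; (fold m_def, intro lin_scal lin_mult[OF lg lY] lin_mult[OF lN(2) lg])?)
    fix i
    have "KK Y * FF Y ^ i = inverse \<zeta> ^ i *\<^sub>s (FF Y ^ i * KK Y)" by (rule qcomm_pow) (rule D_comm[OF Y])
    then have "FF Y ^ i * KK Y = \<zeta> ^ i *\<^sub>s (KK Y * FF Y ^ i)"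
      using zeta_nz by (simp flip: power_mult_distrib)
    moreover have "cl n i * (KN * g) = \<zeta> ^ Suc i *\<^sub>s (g0 * (KK Y * FF Y ^ i))"
      by (simp add: ncl' gcl assoc_ext[OF wg0(1)] mult.assoc)
    ultimately show "cl n i * (KN * g) = cl n i * (\<zeta> *\<^sub>s (g * KK Y))"
      by (simp add: gcl')
  qed
  have gz: "zN * g = g * ZZ Y"
  proof (rule cl_ext[of n y]; (fold m_def, intro lin_mult[OF lg lY] lin_mult[OF lN(3) lg])?)
    fix i
    have "ZZ Y * FF Y ^ i = FF Y ^ i * ZZ Y" using power_intertwine[of "ZZ Y" "FF Y" "FF Y" i] D_comm[OF Y] by simp
    then show "cl n i * (zN * g) = cl n i * (g * ZZ Y)"
      by (simp add: ncl' gcl gcl' assoc_ext[OF wg0(2)[symmetric]] mult.assoc)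
  qed
  define h where "h = rop m (\<lambda>j. g * EE Y ^ j)"
  have hcl: "cl m j * h = g * EE Y ^ j" for j
    unfolding h_def using lg by (subst cl_rop) (auto simp: linsD nilp_ge[OF nil(2)])
  have hcl': "cl m j * (h * x) = g * (EE Y ^ j * x)" for j x using assoc_ext[OF hcl] by (simp add: mult.assoc)
  have lh: "lin (d * m) y h" unfolding h_def by (intro lin_rop lpow lg)
  have lI: "lin (d * m) (d * m) (act (Ind M) a)" for a using D_lin[OF Ind_in_D] by (simp add: rdim_Ind)
  note ocl' = Ocl(1,3,4)[THEN assoc_ext, unfolded mult.assoc]
  have KE: "KK Y * EE Y ^ j = \<zeta> ^ j *\<^sub>s (EE Y ^ j * KK Y)" for j by (rule qcomm_pow) (rule D_comm[OF Y])
  have "cl m j * (act (Ind M) a * h) = cl m j * (h * act Y a)" if "j < d" for a j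
  proof (cases a)
    case GE
    then show ?thesis by (simp add: acts ocl' hcl hcl' power_commutes)
  next
    case GF
    define Ki where "Ki = ZZ Y * KK Y ^ (d - 1)"
    have KiE: "Ki * EE Y ^ k = inverse \<zeta> ^ k *\<^sub>s (EE Y ^ k * Ki)" for k
      unfolding Ki_def by (rule qcomm_pow) (rule D_Ki[OF Y])
    have KNp: "KN ^ k * g = \<zeta> ^ k *\<^sub>s (g * KK Y ^ k)" for k
      by (induction k) (simp_all add: assoc_ext[OF gK] mult.assoc mult.commute)
    have gKi: "zN * KN ^ (d - 1) * g = inverse \<zeta> *\<^sub>s (g * Ki)"
      unfolding mult.assoc KNp zeta_pow_pred by (simp add: Ki_def assoc_ext[OF gz] mult.assoc)
    have gKi': "zN * (KN ^ (d - 1) * (g * x)) = inverse \<zeta> *\<^sub>s (g * (Ki * x))" for x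
      using assoc_ext[OF gKi, of x] by (simp add: mult.assoc)
    have gK': "KN * (g * x) = \<zeta> *\<^sub>s (g * (KK Y * x))" and gF': "FN * (g * x) = g * (FF Y * x)" for x
      using assoc_ext[OF gK, of x] assoc_ext[OF gF, of x] by (simp_all add: mult.assoc)
    have "cl m j * (FF (Ind M) * h) = cl m j * FF (Ind M) * h" by (simp add: mult.assoc)
    also have "\<dots> = FN * (g * EE Y ^ j) - (qnum \<zeta> (d - j) *\<^sub>s (KN * (g * EE Y ^ (j - 1)))
        - qnum (inverse \<zeta>) (d - j) *\<^sub>s (zN * (KN ^ (d - 1) * (g * EE Y ^ (j - 1)))))"
      unfolding acts Ocl(2)[OF that] by (simp add: left_diff_distrib mult.assoc hcl del: One_nat_def)
    also have "\<dots> = g * (FF Y * EE Y ^ j) + g * (EE Y ^ (j - 1) * (qnum \<zeta> j *\<^sub>s KK Y - qnum (inverse \<zeta>) j *\<^sub>s Ki))"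
    proof (cases j)
      case 0
      then show ?thesis by (simp add: gF qnum_d gF')
    next
      case (Suc i)
      \<comment> \<open>Counting from the top produces the q-numbers of d - j; as the q-number of d
        is zero, they become those of j up to sign and a power of \<zeta>.\<close>
      have 1: "\<zeta> * (\<zeta> ^ i * qnum \<zeta> (d - Suc i)) = - qnum \<zeta> (Suc i)" 
        and 2: "inverse \<zeta> * (inverse \<zeta> ^ i * qnum (inverse \<zeta>) (d - Suc i)) = - qnum (inverse \<zeta>) (Suc i)"
        using qnum_compl[of "Suc i"] that Suc by (simp_all add: mult.assoc del: power_inverse)
      have "qnum \<zeta> (d - Suc i) * (\<zeta> * \<zeta> ^ i) = - qnum \<zeta> (Suc i)"
        "qnum (inverse \<zeta>) (d - Suc i) * (inverse \<zeta> * inverse \<zeta> ^ i) = - qnum (inverse \<zeta>) (Suc i)"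
        using 1 2 by (simp_all only: mult_ac)
      then show ?thesis unfolding Suc diff_Suc_1
        by (simp only: gF' gK' gKi' KE KiE scal_simps right_diff_distrib mult.assoc)
            (simp add: mult.assoc algebra_simps scal_simps(7)[symmetric] del: scal_simps(7))
    qed
    also have "\<dots> = g * (EE Y ^ j * FF Y)" by (simp add: D_EF_pow[OF Y] Ki_def distrib_left del: One_nat_def)
    finally show ?thesis by (simp add: GF hcl')
  next
    case GK
    have "inverse \<zeta> ^ Suc j *\<^sub>s (\<zeta> *\<^sub>s (\<zeta> ^ j *\<^sub>s x)) = x" for x
      using zeta_nz by (simp add: field_simps)
    then show ?thesis 
      by (simp add: GK acts ocl' hcl hcl' assoc_ext[OF gK] mult.assoc KE del: power_Suc)
  next
    case GZ
    have "ZZ Y * EE Y ^ j = EE Y ^ j * ZZ Y" using power_intertwine[of "ZZ Y" "EE Y" "EE Y" j] D_comm[OF Y] by simp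
    then show ?thesis by (simp add: GZ acts ocl' hcl hcl' assoc_ext[OF gz] mult.assoc)
  qed
  then have "act (Ind M) a * h = h * act Y a" for a
    by (intro cl_ext[OF lin_mult[OF lI lh] lin_mult[OF lh lY]])
  moreover have "ind_out M * h = g0" using lg0 lg gcl[of 0] hcl[of 0] by (simp add: out_eq mult.assoc)
  ultimately show ?thesis using lh by (auto intro!: exI[of _ h] rhomI simp: rdim_Ind y_def)
qed

end

subsection \<open>Projective and injective modules\<close>

text \<open>Summation over a cyclic group of order d acting on linear maps by conjugation, where
  B^(d-a) plays the role of B^(-a).\<close>

definition avg :: "lop \<Rightarrow> lop \<Rightarrow> lop \<Rightarrow> lop" where
  "avg A B L = (\<Sum>a<d. A ^ a * L * B ^ (d - a))"

lemma avg_commute: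
  assumes "A ^ d * L = L" "L * B ^ d = L" shows "A * avg A B L = avg A B L * B"
proof -
  define T where "T a = A ^ a * L * B ^ (Suc d - a)" for a
  have "A * avg A B L = (\<Sum>a<d. T (Suc a))"
    unfolding avg_def sum_distrib_left T_def by (intro sum.cong) (auto simp: mult.assoc)
  moreover have "avg A B L * B = (\<Sum>a<d. T a)"
    unfolding avg_def sum_distrib_right T_def
    by (intro sum.cong refl) (simp add: mult.assoc Suc_diff_le power_commutes)
  moreover have "T d = T 0"
  proof -
    have "T d = L * B" using assms(1) by (simp add: T_def)
    moreover have "T 0 = L * B ^ d * B" unfolding T_def by (simp only: power_0 mult_1 diff_zero power_Suc2 mult.assoc)
    ultimately show ?thesis using assms(2) by simp
  qed
  moreover have "(\<Sum>a<d. T (Suc a)) + T 0 = (\<Sum>a<d. T a) + T d"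
    using sum.lessThan_Suc_shift[of T d] sum.lessThan_Suc[of T d] by (simp add: add.commute)
  ultimately show ?thesis by simp
qed

lemma avg_left: "f * A = A' * f \<Longrightarrow> f * avg A B L = avg A' B (f * L)"
  unfolding avg_def sum_distrib_left
  by (intro sum.cong refl) (metis mult.assoc power_intertwine)

lemma avg_right: "B * f = f * B' \<Longrightarrow> avg A B L * f = avg A B' (L * f)"
  unfolding avg_def sum_distrib_right
  by (intro sum.cong refl) (metis mult.assoc power_intertwine)

lemma avg_fix:
  assumes "A * L = L * B" "L * B ^ d = L" shows "avg A B L = of_nat d *\<^sub>s L"
proof -
  have "A ^ a * L * B ^ (d - a) = L" if "a < d" for a
  proof -
    have "A ^ a * L = L * B ^ a" using power_intertwine[of L B A a] assms by simp
    then show ?thesis using that assms by (simp add: mult.assoc flip: power_add)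
  qed
  then have "avg A B L = (\<Sum>a<d. 1 *\<^sub>s L)" unfolding avg_def by (intro sum.cong) auto
  also have "\<dots> = of_nat d *\<^sub>s L" by (simp only: scal_sum_left[symmetric]) simp
  finally show ?thesis .
qed

lemma lin_avg:
  assumes "lin m m A" "lin n n B" "lin m n L" shows "lin m n (avg A B L)"
  unfolding avg_def
proof (rule lin_sum)
  fix a
  have "A ^ a * L * B ^ (d - a) = (idn m * A ^ a) * L * (idn n * B ^ (d - a))"
    using assms idn_power_commute[OF assms(1)] by (simp add: mult.assoc linsD)
  then show "lin m n (A ^ a * L * B ^ (d - a))"
    using lin_mult[OF lin_mult[OF lin_idn_power[OF assms(1)] assms(3)] lin_idn_power[OF assms(2)]] by simp
qed

text \<open>The Reynolds projection onto weight-preserving maps. The two cyclic groups generated by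
  K and z account for the normalisation by the square of d.\<close>

definition wavg :: "dgen rep \<Rightarrow> dgen rep \<Rightarrow> lop \<Rightarrow> lop" where
  "wavg X Y L = (1 / of_nat d ^ 2) *\<^sub>s avg (ZZ Y) (ZZ X) (avg (KK Y) (KK X) L)"

lemma KK_pow: "M \<in> DD \<Longrightarrow> KK M ^ d = ide M" and ZZ_pow: "M \<in> DD \<Longrightarrow> ZZ M ^ d = ide M"
  using D_rels by (auto simp: rels_def)

lemma wlin_wavg:
  assumes D: "X \<in> DD" "Y \<in> DD" and L: "lin (rdim Y) (rdim X) L"
  shows "wlin X Y (wavg X Y L)"
proof -
  have l1: "lin (rdim Y) (rdim X) (avg (KK Y) (KK X) L)" by (rule lin_avg[OF D_lin[OF D(2)] D_lin[OF D(1)] L])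
  have l2: "lin (rdim Y) (rdim X) (avg (ZZ Y) (ZZ X) (avg (KK Y) (KK X) L))" by (rule lin_avg[OF D_lin[OF D(2)] D_lin[OF D(1)] l1])
  have k: "KK Y * avg (KK Y) (KK X) L = avg (KK Y) (KK X) L * KK X"
    using D L by (intro avg_commute) (simp_all add: KK_pow linsD)
  have z: "ZZ Y * avg (ZZ Y) (ZZ X) (avg (KK Y) (KK X) L) = avg (ZZ Y) (ZZ X) (avg (KK Y) (KK X) L) * ZZ X"
    using D l1 by (intro avg_commute) (simp_all add: ZZ_pow linsD)
  have "KK Y * avg (ZZ Y) (ZZ X) (avg (KK Y) (KK X) L) = avg (ZZ Y) (ZZ X) (KK Y * avg (KK Y) (KK X) L)"
    using D by (intro avg_left) (simp add: D_comm)
  also have "\<dots> = avg (ZZ Y) (ZZ X) (avg (KK Y) (KK X) L) * KK X"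
    unfolding k using D by (intro avg_right[symmetric]) (simp add: D_comm)
  finally show ?thesis using l2 z by (auto simp: wlin_def wavg_def)
qed

lemma wavg_left: "wlin Y T f \<Longrightarrow> f * wavg X Y L = wavg X T (f * L)"
  by (simp add: wavg_def wlin_def avg_left)
lemma wavg_right: "wlin T X f \<Longrightarrow> wavg X Y L * f = wavg T Y (L * f)"
proof -
  assume "wlin T X f"
  then have w: "ZZ X * f = f * ZZ T" "KK X * f = f * KK T" by (simp_all add: wlin_def)
  show ?thesis by (simp add: wavg_def avg_right[OF w(1)] avg_right[OF w(2)])
qed

lemma avg_scal: "avg A B (c *\<^sub>s L) = c *\<^sub>s avg A B L"
  by (simp add: avg_def scal_sum_right)

lemma wavg_fix:
  assumes X: "X \<in> DD" and L: "wlin X Y L" shows "wavg X Y L = L"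
proof -
  have l: "lin (rdim Y) (rdim X) L" and w: "KK Y * L = L * KK X" "ZZ Y * L = L * ZZ X"
    using L by (simp_all add: wlin_def)
  have "avg (KK Y) (KK X) L = of_nat d *\<^sub>s L" "avg (ZZ Y) (ZZ X) L = of_nat d *\<^sub>s L"
    using l by (auto intro!: avg_fix w simp: KK_pow[OF X] ZZ_pow[OF X] linsD)
  then show ?thesis using d0 by (simp add: wavg_def avg_scal power2_eq_square)
qed

lemma rhom_wlin: "rhom M N f \<Longrightarrow> wlin M N f" by (simp add: rhom_def wlin_def)
lemma wlin_mult: "wlin M N f \<Longrightarrow> wlin L M g \<Longrightarrow> wlin L N (f * g)"
  by (auto simp: wlin_def lin_mult mult.assoc) (simp_all flip: mult.assoc)

text \<open>Semisimplicity of the group algebra of K and z: a linear lift becomes weight-preserving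
  after averaging and is still a lift.\<close>

lemma wlin_lift:
  assumes D: "X \<in> DD" "M \<in> DD" "Y \<in> DD"
    and p: "rhom X Y p" "lin (rdim X) (rdim Y) r" "p * r = ide Y" and g: "wlin M Y g"
  shows "\<exists>h. wlin M X h \<and> p * h = g"
proof (intro exI conjI)
  have lg: "lin (rdim Y) (rdim M) g" using g by (simp add: wlin_def)
  show "wlin M X (wavg M X (r * g))" using D p lg by (intro wlin_wavg) auto
  have "p * wavg M X (r * g) = wavg M Y (p * (r * g))" by (rule wavg_left[OF rhom_wlin[OF p(1)]])
  also have "p * (r * g) = g" using p lg by (simp add: linsD flip: mult.assoc)
  finally show "p * wavg M X (r * g) = g" by (simp add: wavg_fix D g)
qed

lemma wlin_extend:
  assumes D: "X \<in> DD" "M \<in> DD" "Y \<in> DD"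
    and i: "rhom X Y i" "lin (rdim X) (rdim Y) l" "l * i = ide X" and g: "wlin X M g"
  shows "\<exists>h. wlin Y M h \<and> h * i = g"
proof (intro exI conjI)
  have lg: "lin (rdim M) (rdim X) g" using g by (simp add: wlin_def)
  show "wlin Y M (wavg Y M (g * l))" using D i lg by (intro wlin_wavg) auto
  have "wavg Y M (g * l) * i = wavg X M (g * l * i)" by (rule wavg_right[OF rhom_wlin[OF i(1)]])
  also have "g * l * i = g" using i lg by (simp add: linsD mult.assoc)
  finally show "wavg Y M (g * l) * i = g" by (simp add: wavg_fix D g)
qed

lemma rhom_mat: "M \<in> DD \<Longrightarrow> N \<in> DD \<Longrightarrow> f \<in> rep_homs M N \<longleftrightarrow> f \<in> carrier_mat (rdim N) (rdim M) \<and> rhom M N (op_mat f)"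
  by (rule rep_homs_iff) auto

lemma mat_op_rep_homs: "M \<in> DD \<Longrightarrow> N \<in> DD \<Longrightarrow> rhom M N f \<Longrightarrow> mat_op (rdim N) (rdim M) f \<in> rep_homs M N"
  by (simp add: rhom_mat rhom_lin)

lemma projectives_iff:
  "P \<in> projectives DD \<longleftrightarrow> P \<in> DD \<and> (\<forall>X\<in>DD. \<forall>Y\<in>DD. \<forall>p r f. rhom X Y p \<and> lin (rdim X) (rdim Y) r \<and>
     p * r = ide Y \<and> rhom P Y f \<longrightarrow> (\<exists>h. rhom P X h \<and> p * h = f))" (is "_ \<longleftrightarrow> _ \<and> ?R")
proof (cases "P \<in> DD")
  case P: True
  show ?thesis
  proof (intro iffI conjI P ballI allI impI; (elim conjE)?)
    fix X Y p r f assume h: "P \<in> projectives DD" "X \<in> DD" "Y \<in> DD" "rhom X Y p" "lin (rdim X) (rdim Y) r"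
      "p * r = ide Y" "rhom P Y f"
    define p' f' where "p' = mat_op (rdim Y) (rdim X) p" and "f' = mat_op (rdim Y) (rdim P) f"
    have op: "op_mat p' = p" "op_mat f' = f" using h by (simp_all add: p'_def f'_def rhom_lin)
    have "rep_epi X Y p'" using h op by (auto simp: rep_epi_iff p'_def mat_op_rep_homs)
    moreover have "f' \<in> rep_homs P Y" using h P by (simp add: f'_def mat_op_rep_homs)
    ultimately obtain g where g: "g \<in> rep_homs P X" "p' * g = f'" using h(1-3) unfolding projectives_def by blast
    then have "rhom P X (op_mat g)" "p * op_mat g = f"
      using h P op op_mat_mult[of p' "rdim Y" "rdim X" g "rdim P"] by (auto simp: rhom_mat p'_def)
    then show "\<exists>h. rhom P X h \<and> p * h = f" by blast
  next
    assume R: ?R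
    have "\<exists>h\<in>rep_homs P X. p * h = f" if h: "X \<in> DD" "Y \<in> DD" "rep_epi X Y p" "f \<in> rep_homs P Y" for X Y p f
    proof -
      from h obtain r where r: "lin (rdim X) (rdim Y) r" "op_mat p * r = ide Y" and p: "p \<in> rep_homs X Y"
        by (auto simp: rep_epi_iff)
      have pf: "rhom X Y (op_mat p)" "rhom P Y (op_mat f)" using h p P by (simp_all add: rhom_mat)
      obtain g where g: "rhom P X g" "op_mat p * g = op_mat f" using R h(1,2) r pf by meson
      define g' where "g' = mat_op (rdim X) (rdim P) g"
      have g': "g' \<in> rep_homs P X" "op_mat g' = g" using g h P by (simp_all add: g'_def mat_op_rep_homs rhom_lin)
      then have "op_mat (p * g') = op_mat f"
        using g op_mat_mult[of p "rdim Y" "rdim X" g' "rdim P"] p h P by (auto simp: rhom_mat)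
      then have "p * g' = f" using p h P g' op_mat_inj[of "p * g'" "rdim Y" "rdim P" f] by (auto simp: rhom_mat)
      with g' show ?thesis by blast
    qed
    with P show "P \<in> projectives DD" by (auto simp: projectives_def)
  qed
qed (simp add: projectives_def)

lemma injectives_iff:
  "P \<in> injectives DD \<longleftrightarrow> P \<in> DD \<and> (\<forall>X\<in>DD. \<forall>Y\<in>DD. \<forall>i l f. rhom X Y i \<and> lin (rdim X) (rdim Y) l \<and>
     l * i = ide X \<and> rhom X P f \<longrightarrow> (\<exists>h. rhom Y P h \<and> h * i = f))" (is "_ \<longleftrightarrow> _ \<and> ?R")
proof (cases "P \<in> DD")
  case P: True
  show ?thesis
  proof (intro iffI conjI P ballI allI impI; (elim conjE)?)
    fix X Y i l f assume h: "P \<in> injectives DD" "X \<in> DD" "Y \<in> DD" "rhom X Y i" "lin (rdim X) (rdim Y) l"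
      "l * i = ide X" "rhom X P f"
    define i' f' where "i' = mat_op (rdim Y) (rdim X) i" and "f' = mat_op (rdim P) (rdim X) f"
    have op: "op_mat i' = i" "op_mat f' = f" using h by (simp_all add: i'_def f'_def rhom_lin)
    have "rep_mono X Y i'" using h op by (auto simp: rep_mono_iff i'_def mat_op_rep_homs)
    moreover have "f' \<in> rep_homs X P" using h P by (simp add: f'_def mat_op_rep_homs)
    ultimately obtain g where g: "g \<in> rep_homs Y P" "g * i' = f'" using h(1-3) unfolding injectives_def by blast
    then have "rhom Y P (op_mat g)" "op_mat g * i = f"
      using h P op op_mat_mult[of g "rdim P" "rdim Y" i' "rdim X"] by (auto simp: rhom_mat i'_def)
    then show "\<exists>h. rhom Y P h \<and> h * i = f" by blast
  next
    assume R: ?R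
    have "\<exists>h\<in>rep_homs Y P. h * i = f" if h: "X \<in> DD" "Y \<in> DD" "rep_mono X Y i" "f \<in> rep_homs X P" for X Y i f
    proof -
      from h obtain l where l: "lin (rdim X) (rdim Y) l" "l * op_mat i = ide X" and i: "i \<in> rep_homs X Y"
        by (auto simp: rep_mono_iff)
      have pf: "rhom X Y (op_mat i)" "rhom X P (op_mat f)" using h i P by (simp_all add: rhom_mat)
      obtain g where g: "rhom Y P g" "g * op_mat i = op_mat f" using R h(1,2) l pf by meson
      define g' where "g' = mat_op (rdim P) (rdim Y) g"
      have g': "g' \<in> rep_homs Y P" "op_mat g' = g" using g h P by (simp_all add: g'_def mat_op_rep_homs rhom_lin)
      then have "op_mat (g' * i) = op_mat f"
        using g op_mat_mult[of g' "rdim P" "rdim Y" i "rdim X"] i h P by (auto simp: rhom_mat)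
      then have "g' * i = f" using i h P g' op_mat_inj[of "g' * i" "rdim P" "rdim X" f] by (auto simp: rhom_mat)
      with g' show ?thesis by blast
    qed
    with P show "P \<in> injectives DD" by (auto simp: injectives_def)
  qed
qed (simp add: injectives_def)

lemma injective_extend:
  assumes "P \<in> injectives DD" "X \<in> DD" "Y \<in> DD" "rhom X Y i" "lin (rdim X) (rdim Y) l" "l * i = ide X" "rhom X P f"
  obtains h where "rhom Y P h" "h * i = f"
  using assms unfolding injectives_iff by blast

lemma projective_lift:
  assumes "P \<in> projectives DD" "X \<in> DD" "Y \<in> DD" "rhom X Y p" "lin (rdim X) (rdim Y) r" "p * r = ide Y" "rhom P Y f"
  obtains h where "rhom P X h" "p * h = f"
  using assms unfolding projectives_iff by blast

lemma Ind_projective: assumes M: "M \<in> DD" shows "Ind M \<in> projectives DD"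
  unfolding projectives_iff
proof (intro conjI ballI allI impI; (elim conjE)?)
  fix X Y p r f assume h: "X \<in> DD" "Y \<in> DD" "rhom X Y p" "lin (rdim X) (rdim Y) r" "p * r = ide Y" "rhom (Ind M) Y f"
  have "wlin M Y (f * ind_in M)" by (rule wlin_mult[OF rhom_wlin[OF h(6)] wlin_ind_in[OF M]])
  then obtain g where g: "wlin M X g" "p * g = f * ind_in M" using wlin_lift[OF h(1) M h(2-5)] by blast
  obtain k where k: "rhom (Ind M) X k" "k * ind_in M = g" using Ind_hom_exists[OF M h(1) g(1)] by blast
  have "p * k = f" by (rule Ind_hom_ext[OF M rhom_mult[OF h(3) k(1)] h(6)]) (simp add: mult.assoc k g)
  with k show "\<exists>h. rhom (Ind M) X h \<and> p * h = f" by blast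
qed (rule Ind_D[OF M])

lemma Ind_injective: assumes M: "M \<in> DD" shows "Ind M \<in> injectives DD"
  unfolding injectives_iff
proof (intro conjI ballI allI impI; (elim conjE)?)
  fix X Y i l f assume h: "X \<in> DD" "Y \<in> DD" "rhom X Y i" "lin (rdim X) (rdim Y) l" "l * i = ide X" "rhom X (Ind M) f"
  have "wlin X M (ind_out M * f)" by (rule wlin_mult[OF wlin_ind_out[OF M] rhom_wlin[OF h(6)]])
  then obtain g where g: "wlin Y M g" "g * i = ind_out M * f" using wlin_extend[OF h(1) M h(2-5)] by blast
  obtain k where k: "rhom Y (Ind M) k" "ind_out M * k = g" using Ind_cohom_exists[OF M h(2) g(1)] by blast
  have "k * i = f"
  proof (rule Ind_cohom_ext[OF M rhom_mult[OF k(1) h(3)] h(6)])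
    show "ind_out M * (k * i) = ind_out M * f" by (simp add: k g flip: mult.assoc)
  qed
  with k show "\<exists>h. rhom Y (Ind M) h \<and> h * i = f" by blast
qed (rule Ind_D[OF M])

lemma Ind_cover:
  assumes "M \<in> DD" obtains e where "rhom (Ind M) M e" "e * ind_in M = ide M"
  using Ind_hom_exists[OF assms assms, of "ide M"] rhom_wlin[of M M "ide M"] assms by auto

lemma Ind_hull:
  assumes "M \<in> DD" obtains h where "rhom M (Ind M) h" "ind_out M * h = ide M"
  using Ind_cohom_exists[OF assms assms, of "ide M"] rhom_wlin[of M M "ide M"] assms by auto

lemma lin_ind_in: "M \<in> DD \<Longrightarrow> lin (rdim (Ind M)) (rdim M) (ind_in M)"
  and lin_ind_out: "M \<in> DD \<Longrightarrow> lin (rdim M) (rdim (Ind M)) (ind_out M)"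
  using wlin_ind_in wlin_ind_out by (auto simp: wlin_def)

lemma retract_of_Ind_if_projective:
  assumes "P \<in> projectives DD" obtains a b where "rhom P (Ind P) a" "rhom (Ind P) P b" "b * a = ide P"
proof -
  have P: "P \<in> DD" using assms by (simp add: projectives_def)
  obtain e where e: "rhom (Ind P) P e" "e * ind_in P = ide P" using Ind_cover[OF P] .
  from projective_lift[OF assms Ind_D[OF P] P e(1) lin_ind_in[OF P] e(2), of "ide P"] P that e show ?thesis by auto
qed

lemma retract_of_Ind_if_injective:
  assumes "P \<in> injectives DD" obtains a b where "rhom P (Ind P) a" "rhom (Ind P) P b" "b * a = ide P"
proof -
  have P: "P \<in> DD" using assms by (simp add: injectives_def)
  obtain h where h: "rhom P (Ind P) h" "ind_out P * h = ide P" using Ind_hull[OF P] .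
  from injective_extend[OF assms P Ind_D[OF P] h(1) lin_ind_out[OF P] h(2), of "ide P"] P that h show ?thesis by auto
qed

lemma injective_retract:
  assumes "Q \<in> injectives DD" "P \<in> DD" "rhom P Q a" "rhom Q P b" "b * a = ide P"
  shows "P \<in> injectives DD"
  unfolding injectives_iff
proof (intro conjI ballI allI impI assms; (elim conjE)?)
  fix X Y i l f assume h: "X \<in> DD" "Y \<in> DD" "rhom X Y i" "lin (rdim X) (rdim Y) l" "l * i = ide X" "rhom X P f"
  obtain k where k: "rhom Y Q k" "k * i = a * f"
    using injective_extend[OF assms(1) h(1-5) rhom_mult[OF assms(3) h(6)]] .
  have "b * k * i = f" using k assms(5) rhom_lin[OF h(6)] by (simp add: mult.assoc) (simp add: linsD flip: mult.assoc)
  then show "\<exists>h. rhom Y P h \<and> h * i = f" using rhom_mult[OF assms(4) k(1)] by blast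
qed

lemma projective_retract:
  assumes "Q \<in> projectives DD" "P \<in> DD" "rhom P Q a" "rhom Q P b" "b * a = ide P"
  shows "P \<in> projectives DD"
  unfolding projectives_iff
proof (intro conjI ballI allI impI assms; (elim conjE)?)
  fix X Y p r f assume h: "X \<in> DD" "Y \<in> DD" "rhom X Y p" "lin (rdim X) (rdim Y) r" "p * r = ide Y" "rhom P Y f"
  obtain k where k: "rhom Q X k" "p * k = f * b"
    using projective_lift[OF assms(1) h(1-5) rhom_mult[OF h(6) assms(4)]] .
  have "p * (k * a) = f" using k assms(5) rhom_lin[OF h(6)] by (simp add: linsD mult.assoc flip: mult.assoc[of p])
  then show "\<exists>h. rhom P X h \<and> p * h = f" using rhom_mult[OF k(1) assms(3)] by blast
qed

text \<open>A projective or injective module P is a retract of \<open>Ind P\<close>, and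
  \<open>Ind P\<close> has both properties. This is the self-injectivity that makes Happel's
  triangles available.\<close>

lemma projectives_eq_injectives: "projectives DD = injectives DD"
proof (intro equalityI subsetI)
  fix P assume P: "P \<in> projectives DD"
  then have D: "P \<in> DD" by (simp add: projectives_def)
  from retract_of_Ind_if_projective[OF P] show "P \<in> injectives DD"
    using injective_retract[OF Ind_injective[OF D] D] by blast
next
  fix P assume P: "P \<in> injectives DD"
  then have D: "P \<in> DD" by (simp add: injectives_def)
  from retract_of_Ind_if_injective[OF P] show "P \<in> projectives DD"
    using projective_retract[OF Ind_projective[OF D] D] by blast
qed

lemma ctr_retract:
  assumes "ctr Q" "P \<in> DD" "rhom P Q a" "rhom Q P b" "b * a = ide P"
  shows "ctr P"
  using ctr_enull[OF assms(1) rhom_elin[OF assms(4)] rhom_elin[OF assms(3)]] assms(5) by (simp add: ctr_def)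

lemma ctr_injective: assumes "P \<in> injectives DD" shows "ctr P"
proof -
  have D: "P \<in> DD" using assms by (simp add: injectives_def)
  from retract_of_Ind_if_injective[OF assms] show ?thesis using ctr_retract[OF ctr_Ind[OF D] D] by blast
qed

subsection \<open>The chosen embeddings\<close>

definition IO :: "dgen rep \<Rightarrow> dgen rep" where "IO X = inj_obj DD X"
definition Sg :: "dgen rep \<Rightarrow> dgen rep" where "Sg X = cosyz DD X"
definition im :: "dgen rep \<Rightarrow> lop" where "im X = op_mat (inj_map DD X)"
definition pm :: "dgen rep \<Rightarrow> lop" where "pm X = op_mat (cosyz_map DD X)"

text \<open>The choice operator delivers its specification once some embedding exists; one is given
  by M into \<open>Ind M\<close>, the map that corresponds to the identity under
  coinduction.\<close>

lemma chosen_embedding: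
  assumes X: "X \<in> DD"
  shows "IO X \<in> injectives DD" "Sg X \<in> DD" "\<exists>l r. ses X (im X) (IO X) (pm X) (Sg X) l r"
    "short_exact X (inj_map DD X) (IO X) (cosyz_map DD X) (Sg X)"
    "inj_map DD X \<in> carrier_mat (rdim (IO X)) (rdim X)" "cosyz_map DD X \<in> carrier_mat (rdim (Sg X)) (rdim (IO X))"
proof -
  define Pr where "Pr = (\<lambda>(I, i, Q, p). I \<in> injectives DD \<and> Q \<in> DD \<and> short_exact X i I p Q)"
  obtain h where h: "rhom X (Ind X) h" "ind_out X * h = ide X" using Ind_hull[OF X] .
  obtain Z p r where Z: "Z \<in> DD" "ses X h (Ind X) p Z (ind_out X) r"
    using cokernel_exists[OF X Ind_D[OF X] h(1) lin_ind_out[OF X] h(2)] .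
  have "Pr (Ind X, mat_op (rdim (Ind X)) (rdim X) h, Z, mat_op (rdim Z) (rdim (Ind X)) p)"
    using Z X Ind_injective[OF X] Ind_D[OF X] sesD[OF Z(2)]
    by (auto simp: Pr_def short_exact_iff intro!: exI)
  then have "Pr (chosen_embedding DD X)" unfolding chosen_embedding_def Pr_def[symmetric] by (rule someI)
  then show *: "IO X \<in> injectives DD" "Sg X \<in> DD" "short_exact X (inj_map DD X) (IO X) (cosyz_map DD X) (Sg X)"
    by (auto simp: Pr_def IO_def Sg_def inj_obj_def inj_map_def cosyz_def cosyz_map_def split: prod.splits)
  from this(1) have "IO X \<in> DD" by (simp add: injectives_def)
  with * X show "\<exists>l r. ses X (im X) (IO X) (pm X) (Sg X) l r" 
    "inj_map DD X \<in> carrier_mat (rdim (IO X)) (rdim X)" "cosyz_map DD X \<in> carrier_mat (rdim (Sg X)) (rdim (IO X))"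
    by (auto simp: short_exact_iff im_def pm_def)
qed

lemma IO_inj: "X \<in> DD \<Longrightarrow> IO X \<in> injectives DD" and Sg_D [intro, simp]: "X \<in> DD \<Longrightarrow> Sg X \<in> DD"
  by (auto dest: chosen_embedding)
lemma IO_D [intro, simp]: "X \<in> DD \<Longrightarrow> IO X \<in> DD" using IO_inj by (simp add: injectives_def)
lemma IO_ctr: "X \<in> DD \<Longrightarrow> ctr (IO X)" by (rule ctr_injective[OF IO_inj])

lemma rhom_im [intro, simp]: "X \<in> DD \<Longrightarrow> rhom X (IO X) (im X)" and rhom_pm [intro, simp]: "X \<in> DD \<Longrightarrow> rhom (IO X) (Sg X) (pm X)"
  using chosen_embedding(3) sesD by blast+

text \<open>The zero maps of the stable category. A map through any injective module extends to the
  chosen hull, so factorisation through \<open>im X\<close> captures all of them and is visibly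
  additive.\<close>

definition Dnull :: "dgen rep \<Rightarrow> dgen rep \<Rightarrow> lop \<Rightarrow> bool" where
  "Dnull X Y f \<longleftrightarrow> (\<exists>k. rhom (IO X) Y k \<and> f = k * im X)"

lemma Dnull_factor:
  assumes "X \<in> DD" "P \<in> injectives DD" "rhom X P a" "rhom P Y b" shows "Dnull X Y (b * a)"
proof -
  obtain l r where s: "ses X (im X) (IO X) (pm X) (Sg X) l r" using chosen_embedding[OF assms(1)] by blast
  obtain a' where a': "rhom (IO X) P a'" "a' * im X = a"
    using injective_extend[OF assms(2,1) IO_D[OF assms(1)] sesD(1,5,7)[OF s] assms(3)] .
  then show ?thesis unfolding Dnull_def using rhom_mult[OF assms(4) a'(1)] by (auto simp: mult.assoc intro!: exI[of _ "b * a'"])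
qed

lemma Dnull_0 [simp, intro]: "Dnull X Y 0" unfolding Dnull_def by (intro exI[of _ 0]) simp
lemma Dnull_add: "Dnull X Y f \<Longrightarrow> Dnull X Y g \<Longrightarrow> Dnull X Y (f + g)"
  unfolding Dnull_def by (metis distrib_right rhom_add)
lemma Dnull_diff: "Dnull X Y f \<Longrightarrow> Dnull X Y g \<Longrightarrow> Dnull X Y (f - g)"
  unfolding Dnull_def by (metis left_diff_distrib rhom_diff)
lemma Dnull_uminus: "Dnull X Y f \<Longrightarrow> Dnull X Y (- f)"
  using Dnull_diff[of X Y 0 f] by simp
lemma Dnull_minus_sym: "Dnull X Y (f - g) \<longleftrightarrow> Dnull X Y (g - f)"
  using Dnull_uminus[of X Y "f - g"] Dnull_uminus[of X Y "g - f"] by auto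
lemma Dnull_left: "rhom Y Z g \<Longrightarrow> Dnull X Y f \<Longrightarrow> Dnull X Z (g * f)"
  unfolding Dnull_def by (metis mult.assoc rhom_mult)
lemma Dnull_right:
  assumes "W \<in> DD" "X \<in> DD" "Dnull X Y f" "rhom W X g" shows "Dnull W Y (f * g)"
proof -
  obtain k where k: "rhom (IO X) Y k" "f = k * im X" using assms(3) by (auto simp: Dnull_def)
  show ?thesis unfolding k(2) mult.assoc
    by (rule Dnull_factor[OF assms(1) IO_inj[OF assms(2)] rhom_mult[OF rhom_im[OF assms(2)] assms(4)] k(1)])
qed
lemma Dnull_enull: assumes "X \<in> DD" "Dnull X Y f" shows "enull X Y f"
proof -
  obtain k where k: "rhom (IO X) Y k" "f = k * im X" using assms(2) by (auto simp: Dnull_def)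
  show ?thesis unfolding k(2)
    by (rule ctr_enull[OF IO_ctr[OF assms(1)] rhom_elin[OF k(1)] rhom_elin[OF rhom_im[OF assms(1)]]])
qed

lemma Sg_lift_exists:
  assumes "X \<in> DD" "Y \<in> DD" "rhom X Y f"
  obtains h g where "rhom (IO X) (IO Y) h" "h * im X = im Y * f" "rhom (Sg X) (Sg Y) g" "g * pm X = pm Y * h"
proof -
  obtain l r where s: "ses X (im X) (IO X) (pm X) (Sg X) l r" using chosen_embedding[OF assms(1)] by blast
  obtain l' r' where s': "ses Y (im Y) (IO Y) (pm Y) (Sg Y) l' r'" using chosen_embedding[OF assms(2)] by blast
  note A = sesD[OF s] and B = sesD[OF s']
  obtain h where h: "rhom (IO X) (IO Y) h" "h * im X = im Y * f"
    using injective_extend[OF IO_inj[OF assms(2)] assms(1) IO_D[OF assms(1)] A(1,5,7) rhom_mult[OF B(1) assms(3)]] .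
  define g where "g = pm Y * (h * r)"
  have "g * pm X = pm Y * (h * (ide (IO X) - im X * l))" by (simp add: g_def A(11) mult.assoc)
  also have "\<dots> = pm Y * h"
    using rhom_lin[OF h(1)] by (simp add: right_diff_distrib linsD assoc_ext[OF h(2)] mult.assoc B)
  finally have gp: "g * pm X = pm Y * h" .
  have "rhom (Sg X) (Sg Y) g"
  proof (rule rhom_epi_cancel[OF A(2,8)])
    show "rhom (IO X) (Sg Y) (g * pm X)" unfolding gp using B h by blast
    show "lin (rdim (Sg Y)) (rdim (Sg X)) g" unfolding g_def using A B rhom_lin[OF h(1)] by blast
  qed (use assms in auto)
  with h gp that show ?thesis by blast
qed

text \<open>If f = k i, then h - i k vanishes on X and descends to the cosyzygy, so g factors
  through an injective module. This makes the shift well defined on stable classes and independent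
  of the lifts h and g.\<close>

lemma Sg_null:
  assumes D: "X \<in> DD" "Y \<in> DD" and f: "Dnull X Y f"
    and h: "rhom (IO X) (IO Y) h" "h * im X = im Y * f" and g: "rhom (Sg X) (Sg Y) g" "g * pm X = pm Y * h"
  shows "Dnull (Sg X) (Sg Y) g"
proof -
  obtain l r where s: "ses X (im X) (IO X) (pm X) (Sg X) l r" using chosen_embedding[OF D(1)] by blast
  obtain l' r' where s': "ses Y (im Y) (IO Y) (pm Y) (Sg Y) l' r'" using chosen_embedding[OF D(2)] by blast
  note A = sesD[OF s] and B = sesD[OF s']
  obtain k where k: "rhom (IO X) Y k" "f = k * im X" using f by (auto simp: Dnull_def)
  define m where "m = (h - im Y * k) * r"
  have "m * pm X = (h - im Y * k) * (ide (IO X) - im X * l)" by (simp add: m_def A(11) mult.assoc)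
  also have "\<dots> = h - im Y * k"
    using linsD[OF rhom_lin[OF h(1)]] linsD[OF rhom_lin[OF k(1)]] linsD[OF B(3)]
    by (simp add: right_diff_distrib left_diff_distrib assoc_ext[OF h(2)] mult.assoc k(2))
  finally have mp: "m * pm X = h - im Y * k" .
  have rm: "rhom (Sg X) (IO Y) m"
  proof (rule rhom_epi_cancel[OF A(2,8)])
    show "rhom (IO X) (IO Y) (m * pm X)" unfolding mp using B h k by blast
    show "lin (rdim (IO Y)) (rdim (Sg X)) m" unfolding m_def using A B rhom_lin[OF h(1)] rhom_lin[OF k(1)] by blast
  qed (use D in auto)
  have "g * pm X = pm Y * (m * pm X)" unfolding mp using B(14)[of k] g(2) by (simp add: right_diff_distrib)
  from arg_cong[OF this, of "\<lambda>x. x * r"] have "g * (pm X * r) = pm Y * (m * (pm X * r))" by (simp only: mult.assoc)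
  then have "g = pm Y * m" using linsD[OF rhom_lin[OF g(1)]] linsD[OF rhom_lin[OF rm]] by (simp add: A mult.assoc)
  then show ?thesis using Dnull_factor[OF Sg_D[OF D(1)] IO_inj[OF D(2)] rm B(2)] by simp
qed

subsection \<open>The stable category\<close>

abbreviation TT :: "(dgen rep, complex mat set) tri_cat" where "TT \<equiv> D_stab d \<zeta>"

definition Sc :: "dgen rep \<Rightarrow> dgen rep \<Rightarrow> lop \<Rightarrow> complex mat set" where
  "Sc X Y f = stable_class DD X Y (mat_op (rdim Y) (rdim X) f)"

lemma op_mat_hom_mult:
  "g \<in> rep_homs Y Z \<Longrightarrow> f \<in> rep_homs X Y \<Longrightarrow> op_mat (g * f) = op_mat g * op_mat f"
  by (rule op_mat_mult) (auto simp: rep_homs_def)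

lemma rhom_op_mat: "X \<in> DD \<Longrightarrow> Y \<in> DD \<Longrightarrow> f \<in> rep_homs X Y \<Longrightarrow> rhom X Y (op_mat f)"
  by (simp add: rhom_mat)

lemma stable_class_mem:
  assumes D: "X \<in> DD" "Y \<in> DD" and f: "f \<in> rep_homs X Y"
  shows "g \<in> stable_class DD X Y f \<longleftrightarrow> g \<in> rep_homs X Y \<and> Dnull X Y (op_mat g - op_mat f)"
proof (cases "g \<in> rep_homs X Y")
  case g: True
  have c: "g \<in> carrier_mat (rdim Y) (rdim X)" "f \<in> carrier_mat (rdim Y) (rdim X)"
    using f g by (auto simp: rep_homs_def)
  note od = op_mat_diff[OF c]
  have "(\<exists>P\<in>projectives DD. \<exists>a\<in>rep_homs X P. \<exists>b\<in>rep_homs P Y. g - f = b * a) \<longleftrightarrow> Dnull X Y (op_mat g - op_mat f)"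
  proof
    assume "\<exists>P\<in>projectives DD. \<exists>a\<in>rep_homs X P. \<exists>b\<in>rep_homs P Y. g - f = b * a"
    then obtain P a b where P: "P \<in> projectives DD" "a \<in> rep_homs X P" "b \<in> rep_homs P Y" "g - f = b * a" by blast
    have PD: "P \<in> DD" using P(1) by (simp add: projectives_def)
    have "op_mat g - op_mat f = op_mat b * op_mat a" using od P(4) op_mat_hom_mult[OF P(3,2)] by simp
    then show "Dnull X Y (op_mat g - op_mat f)"
      using Dnull_factor[OF D(1) P(1)[unfolded projectives_eq_injectives] rhom_op_mat[OF D(1) PD P(2)] rhom_op_mat[OF PD D(2) P(3)]]
      by simp
  next
    assume "Dnull X Y (op_mat g - op_mat f)"
    then obtain k where k: "rhom (IO X) Y k" "op_mat g - op_mat f = k * im X" by (auto simp: Dnull_def)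
    define b where "b = mat_op (rdim Y) (rdim (IO X)) k"
    have b: "b \<in> rep_homs (IO X) Y" using k D by (simp add: b_def mat_op_rep_homs)
    have ob: "op_mat b = k" using rhom_lin[OF k(1)] by (simp add: b_def)
    have a: "inj_map DD X \<in> rep_homs X (IO X)"
      using chosen_embedding(5)[OF D(1)] rhom_im[OF D(1)] D by (simp add: rhom_mat im_def)
    have "op_mat (g - f) = op_mat (b * inj_map DD X)"
      using od k(2) op_mat_hom_mult[OF b a] ob by (simp add: im_def)
    moreover have "b * inj_map DD X \<in> carrier_mat (rdim Y) (rdim X)" "g - f \<in> carrier_mat (rdim Y) (rdim X)"
      using a b c by (auto simp: rep_homs_def)
    ultimately have "g - f = b * inj_map DD X" using op_mat_inj by blast
    with a b IO_inj[OF D(1)] show "\<exists>P\<in>projectives DD. \<exists>a\<in>rep_homs X P. \<exists>b\<in>rep_homs P Y. g - f = b * a"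
      unfolding projectives_eq_injectives by blast
  qed
  with g show ?thesis by (simp add: stable_class_def)
qed (simp add: stable_class_def)

lemma stable_class_eq_iff:
  assumes D: "X \<in> DD" "Y \<in> DD" and f: "f \<in> rep_homs X Y" and g: "g \<in> rep_homs X Y"
  shows "stable_class DD X Y f = stable_class DD X Y g \<longleftrightarrow> Dnull X Y (op_mat f - op_mat g)"
proof
  assume "stable_class DD X Y f = stable_class DD X Y g"
  moreover have "f \<in> stable_class DD X Y f" using stable_class_mem[OF D f] f by simp
  ultimately show "Dnull X Y (op_mat f - op_mat g)" using stable_class_mem[OF D g] by simp
next
  assume n: "Dnull X Y (op_mat f - op_mat g)"
  have "Dnull X Y (op_mat h - op_mat f) \<longleftrightarrow> Dnull X Y (op_mat h - op_mat g)" for h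
    using Dnull_add[OF _ n, of "op_mat h - op_mat f"] Dnull_diff[OF _ n, of "op_mat h - op_mat g"] by auto
  then show "stable_class DD X Y f = stable_class DD X Y g"
    using stable_class_mem[OF D f] stable_class_mem[OF D g] by blast
qed

lemma Sc_mem: "X \<in> DD \<Longrightarrow> Y \<in> DD \<Longrightarrow> rhom X Y f \<Longrightarrow> g \<in> Sc X Y f \<longleftrightarrow> g \<in> rep_homs X Y \<and> Dnull X Y (op_mat g - f)"
  unfolding Sc_def using stable_class_mem[of X Y "mat_op (rdim Y) (rdim X) f"] by (simp add: mat_op_rep_homs rhom_lin)

lemma Sc_eq_iff: "X \<in> DD \<Longrightarrow> Y \<in> DD \<Longrightarrow> rhom X Y f \<Longrightarrow> rhom X Y g \<Longrightarrow> Sc X Y f = Sc X Y g \<longleftrightarrow> Dnull X Y (f - g)"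
  unfolding Sc_def by (simp add: stable_class_eq_iff mat_op_rep_homs rhom_lin)

lemma stable_class_Sc: "X \<in> DD \<Longrightarrow> Y \<in> DD \<Longrightarrow> f \<in> rep_homs X Y \<Longrightarrow> stable_class DD X Y f = Sc X Y (op_mat f)"
  unfolding Sc_def by (simp add: rep_homs_def)

lemma stab_ob [simp]: "ob TT = DD" and stab_sh [simp]: "sh TT X = Sg X"
  by (simp_all add: D_stab_def stable_category_def with_triangles_def stable_shift_cat_def shift_cat.extend_def Sg_def)

lemma mat_op_idn [simp]: "mat_op n n (idn n) = 1\<^sub>m n"
  using mat_op_op_mat[of "1\<^sub>m n" n n] by simp

lemma stab_idt: "idt TT X = Sc X X (ide X)"
  by (simp add: D_stab_def stable_category_def with_triangles_def stable_shift_cat_def shift_cat.extend_def Sc_def)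

lemma stab_arr: assumes "X \<in> DD" "Y \<in> DD" shows "arr TT X Y = {Sc X Y f | f. rhom X Y f}"
proof -
  have "stable_class DD X Y ` rep_homs X Y = {Sc X Y f | f. rhom X Y f}" (is "?L = ?R")
  proof
    show "?L \<subseteq> ?R" using assms by (auto simp: stable_class_Sc rhom_op_mat)
    show "?R \<subseteq> ?L" using assms by (auto simp: Sc_def mat_op_rep_homs)
  qed
  then show ?thesis
    by (simp add: D_stab_def stable_category_def with_triangles_def stable_shift_cat_def shift_cat.extend_def)
qed

lemma Sc_arr [intro]: "X \<in> DD \<Longrightarrow> Y \<in> DD \<Longrightarrow> rhom X Y f \<Longrightarrow> Sc X Y f \<in> arr TT X Y"
  by (auto simp: stab_arr)

text \<open>Composition is defined as a union over all representatives. The classes are nonempty and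
  null maps form an ideal, so the union collapses to a single class.\<close>

lemma stab_cmp:
  assumes D: "X \<in> DD" "Y \<in> DD" "Z \<in> DD" and f: "rhom X Y f" and g: "rhom Y Z g"
  shows "cmp TT X Y Z (Sc Y Z g) (Sc X Y f) = Sc X Z (g * f)"
proof -
  have eq: "stable_class DD X Z (g' * f') = Sc X Z (g * f)" if "g' \<in> Sc Y Z g" "f' \<in> Sc X Y f" for g' f'
  proof -
    have g': "g' \<in> rep_homs Y Z" "Dnull Y Z (op_mat g' - g)" and f': "f' \<in> rep_homs X Y" "Dnull X Y (op_mat f' - f)"
      using that D f g by (auto simp: Sc_mem)
    note r = rhom_op_mat[OF D(2,3) g'(1)] rhom_op_mat[OF D(1,2) f'(1)]
    have gf: "g' * f' \<in> rep_homs X Z"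
      using rhom_mult[OF r] op_mat_hom_mult[OF g'(1) f'(1)] g'(1) f'(1) D by (auto simp: rhom_mat)
    have "op_mat g' * op_mat f' - g * f = (op_mat g' - g) * op_mat f' + g * (op_mat f' - f)"
      by (simp add: algebra_simps)
    then have "Dnull X Z (op_mat (g' * f') - g * f)" unfolding op_mat_hom_mult[OF g'(1) f'(1)]
      using Dnull_add[OF Dnull_right[OF D(1,2) g'(2) r(2)] Dnull_left[OF g f'(2)]] by simp
    then show ?thesis using gf f g D by (simp add: stable_class_Sc Sc_eq_iff rhom_op_mat rhom_mult)
  qed
  have ne: "mat_op (rdim Z) (rdim Y) g \<in> Sc Y Z g" "mat_op (rdim Y) (rdim X) f \<in> Sc X Y f"
    using D f g by (simp_all add: Sc_mem mat_op_rep_homs rhom_lin)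
  have "(\<Union>g\<in>Sc Y Z g. \<Union>f\<in>Sc X Y f. stable_class DD X Z (g * f)) = Sc X Z (g * f)"
    using eq ne by (auto 0 4)
  then show ?thesis
    by (simp add: D_stab_def stable_category_def with_triangles_def stable_shift_cat_def shift_cat.extend_def)
qed

lemma stab_shm:
  assumes D: "X \<in> DD" "Y \<in> DD" and f: "rhom X Y f" and h: "rhom (IO X) (IO Y) h" "h * im X = im Y * f"
    and g: "rhom (Sg X) (Sg Y) g" "g * pm X = pm Y * h"
  shows "shm TT X Y (Sc X Y f) = Sc (Sg X) (Sg Y) g"
proof -
  define Q where "Q f' g' h' \<longleftrightarrow> h' \<in> rep_homs (IO X) (IO Y) \<and> h' * inj_map DD X = inj_map DD Y * f' \<and>
     g' \<in> rep_homs (Sg X) (Sg Y) \<and> g' * cosyz_map DD X = cosyz_map DD Y * h'" for f' g' h'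
  have sD: "Sg X \<in> DD" "Sg Y \<in> DD" "IO X \<in> DD" "IO Y \<in> DD" using D by auto
  have maps: "inj_map DD X \<in> rep_homs X (IO X)" "inj_map DD Y \<in> rep_homs Y (IO Y)"
    "cosyz_map DD X \<in> rep_homs (IO X) (Sg X)" "cosyz_map DD Y \<in> rep_homs (IO Y) (Sg Y)"
    using chosen_embedding(5,6)[OF D(1)] chosen_embedding(5,6)[OF D(2)] rhom_im[OF D(1)] rhom_im[OF D(2)]
      rhom_pm[OF D(1)] rhom_pm[OF D(2)] D sD by (simp_all add: rhom_mat im_def pm_def)
  have eq: "stable_class DD (Sg X) (Sg Y) g' = Sc (Sg X) (Sg Y) g" if "f' \<in> Sc X Y f" "Q f' g' h'" for f' g' h'
  proof -
    have f': "f' \<in> rep_homs X Y" "Dnull X Y (op_mat f' - f)" using that D f by (auto simp: Sc_mem)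
    have h': "h' \<in> rep_homs (IO X) (IO Y)" and g': "g' \<in> rep_homs (Sg X) (Sg Y)" using that by (simp_all add: Q_def)
    have e: "op_mat h' * im X = im Y * op_mat f'" "op_mat g' * pm X = pm Y * op_mat h'"
      using that(2) op_mat_hom_mult[OF h' maps(1)] op_mat_hom_mult[OF maps(2) f'(1)]
        op_mat_hom_mult[OF g' maps(3)] op_mat_hom_mult[OF maps(4) h'] by (auto simp: Q_def im_def pm_def)
    have "Dnull (Sg X) (Sg Y) (op_mat g' - g)"
      by (rule Sg_null[OF D f'(2) rhom_diff[OF rhom_op_mat[OF sD(3,4) h'] h(1)] _ rhom_diff[OF rhom_op_mat[OF sD(1,2) g'] g(1)]])
        (simp_all add: left_diff_distrib right_diff_distrib e h g)
    then show ?thesis using g g' sD by (simp add: stable_class_Sc Sc_eq_iff rhom_op_mat)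
  qed
  define f0 h0 g0 where "f0 = mat_op (rdim Y) (rdim X) f" and "h0 = mat_op (rdim (IO Y)) (rdim (IO X)) h"
    and "g0 = mat_op (rdim (Sg Y)) (rdim (Sg X)) g"
  have fhg: "f0 \<in> rep_homs X Y" "h0 \<in> rep_homs (IO X) (IO Y)" "g0 \<in> rep_homs (Sg X) (Sg Y)"
    "op_mat f0 = f" "op_mat h0 = h" "op_mat g0 = g"
    using D sD f h g by (simp_all add: f0_def h0_def g0_def mat_op_rep_homs rhom_lin)
  have "f0 \<in> Sc X Y f" using fhg D f by (simp add: Sc_mem)
  moreover have "Q f0 g0 h0"
  proof -
    have "op_mat (h0 * inj_map DD X) = op_mat (inj_map DD Y * f0)" "op_mat (g0 * cosyz_map DD X) = op_mat (cosyz_map DD Y * h0)"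
      using op_mat_hom_mult[OF fhg(2) maps(1)] op_mat_hom_mult[OF maps(2) fhg(1)]
        op_mat_hom_mult[OF fhg(3) maps(3)] op_mat_hom_mult[OF maps(4) fhg(2)] fhg h g by (simp_all add: im_def pm_def)
    moreover have "h0 * inj_map DD X \<in> carrier_mat (rdim (IO Y)) (rdim X)" "inj_map DD Y * f0 \<in> carrier_mat (rdim (IO Y)) (rdim X)"
      "g0 * cosyz_map DD X \<in> carrier_mat (rdim (Sg Y)) (rdim (IO X))" "cosyz_map DD Y * h0 \<in> carrier_mat (rdim (Sg Y)) (rdim (IO X))"
      using maps fhg(1-3) by (auto simp: rep_homs_def)
    ultimately show ?thesis using fhg op_mat_inj by (auto simp: Q_def)
  qed
  ultimately have "(\<Union>f\<in>Sc X Y f. \<Union>{stable_class DD (Sg X) (Sg Y) g | g h. Q f g h}) = Sc (Sg X) (Sg Y) g"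
    using eq by (auto 0 4)
  then show ?thesis unfolding Q_def
    by (simp add: D_stab_def stable_category_def with_triangles_def stable_shift_cat_def shift_cat.extend_def Sg_def IO_def)
qed

lemma stab_shm_ide: "X \<in> DD \<Longrightarrow> shm TT X X (Sc X X (ide X)) = Sc (Sg X) (Sg X) (ide (Sg X))"
  by (rule stab_shm[where h = "ide (IO X)"])
    (simp_all add: linsD[OF rhom_lin[OF rhom_im]] linsD[OF rhom_lin[OF rhom_pm]])

definition std_triangle :: "dgen rep \<Rightarrow> lop \<Rightarrow> dgen rep \<Rightarrow> lop \<Rightarrow> dgen rep \<Rightarrow> lop \<Rightarrow> bool" where
  "std_triangle X u Y v Z w \<longleftrightarrow> X \<in> DD \<and> Y \<in> DD \<and> Z \<in> DD \<and> rhom X Y u \<and>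
     (\<exists>l r j. ses Y v Z w (Sg X) l r \<and> rhom (IO X) Z j \<and> j * im X = v * u \<and> w * j = pm X)"

lemma std_triangles:
  "{(X, Y, Z, stable_class DD X Y u, stable_class DD Y Z v, stable_class DD Z (cosyz DD X) w)
        | X Y Z u v w. X \<in> DD \<and> Y \<in> DD \<and> Z \<in> DD \<and> u \<in> rep_homs X Y \<and>
        short_exact Y v Z w (cosyz DD X) \<and>
        (\<exists>j\<in>rep_homs (inj_obj DD X) Z. j * inj_map DD X = v * u \<and> w * j = cosyz_map DD X)} =
   {(X, Y, Z, Sc X Y u, Sc Y Z v, Sc Z (Sg X) w) | X Y Z u v w. std_triangle X u Y v Z w}" (is "?L = ?R")
proof
  show "?L \<subseteq> ?R"
  proof clarify
    fix X Y Z u v w j assume D: "X \<in> DD" "Y \<in> DD" "Z \<in> DD" and u: "u \<in> rep_homs X Y"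
      and s: "short_exact Y v Z w (cosyz DD X)" and j: "j \<in> rep_homs (inj_obj DD X) Z"
      "j * inj_map DD X = v * u" "w * j = cosyz_map DD X"
    note s' = s[folded Sg_def] and j' = j[folded IO_def]
    have vw: "v \<in> rep_homs Y Z" "w \<in> rep_homs Z (Sg X)" using s' by (auto simp: short_exact_def rep_mono_def rep_epi_def)
    have mi: "inj_map DD X \<in> rep_homs X (IO X)"
      using chosen_embedding(5)[OF D(1)] rhom_im[OF D(1)] D by (simp add: rhom_mat im_def)
    obtain l r where lr: "ses Y (op_mat v) Z (op_mat w) (Sg X) l r" using s' D by (auto simp: short_exact_iff)
    have "std_triangle X (op_mat u) Y (op_mat v) Z (op_mat w)"
      unfolding std_triangle_def using D lr rhom_op_mat[OF D(1,2) u] rhom_op_mat[OF IO_D[OF D(1)] D(3) j'(1)]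
        op_mat_hom_mult[OF j'(1) mi] op_mat_hom_mult[OF vw(1) u] op_mat_hom_mult[OF vw(2) j'(1)] j'(2,3)
      by (intro conjI exI[of _ l] exI[of _ r] exI[of _ "op_mat j"]) (auto simp: im_def pm_def)
    moreover have "stable_class DD X Y u = Sc X Y (op_mat u)" "stable_class DD Y Z v = Sc Y Z (op_mat v)"
      "stable_class DD Z (cosyz DD X) w = Sc Z (Sg X) (op_mat w)" using D u vw by (simp_all add: stable_class_Sc Sg_def[symmetric])
    ultimately show "\<exists>X' Y' Z' u' v' w'. (X, Y, Z, stable_class DD X Y u, stable_class DD Y Z v, stable_class DD Z (cosyz DD X) w) =
      (X', Y', Z', Sc X' Y' u', Sc Y' Z' v', Sc Z' (Sg X') w') \<and> std_triangle X' u' Y' v' Z' w'" by blast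
  qed
  show "?R \<subseteq> ?L"
  proof clarify
    fix X Y Z u v w assume t: "std_triangle X u Y v Z w"
    then obtain l r j where D: "X \<in> DD" "Y \<in> DD" "Z \<in> DD" and u: "rhom X Y u" and s: "ses Y v Z w (Sg X) l r"
      and j: "rhom (IO X) Z j" "j * im X = v * u" "w * j = pm X" by (auto simp: std_triangle_def)
    note vw = sesD(1,2)[OF s]
    define u0 v0 w0 j0 where "u0 = mat_op (rdim Y) (rdim X) u" and "v0 = mat_op (rdim Z) (rdim Y) v"
      and "w0 = mat_op (rdim (Sg X)) (rdim Z) w" and "j0 = mat_op (rdim Z) (rdim (IO X)) j"
    have h: "u0 \<in> rep_homs X Y" "v0 \<in> rep_homs Y Z" "w0 \<in> rep_homs Z (Sg X)" "j0 \<in> rep_homs (IO X) Z"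
      using D u vw j by (simp_all add: u0_def v0_def w0_def j0_def mat_op_rep_homs)
    have o: "op_mat u0 = u" "op_mat v0 = v" "op_mat w0 = w" "op_mat j0 = j"
      using u vw j by (simp_all add: u0_def v0_def w0_def j0_def rhom_lin)
    have mi: "inj_map DD X \<in> rep_homs X (IO X)"
      using chosen_embedding(5)[OF D(1)] rhom_im[OF D(1)] D by (simp add: rhom_mat im_def)
    have "op_mat (j0 * inj_map DD X) = op_mat (v0 * u0)" "op_mat (w0 * j0) = op_mat (cosyz_map DD X)"
      using op_mat_hom_mult[OF h(4) mi] op_mat_hom_mult[OF h(2,1)] op_mat_hom_mult[OF h(3,4)] j o by (simp_all add: im_def pm_def)
    moreover have "j0 * inj_map DD X \<in> carrier_mat (rdim Z) (rdim X)" "v0 * u0 \<in> carrier_mat (rdim Z) (rdim X)"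
      "w0 * j0 \<in> carrier_mat (rdim (Sg X)) (rdim (IO X))"
      using h mi by (auto simp: rep_homs_def)
    ultimately have e: "j0 * inj_map DD X = v0 * u0" "w0 * j0 = cosyz_map DD X"
      using op_mat_inj chosen_embedding(6)[OF D(1)] by blast+
    have "short_exact Y v0 Z w0 (Sg X)" using s o D h by (auto simp: short_exact_iff rep_homs_def)
    then show "\<exists>X' Y' Z' u' v' w'. (X, Y, Z, Sc X Y u, Sc Y Z v, Sc Z (Sg X) w) =
      (X', Y', Z', stable_class DD X' Y' u', stable_class DD Y' Z' v', stable_class DD Z' (cosyz DD X') w') \<and>
      X' \<in> DD \<and> Y' \<in> DD \<and> Z' \<in> DD \<and> u' \<in> rep_homs X' Y' \<and> short_exact Y' v' Z' w' (cosyz DD X') \<and>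
      (\<exists>j\<in>rep_homs (inj_obj DD X') Z'. j * inj_map DD X' = v' * u' \<and> w' * j = cosyz_map DD X')"
      using D h e by (intro exI[of _ X] exI[of _ Y] exI[of _ Z] exI[of _ u0] exI[of _ v0] exI[of _ w0])
        (auto simp: stable_class_Sc o Sg_def[symmetric] IO_def[symmetric])
  qed
qed

lemma stab_tri:
  "t \<in> tri TT \<longleftrightarrow> candidate_triangle TT t \<and> (\<exists>X Y Z u v w. std_triangle X u Y v Z w \<and>
     triangle_iso TT t (X, Y, Z, Sc X Y u, Sc Y Z v, Sc Z (Sg X) w))"
proof -
  have "candidate_triangle TT t \<longleftrightarrow> candidate_triangle (stable_shift_cat DD) t"
    "triangle_iso TT t t' \<longleftrightarrow> triangle_iso (stable_shift_cat DD) t t'" for t t'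
    by (cases t; cases t'; simp add: D_stab_def stable_category_def with_triangles_def shift_cat.extend_def iso_arr_def)+
  then have ci: "candidate_triangle TT = candidate_triangle (stable_shift_cat DD)" "triangle_iso TT = triangle_iso (stable_shift_cat DD)"
    by blast+
  have c: "candidate_triangle TT (X, Y, Z, Sc X Y u, Sc Y Z v, Sc Z (Sg X) w)" if "std_triangle X u Y v Z w" for X Y Z u v w
    using that by (auto simp: std_triangle_def dest: sesD(1,2))
  have tr: "tri TT = {t. candidate_triangle TT t \<and> (\<exists>t'\<in>{(X, Y, Z, Sc X Y u, Sc Y Z v, Sc Z (Sg X) w) | X Y Z u v w.
     std_triangle X u Y v Z w}. candidate_triangle TT t' \<and> triangle_iso TT t t')}"
    unfolding ci unfolding D_stab_def stable_category_def std_triangles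
    by (simp add: with_triangles_def shift_cat.extend_def tri_cat.defs)
  show ?thesis unfolding tr mem_Collect_eq Bex_def using c by blast
qed

lemma stab_iso_arr_iff:
  assumes D: "X \<in> DD" "Y \<in> DD"
  shows "iso_arr TT X Y A \<longleftrightarrow> (\<exists>a b. A = Sc X Y a \<and> rhom X Y a \<and> rhom Y X b \<and> Dnull X X (b * a - ide X) \<and> Dnull Y Y (a * b - ide Y))"
proof -
  have key: "(\<exists>g\<in>arr TT Y X. cmp TT X Y X g A = idt TT X \<and> cmp TT Y X Y A g = idt TT Y) \<longleftrightarrow>
     (\<exists>b. rhom Y X b \<and> Dnull X X (b * a - ide X) \<and> Dnull Y Y (a * b - ide Y))" if "A = Sc X Y a" "rhom X Y a" for a
  proof -
    have e: "(cmp TT X Y X (Sc Y X b) A = idt TT X) = Dnull X X (b * a - ide X)"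
      "(cmp TT Y X Y A (Sc Y X b) = idt TT Y) = Dnull Y Y (a * b - ide Y)" if "rhom Y X b" for b
      using that \<open>A = _\<close> \<open>rhom X Y a\<close> D by (simp_all add: stab_cmp stab_idt Sc_eq_iff rhom_mult)
    then show ?thesis unfolding stab_arr[OF D(2,1)] by blast
  qed
  have "iso_arr TT X Y A \<longleftrightarrow> (\<exists>a. A = Sc X Y a \<and> rhom X Y a \<and>
    (\<exists>g\<in>arr TT Y X. cmp TT X Y X g A = idt TT X \<and> cmp TT Y X Y A g = idt TT Y))"
    unfolding iso_arr_def stab_arr[OF D] by blast
  also have "\<dots> \<longleftrightarrow> (\<exists>a b. A = Sc X Y a \<and> rhom X Y a \<and> rhom Y X b \<and> Dnull X X (b * a - ide X) \<and> Dnull Y Y (a * b - ide Y))"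
    using key by (metis (no_types, lifting))
  finally show ?thesis .
qed

lemma stab_iso_arr_eiso:
  assumes D: "X \<in> DD" "Y \<in> DD" and "iso_arr TT X Y A"
  obtains a where "A = Sc X Y a" "rhom X Y a" "eiso X Y a"
proof -
  obtain a b where ab: "A = Sc X Y a" "rhom X Y a" "rhom Y X b" "Dnull X X (b * a - ide X)" "Dnull Y Y (a * b - ide Y)"
    using assms by (auto simp: stab_iso_arr_iff)
  have "enull X X (ide X - b * a)" "enull Y Y (ide Y - a * b)"
    using Dnull_enull[OF D(1), OF Dnull_minus_sym[THEN iffD1, OF ab(4)]]
      Dnull_enull[OF D(2), OF Dnull_minus_sym[THEN iffD1, OF ab(5)]] .
  then have "eiso X Y a" using ab unfolding eiso_def einv_def by auto
  with ab that show ?thesis by blast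
qed

lemma stab_iso_ide: "X \<in> DD \<Longrightarrow> iso_arr TT X X (Sc X X (ide X))"
  by (auto simp: stab_iso_arr_iff intro!: exI[of _ "ide X"])

lemma stab_tri_std:
  assumes "std_triangle X u Y v Z w" shows "(X, Y, Z, Sc X Y u, Sc Y Z v, Sc Z (Sg X) w) \<in> tri TT"
proof -
  have D: "X \<in> DD" "Y \<in> DD" "Z \<in> DD" and r: "rhom X Y u" "rhom Y Z v" "rhom Z (Sg X) w"
    using assms by (auto simp: std_triangle_def dest: sesD(1,2))
  have "triangle_iso TT (X, Y, Z, Sc X Y u, Sc Y Z v, Sc Z (Sg X) w) (X, Y, Z, Sc X Y u, Sc Y Z v, Sc Z (Sg X) w)"
    unfolding triangle_iso.simps
    by (intro exI[of _ "Sc X X (ide X)"] exI[of _ "Sc Y Y (ide Y)"] exI[of _ "Sc Z Z (ide Z)"])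
      (use D r stab_iso_ide in \<open>simp add: stab_cmp stab_shm_ide linsD[OF rhom_lin]\<close>)
  moreover have "candidate_triangle TT (X, Y, Z, Sc X Y u, Sc Y Z v, Sc Z (Sg X) w)" using D r by auto
  ultimately show ?thesis unfolding stab_tri using assms by blast
qed

subsection \<open>Modules that are projective over the Taft algebra\<close>

abbreviation BB :: "bgen rep set" where "BB \<equiv> B_modules d \<zeta>"

lemma B_modules_rels:
  assumes "X \<in> BB"
  shows "wf_rep X" "act X BK ^ d = ide X" "act X BE ^ d = 0" "act X BK * act X BE = \<zeta> *\<^sub>s (act X BE * act X BK)"
proof -
  let ?n = "rdim X"
  have c: "ract X g \<in> carrier_mat ?n ?n" for g using assms by (simp add: B_modules_def Let_def)
  then show wf: "wf_rep X" by (simp add: wf_rep_def)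
  have m: "ract X BK ^\<^sub>m d = 1\<^sub>m ?n" "ract X BE ^\<^sub>m d = 0\<^sub>m ?n ?n" "ract X BK * ract X BE = \<zeta> \<cdot>\<^sub>m (ract X BE * ract X BK)"
    using assms by (simp_all add: B_modules_def Let_def)
  have p: "ide X * act X g ^ d = act X g ^ d" for g using lin_left[OF lin_power[OF lin_act[OF wf] d0(1)]] .
  show "act X BK ^ d = ide X" "act X BE ^ d = 0"
    using arg_cong[OF m(1), of op_mat] arg_cong[OF m(2), of op_mat] p by (simp_all add: op_mat_pow[OF c] act_def)
  show "act X BK * act X BE = \<zeta> *\<^sub>s (act X BE * act X BK)"
    using arg_cong[OF m(3), of op_mat] by (simp add: op_mat_mult[OF c c] op_mat_smult act_def)
qed

lemma restrict_B_BB: "M \<in> DD \<Longrightarrow> restrict_B M \<in> BB"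
  by (auto simp: B_modules_def D_modules_def restrict_B_def Let_def split: bgen.splits)

lemma restrict_B_act [simp]: "act (restrict_B M) BE = EE M" "act (restrict_B M) BK = KK M" "rdim (restrict_B M) = rdim M"
  by (simp_all add: act_def restrict_B_def)

lemma rhom_B_iff: "rhom X Y f \<longleftrightarrow> lin (rdim Y) (rdim X) f \<and> f * act X BE = act Y BE * f \<and> f * act X BK = act Y BK * f"
  by (auto simp: rhom_def) (metis bgen.exhaust)

text \<open>Moving E across K^a costs \<zeta>^(-a), and moving it across the remaining d - a factors
  costs the inverse power. Conjugation by K therefore preserves E-linearity, and so does averaging
  over K.\<close>

lemma scaled_conjugate:
  assumes "K * E = \<zeta> *\<^sub>s (E * K)" "K' * E' = \<zeta> *\<^sub>s (E' * K')" "E * h = h * E'" "a \<le> d"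
  shows "E * (K ^ a * h * K' ^ (d - a)) = K ^ a * h * K' ^ (d - a) * E'"
proof (rule scal_cancel)
  have "\<zeta> ^ a *\<^sub>s (E * (K ^ a * h * K' ^ (d - a))) = (\<zeta> ^ a *\<^sub>s (E * K ^ a)) * (h * K' ^ (d - a))"
    by (simp add: mult.assoc)
  also have "\<dots> = K ^ a * (E * h) * K' ^ (d - a)"
    using assoc_ext[OF qcomm_pow'[OF assms(1), of a], of "h * K' ^ (d - a)"] by (simp add: mult.assoc)
  also have "\<dots> = \<zeta> ^ a *\<^sub>s (\<zeta> ^ (d - a) *\<^sub>s (K ^ a * h * (E' * K' ^ (d - a))))"
    using assms(4) zeta_pow_d by (simp add: assms(3) mult.assoc flip: power_add)
  also have "\<zeta> ^ (d - a) *\<^sub>s (K ^ a * h * (E' * K' ^ (d - a))) = K ^ a * h * (K' ^ (d - a) * E')"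
    using qcomm_pow'[OF assms(2), of "d - a"] by simp
  finally show "\<zeta> ^ a *\<^sub>s (E * (K ^ a * h * K' ^ (d - a))) = \<zeta> ^ a *\<^sub>s (K ^ a * h * K' ^ (d - a) * E')"
    by (simp add: mult.assoc)
qed (simp add: zeta_nz)

text \<open>In one direction the surjection from \<open>Ind M\<close> onto M splits over B, and
  \<open>Ind M\<close> is E-free. In the other, a linear lift is made E-linear by the trace with s
  and then K-linear by averaging over K, whose order d is invertible.\<close>

lemma D_proj_B_iff: "M \<in> D_proj_B d \<zeta> \<longleftrightarrow> M \<in> DD \<and> ctr M"
proof (cases "M \<in> DD")
  case M: True
  note RM = restrict_B_BB[OF M]
  have "restrict_B M \<in> projectives BB \<longleftrightarrow> ctr M"
  proof
    assume P: "restrict_B M \<in> projectives BB"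
    obtain e where e: "rhom (Ind M) M e" "e * ind_in M = ide M" using Ind_cover[OF M] .
    note I = Ind_D[OF M] and RI = restrict_B_BB[OF Ind_D[OF M]]
    define e0 where "e0 = mat_op (rdim M) (rdim (Ind M)) e"
    have oe: "op_mat e0 = e" "e0 \<in> carrier_mat (rdim M) (rdim (Ind M))" using rhom_lin[OF e(1)] by (simp_all add: e0_def)
    have "rhom (restrict_B (Ind M)) (restrict_B M) e" using e(1) by (simp add: rhom_B_iff rhom_def)
    then have "e0 \<in> rep_homs (restrict_B (Ind M)) (restrict_B M)"
      using oe B_modules_rels(1)[OF RM] B_modules_rels(1)[OF RI] by (simp add: rep_homs_iff)
    then have epi: "rep_epi (restrict_B (Ind M)) (restrict_B M) e0"
      using oe e(2) lin_ind_in[OF M] B_modules_rels(1)[OF RM] B_modules_rels(1)[OF RI] by (auto simp: rep_epi_iff)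
    have "1\<^sub>m (rdim M) \<in> rep_homs (restrict_B M) (restrict_B M)"
      using rhom_ide[OF B_modules_rels(1)[OF RM]] B_modules_rels(1)[OF RM] by (simp add: rep_homs_iff)
    then obtain h where h: "h \<in> rep_homs (restrict_B M) (restrict_B (Ind M))" "e0 * h = 1\<^sub>m (rdim M)"
      using P epi RI RM unfolding projectives_def by blast
    have "rhom (restrict_B M) (restrict_B (Ind M)) (op_mat h)"
      using h(1) B_modules_rels(1)[OF RM] B_modules_rels(1)[OF RI] by (simp add: rep_homs_iff)
    then have "elin M (Ind M) (op_mat h)" by (simp add: rhom_B_iff elin_def)
    moreover have "e * op_mat h = ide M"
      using arg_cong[OF h(2), of op_mat] op_mat_mult[OF oe(2), of h "rdim M"] h(1) oe(1) by (simp add: rep_homs_def)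
    ultimately show "ctr M" using ctr_enull[OF ctr_Ind[OF M] rhom_elin[OF e(1)]] by (metis ctr_def)
  next
    assume "ctr M"
    then obtain s where s: "lin (rdim M) (rdim M) s" "ide M = trE (EE M) (EE M) d s" using trE_ctr by blast
    have "\<exists>h\<in>rep_homs (restrict_B M) X. p * h = f" if XY: "X \<in> BB" "Y \<in> BB" and p: "rep_epi X Y p"
      and f: "f \<in> rep_homs (restrict_B M) Y" for X Y p f
    proof -
      note RX = B_modules_rels[OF XY(1)] and RY = B_modules_rels[OF XY(2)] and R = B_modules_rels[OF RM, simplified]
      obtain r where r: "lin (rdim X) (rdim Y) r" "op_mat p * r = ide Y" and ph: "p \<in> rep_homs X Y"
        using p RX RY by (auto simp: rep_epi_iff)
      define p' f' where "p' = op_mat p" and "f' = op_mat f"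
      have p': "lin (rdim Y) (rdim X) p'" "p' * act X BE = act Y BE * p'" "p' * act X BK = act Y BK * p'"
        using ph RX RY by (auto simp: rep_homs_iff rhom_B_iff p'_def)
      have f': "lin (rdim Y) (rdim M) f'" "f' * EE M = act Y BE * f'" "f' * KK M = act Y BK * f'"
        using f R(1) RY by (auto simp: rep_homs_iff rhom_B_iff f'_def)
      have lX: "lin (rdim X) (rdim X) (act X g)" for g using RX(1) by simp
      define h1 where "h1 = trE (act X BE) (EE M) d (r * f' * s)"
      have lh1: "lin (rdim X) (rdim M) h1" unfolding h1_def using lX M r f' s by blast
      have "p' * (r * (f' * s)) = f' * s" using assoc_ext[OF r(2)[folded p'_def]] f'(1) by (simp add: linsD)
      moreover have "trE (act Y BE) (EE M) d (f' * s) = f' * ide M"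
        unfolding s(2) by (rule trE_left[OF f'(2), symmetric])
      ultimately have ph1: "p' * h1 = f'"
        unfolding h1_def trE_left[OF p'(2)] using f'(1) by (simp add: mult.assoc linsD)
      have Eh1: "act X BE * h1 = h1 * EE M"
      proof -
        have "trE (act X BE) (EE M) (Suc d) (r * f' * s) = h1 * EE M"
          unfolding h1_def by (subst trE_alt) (simp add: RX(3))
        then show ?thesis using EE_nilp[OF M] by (simp add: h1_def)
      qed
      define h where "h = (1 / of_nat d) *\<^sub>s avg (act X BK) (KK M) h1"
      have "lin (rdim X) (rdim M) h" unfolding h_def using lX M lh1 by (auto intro: lin_avg)
      moreover have "act X BK * h = h * KK M"
        unfolding h_def using avg_commute[of "act X BK" h1 "KK M"] RX(2) R(2) lh1 by (simp add: linsD)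
      moreover have "act X BE * h = h * EE M"
        unfolding h_def avg_def using scaled_conjugate[OF RX(4) R(4) Eh1]
        by (simp add: sum_distrib_left sum_distrib_right scal_sum_right)
      moreover have "p' * h = f'"
      proof -
        have "p' * h = (1 / of_nat d) *\<^sub>s avg (act Y BK) (KK M) f'" unfolding h_def using avg_left[OF p'(3)] ph1 by simp
        also have "avg (act Y BK) (KK M) f' = of_nat d *\<^sub>s f'" using f' R(2) by (intro avg_fix) (auto simp: linsD)
        finally show ?thesis using d2 by simp
      qed
      ultimately have h: "rhom (restrict_B M) X h" "p' * h = f'" by (simp_all add: rhom_B_iff)
      define h0 where "h0 = mat_op (rdim X) (rdim M) h"
      have h0: "op_mat h0 = h" "h0 \<in> rep_homs (restrict_B M) X"
        using h rhom_lin[OF h(1)] R(1) RX(1) by (simp_all add: h0_def rep_homs_iff)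
      then have "op_mat (p * h0) = op_mat f" using op_mat_hom_mult[OF ph h0(2)] h(2) by (simp add: p'_def f'_def)
      moreover have "p * h0 \<in> carrier_mat (rdim Y) (rdim M)" "f \<in> carrier_mat (rdim Y) (rdim M)"
        using ph h0(2) f by (auto simp: rep_homs_def)
      ultimately show ?thesis using h0(2) op_mat_inj by blast
    qed
    with RM show "restrict_B M \<in> projectives BB" by (auto simp: projectives_def)
  qed
  with M show ?thesis by (simp add: D_proj_B_def)
qed (simp add: D_proj_B_def)

subsection \<open>Arrows with a cone that is projective over the Taft algebra\<close>

lemma ctr_eiso:
  assumes "ctr M" "N \<in> DD" "eiso M N f" shows "ctr N"
proof -
  obtain g where g: "elin M N f" "elin N M g" "enull N N (ide N - f * g)" using assms(3) by (auto simp: eiso_def einv_def)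
  have "ide N = (ide N - f * g) + f * g" by simp
  then show ?thesis unfolding ctr_def using enull_add[OF g(3) ctr_enull[OF assms(1) g(1,2)]] by simp
qed

abbreviation qis :: "dgen rep \<Rightarrow> dgen rep \<Rightarrow> complex mat set \<Rightarrow> bool" where
  "qis \<equiv> cone_in TT (D_proj_B d \<zeta>)"

text \<open>Removes triangles from the description of the inverted arrows. A triangle is replaced by
  an isomorphic standard one, whose third term is a pushout, and there freeness of the cone is
  equivalent to stable E-invertibility.\<close>

lemma qis_iff:
  assumes D: "X \<in> DD" "Y \<in> DD"
  shows "qis X Y s \<longleftrightarrow> (\<exists>f. s = Sc X Y f \<and> rhom X Y f \<and> eiso X Y f)"
proof
  assume "qis X Y s"
  then obtain C V W where C: "C \<in> DD" "ctr C" and t: "(X, Y, C, s, V, W) \<in> tri TT"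
    by (auto simp: cone_in_def D_proj_B_iff)
  then obtain X' Y' Z' u v w where st: "std_triangle X' u Y' v Z' w"
    and iso: "triangle_iso TT (X, Y, C, s, V, W) (X', Y', Z', Sc X' Y' u, Sc Y' Z' v, Sc Z' (Sg X') w)"
    and cand: "candidate_triangle TT (X, Y, C, s, V, W)" unfolding stab_tri by blast
  obtain l r j where D': "X' \<in> DD" "Y' \<in> DD" "Z' \<in> DD" and u: "rhom X' Y' u" and ses: "ses Y' v Z' w (Sg X') l r"
    and j: "rhom (IO X') Z' j" "j * im X' = v * u" "w * j = pm X'" using st by (auto simp: std_triangle_def)
  obtain a b c where a: "rhom X X' a" "eiso X X' a" and b: "rhom Y Y' b" "eiso Y Y' b" and c: "rhom C Z' c" "eiso C Z' c"
    and e: "cmp TT X Y Y' (Sc Y Y' b) s = cmp TT X X' Y' (Sc X' Y' u) (Sc X X' a)"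
  proof -
    obtain A B G where i: "iso_arr TT X X' A" "iso_arr TT Y Y' B" "iso_arr TT C Z' G"
      and e: "cmp TT X Y Y' B s = cmp TT X X' Y' (Sc X' Y' u) A" using iso unfolding triangle_iso.simps by blast
    obtain a where a: "A = Sc X X' a" "rhom X X' a" "eiso X X' a" using stab_iso_arr_eiso[OF D(1) D'(1) i(1)] .
    obtain b where b: "B = Sc Y Y' b" "rhom Y Y' b" "eiso Y Y' b" using stab_iso_arr_eiso[OF D(2) D'(2) i(2)] .
    obtain c where "rhom C Z' c" "eiso C Z' c" using stab_iso_arr_eiso[OF C(1) D'(3) i(3)] .
    with a b e that show ?thesis by simp
  qed
  obtain f where f: "s = Sc X Y f" "rhom X Y f" using cand D by (auto simp: stab_arr)
  obtain l1 r1 where ses1: "ses X' (im X') (IO X') (pm X') (Sg X') l1 r1" using chosen_embedding[OF D'(1)] by blast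
  have "ctr Z'" by (rule ctr_eiso[OF C(2) D'(3) c(2)])
  then have "eiso X' Y' u"
    using eiso_of_ctr_cone[OF D'(1,2) IO_D[OF D'(1)] Sg_D[OF D'(1)] D'(3) ses1 ses rhom_elin[OF u] rhom_elin[OF j(1)] j(2,3) IO_ctr[OF D'(1)]]
    by blast
  then have ua: "eiso X Y' (u * a)" using a by (blast intro: eiso_mult)
  have "Dnull X Y' (u * a - b * f)" using e f a b u D D' by (simp add: stab_cmp Sc_eq_iff rhom_mult Dnull_minus_sym)
  then have "eiso X Y' (b * f)" using eiso_perturb[OF ua _ Dnull_enull[OF D(1)]] b f by blast
  then have "eiso X Y f" using eiso_cancel_left[OF b(2)] f by blast
  with f show "\<exists>f. s = Sc X Y f \<and> rhom X Y f \<and> eiso X Y f" by blast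
next
  assume "\<exists>f. s = Sc X Y f \<and> rhom X Y f \<and> eiso X Y f"
  then obtain f where f: "s = Sc X Y f" "rhom X Y f" "eiso X Y f" by blast
  obtain l1 r1 where ses1: "ses X (im X) (IO X) (pm X) (Sg X) l1 r1" using chosen_embedding[OF D(1)] by blast
  obtain Z v w j l2 r2 where Z: "Z \<in> DD" "ses Y v Z w (Sg X) l2 r2" "rhom (IO X) Z j" "j * im X = v * f" "w * j = pm X"
    using pushout_exists[OF D IO_D[OF D(1)] Sg_D[OF D(1)] ses1 f(2)] .
  have "ctr Z"
    using ctr_cone_of_eiso[OF D IO_D[OF D(1)] Sg_D[OF D(1)] Z(1) ses1 Z(2) rhom_elin[OF f(2)] rhom_elin[OF Z(3)] Z(4,5) IO_ctr[OF D(1)] f(3)] .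
  moreover have "std_triangle X f Y v Z w" unfolding std_triangle_def using D Z f by blast
  ultimately show "qis X Y s" unfolding cone_in_def using stab_tri_std[of X f Y v Z w] Z(1) f D by (auto simp: D_proj_B_iff)
qed

text \<open>A pullback needs a surjection, so a projective module P covering Y is added to V. The
  kernel of the resulting q is E-free and is also the kernel of its pullback \<open>t'\<close>,
  which is therefore inverted; the square commutes up to a map through P, that is, in the stable
  category.\<close>

lemma qis_ore:
  assumes D: "V \<in> DD" "Y \<in> DD" "W \<in> DD" and t: "qis V Y t" and f: "f \<in> arr TT W Y"
  shows "\<exists>U\<in>DD. \<exists>t' f'. qis U W t' \<and> f' \<in> arr TT U V \<and> cmp TT U W Y f t' = cmp TT U V Y t f'"
proof -
  obtain t0 where t0: "t = Sc V Y t0" "rhom V Y t0" "eiso V Y t0" using t D by (auto simp: qis_iff)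
  obtain f0 where f0: "f = Sc W Y f0" "rhom W Y f0" using f D by (auto simp: stab_arr)
  define P where "P = Ind Y"
  have P: "P \<in> DD" "P \<in> injectives DD" using Ind_D[OF D(2)] Ind_injective[OF D(2)] by (simp_all add: P_def)
  obtain e where e: "rhom P Y e" "e * ind_in Y = ide Y" using Ind_cover[OF D(2)] unfolding P_def .
  obtain S i1 p1 i2 p2 where S: "S \<in> DD" "rhom V S i1" "rhom S V p1" "rhom P S i2" "rhom S P p2"
      "p1 * i1 = ide V" "p2 * i2 = ide P" "p1 * i2 = 0" "p2 * i1 = 0" "i1 * p1 + i2 * p2 = ide S"
    using direct_sum_exists[OF D(1) P(1)] .
  define q where "q = t0 * p1 + e * p2"
  have q: "rhom S Y q" unfolding q_def using t0 e S by blast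
  have ep2: "enull S Y (e * p2)" by (rule ctr_enull[OF ctr_injective[OF P(2)] rhom_elin[OF e(1)] rhom_elin[OF S(5)]])
  have p1: "eiso S V p1"
  proof -
    have "enull S S (i2 * p2)" by (rule ctr_enull[OF ctr_injective[OF P(2)] rhom_elin[OF S(4)] rhom_elin[OF S(5)]])
    moreover have "ide S - i1 * p1 = i2 * p2" using S(10) by (simp add: algebra_simps)
    ultimately have "einv S V p1 i1" unfolding einv_def using S by auto
    then show ?thesis by (auto simp: eiso_def)
  qed
  have "eiso S Y q"
    by (rule eiso_perturb[OF eiso_mult[OF t0(3) p1] rhom_elin[OF q]]) (use ep2 in \<open>simp add: q_def enull_uminus\<close>)
  have lin_r: "lin (rdim S) (rdim Y) (i2 * ind_in Y)" using rhom_lin[OF S(4)] lin_ind_in[OF D(2)] unfolding P_def by blast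
  have "q * (i2 * ind_in Y) = ide Y"
    unfolding q_def using e S(7,8) rhom_lin[OF e(1)] lin_ind_in[OF D(2), folded P_def]
    by (simp add: distrib_right mult.assoc assoc_ext[OF S(7)] assoc_ext[OF S(8)] linsD)
  then obtain K i l r where K: "K \<in> DD" "ses K i S q Y l r" using kernel_exists[OF S(1) D(2) q lin_r] by blast
  have "ctr K" by (rule ctr_kernel_of_eiso[OF K(1) S(1) D(2) K(2) \<open>eiso S Y q\<close>])
  obtain U t' h i2' l2 r2 where U: "U \<in> DD" "ses K i2' U t' W l2 r2" "rhom U S h" "f0 * t' = q * h"
    using pullback_exists[OF K(1) S(1) D(2,3) K(2) f0(2)] .
  have t': "rhom U W t'" "eiso U W t'" using sesD(2)[OF U(2)] eiso_of_ctr_kernel[OF K(1) U(1) D(3) U(2) \<open>ctr K\<close>] by auto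
  have ph: "rhom U V (p1 * h)" using S U by blast
  have "f0 * t' - t0 * (p1 * h) = e * (p2 * h)" by (simp add: U(4) q_def distrib_right mult.assoc)
  then have "Dnull U Y (f0 * t' - t0 * (p1 * h))" using Dnull_factor[OF U(1) P(2) rhom_mult[OF S(5) U(3)] e(1)] by simp
  then have "cmp TT U W Y f (Sc U W t') = cmp TT U V Y t (Sc U V (p1 * h))"
    using t0 f0 t' ph D U(1) by (simp add: stab_cmp Sc_eq_iff rhom_mult)
  moreover have "qis U W (Sc U W t')" using t' U D by (auto simp: qis_iff)
  ultimately show ?thesis using U(1) ph D by blast
qed

end

section \<open>Right fractions\<close>

text \<open>The interface between the module theory and the calculus of roofs: \<open>ore\<close>
  completes a cospan, and \<open>q_cancel\<close> is the instance of two-out-of-three that makes the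
  legs of a common refinement inverted.\<close>

locale right_fractions =
  fixes T :: "('o, 'm) tri_cat" and N :: "'o set"
  assumes cmp_arr: "X \<in> ob T \<Longrightarrow> Y \<in> ob T \<Longrightarrow> Z \<in> ob T \<Longrightarrow> f \<in> arr T X Y \<Longrightarrow> g \<in> arr T Y Z \<Longrightarrow> cmp T X Y Z g f \<in> arr T X Z"
    and assoc: "W \<in> ob T \<Longrightarrow> X \<in> ob T \<Longrightarrow> Y \<in> ob T \<Longrightarrow> Z \<in> ob T \<Longrightarrow> f \<in> arr T W X \<Longrightarrow> g \<in> arr T X Y \<Longrightarrow> h \<in> arr T Y Z \<Longrightarrow>
      cmp T W X Z (cmp T X Y Z h g) f = cmp T W Y Z h (cmp T W X Y g f)"
    and id_arr: "X \<in> ob T \<Longrightarrow> idt T X \<in> arr T X X"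
    and id_left: "X \<in> ob T \<Longrightarrow> Y \<in> ob T \<Longrightarrow> f \<in> arr T X Y \<Longrightarrow> cmp T X Y Y (idt T Y) f = f"
    and id_right: "X \<in> ob T \<Longrightarrow> Y \<in> ob T \<Longrightarrow> f \<in> arr T X Y \<Longrightarrow> cmp T X X Y f (idt T X) = f"
    and q_id: "X \<in> ob T \<Longrightarrow> cone_in T N X X (idt T X)"
    and q_cmp: "X \<in> ob T \<Longrightarrow> Y \<in> ob T \<Longrightarrow> Z \<in> ob T \<Longrightarrow> cone_in T N X Y f \<Longrightarrow> cone_in T N Y Z g \<Longrightarrow> cone_in T N X Z (cmp T X Y Z g f)"
    and q_cancel: "X \<in> ob T \<Longrightarrow> Y \<in> ob T \<Longrightarrow> Z \<in> ob T \<Longrightarrow> f \<in> arr T X Y \<Longrightarrow> cone_in T N Y Z g \<Longrightarrow>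
      cone_in T N X Z (cmp T X Y Z g f) \<Longrightarrow> cone_in T N X Y f"
    and ore: "V \<in> ob T \<Longrightarrow> Y \<in> ob T \<Longrightarrow> W \<in> ob T \<Longrightarrow> cone_in T N V Y t \<Longrightarrow> f \<in> arr T W Y \<Longrightarrow>
      \<exists>U\<in>ob T. \<exists>t' f'. cone_in T N U W t' \<and> f' \<in> arr T U V \<and> cmp T U W Y f t' = cmp T U V Y t f'"
    and sh_ob: "X \<in> ob T \<Longrightarrow> sh T X \<in> ob T"
    and shm_arr: "X \<in> ob T \<Longrightarrow> Y \<in> ob T \<Longrightarrow> f \<in> arr T X Y \<Longrightarrow> shm T X Y f \<in> arr T (sh T X) (sh T Y)"
    and shm_id: "X \<in> ob T \<Longrightarrow> shm T X X (idt T X) = idt T (sh T X)"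
    and shm_cmp: "X \<in> ob T \<Longrightarrow> Y \<in> ob T \<Longrightarrow> Z \<in> ob T \<Longrightarrow> f \<in> arr T X Y \<Longrightarrow> g \<in> arr T Y Z \<Longrightarrow>
      shm T X Z (cmp T X Y Z g f) = cmp T (sh T X) (sh T Y) (sh T Z) (shm T Y Z g) (shm T X Y f)"
    and shm_q: "X \<in> ob T \<Longrightarrow> Y \<in> ob T \<Longrightarrow> cone_in T N X Y f \<Longrightarrow> cone_in T N (sh T X) (sh T Y) (shm T X Y f)"
begin

abbreviation "Q \<equiv> cone_in T N"
abbreviation "c \<equiv> cmp T"
abbreviation "loc \<equiv> loc_arr T N"
abbreviation "VQ \<equiv> verdier_shift_cat T N"

lemma q_arr: "Q X Y s \<Longrightarrow> s \<in> arr T X Y" by (simp add: cone_in_def)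

lemma roof_equiv_refl:
  assumes "X \<in> ob T" "Y \<in> ob T" "is_roof T N X Y r" shows "roof_equiv T N X Y r r"
proof (cases r)
  case (fields W s f)
  then show ?thesis using assms by (auto intro!: bexI[of _ W] bexI[of _ "idt T W"] simp: id_right q_arr id_arr)
qed

lemma roof_equiv_sym: "roof_equiv T N X Y r r' \<Longrightarrow> roof_equiv T N X Y r' r"
  by (cases r; cases r') force

text \<open>Both refinements map to the middle apex, one of them by an inverted arrow thanks to
  \<open>q_cancel\<close>. An Ore square over the middle apex then joins them.\<close>

lemma roof_equiv_trans:
  assumes XY: "X \<in> ob T" "Y \<in> ob T" and "is_roof T N X Y r" "is_roof T N X Y r'" "is_roof T N X Y r''"
    and "roof_equiv T N X Y r r'" "roof_equiv T N X Y r' r''"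
  shows "roof_equiv T N X Y r r''"
proof -
  obtain W s f where r: "r = (W, s, f)" by (cases r)
  obtain W' s' f' where r': "r' = (W', s', f')" by (cases r')
  obtain W'' s'' f'' where r'': "r'' = (W'', s'', f'')" by (cases r'')
  have m: "W \<in> ob T" "W' \<in> ob T" "W'' \<in> ob T" "s \<in> arr T W X" "s' \<in> arr T W' X" "s'' \<in> arr T W'' X"
    "f \<in> arr T W Y" "f' \<in> arr T W' Y" "f'' \<in> arr T W'' Y" "Q W' X s'"
    using assms(3-5) by (auto simp: r r' r'' q_arr)
  obtain V u u' where V: "V \<in> ob T" "u \<in> arr T V W" "u' \<in> arr T V W'" "Q V X (c V W X s u)"
    "c V W X s u = c V W' X s' u'" "c V W Y f u = c V W' Y f' u'" using assms(6) by (auto simp: r r')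
  obtain V2 v v' where V2: "V2 \<in> ob T" "v \<in> arr T V2 W'" "v' \<in> arr T V2 W''" "Q V2 X (c V2 W' X s' v)"
    "c V2 W' X s' v = c V2 W'' X s'' v'" "c V2 W' Y f' v = c V2 W'' Y f'' v'" using assms(7) by (auto simp: r' r'')
  have qu: "Q V W' u'" using q_cancel[OF V(1) m(2) XY(1) V(3) m(10)] V(4,5) by simp
  obtain P p p' where P: "P \<in> ob T" "Q P V2 p" "p' \<in> arr T P V" "c P V2 W' v p = c P V W' u' p'"
    using ore[OF V(1) m(2) V2(1) qu V2(2)] by blast
  note M = XY m V(1-3) V2(1-3) P(1,3) q_arr[OF P(2)]
  have 1: "c P W X s (c P V W u p') = c P V2 X (c V2 W' X s' v) p"
  proof -
    have "c P W X s (c P V W u p') = c P V X (c V W X s u) p'" by (simp add: assoc M)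
    also have "\<dots> = c P V2 X (c V2 W' X s' v) p" unfolding V(5) by (simp add: assoc M P(4))
    finally show ?thesis .
  qed
  have 2: "c P W Y f (c P V W u p') = c P W'' Y f'' (c P V2 W'' v' p)"
  proof -
    have "c P W Y f (c P V W u p') = c P V Y (c V W Y f u) p'" by (simp add: assoc M)
    also have "\<dots> = c P V2 Y (c V2 W' Y f' v) p" unfolding V(6) by (simp add: assoc M P(4))
    also have "\<dots> = c P W'' Y f'' (c P V2 W'' v' p)" unfolding V2(6) by (simp add: assoc M)
    finally show ?thesis .
  qed
  have 3: "c P V2 X (c V2 W' X s' v) p = c P W'' X s'' (c P V2 W'' v' p)" unfolding V2(5) by (simp add: assoc M)
  have 4: "Q P X (c P V2 X (c V2 W' X s' v) p)" by (rule q_cmp[OF P(1) V2(1) XY(1) P(2) V2(4)])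
  have mm: "c P V W u p' \<in> arr T P W" "c P V2 W'' v' p \<in> arr T P W''" by (simp_all add: M cmp_arr[of P V W] cmp_arr[of P V2 W''])
  show ?thesis unfolding r r'' roof_equiv.simps
    by (rule bexI[OF _ P(1)], rule bexI[OF _ mm(1)], rule bexI[OF _ mm(2)]) (use 1 2 3 4 in simp)
qed

lemma roof_class_eq:
  assumes "X \<in> ob T" "Y \<in> ob T" "is_roof T N X Y r" "is_roof T N X Y r'" "roof_equiv T N X Y r r'"
  shows "roof_class T N X Y r = roof_class T N X Y r'"
  using roof_equiv_trans[OF assms(1,2)] roof_equiv_sym assms(3-5) unfolding roof_class_def by blast

lemma loc_roof: "X \<in> ob T \<Longrightarrow> f \<in> arr T X Y \<Longrightarrow> is_roof T N X Y (X, idt T X, f)"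
  by (simp add: q_id)

lemma loc_mem: "X \<in> ob T \<Longrightarrow> Y \<in> ob T \<Longrightarrow> f \<in> arr T X Y \<Longrightarrow> (X, idt T X, f) \<in> loc X Y f"
  unfolding loc_arr_def roof_class_def using roof_equiv_refl[OF _ _ loc_roof] by (simp add: q_id)

lemma loc_memE:
  assumes X: "X \<in> ob T" "Y \<in> ob T" and f: "f \<in> arr T X Y" and r: "(W, s, f0) \<in> loc X Y f"
  obtains V u where "V \<in> ob T" "Q V W u" "c V X Y f (c V W X s u) = c V W Y f0 u" "W \<in> ob T" "Q W X s" "f0 \<in> arr T W Y"
proof -
  have m: "W \<in> ob T" "Q W X s" "f0 \<in> arr T W Y" using r by (auto simp: loc_arr_def roof_class_def)
  obtain V u1 u where V: "V \<in> ob T" "u1 \<in> arr T V X" "u \<in> arr T V W" "Q V X (c V X X (idt T X) u1)"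
    "c V X X (idt T X) u1 = c V W X s u" "c V X Y f u1 = c V W Y f0 u"
    using r by (auto simp: loc_arr_def roof_class_def)
  have "u1 = c V W X s u" using V X by (simp add: id_left)
  moreover from this have "Q V W u" using q_cancel[OF V(1) m(1) X(1) V(3) m(2)] V(4,5) by simp
  ultimately show ?thesis using that V m by blast
qed

text \<open>Composition of roofs collects all completions at once, so each completion has to be
  compared with the plain composite. Two successive Ore squares lead to an object B on which both
  roofs are given by the arrows f and g themselves.\<close>

lemma loc_cmp:
  assumes X: "X \<in> ob T" "Y \<in> ob T" "Z \<in> ob T" and f: "f \<in> arr T X Y" and g: "g \<in> arr T Y Z"
  shows "roof_comp T N X Y Z (loc Y Z g) (loc X Y f) = loc X Z (c X Y Z g f)"
proof -
  have gf: "c X Y Z g f \<in> arr T X Z" using X f g by (simp add: cmp_arr)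
  have A: "is_roof T N X Z (U, c U W X s t', c U V Z g0 f') \<and>
      roof_equiv T N X Z (U, c U W X s t', c U V Z g0 f') (X, idt T X, c X Y Z g f)"
    if h: "(W, s, f0) \<in> loc X Y f" "(V, t, g0) \<in> loc Y Z g" "U \<in> ob T" "Q U W t'" "f' \<in> arr T U V"
      "c U W Y f0 t' = c U V Y t f'" for W s f0 V t g0 U t' f'
  proof -
    obtain V1 u where V1: "V1 \<in> ob T" "Q V1 W u" "c V1 X Y f (c V1 W X s u) = c V1 W Y f0 u" "W \<in> ob T" "Q W X s" "f0 \<in> arr T W Y"
      using loc_memE[OF X(1,2) f h(1)] .
    obtain V2 w where V2: "V2 \<in> ob T" "Q V2 V w" "c V2 Y Z g (c V2 V Y t w) = c V2 V Z g0 w" "V \<in> ob T" "Q V Y t" "g0 \<in> arr T V Z"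
      using loc_memE[OF X(2,3) g h(2)] .
    obtain A a a' where A: "A \<in> ob T" "Q A U a" "a' \<in> arr T A V1" "c A U W t' a = c A V1 W u a'"
      using ore[OF V1(1) V1(4) h(3) V1(2) q_arr[OF h(4)]] by blast
    have fa: "c A U V f' a \<in> arr T A V" using A V2 h q_arr by (simp add: cmp_arr[of A U V])
    obtain B b b' where B: "B \<in> ob T" "Q B A b" "b' \<in> arr T B V2" "c B A V (c A U V f' a) b = c B V2 V w b'"
      using ore[OF V2(1) V2(4) A(1) V2(2) fa] by blast
    note M = X f g V1(1,4,6) q_arr[OF V1(2)] q_arr[OF V1(5)] V2(1,4,6) q_arr[OF V2(2)] q_arr[OF V2(5)] A(1,3) q_arr[OF A(2)]
      B(1,3) q_arr[OF B(2)] h(3,5) q_arr[OF h(4)]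
    have ab: "c B A U a b \<in> arr T B U" by (rule cmp_arr) (simp_all add: M)
    have ab': "c B A V1 a' b \<in> arr T B V1" by (rule cmp_arr) (simp_all add: M)
    have st: "c U W X s t' \<in> arr T U X" by (rule cmp_arr) (simp_all add: M)
    have tab: "c B U W t' (c B A U a b) = c B V1 W u (c B A V1 a' b)"
    proof -
      have "c B U W t' (c B A U a b) = c B A W (c A U W t' a) b" by (simp add: assoc M)
      also have "\<dots> = c B V1 W u (c B A V1 a' b)" unfolding A(4) by (simp add: assoc M)
      finally show ?thesis .
    qed
    have fab: "c B U V f' (c B A U a b) = c B V2 V w b'" using B(4) by (simp add: assoc M)
    have u': "c B U X (c U W X s t') (c B A U a b) \<in> arr T B X" by (rule cmp_arr) (simp_all add: M ab st)
    have qst: "Q U X (c U W X s t')" using q_cmp[OF h(3) V1(4) X(1) h(4) V1(5)] .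
    have q: "Q B X (c B U X (c U W X s t') (c B A U a b))"
      using q_cmp[OF B(1) h(3) X(1) q_cmp[OF B(1) A(1) h(3) B(2) A(2)] qst] .
    have "c B U Z (c U V Z g0 f') (c B A U a b) = c B V2 Z (c V2 V Z g0 w) b'" by (simp add: assoc M ab fab)
    also have "\<dots> = c B Y Z g (c B V Y t (c B V2 V w b'))" unfolding V2(3)[symmetric]
      by (simp add: assoc M cmp_arr[of V2 V Y])
    also have "c B V Y t (c B V2 V w b') = c B U Y (c U V Y t f') (c B A U a b)" by (simp add: assoc M ab fab)
    also have "\<dots> = c B V1 Y (c V1 W Y f0 u) (c B A V1 a' b)" unfolding h(6)[symmetric] by (simp add: assoc M ab ab' tab)
    also have "\<dots> = c B X Y f (c B W X s (c B V1 W u (c B A V1 a' b)))" unfolding V1(3)[symmetric]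
      by (simp add: assoc M ab' cmp_arr[of V1 W X])
    also have "c B W X s (c B V1 W u (c B A V1 a' b)) = c B U X (c U W X s t') (c B A U a b)"
      by (simp add: assoc M ab tab)
    also have "c B Y Z g (c B X Y f (c B U X (c U W X s t') (c B A U a b))) =
        c B X Z (c X Y Z g f) (c B U X (c U W X s t') (c B A U a b))" by (rule assoc[symmetric]) (simp_all add: M u')
    finally have eq: "c B U Z (c U V Z g0 f') (c B A U a b) = c B X Z (c X Y Z g f) (c B U X (c U W X s t') (c B A U a b))" .
    have "roof_equiv T N X Z (U, c U W X s t', c U V Z g0 f') (X, idt T X, c X Y Z g f)"
      unfolding roof_equiv.simps
      by (rule bexI[OF _ B(1)], rule bexI[OF _ ab], rule bexI[OF _ u']) (use q eq u' B X in \<open>simp add: id_left\<close>)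
    moreover have "c U V Z g0 f' \<in> arr T U Z" by (rule cmp_arr) (simp_all add: M)
    ultimately show ?thesis using qst h(3) by simp
  qed
  have B: "(X, idt T X, f) \<in> loc X Y f" "(Y, idt T Y, g) \<in> loc Y Z g" "Q X X (idt T X)" "c X X Y f (idt T X) = c X Y Y (idt T Y) f"
    "c X X X (idt T X) (idt T X) = idt T X"
    using X f g loc_mem q_id by (simp_all add: id_left id_right id_arr)
  show ?thesis
  proof (intro equalityI subsetI)
    fix r assume "r \<in> roof_comp T N X Y Z (loc Y Z g) (loc X Y f)"
    then obtain W s f0 V t g0 U t' f' where r: "is_roof T N X Z r" and
      h: "(W, s, f0) \<in> loc X Y f" "(V, t, g0) \<in> loc Y Z g" "U \<in> ob T" "Q U W t'" "f' \<in> arr T U V" "c U W Y f0 t' = c U V Y t f'"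
      and e: "roof_equiv T N X Z (U, c U W X s t', c U V Z g0 f') r" unfolding roof_comp_def by blast
    from A[OF h] have "roof_equiv T N X Z (X, idt T X, c X Y Z g f) r"
      using roof_equiv_trans[OF X(1,3) loc_roof[OF X(1) gf] _ r roof_equiv_sym e] by blast
    with r show "r \<in> loc X Z (c X Y Z g f)" by (simp add: loc_arr_def roof_class_def)
  next
    fix r assume "r \<in> loc X Z (c X Y Z g f)"
    then have "is_roof T N X Z r" "roof_equiv T N X Z (X, c X X X (idt T X) (idt T X), c X Y Z g f) r"
      by (simp_all add: loc_arr_def roof_class_def B(5))
    then show "r \<in> roof_comp T N X Y Z (loc Y Z g) (loc X Y f)" unfolding roof_comp_def using B(1-4) X(1) f by blast
  qed
qed

lemma verdier_sel [simp]: "ob VQ = ob T" "sh VQ = sh T" "cmp VQ = roof_comp T N" "idt VQ X = loc X X (idt T X)"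
  "arr VQ X Y = roof_class T N X Y ` Collect (is_roof T N X Y)"
  by (simp_all add: verdier_shift_cat_def)

lemma loc_arr: "X \<in> ob T \<Longrightarrow> f \<in> arr T X Y \<Longrightarrow> loc X Y f \<in> arr VQ X Y"
  using loc_roof by (auto simp: loc_arr_def)

text \<open>The triangle isomorphisms constructed below are the identity on the first vertex, and
  its shift enters their last square.\<close>

lemma loc_shm_id:
  assumes X: "X \<in> ob T" shows "shm VQ X X (loc X X (idt T X)) = loc (sh T X) (sh T X) (idt T (sh T X))"
proof -
  let ?S = "sh T X"
  have S: "?S \<in> ob T" using sh_ob X .
  have A: "is_roof T N ?S ?S (sh T W, shm T W X s, shm T W X f) \<and>
     roof_equiv T N ?S ?S (sh T W, shm T W X s, shm T W X f) (?S, idt T ?S, idt T ?S)"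
    if h: "(W, s, f) \<in> loc X X (idt T X)" for W s f
  proof -
    obtain V u where V: "V \<in> ob T" "Q V W u" "c V X X (idt T X) (c V W X s u) = c V W X f u" "W \<in> ob T" "Q W X s" "f \<in> arr T W X"
      using loc_memE[OF X X id_arr[OF X] h] .
    have su: "Q V X (c V W X s u)" using q_cmp[OF V(1,4) X V(2,5)] .
    have "c V W X s u = c V W X f u" using V(3) id_left[OF V(1) X q_arr[OF su]] by simp
    then have e: "c (sh T V) (sh T W) ?S (shm T W X s) (shm T V W u) = c (sh T V) (sh T W) ?S (shm T W X f) (shm T V W u)"
      using shm_cmp[OF V(1,4) X q_arr[OF V(2)]] V(6) q_arr[OF V(5)] by metis
    have q: "Q (sh T V) ?S (c (sh T V) (sh T W) ?S (shm T W X s) (shm T V W u))"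
      by (rule q_cmp) (use V X S in \<open>auto simp: sh_ob shm_q\<close>)
    have su: "shm T V W u \<in> arr T (sh T V) (sh T W)" using V q_arr by (simp add: shm_arr)
    have "roof_equiv T N ?S ?S (sh T W, shm T W X s, shm T W X f) (?S, idt T ?S, idt T ?S)"
      unfolding roof_equiv.simps
      by (rule bexI[OF _ sh_ob[OF V(1)]], rule bexI[OF _ su], rule bexI[OF _ q_arr[OF q]])
        (use q e S V q_arr[OF q] in \<open>simp add: id_left sh_ob\<close>)
    moreover have "is_roof T N ?S ?S (sh T W, shm T W X s, shm T W X f)" using V X by (simp add: sh_ob shm_q shm_arr)
    ultimately show ?thesis by blast
  qed
  have I: "is_roof T N ?S ?S (?S, idt T ?S, idt T ?S)" using S by (simp add: q_id id_arr)
  have "shm VQ X X (loc X X (idt T X)) = {r. is_roof T N ?S ?S r \<and> (\<exists>W s f. (W, s, f) \<in> loc X X (idt T X) \<and>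
     roof_equiv T N ?S ?S (sh T W, shm T W X s, shm T W X f) r)}" by (simp add: verdier_shift_cat_def)
  also have "\<dots> = {r. is_roof T N ?S ?S r \<and> roof_equiv T N ?S ?S (?S, idt T ?S, idt T ?S) r}"
  proof (intro Collect_cong conj_cong refl iffI)
    fix r assume r: "is_roof T N ?S ?S r" and "\<exists>W s f. (W, s, f) \<in> loc X X (idt T X) \<and> roof_equiv T N ?S ?S (sh T W, shm T W X s, shm T W X f) r"
    then obtain W s f where h: "(W, s, f) \<in> loc X X (idt T X)" "roof_equiv T N ?S ?S (sh T W, shm T W X s, shm T W X f) r" by blast
    then show "roof_equiv T N ?S ?S (?S, idt T ?S, idt T ?S) r"
      using roof_equiv_trans[OF S S I _ r roof_equiv_sym h(2)] A[OF h(1)] by blast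
  next
    fix r assume "is_roof T N ?S ?S r" "roof_equiv T N ?S ?S (?S, idt T ?S, idt T ?S) r"
    then show "\<exists>W s f. (W, s, f) \<in> loc X X (idt T X) \<and> roof_equiv T N ?S ?S (sh T W, shm T W X s, shm T W X f) r"
      using loc_mem[OF X X id_arr[OF X]] shm_id[OF X] by (intro exI[of _ X] exI[of _ "idt T X"]) simp
  qed
  finally show ?thesis by (simp add: loc_arr_def roof_class_def)
qed

lemma verdier_tri_iff:
  "t \<in> tri (verdier_quotient T N) \<longleftrightarrow> candidate_triangle VQ t \<and> (\<exists>t'\<in>{(X, Y, Z, loc X Y u, loc Y Z v, loc Z (sh T X) w) | X Y Z u v w.
     (X, Y, Z, u, v, w) \<in> tri T}. candidate_triangle VQ t' \<and> triangle_iso VQ t t')"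
  by (simp add: verdier_quotient_def with_triangles_def shift_cat.extend_def tri_cat.defs)

lemma verdier_ob [simp]: "ob (verdier_quotient T N) = ob T"
  by (simp add: verdier_quotient_def with_triangles_def shift_cat.extend_def)

lemma loc_cmp_iso:
  assumes "X \<in> ob T" "Y \<in> ob T" "f \<in> arr T X Y" "g \<in> arr T Y X"
    and "loc X X (c X Y X g f) = loc X X (idt T X)" "loc Y Y (c Y X Y f g) = loc Y Y (idt T Y)"
  shows "iso_arr VQ X Y (loc X Y f)"
  unfolding iso_arr_def using assms loc_arr[OF assms(1,3)]
  by (intro conjI bexI[OF _ loc_arr[OF assms(2,4)]]) (simp_all add: loc_cmp del: verdier_sel(5))

lemma verdier_iso_idt: "X \<in> ob T \<Longrightarrow> iso_arr VQ X X (loc X X (idt T X))"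
  by (rule loc_cmp_iso[where g = "idt T X"]) (simp_all add: id_arr id_left)

text \<open>Allows the third vertex of a triangle to be exchanged for an object that is isomorphic
  to it only in the quotient, such as zero for an E-free module.\<close>

lemma verdier_tri_replace:
  assumes t: "(X, Y, Z, u, v, w) \<in> tri T" and cand: "candidate_triangle T (X, Y, Z, u, v, w)"
    and Z': "Z' \<in> ob T" "q \<in> arr T Z' Z" "iso_arr VQ Z' Z (loc Z' Z q)" "v' \<in> arr T Y Z'" "loc Y Z (c Y Z' Z q v') = loc Y Z v"
  shows "(X, Y, Z', loc X Y u, loc Y Z' v', loc Z' (sh T X) (c Z' Z (sh T X) w q)) \<in> tri (verdier_quotient T N)"
proof -
  have O: "X \<in> ob T" "Y \<in> ob T" "Z \<in> ob T" "u \<in> arr T X Y" "v \<in> arr T Y Z" "w \<in> arr T Z (sh T X)" "sh T X \<in> ob T"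
    using cand sh_ob by auto
  have wq: "c Z' Z (sh T X) w q \<in> arr T Z' (sh T X)" using O Z' by (simp add: cmp_arr)
  have c1: "candidate_triangle VQ (X, Y, Z', loc X Y u, loc Y Z' v', loc Z' (sh T X) (c Z' Z (sh T X) w q))"
    "candidate_triangle VQ (X, Y, Z, loc X Y u, loc Y Z v, loc Z (sh T X) w)"
    using O Z' wq loc_arr by auto
  have "triangle_iso VQ (X, Y, Z', loc X Y u, loc Y Z' v', loc Z' (sh T X) (c Z' Z (sh T X) w q))
     (X, Y, Z, loc X Y u, loc Y Z v, loc Z (sh T X) w)"
    unfolding triangle_iso.simps
    by (rule exI[of _ "loc X X (idt T X)"], rule exI[of _ "loc Y Y (idt T Y)"], rule exI[of _ "loc Z' Z q"])
      (use O Z' wq verdier_iso_idt in \<open>simp add: loc_cmp id_arr id_left id_right loc_shm_id[simplified]\<close>)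
  then show ?thesis unfolding verdier_tri_iff using c1 t by blast
qed

lemma verdier_tri_loc:
  assumes t: "(X, Y, Z, u, v, w) \<in> tri T" and cand: "candidate_triangle T (X, Y, Z, u, v, w)"
  shows "\<exists>U V W. (X, Y, Z, U, V, W) \<in> tri (verdier_quotient T N)"
  using verdier_tri_replace[OF t cand, of Z "idt T Z" v] cand verdier_iso_idt by (auto simp: id_arr id_left)

end

context taft
begin

subsection \<open>The Verdier quotient\<close>

lemma Sc_arrE: "X \<in> DD \<Longrightarrow> Y \<in> DD \<Longrightarrow> F \<in> arr TT X Y \<Longrightarrow> (\<And>f. F = Sc X Y f \<Longrightarrow> rhom X Y f \<Longrightarrow> thesis) \<Longrightarrow> thesis"
  by (auto simp: stab_arr)

lemma qisE: "X \<in> DD \<Longrightarrow> Y \<in> DD \<Longrightarrow> qis X Y F \<Longrightarrow> (\<And>f. F = Sc X Y f \<Longrightarrow> rhom X Y f \<Longrightarrow> eiso X Y f \<Longrightarrow> thesis) \<Longrightarrow> thesis"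
  by (auto simp: qis_iff)

lemma qisI: "X \<in> DD \<Longrightarrow> Y \<in> DD \<Longrightarrow> rhom X Y f \<Longrightarrow> eiso X Y f \<Longrightarrow> qis X Y (Sc X Y f)"
  by (auto simp: qis_iff)

lemma Sc_cong_enull: "X \<in> DD \<Longrightarrow> Y \<in> DD \<Longrightarrow> rhom X Y f \<Longrightarrow> rhom X Y g \<Longrightarrow> Sc X Y f = Sc X Y g \<Longrightarrow> enull X Y (f - g)"
  by (simp add: Sc_eq_iff Dnull_enull)

lemma shm_lift:
  assumes D: "X \<in> DD" "Y \<in> DD" and f: "rhom X Y f"
  obtains h g where "rhom (IO X) (IO Y) h" "h * im X = im Y * f" "rhom (Sg X) (Sg Y) g" "g * pm X = pm Y * h"
    "shm TT X Y (Sc X Y f) = Sc (Sg X) (Sg Y) g"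
  using Sg_lift_exists[OF D f] stab_shm[OF D f] by metis

sublocale V: right_fractions TT "D_proj_B d \<zeta>"
proof
  fix X Y Z :: "dgen rep" and f g
  assume D: "X \<in> ob TT" "Y \<in> ob TT" "Z \<in> ob TT" and fg: "f \<in> arr TT X Y" "g \<in> arr TT Y Z"
  note D' = D[simplified]
  obtain f0 where f0: "f = Sc X Y f0" "rhom X Y f0" using Sc_arrE[OF D'(1,2) fg(1)] .
  obtain g0 where g0: "g = Sc Y Z g0" "rhom Y Z g0" using Sc_arrE[OF D'(2,3) fg(2)] .
  show "cmp TT X Y Z g f \<in> arr TT X Z"
    using D' f0 g0 rhom_mult[OF g0(2) f0(2)] by (simp add: stab_cmp Sc_arr)
  show "shm TT X Z (cmp TT X Y Z g f) = cmp TT (sh TT X) (sh TT Y) (sh TT Z) (shm TT Y Z g) (shm TT X Y f)"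
  proof -
    obtain h k where h: "rhom (IO X) (IO Y) h" "h * im X = im Y * f0" "rhom (Sg X) (Sg Y) k" "k * pm X = pm Y * h"
      "shm TT X Y f = Sc (Sg X) (Sg Y) k" using shm_lift[OF D'(1,2) f0(2)] f0(1) by metis
    obtain h' k' where h': "rhom (IO Y) (IO Z) h'" "h' * im Y = im Z * g0" "rhom (Sg Y) (Sg Z) k'" "k' * pm Y = pm Z * h'"
      "shm TT Y Z g = Sc (Sg Y) (Sg Z) k'" using shm_lift[OF D'(2,3) g0(2)] g0(1) by metis
    have "h' * h * im X = im Z * (g0 * f0)" using h(2) assoc_ext[OF h'(2), of f0] by (simp add: mult.assoc)
    moreover have "k' * k * pm X = pm Z * (h' * h)" using h(4) assoc_ext[OF h'(4), of h] by (simp add: mult.assoc)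
    ultimately have "shm TT X Z (Sc X Z (g0 * f0)) = Sc (Sg X) (Sg Z) (k' * k)"
      using stab_shm[OF D'(1,3) rhom_mult[OF g0(2) f0(2)] rhom_mult[OF h'(1) h(1)] _ rhom_mult[OF h'(3) h(3)]] by blast
    then show ?thesis using D' f0 g0 h h' by (simp add: stab_cmp)
  qed
next
  fix W X Y Z f g h
  assume "W \<in> ob TT" "X \<in> ob TT" "Y \<in> ob TT" "Z \<in> ob TT" and a: "f \<in> arr TT W X" "g \<in> arr TT X Y" "h \<in> arr TT Y Z"
  then have D: "W \<in> DD" "X \<in> DD" "Y \<in> DD" "Z \<in> DD" by simp_all
  obtain f0 where f0: "f = Sc W X f0" "rhom W X f0" using Sc_arrE[OF D(1,2) a(1)] .
  obtain g0 where g0: "g = Sc X Y g0" "rhom X Y g0" using Sc_arrE[OF D(2,3) a(2)] .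
  obtain h0 where h0: "h = Sc Y Z h0" "rhom Y Z h0" using Sc_arrE[OF D(3,4) a(3)] .
  show "cmp TT W X Z (cmp TT X Y Z h g) f = cmp TT W Y Z h (cmp TT W X Y g f)"
    using D f0 g0 h0 by (simp add: stab_cmp rhom_mult mult.assoc)
next
  fix X assume "X \<in> ob TT"
  then have D: "X \<in> DD" by simp
  then show "idt TT X \<in> arr TT X X" by (auto simp: stab_idt)
  show "qis X X (idt TT X)" using D by (simp add: stab_idt qisI eiso_ide)
  show "sh TT X \<in> ob TT" using D by simp
  show "shm TT X X (idt TT X) = idt TT (sh TT X)" using D by (simp add: stab_idt stab_shm_ide)
next
  fix X Y f assume "X \<in> ob TT" "Y \<in> ob TT" and f: "f \<in> arr TT X Y"
  then have D: "X \<in> DD" "Y \<in> DD" by simp_all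
  obtain f0 where f0: "f = Sc X Y f0" "rhom X Y f0" using Sc_arrE[OF D f] .
  then show "cmp TT X Y Y (idt TT Y) f = f" "cmp TT X X Y f (idt TT X) = f"
    using D by (simp_all add: stab_idt stab_cmp linsD[OF rhom_lin])
  show "shm TT X Y f \<in> arr TT (sh TT X) (sh TT Y)"
  proof -
    obtain h k where "rhom (Sg X) (Sg Y) k" "shm TT X Y f = Sc (Sg X) (Sg Y) k" using shm_lift[OF D f0(2)] f0(1) by metis
    then show ?thesis using D by auto
  qed
next
  fix X Y f assume "X \<in> ob TT" "Y \<in> ob TT" and f: "qis X Y f"
  then have D: "X \<in> DD" "Y \<in> DD" by simp_all
  obtain f0 where f0: "f = Sc X Y f0" "rhom X Y f0" "eiso X Y f0" using qisE[OF D f] .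
  obtain h k where h: "rhom (IO X) (IO Y) h" "h * im X = im Y * f0" "rhom (Sg X) (Sg Y) k" "k * pm X = pm Y * h"
      "shm TT X Y f = Sc (Sg X) (Sg Y) k" using shm_lift[OF D f0(2)] f0(1) by metis
  obtain l r where s: "ses X (im X) (IO X) (pm X) (Sg X) l r" using chosen_embedding[OF D(1)] by blast
  obtain l' r' where s': "ses Y (im Y) (IO Y) (pm Y) (Sg Y) l' r'" using chosen_embedding[OF D(2)] by blast
  have "eiso (Sg X) (Sg Y) k"
    using eiso_cosyzygy[OF D(1) IO_D[OF D(1)] Sg_D[OF D(1)] D(2) IO_D[OF D(2)] Sg_D[OF D(2)] s s' IO_ctr[OF D(1)] IO_ctr[OF D(2)] f0(3)
        rhom_elin[OF h(1)] h(2) rhom_elin[OF h(3)] h(4)] .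
  then show "qis (sh TT X) (sh TT Y) (shm TT X Y f)" using h D by (simp add: qisI)
next
  fix X Y Z f g assume "X \<in> ob TT" "Y \<in> ob TT" "Z \<in> ob TT" and fg: "qis X Y f" "qis Y Z g"
  then have D: "X \<in> DD" "Y \<in> DD" "Z \<in> DD" by simp_all
  obtain f0 where f0: "f = Sc X Y f0" "rhom X Y f0" "eiso X Y f0" using qisE[OF D(1,2) fg(1)] .
  obtain g0 where g0: "g = Sc Y Z g0" "rhom Y Z g0" "eiso Y Z g0" using qisE[OF D(2,3) fg(2)] .
  show "qis X Z (cmp TT X Y Z g f)"
    using D f0 g0 qisI[OF D(1,3) rhom_mult[OF g0(2) f0(2)] eiso_mult[OF g0(3) f0(3)]] by (simp add: stab_cmp)
next
  fix X Y Z f g assume "X \<in> ob TT" "Y \<in> ob TT" "Z \<in> ob TT" and f: "f \<in> arr TT X Y" and g: "qis Y Z g"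
    and gf: "qis X Z (cmp TT X Y Z g f)"
  then have D: "X \<in> DD" "Y \<in> DD" "Z \<in> DD" by simp_all
  obtain f0 where f0: "f = Sc X Y f0" "rhom X Y f0" using Sc_arrE[OF D(1,2) f] .
  obtain g0 where g0: "g = Sc Y Z g0" "rhom Y Z g0" "eiso Y Z g0" using qisE[OF D(2,3) g] .
  have "qis X Z (Sc X Z (g0 * f0))" using gf f0 g0 D by (simp add: stab_cmp)
  then obtain k where k: "Sc X Z (g0 * f0) = Sc X Z k" "rhom X Z k" "eiso X Z k" using qisE[OF D(1,3)] by blast
  have "eiso X Z (g0 * f0)"
    using eiso_perturb[OF k(3) rhom_elin[OF rhom_mult[OF g0(2) f0(2)]] Sc_cong_enull[OF D(1,3) k(2) rhom_mult[OF g0(2) f0(2)] k(1)[symmetric]]] .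
  then have "eiso X Y f0" using eiso_cancel_left[OF g0(3)] f0(2) by blast
  then show "qis X Y f" using f0 D by (simp add: qisI)
next
  fix V Y W t f assume "V \<in> ob TT" "Y \<in> ob TT" "W \<in> ob TT" "qis V Y t" "f \<in> arr TT W Y"
  then show "\<exists>U\<in>ob TT. \<exists>t' f'. qis U W t' \<and> f' \<in> arr TT U V \<and> cmp TT U W Y f t' = cmp TT U V Y t f'"
    using qis_ore by simp
qed

section \<open>Quotient arrows as E-linear maps modulo trace maps\<close>

abbreviation "TB \<equiv> D_stab_B d \<zeta>"

text \<open>\<open>repr X Y F h\<close> says that the arrow \<open>F\<close> of the Verdier quotient acts as \<open>h\<close> in the stable category
  of E-linear maps, in which the inverted arrows are already invertible.\<close>

definition repr :: "dgen rep \<Rightarrow> dgen rep \<Rightarrow> (dgen rep, complex mat set) roof set \<Rightarrow> lop \<Rightarrow> bool" where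
  "repr X Y F h \<longleftrightarrow> elin X Y h \<and> (\<forall>W s f. W \<in> DD \<and> rhom W X s \<and> rhom W Y f \<and> (W, Sc W X s, Sc W Y f) \<in> F \<longrightarrow> enull W Y (f - h * s))"

lemma roof_repE:
  assumes "X \<in> DD" "Y \<in> DD" "is_roof TT (D_proj_B d \<zeta>) X Y (W, S, F)"
  obtains s f where "W \<in> DD" "S = Sc W X s" "F = Sc W Y f" "rhom W X s" "eiso W X s" "rhom W Y f"
proof -
  have W: "W \<in> DD" "qis W X S" "F \<in> arr TT W Y" using assms(3) by auto
  obtain s where s: "S = Sc W X s" "rhom W X s" "eiso W X s" using qisE[OF W(1) assms(1) W(2)] .
  obtain f where f: "F = Sc W Y f" "rhom W Y f" using Sc_arrE[OF W(1) assms(2) W(3)] .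
  show ?thesis using that W(1) s f by blast
qed

text \<open>The roof (W, s, f) acts as f t with t a stable E-linear inverse of s. Any other roof in
  the class agrees with it on a common refinement, and the leg of that refinement is stably
  invertible and can be cancelled.\<close>

lemma repr_exists:
  assumes D: "X \<in> DD" "Y \<in> DD" and F: "F \<in> arr (verdier_shift_cat TT (D_proj_B d \<zeta>)) X Y"
  obtains h W s f where "repr X Y F h" "W \<in> DD" "rhom W X s" "eiso W X s" "rhom W Y f" "(W, Sc W X s, Sc W Y f) \<in> F" "elin X Y h"
proof -
  obtain W S G where F': "F = roof_class TT (D_proj_B d \<zeta>) X Y (W, S, G)" and rf: "is_roof TT (D_proj_B d \<zeta>) X Y (W, S, G)"
    using F by auto
  obtain s f where W: "W \<in> DD" "S = Sc W X s" "G = Sc W Y f" "rhom W X s" "eiso W X s" "rhom W Y f" using roof_repE[OF D rf] .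
  obtain t where t: "einv W X s t" using W by (auto simp: eiso_def)
  have lt: "elin X W t" using t by (simp add: einv_def)
  have h: "elin X Y (f * t)" using lt W by blast
  have "enull W' Y (f' - f * t * s')" if W': "W' \<in> DD" "rhom W' X s'" "rhom W' Y f'" "(W', Sc W' X s', Sc W' Y f') \<in> F" for W' s' f'
  proof -
    obtain V u u' where V: "V \<in> DD" "u \<in> arr TT V W" "u' \<in> arr TT V W'" "qis V X (cmp TT V W X S u)"
      "cmp TT V W X S u = cmp TT V W' X (Sc W' X s') u'" "cmp TT V W Y G u = cmp TT V W' Y (Sc W' Y f') u'"
      and q': "qis W' X (Sc W' X s')"
      using W'(4) unfolding F' roof_class_def by auto
    obtain v v' where v: "u = Sc V W v" "rhom V W v" "u' = Sc V W' v'" "rhom V W' v'"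
      using Sc_arrE[OF V(1) W(1) V(2)] Sc_arrE[OF V(1) W'(1) V(3)] by metis
    have "Sc V X (s * v) = Sc V X (s' * v')" "Sc V Y (f * v) = Sc V Y (f' * v')"
      using V(1,5,6) v W W' D by (simp_all add: stab_cmp)
    then have e: "enull V X (s * v - s' * v')" "enull V Y (f * v - f' * v')"
      using Sc_cong_enull[OF V(1) D(1) rhom_mult[OF W(4) v(2)] rhom_mult[OF W'(2) v(4)]]
        Sc_cong_enull[OF V(1) D(2) rhom_mult[OF W(6) v(2)] rhom_mult[OF W'(3) v(4)]] by blast+
    have qu': "qis V W' u'" using V.q_cancel[of V W' X u' "Sc W' X s'"] V W' D q' by simp
    then obtain v2 where v2: "u' = Sc V W' v2" "rhom V W' v2" "eiso V W' v2" using qisE[OF V(1) W'(1)] by blast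
    have v': "eiso V W' v'"
      using eiso_perturb[OF v2(3) rhom_elin[OF v(4)]] Sc_cong_enull[OF V(1) W'(1) v2(2) v(4)] v2(1) v(3) by simp
    then obtain w where w: "einv V W' v' w" by (auto simp: eiso_def)
    have lw: "elin W' V w" "enull W' W' (ide W' - v' * w)" using w by (simp_all add: einv_def)
    have "enull W W (ide W - t * s)" using t by (simp add: einv_def)
    note N = enull_left[OF rhom_elin[OF W(6)] enull_right[OF this rhom_elin[OF v(2)]]]
    have "f' * v' - f * t * (s' * v') = - (f * v - f' * v') + f * ((ide W - t * s) * v) + f * t * (s * v - s' * v')"
      using rhom_lin[OF v(2)] by (simp add: algebra_simps linsD)
    also have "enull V Y \<dots>" using enull_add[OF enull_add[OF enull_uminus[OF e(2)] N] enull_left[OF h e(1)]] .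
    finally have "enull V Y (f' * v' - f * t * (s' * v'))" .
    from enull_right[OF this lw(1)] have 1: "enull W' Y ((f' * v' - f * t * (s' * v')) * w)" .
    have 2: "enull W' Y ((f' - f * t * s') * (ide W' - v' * w))"
      using enull_left[OF elin_diff[OF rhom_elin[OF W'(3)] elin_mult[OF h rhom_elin[OF W'(2)]]] lw(2)] .
    have "f' - f * t * s' = (f' * v' - f * t * (s' * v')) * w + (f' - f * t * s') * (ide W' - v' * w)"
      using rhom_lin[OF W'(3)] rhom_lin[OF W'(2)] by (simp add: algebra_simps linsD)
    with enull_add[OF 1 2] show ?thesis by simp
  qed
  then have "repr X Y F (f * t)" unfolding repr_def using h by blast
  moreover have "(W, S, G) \<in> F" unfolding F' roof_class_def using V.roof_equiv_refl[of X Y "(W, S, G)"] D rf by simp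
  ultimately show ?thesis using that W h by blast
qed

text \<open>The completed roof is refined to an apex P on which the two composites into X agree
  stably. The leg from P to X is stably E-invertible, so the identity obtained on P descends to
  X.\<close>

lemma repr_id:
  assumes D: "X \<in> DD" "Y \<in> DD" and F: "repr X Y F h" and G: "repr Y X G k"
    and sub: "F \<in> arr (verdier_shift_cat TT (D_proj_B d \<zeta>)) X Y" "G \<in> arr (verdier_shift_cat TT (D_proj_B d \<zeta>)) Y X"
    and id: "roof_comp TT (D_proj_B d \<zeta>) X Y X G F = V.loc X X (idt TT X)"
  shows "enull X X (ide X - k * h)"
proof -
  have "(X, idt TT X, idt TT X) \<in> roof_comp TT (D_proj_B d \<zeta>) X Y X G F"
    unfolding id using V.loc_mem[of X X "idt TT X"] V.id_arr[of X] D by simp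
  then obtain W S f V T g U t f' where h: "(W, S, f) \<in> F" "(V, T, g) \<in> G" "U \<in> DD" "qis U W t" "f' \<in> arr TT U V"
    "cmp TT U W Y f t = cmp TT U V Y T f'"
    and e: "roof_equiv TT (D_proj_B d \<zeta>) X X (U, cmp TT U W X S t, cmp TT U V X g f') (X, idt TT X, idt TT X)"
    unfolding roof_comp_def stab_ob mem_Collect_eq by blast
  have "is_roof TT (D_proj_B d \<zeta>) X Y (W, S, f)" "is_roof TT (D_proj_B d \<zeta>) Y X (V, T, g)"
    using h(1,2) sub by (auto simp: roof_class_def)
  then obtain s0 f0 t0 g0 where W: "W \<in> DD" "S = Sc W X s0" "f = Sc W Y f0" "rhom W X s0" "rhom W Y f0"
    and V: "V \<in> DD" "T = Sc V Y t0" "g = Sc V X g0" "rhom V Y t0" "rhom V X g0"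
    using roof_repE D by metis
  obtain t1 where t1: "t = Sc U W t1" "rhom U W t1" using qisE[OF h(3) W(1) h(4)] by blast
  obtain f1 where f1: "f' = Sc U V f1" "rhom U V f1" using Sc_arrE[OF h(3) V(1) h(5)] .
  have "Sc U Y (f0 * t1) = Sc U Y (t0 * f1)" using h(3,6) W V t1 f1 D by (simp add: stab_cmp)
  then have e1: "enull U Y (f0 * t1 - t0 * f1)"
    using Sc_cong_enull[OF h(3) D(2) rhom_mult[OF W(5) t1(2)] rhom_mult[OF V(4) f1(2)]] by blast
  have e2: "enull W Y (f0 - h * s0)" "enull V X (g0 - k * t0)"
    using F G W V h(1,2) unfolding repr_def by blast+
  have hk: "elin X Y h" "elin Y X k" using F G by (simp_all add: repr_def)
  obtain P u u' where P: "P \<in> DD" "u \<in> arr TT P U" "u' \<in> arr TT P X" "qis P X (cmp TT P U X (cmp TT U W X S t) u)"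
    "cmp TT P U X (cmp TT U W X S t) u = cmp TT P X X (idt TT X) u'" "cmp TT P U X (cmp TT U V X g f') u = cmp TT P X X (idt TT X) u'"
    using e by auto
  obtain v where v: "u = Sc P U v" "rhom P U v" using Sc_arrE[OF P(1) h(3) P(2)] .
  have r: "rhom P X (s0 * t1 * v)" "rhom P X (g0 * f1 * v)" using W t1 v V f1 by blast+
  have "Sc P X (s0 * t1 * v) = Sc P X (g0 * f1 * v)"
    using P(5,6) P(1) h(3) W V t1 f1 v D by (simp add: stab_cmp rhom_mult)
  then have e3: "enull P X (s0 * t1 * v - g0 * f1 * v)" using Sc_cong_enull[OF P(1) D(1) r] by blast
  have "qis P X (Sc P X (s0 * t1 * v))" using P(4) P(1) h(3) W t1 v D by (simp add: stab_cmp rhom_mult)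
  then obtain x where x: "Sc P X (s0 * t1 * v) = Sc P X x" "rhom P X x" "eiso P X x" using qisE[OF P(1) D(1)] by blast
  have iso: "eiso P X (s0 * t1 * v)"
    using eiso_perturb[OF x(3) rhom_elin[OF r(1)] Sc_cong_enull[OF P(1) D(1) x(2) r(1) x(1)[symmetric]]] .
  then obtain y where y: "einv P X (s0 * t1 * v) y" by (auto simp: eiso_def)
  have ly: "elin X P y" "enull X X (ide X - s0 * t1 * v * y)" using y by (simp_all add: einv_def)
  have "(ide X - k * h) * (s0 * t1 * v) = (s0 * t1 * v - g0 * f1 * v) + (g0 - k * t0) * (f1 * v)
     - k * ((f0 * t1 - t0 * f1) * v) + k * ((f0 - h * s0) * (t1 * v))"
    using rhom_lin[OF W(4)] by (simp add: algebra_simps linsD)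
  also have "enull P X \<dots>"
    by (intro enull_add enull_diff e3 enull_left[OF hk(2)] enull_right[OF e2(2)] enull_right[OF e2(1)] enull_right[OF e1])
      (use v f1 t1 in auto)
  finally have "enull P X ((ide X - k * h) * (s0 * t1 * v))" .
  from enull_right[OF this ly(1)] have 1: "enull X X ((ide X - k * h) * (s0 * t1 * v) * y)" .
  have 2: "enull X X ((ide X - k * h) * (ide X - s0 * t1 * v * y))"
    using enull_left[OF elin_diff[OF elin_ide[OF D(1)] elin_mult[OF hk(2,1)]] ly(2)] .
  have "ide X - k * h = (ide X - k * h) * (s0 * t1 * v) * y + (ide X - k * h) * (ide X - s0 * t1 * v * y)"
    using elin_lin[OF hk(1)] by (simp add: algebra_simps linsD)
  with enull_add[OF 1 2] show ?thesis by simp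
qed

text \<open>Invariance of the traces is available for D(B)-maps only, while the E-linear map h
  attached to F need not be one. The comparison therefore passes through the apex W of a roof, both
  of whose legs are D(B)-linear and stably E-invertible.\<close>

lemma theta_verdier_iso:
  assumes D: "X \<in> DD" "Y \<in> DD" and i: "iso_arr (verdier_shift_cat TT (D_proj_B d \<zeta>)) X Y F" and a: "a \<in> {1..<d}"
  shows "theta X a b = theta Y a b"
proof -
  have F: "F \<in> arr (verdier_shift_cat TT (D_proj_B d \<zeta>)) X Y" using i by (simp only: iso_arr_def)
  obtain G where G: "G \<in> arr (verdier_shift_cat TT (D_proj_B d \<zeta>)) Y X"
    "roof_comp TT (D_proj_B d \<zeta>) X Y X G F = V.loc X X (idt TT X)" "roof_comp TT (D_proj_B d \<zeta>) Y X Y F G = V.loc Y Y (idt TT Y)"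
    using i unfolding iso_arr_def V.verdier_sel(3,4) by blast
  obtain h W s f where h: "repr X Y F h" "W \<in> DD" "rhom W X s" "eiso W X s" "rhom W Y f" "(W, Sc W X s, Sc W Y f) \<in> F" "elin X Y h"
    using repr_exists[OF D F] .
  obtain k where k: "repr Y X G k" "elin Y X k" using repr_exists[OF D(2,1) G(1)] by blast
  have "einv X Y h k" unfolding einv_def
    using h(7) k(2) repr_id[OF D h(1) k(1) F G(1,2)] repr_id[OF D(2,1) k(1) h(1) G(1) F G(3)] by blast
  then have hs: "eiso W Y (h * s)" using eiso_mult[OF _ h(4)] by (auto simp: eiso_def)
  have "enull W Y (f - h * s)" using h unfolding repr_def by blast
  then have "enull W Y (h * s - f)" using enull_uminus[of W Y "f - h * s"] by simp
  then have "eiso W Y f" using eiso_perturb[OF hs rhom_elin[OF h(5)]] by blast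
  then show ?thesis using theta_eiso[OF h(2) D(1) h(3,4) a] theta_eiso[OF h(2) D(2) h(5) _ a] by simp
qed

text \<open>The injective hull is E-free and has zero trace, so the shift changes the sign; the
  pushout sequence then yields additivity.\<close>

lemma theta_std_triangle:
  assumes "std_triangle X u Y v Z w" "a \<in> {1..<d}" shows "theta Y a b = theta X a b + theta Z a b"
proof -
  obtain l r where D: "X \<in> DD" "Y \<in> DD" "Z \<in> DD" and s: "ses Y v Z w (Sg X) l r" using assms(1) by (auto simp: std_triangle_def)
  obtain l' r' where s': "ses X (im X) (IO X) (pm X) (Sg X) l' r'" using chosen_embedding[OF D(1)] by blast
  have "theta (IO X) a b = 0" using theta_ctr[OF IO_D[OF D(1)] IO_ctr[OF D(1)] assms(2)] .
  moreover have "theta Z a b = theta Y a b + theta (Sg X) a b" "theta (IO X) a b = theta X a b + theta (Sg X) a b"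
    using theta_ses[OF s D(2,3) Sg_D[OF D(1)]] theta_ses[OF s' D(1) IO_D[OF D(1)] Sg_D[OF D(1)]] assms(2) by auto
  ultimately have "theta (Sg X) a b = - theta X a b" "theta Z a b = theta Y a b + theta (Sg X) a b"
    by (metis add_eq_0_iff)+
  then show ?thesis by simp
qed

lemma theta_tri_stab:
  assumes "(X, Y, Z, u, v, w) \<in> tri TT" "a \<in> {1..<d}" shows "theta Y a b = theta X a b + theta Z a b"
proof -
  obtain X' Y' Z' u' v' w' where st: "std_triangle X' u' Y' v' Z' w'"
    and i: "triangle_iso TT (X, Y, Z, u, v, w) (X', Y', Z', Sc X' Y' u', Sc Y' Z' v', Sc Z' (Sg X') w')"
    using assms(1) unfolding stab_tri by blast
  have D: "X \<in> DD" "Y \<in> DD" "Z \<in> DD" using assms(1) unfolding stab_tri by auto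
  have D': "X' \<in> DD" "Y' \<in> DD" "Z' \<in> DD" using st by (auto simp: std_triangle_def)
  have *: "theta A a b = theta B a b" if "A \<in> DD" "B \<in> DD" "iso_arr TT A B x" for A B x
    using stab_iso_arr_eiso[OF that] theta_eiso[OF that(1,2) _ _ assms(2)] by metis
  show ?thesis using i *[OF D(1) D'(1)] *[OF D(2) D'(2)] *[OF D(3) D'(3)] theta_std_triangle[OF st assms(2)] by auto
qed

lemma theta_tri:
  assumes t: "(X, Y, Z, u, v, w) \<in> tri TB" and a: "a \<in> {1..<d}"
  shows "X \<in> DD" "Y \<in> DD" "Z \<in> DD" "theta Y a b = theta X a b + theta Z a b"
proof -
  have t': "(X, Y, Z, u, v, w) \<in> tri (verdier_quotient TT (D_proj_B d \<zeta>))" using t by (simp add: D_stab_B_def)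
  from t' show D: "X \<in> DD" "Y \<in> DD" "Z \<in> DD" unfolding V.verdier_tri_iff by auto
  from t' obtain X' Y' Z' u' v' w' where t2: "(X', Y', Z', u', v', w') \<in> tri TT"
    and i: "triangle_iso V.VQ (X, Y, Z, u, v, w) (X', Y', Z', V.loc X' Y' u', V.loc Y' Z' v', V.loc Z' (sh TT X') w')"
    unfolding V.verdier_tri_iff by blast
  have D': "X' \<in> DD" "Y' \<in> DD" "Z' \<in> DD" using t2 unfolding stab_tri by auto
  have "theta X a b = theta X' a b" "theta Y a b = theta Y' a b" "theta Z a b = theta Z' a b"
    using i theta_verdier_iso[OF D(1) D'(1) _ a] theta_verdier_iso[OF D(2) D'(2) _ a] theta_verdier_iso[OF D(3) D'(3) _ a]
    unfolding triangle_iso.simps by blast+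
  then show "theta Y a b = theta X a b + theta Z a b" using theta_tri_stab[OF t2 a, of b] by simp
qed

subsection \<open>The relations of the Grothendieck group\<close>

abbreviation "FG \<equiv> free_Abelian_group DD"
abbreviation "I \<equiv> triangle_relations TB"

lemma TB_ob [simp]: "ob TB = DD" by (simp add: D_stab_B_def)

text \<open>Since u is injective, its standard cone can be realised on the sum of the hull of X and
  Z: the hull map extends along u to k, and v has components k and q. The injective summand is
  invisible stably, so the cone is isomorphic to Z.\<close>

lemma triangle_of_ses:
  assumes D: "X \<in> DD" "Y \<in> DD" "Z \<in> DD" and s: "ses X u Y q Z l r"
  shows "\<exists>U V W. (X, Y, Z, U, V, W) \<in> tri TT"
proof -
  note A = sesD[OF s]
  obtain l1 r1 where s1: "ses X (im X) (IO X) (pm X) (Sg X) l1 r1" using chosen_embedding[OF D(1)] by blast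
  note B = sesD[OF s1]
  have DI: "IO X \<in> DD" "Sg X \<in> DD" using D by auto
  obtain k where k: "rhom Y (IO X) k" "k * u = im X"
    using injective_extend[OF IO_inj[OF D(1)] D(1,2) A(1,5,7) B(1)] .
  obtain S i1 p1 i2 p2 where S: "S \<in> DD" "rhom (IO X) S i1" "rhom S (IO X) p1" "rhom Z S i2" "rhom S Z p2"
      "p1 * i1 = ide (IO X)" "p2 * i2 = ide Z" "p1 * i2 = 0" "p2 * i1 = 0" "i1 * p1 + i2 * p2 = ide S"
    using direct_sum_exists[OF DI(1) D(3)] .
  note LL = linsD[OF rhom_lin[OF k(1)]] linsD[OF rhom_lin[OF S(2)]] linsD[OF rhom_lin[OF S(3)]] linsD[OF rhom_lin[OF S(4)]]
    linsD[OF rhom_lin[OF S(5)]] linsD[OF A(3)] linsD[OF A(4)] linsD[OF A(5)] linsD[OF A(6)]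
    linsD[OF B(3)] linsD[OF B(4)] linsD[OF B(5)] linsD[OF B(6)]
  note SS = S(6-9) assoc_ext[OF S(6)] assoc_ext[OF S(7)] assoc_ext[OF S(8)] assoc_ext[OF S(9)]
  note kk = k(2) assoc_ext[OF k(2)]
  \<comment> \<open>The connecting map: it is what k induces on cokernels, as the next equations
    confirm.\<close>
  define \<delta> where "\<delta> = pm X * (k * r)"
  have "\<delta> * q = pm X * (k * (ide Y - u * l))" by (simp add: \<delta>_def A(11) mult.assoc)
  also have "\<dots> = pm X * k" by (simp add: right_diff_distrib LL kk mult.assoc B)
  finally have \<delta>q: "\<delta> * q = pm X * k" .
  have l\<delta>: "lin (rdim (Sg X)) (rdim Z) \<delta>" unfolding \<delta>_def using A B rhom_lin[OF k(1)] by blast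
  have \<delta>: "rhom Z (Sg X) \<delta>"
    by (rule rhom_epi_cancel[OF A(2,8) _ l\<delta> D(3)]) (unfold \<delta>q, rule rhom_mult[OF B(2) k(1)])
  define v where "v = i1 * k + i2 * q"
  define w where "w = pm X * p1 - \<delta> * p2"
  have rv: "rhom Y S v" unfolding v_def using S k A by blast
  have rw: "rhom S (Sg X) w" unfolding w_def using S \<delta> B by blast
  define l2 where "l2 = u * l1 * (p1 - k * r * p2) + r * p2"
  define r2 where "r2 = i1 * r1"
  have vu: "v * u = i1 * im X" by (simp add: v_def distrib_right mult.assoc kk A)
  have wv: "w * v = 0"
    by (simp add: w_def v_def algebra_simps SS LL linsD[OF l\<delta>] \<delta>q)
  have wr: "w * r2 = ide (Sg X)"
    by (simp add: w_def r2_def left_diff_distrib mult.assoc SS LL B)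
  have "l2 * v = u * (l1 * (k - k * (r * q))) + r * q"
    by (simp add: l2_def v_def algebra_simps SS LL)
  also have "k - k * (r * q) = k * u * l" by (simp add: A(11) algebra_simps LL)
  also have "u * (l1 * (k * u * l)) + r * q = ide Y" 
    by (simp only: kk(2) mult.assoc B(12) LL) (simp add: A(11))
  finally have lv: "l2 * v = ide Y" .
  have lr: "l2 * r2 = 0" by (simp add: l2_def r2_def algebra_simps SS LL B)
  have one: "v * l2 + r2 * w = ide S"
  proof -
    have p\<delta>: "\<delta> = pm X * (k * r)" by (simp add: \<delta>_def)
    have vr: "v * r = i1 * (k * r) + i2" by (simp add: v_def distrib_right mult.assoc A LL)
    have 1: "(v * l2 + r2 * w) * i1 = i1"
    proof -
      have "(v * l2 + r2 * w) * i1 = v * u * l1 + i1 * (r1 * pm X)"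
        by (simp add: l2_def r2_def w_def algebra_simps SS LL)
      also have "\<dots> = i1" unfolding vu by (simp add: mult.assoc B(11) right_diff_distrib LL)
      finally show ?thesis .
    qed
    have 2: "(v * l2 + r2 * w) * i2 = i2"
    proof -
      have "(v * l2 + r2 * w) * i2 = v * r - v * u * (l1 * (k * r)) - i1 * (r1 * \<delta>)"
        by (simp add: l2_def r2_def w_def algebra_simps SS LL linsD[OF l\<delta>])
      also have "\<dots> = i2" unfolding vu vr p\<delta>
        by (simp add: mult.assoc B(16) right_diff_distrib LL)
      finally show ?thesis .
    qed
    have "v * l2 + r2 * w = (v * l2 + r2 * w) * (i1 * p1 + i2 * p2)"
    proof -
      have "lin (rdim S) (rdim S) (v * l2 + r2 * w)" unfolding l2_def r2_def
        using rhom_lin[OF rv] rhom_lin[OF rw] A B rhom_lin[OF k(1)] S(2-5)[THEN rhom_lin] by (intro lin_add lin_mult lin_diff)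
      then show ?thesis by (simp add: S(10) linsD)
    qed
    also have "\<dots> = ((v * l2 + r2 * w) * i1) * p1 + ((v * l2 + r2 * w) * i2) * p2" by (simp add: distrib_left mult.assoc)
    also have "\<dots> = ide S" unfolding 1 2 by (rule S(10))
    finally show ?thesis .
  qed
  have "lin (rdim Y) (rdim S) l2" "lin (rdim S) (rdim (Sg X)) r2" unfolding l2_def r2_def
    using A B rhom_lin[OF k(1)] S(2-5)[THEN rhom_lin] by (blast intro: lin_add lin_mult lin_diff)+
  then have "ses Y v S w (Sg X) l2 r2" using rv rw lv wr wv lr one by (simp add: ses_def)
  moreover have "w * i1 = pm X" by (simp add: w_def left_diff_distrib mult.assoc SS LL)
  ultimately have st: "std_triangle X u Y v S w"
    unfolding std_triangle_def using D S vu A(1) by (intro conjI exI[of _ l2] exI[of _ r2] exI[of _ i1]) auto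
  have n: "Dnull S S (i1 * p1)" by (rule Dnull_factor[OF S(1) IO_inj[OF D(1)] S(3) S(2)])
  have i2p2: "i2 * p2 - ide S = - (i1 * p1)" using S(10) by (simp add: algebra_simps)
  have iso: "iso_arr TT Z S (Sc Z S i2)"
    unfolding stab_iso_arr_iff[OF D(3) S(1)]
    by (intro exI[of _ i2] exI[of _ p2]) (simp add: S(4,5,7) i2p2 Dnull_uminus[OF n])
  have "Sc Y S (i2 * (p2 * v)) = Sc Y S v"
  proof -
    have "i2 * (p2 * v) - v = - (i1 * p1) * v" using arg_cong[OF i2p2, of "\<lambda>x. x * v"] rhom_lin[OF rv] by (simp add: algebra_simps linsD)
    then show ?thesis using Dnull_right[OF D(2) S(1) Dnull_uminus[OF n] rv] S(4,5) rv D S(1) by (simp add: Sc_eq_iff rhom_mult)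
  qed
  then have "triangle_iso TT (X, Y, Z, Sc X Y u, Sc Y Z (p2 * v), Sc Z (Sg X) (w * i2)) (X, Y, S, Sc X Y u, Sc Y S v, Sc S (Sg X) w)"
    unfolding triangle_iso.simps
    by (intro exI[of _ "Sc X X (ide X)"] exI[of _ "Sc Y Y (ide Y)"] exI[of _ "Sc Z S i2"])
      (use D DI S(1,4,5) iso rv rw A(1) stab_iso_ide in \<open>simp add: stab_cmp stab_shm_ide rhom_mult LL linsD[OF rhom_lin[OF rv]]
        linsD[OF rhom_lin[OF rw]]\<close>)
  moreover have "candidate_triangle TT (X, Y, Z, Sc X Y u, Sc Y Z (p2 * v), Sc Z (Sg X) (w * i2))"
    using D DI S A rv rw by auto
  ultimately show ?thesis unfolding stab_tri using st by blast
qed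

lemma tri_TB_of_ses:
  assumes D: "X \<in> DD" "Y \<in> DD" "Z \<in> DD" and s: "ses X u Y q Z l r"
  shows "\<exists>U V W. (X, Y, Z, U, V, W) \<in> tri TB"
proof -
  obtain U V W where t: "(X, Y, Z, U, V, W) \<in> tri TT" using triangle_of_ses[OF assms] by blast
  then have "candidate_triangle TT (X, Y, Z, U, V, W)" unfolding stab_tri by blast
  from V.verdier_tri_loc[OF t this] show ?thesis by (simp add: D_stab_B_def)
qed

definition O0 :: "dgen rep" where "O0 = mk_rep 0 (\<lambda>g. 0)"

lemma idn_0 [simp]: "idn 0 = 0" by (rule lop_eqI) simp

lemma O0_D [simp, intro]: "O0 \<in> DD" and rdim_O0 [simp]: "rdim O0 = 0"
proof -
  have "rels 0 (\<lambda>g. 0)" using d2 by (simp add: rels_def power_0_left)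
  then show "O0 \<in> DD" unfolding O0_def by (rule mk_rep_D)
qed (simp add: O0_def)

text \<open>The map from the zero module to an E-free module P is inverted, and all arrows out of P
  agree after composition with it; hence P is a zero object of the quotient.\<close>

lemma loc_ctr:
  assumes P: "P \<in> DD" "ctr P" "Y \<in> DD" and f: "f \<in> arr TT P Y" and g: "g \<in> arr TT P Y"
  shows "V.loc P Y f = V.loc P Y g"
proof -
  obtain f0 where f0: "f = Sc P Y f0" "rhom P Y f0" using Sc_arrE[OF P(1,3) f] .
  obtain g0 where g0: "g = Sc P Y g0" "rhom P Y g0" using Sc_arrE[OF P(1,3) g] .
  have "einv O0 P 0 0" unfolding einv_def using P(2) by (auto simp: ctr_def)
  then have z: "qis O0 P (Sc O0 P 0)" using qisI[OF O0_D P(1)] by (auto simp: eiso_def)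
  have z': "Sc O0 P 0 \<in> arr TT O0 P" using P by auto
  have "roof_equiv TT (D_proj_B d \<zeta>) P Y (P, idt TT P, f) (P, idt TT P, g)"
    unfolding roof_equiv.simps stab_ob
    by (rule bexI[OF _ O0_D], rule bexI[OF _ z'], rule bexI[OF _ z']) (use P f0 g0 z in \<open>simp add: stab_idt stab_cmp\<close>)
  then show ?thesis unfolding loc_arr_def using V.roof_class_eq[of P Y] V.loc_roof[of P] P f g by simp
qed

text \<open>Start from the triangle of the identity of P and exchange its third vertex for the zero
  module.\<close>

lemma tri_TB_of_ctr:
  assumes P: "P \<in> DD" "ctr P"
  shows "\<exists>U V W. (O0, P, O0, U, V, W) \<in> tri TB"
proof -
  have "ses O0 0 P (ide P) P 0 (ide P)" using P by (simp add: ses_def)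
  from triangle_of_ses[OF O0_D P(1) P(1) this] obtain u v w where t: "(O0, P, P, u, v, w) \<in> tri TT" by blast
  then have c: "candidate_triangle TT (O0, P, P, u, v, w)" unfolding stab_tri by blast
  have z: "Sc O0 P 0 \<in> arr TT O0 P" "Sc P O0 0 \<in> arr TT P O0" using P by auto
  have "ctr O0" unfolding ctr_def by simp
  have cc: "cmp TT P O0 P (Sc O0 P 0) (Sc P O0 0) = Sc P P 0" "cmp TT O0 P O0 (Sc P O0 0) (Sc O0 P 0) = idt TT O0"
    using P by (simp_all add: stab_cmp stab_idt)
  have id: "idt TT P \<in> arr TT P P" using V.id_arr[of P] P by simp
  have "iso_arr V.VQ O0 P (V.loc O0 P (Sc O0 P 0))"
  proof (rule V.loc_cmp_iso[OF _ _ z])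
    show "V.loc P P (cmp TT P O0 P (Sc O0 P 0) (Sc P O0 0)) = V.loc P P (idt TT P)"
      unfolding cc by (rule loc_ctr[OF P P(1) _ id]) (use P in auto)
  qed (use P cc in auto)
  moreover have "V.loc P P (cmp TT P O0 P (Sc O0 P 0) (Sc P O0 0)) = V.loc P P v"
    unfolding cc using c by (intro loc_ctr[OF P P(1)]) (use P in auto)
  ultimately show ?thesis using V.verdier_tri_replace[OF t c _ z(1) _ z(2)] by (auto simp: D_stab_B_def)
qed

lemma frag_gens: "{frag_of Y - frag_of X - frag_of Z | X Y Z. \<exists>u v w. (X, Y, Z, u, v, w) \<in> tri TB} \<subseteq> carrier FG"
proof clarify
  fix X Y Z u v w assume "(X, Y, Z, u, v, w) \<in> tri TB"
  from theta_tri(1-3)[OF this, of 1] have "X \<in> DD" "Y \<in> DD" "Z \<in> DD" using d2 by auto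
  then show "frag_of Y - frag_of X - frag_of Z \<in> carrier FG"
    using keys_diff[of "frag_of Y - frag_of X" "frag_of Z"] keys_diff[of "frag_of Y" "frag_of X"]
    by (auto simp: keys_frag_of)
qed

lemma I_subgroup: "subgroup I FG"
  unfolding triangle_relations_def TB_ob using group.generate_is_subgroup[OF _ frag_gens] by simp

lemma I_closed: "0 \<in> I" "x \<in> I \<Longrightarrow> y \<in> I \<Longrightarrow> x + y \<in> I" "x \<in> I \<Longrightarrow> - x \<in> I" "x \<in> I \<Longrightarrow> y \<in> I \<Longrightarrow> x - y \<in> I" "x \<in> I \<Longrightarrow> x \<in> carrier FG"
proof -
  note S = I_subgroup
  show "0 \<in> I" using subgroup.one_closed[OF S] by simp
  show c: "x \<in> carrier FG" if "x \<in> I" for x using subgroup.mem_carrier[OF S that] .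
  show p: "x + y \<in> I" if "x \<in> I" "y \<in> I" for x y using subgroup.m_closed[OF S that] by simp
  show m: "- x \<in> I" if "x \<in> I" for x using subgroup.m_inv_closed[OF S that] c[OF that] by simp
  show "x - y \<in> I" if "x \<in> I" "y \<in> I" for x y using p[OF that(1) m[OF that(2)]] by simp
qed

lemma I_gen: "(X, Y, Z, u, v, w) \<in> tri TB \<Longrightarrow> frag_of Y - frag_of X - frag_of Z \<in> I"
  unfolding triangle_relations_def by (rule generate.incl) blast

lemma I_ses: "X \<in> DD \<Longrightarrow> Y \<in> DD \<Longrightarrow> Z \<in> DD \<Longrightarrow> ses X u Y q Z l r \<Longrightarrow> frag_of Y - frag_of X - frag_of Z \<in> I"
  using tri_TB_of_ses I_gen by metis

text \<open>The triangle yields [P] = 2 [0]; for P the zero module this already forces [0] =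
  0.\<close>

lemma I_ctr: assumes "P \<in> DD" "ctr P" shows "frag_of P \<in> I"
proof -
  have 1: "frag_of P - frag_of O0 - frag_of O0 \<in> I" if "P \<in> DD" "ctr P" for P using tri_TB_of_ctr[OF that] I_gen by metis
  have "ctr O0" unfolding ctr_def by simp
  from I_closed(3)[OF 1[OF O0_D this]] have "frag_of O0 \<in> I" by simp
  from I_closed(2)[OF I_closed(2)[OF 1[OF assms] this] this] show ?thesis by simp
qed

section \<open>Graded traces on the free abelian group of modules\<close>

definition Th :: "(dgen rep \<Rightarrow>\<^sub>0 int) \<Rightarrow> nat \<Rightarrow> nat \<Rightarrow> complex" where
  "Th f a b = (\<Sum>M\<in>Poly_Mapping.keys f. of_int (Poly_Mapping.lookup f M) * theta M a b)"

lemma Th_superset: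
  assumes "finite A" "Poly_Mapping.keys f \<subseteq> A" shows "Th f a b = (\<Sum>M\<in>A. of_int (Poly_Mapping.lookup f M) * theta M a b)"
  unfolding Th_def using assms by (intro sum.mono_neutral_left) (auto simp: in_keys_iff)

lemma Th_add: "Th (f + g) a b = Th f a b + Th g a b"
proof -
  define A where "A = Poly_Mapping.keys f \<union> Poly_Mapping.keys g"
  have A: "finite A" "Poly_Mapping.keys f \<subseteq> A" "Poly_Mapping.keys g \<subseteq> A" "Poly_Mapping.keys (f + g) \<subseteq> A"
    using Poly_Mapping.keys_add[of f g] by (auto simp: A_def)
  show ?thesis unfolding Th_superset[OF A(1,2)] Th_superset[OF A(1,3)] Th_superset[OF A(1,4)]
    by (simp add: lookup_add distrib_right sum.distrib)
qed

lemma Th_zero [simp]: "Th 0 a b = 0" by (simp add: Th_def)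
lemma Th_uminus: "Th (- f) a b = - Th f a b" using Th_add[of f "- f" a b] by (simp add: add_eq_0_iff)
lemma Th_diff: "Th (f - g) a b = Th f a b - Th g a b" using Th_add[of f "- g" a b] by (simp add: Th_uminus)
lemma Th_of [simp]: "Th (frag_of M) a b = theta M a b" by (simp add: Th_def keys_frag_of)
lemma Th_cmul: "Th (frag_cmul k f) a b = of_int k * Th f a b"
proof (cases "k = 0")
  case False
  then have "Poly_Mapping.keys (frag_cmul k f) = Poly_Mapping.keys f" by auto
  then show ?thesis by (simp add: Th_def sum_distrib_left mult.assoc)
qed simp
lemma Th_sum: "Th (\<Sum>i\<in>A. f i) a b = (\<Sum>i\<in>A. Th (f i) a b)"
  by (induction A rule: infinite_finite_induct) (simp_all add: Th_add)

lemma Th_extend: "Th (frag_extend h f) a b = (\<Sum>x\<in>Poly_Mapping.keys f. of_int (Poly_Mapping.lookup f x) * Th (h x) a b)"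
  by (simp add: frag_extend_def Th_sum Th_cmul)

lemma Th_I:
  assumes "f \<in> I" "a \<in> {1..<d}" shows "Th f a b = 0"
  using assms(1) unfolding triangle_relations_def TB_ob
proof (induction rule: generate.induct)
  case (incl h)
  then show ?case using theta_tri(4)[OF _ assms(2)] by (auto simp: Th_diff)
next
  case (inv h)
  then have "h \<in> carrier FG" using frag_gens by blast
  then have "inv\<^bsub>FG\<^esub> h = - h" by simp
  then show ?case using inv theta_tri(4)[OF _ assms(2)] by (auto simp: Th_diff Th_uminus)
qed (simp_all add: Th_add)

end

section \<open>Tensor products\<close>

lemma sum_div_mod:
  fixes f :: "nat \<Rightarrow> nat \<Rightarrow> 'a::comm_monoid_add"
  shows "(\<Sum>k<m * n. f (k div n) (k mod n)) = (\<Sum>a<m. \<Sum>b<n. f a b)"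
proof -
  have "sum (\<lambda>k. f (k div n) (k mod n)) {a * n..<a * n + n} = (\<Sum>b<n. f a b)" for a
    by (simp add: sum.atLeastLessThan_shift_0[of _ "a * n"] atLeast0LessThan)
  then show ?thesis by (simp flip: sum.nat_group)
qed

lemma kron_carrier: "A \<in> carrier_mat m m' \<Longrightarrow> B \<in> carrier_mat n n' \<Longrightarrow> kron A B \<in> carrier_mat (m * n) (m' * n')"
  by (auto simp: kron_def)

lemma index_kron: "A \<in> carrier_mat m m' \<Longrightarrow> B \<in> carrier_mat n n' \<Longrightarrow> i < m * n \<Longrightarrow> j < m' * n' \<Longrightarrow>
    kron A B $$ (i, j) = A $$ (i div n, j div n') * B $$ (i mod n, j mod n')"
  by (auto simp: kron_def)

lemma div_mod_bounds: "(k :: nat) < m * n \<Longrightarrow> k div n < m" "k < m * n \<Longrightarrow> k mod n < n"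
  by (simp_all add: less_mult_imp_div_less) (metis gr0I mod_less_divisor mult_0_right not_less_zero)

lemma kron_mult:
  assumes c: "A \<in> carrier_mat m m" "B \<in> carrier_mat n n" "C \<in> carrier_mat m m" "D \<in> carrier_mat n n"
  shows "kron A B * kron C D = kron (A * C) (B * D)"
proof (rule eq_matI)
  note k = kron_carrier[OF c(1,2)] kron_carrier[OF c(3,4)] kron_carrier[OF mult_carrier_mat[OF c(1,3)] mult_carrier_mat[OF c(2,4)]]
  fix i j assume "i < dim_row (kron (A * C) (B * D))" "j < dim_col (kron (A * C) (B * D))"
  then have ij: "i < m * n" "j < m * n" using k by auto
  note b = div_mod_bounds[OF ij(1)] div_mod_bounds[OF ij(2)]
  have "(kron A B * kron C D) $$ (i, j) = (\<Sum>k<m * n. kron A B $$ (i, k) * kron C D $$ (k, j))"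
    using k ij by (simp add: scalar_prod_def atLeast0LessThan)
  also have "\<dots> = (\<Sum>k<m * n. (\<lambda>a b. A $$ (i div n, a) * B $$ (i mod n, b) * (C $$ (a, j div n) * D $$ (b, j mod n))) (k div n) (k mod n))"
    using ij by (intro sum.cong) (auto simp: index_kron[OF c(1,2)] index_kron[OF c(3,4)])
  also have "\<dots> = (\<Sum>a<m. \<Sum>b<n. A $$ (i div n, a) * B $$ (i mod n, b) * (C $$ (a, j div n) * D $$ (b, j mod n)))"
    by (rule sum_div_mod)
  also have "\<dots> = (\<Sum>a<m. A $$ (i div n, a) * C $$ (a, j div n)) * (\<Sum>b<n. B $$ (i mod n, b) * D $$ (b, j mod n))"
    by (simp add: sum_product mult_ac)
  also have "\<dots> = kron (A * C) (B * D) $$ (i, j)"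
    using b c by (subst index_kron[OF mult_carrier_mat[OF c(1,3)] mult_carrier_mat[OF c(2,4)] ij])
      (simp add: scalar_prod_def atLeast0LessThan)
  finally show "(kron A B * kron C D) $$ (i, j) = kron (A * C) (B * D) $$ (i, j)" .
qed (use c in \<open>auto simp: kron_def\<close>)

definition tn :: "nat \<Rightarrow> nat \<Rightarrow> lop \<Rightarrow> lop \<Rightarrow> lop" where
  "tn m n f g = op_mat (kron (mat_op m m f) (mat_op n n g))"

lemma lin_tn [intro, simp]: "lin (m * n) (m * n) (tn m n f g)"
  unfolding tn_def by (intro lin_op_mat kron_carrier) auto

lemma app_tn: "i < m * n \<Longrightarrow> j < m * n \<Longrightarrow> app (tn m n f g) (delta j) i =
    app f (delta (j div n)) (i div n) * app g (delta (j mod n)) (i mod n)"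
  unfolding tn_def using kron_carrier[of "mat_op m m f" m m "mat_op n n g" n n] div_mod_bounds[of i m n] div_mod_bounds[of j m n]
  by (subst app_op_mat_delta) (auto simp: index_kron[of _ m m _ n n] mat_op_def simp del: delta_app)

lemma tn_mult:
  assumes "lin m m f" "lin n n g" "lin m m f'" "lin n n g'"
  shows "tn m n f g * tn m n f' g' = tn m n (f * f') (g * g')"
  unfolding tn_def
  by (subst op_mat_mult[symmetric, of _ "m * n" "m * n" _ "m * n"])
    (simp_all add: kron_carrier[of _ m m _ n n] kron_mult[of _ m _ n] mat_op_mult[OF assms(1,3)] mat_op_mult[OF assms(2,4)])

lemma tn_add: "tn m n (f + f') g = tn m n f g + tn m n f' g" "tn m n f (g + g') = tn m n f g + tn m n f g'"
  and tn_diff: "tn m n (f - f') g = tn m n f g - tn m n f' g" "tn m n f (g - g') = tn m n f g - tn m n f g'"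
  and tn_scal: "tn m n (c *\<^sub>s f) g = c *\<^sub>s tn m n f g" "tn m n f (c *\<^sub>s g) = c *\<^sub>s tn m n f g"
  by (rule lin_eqI[of "m * n" "m * n"]; auto simp: app_tn algebra_simps simp del: delta_app)+

lemma tn_zero [simp]: "tn m n 0 g = 0" "tn m n f 0 = 0"
  using tn_scal(1)[of m n 0 0 g] tn_scal(2)[of m n f 0 0] by simp_all

lemma tn_idn [simp]: "tn m n (idn m) (idn n) = idn (m * n)"
proof (rule lin_eqI[of "m * n" "m * n"])
  fix i j assume ij: "i < m * n" "j < m * n"
  have "i = j \<longleftrightarrow> i div n = j div n \<and> i mod n = j mod n" by (metis div_mult_mod_eq)
  then show "app (tn m n (idn m) (idn n)) (delta j) i = app (idn (m * n)) (delta j) i"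
    using ij div_mod_bounds[OF ij(1)] by (auto simp: app_tn)
qed auto

text \<open>Restricted to positive exponents because the zeroth power is the global identity and not
  \<open>idn (m * n)\<close>.\<close>

lemma tn_power:
  assumes "lin m m f" "lin n n g" shows "tn m n f g ^ Suc k = tn m n (f ^ Suc k) (g ^ Suc k)"
proof (induction k)
  case (Suc k)
  have l: "lin m m (f ^ Suc k)" "lin n n (g ^ Suc k)" using lin_power assms by blast+
  have "tn m n f g ^ Suc (Suc k) = tn m n f g * tn m n (f ^ Suc k) (g ^ Suc k)" by (subst power_Suc) (simp only: Suc)
  then show ?case using tn_mult[OF assms l] by simp
qed simp

lemma trc_tn: "trc (m * n) (tn m n f g) = trc m f * trc n g"
proof -
  have "trc (m * n) (tn m n f g) = (\<Sum>k<m * n. (\<lambda>a b. app f (delta a) a * app g (delta b) b) (k div n) (k mod n))"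
    unfolding trc_def by (intro sum.cong) (auto simp: app_tn simp del: delta_app)
  also have "\<dots> = (\<Sum>a<m. \<Sum>b<n. app f (delta a) a * app g (delta b) b)" by (rule sum_div_mod)
  finally show ?thesis by (simp add: trc_def sum_product)
qed

context taft
begin

section \<open>Gaussian binomial coefficients at a root of unity\<close>

fun qbinom :: "nat \<Rightarrow> nat \<Rightarrow> complex" where
  "qbinom n 0 = 1"
| "qbinom 0 (Suc k) = 0"
| "qbinom (Suc n) (Suc k) = qbinom n k + \<zeta> ^ Suc k * qbinom n (Suc k)"

lemma qbinom_gt: "n < k \<Longrightarrow> qbinom n k = 0"
  by (induction n k rule: qbinom.induct) auto

text \<open>For n + 1 = d the right-hand side vanishes while the q-numbers of 1, ..., d - 1 do not,
  which kills all inner Gaussian binomials of d.\<close>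

lemma qbinom_absorb: "qnum \<zeta> (Suc k) * qbinom (Suc n) (Suc k) = qnum \<zeta> (Suc n) * qbinom n k"
proof (induction n arbitrary: k)
  case 0
  then show ?case by (cases k) (auto simp: qnum_Suc')
next
  case (Suc n)
  show ?case
  proof (cases k)
    case 0
    then show ?thesis using Suc.IH[of 0] qnum_Suc'[of \<zeta> "Suc n"] qnum_Suc'[of \<zeta> 0] by (simp add: algebra_simps)
  next
    case (Suc j)
    have "qnum \<zeta> (Suc k) * qbinom (Suc (Suc n)) (Suc k) =
      qnum \<zeta> (Suc k) * qbinom (Suc n) k + \<zeta> ^ Suc k * (qnum \<zeta> (Suc k) * qbinom (Suc n) (Suc k))"
      by (simp only: qbinom.simps(3)[of "Suc n"] algebra_simps)
    also have "\<dots> = qnum \<zeta> (Suc k) * qbinom (Suc n) k + \<zeta> ^ Suc k * (qnum \<zeta> (Suc n) * qbinom n k)" by (simp only: Suc.IH)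
    also have "qnum \<zeta> (Suc k) * qbinom (Suc n) k = qbinom (Suc n) k + \<zeta> * (qnum \<zeta> k * qbinom (Suc n) k)"
      unfolding qnum_Suc'[of \<zeta> k] by (simp add: algebra_simps)
    also have "qnum \<zeta> k * qbinom (Suc n) k = qnum \<zeta> (Suc n) * qbinom n j" unfolding Suc by (rule Suc.IH)
    finally have "qnum \<zeta> (Suc k) * qbinom (Suc (Suc n)) (Suc k) =
      qbinom (Suc n) k + \<zeta> * qnum \<zeta> (Suc n) * (qbinom n j + \<zeta> ^ Suc j * qbinom n (Suc j))"
      by (simp add: Suc algebra_simps)
    also have "qbinom n j + \<zeta> ^ Suc j * qbinom n (Suc j) = qbinom (Suc n) k" by (simp add: Suc)
    finally show ?thesis unfolding qnum_Suc'[of \<zeta> "Suc n"] by (simp add: algebra_simps)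
  qed
qed

lemma qnum_geometric: "(\<zeta> - 1) * qnum \<zeta> k = \<zeta> ^ k - 1"
  by (induction k) (simp_all add: qnum_Suc algebra_simps)

lemma qnum_nz: "k \<in> {1..<d} \<Longrightarrow> qnum \<zeta> k \<noteq> 0"
  using qnum_geometric[of k] zeta_pow_neq_1[of k] by auto

lemma qbinom_d: "k \<in> {1..<d} \<Longrightarrow> qbinom d k = 0"
  using qbinom_absorb[of "k - 1" "d - 1"] qnum_nz[of k] qnum_d(1) d2 by auto

lemma qbinom_diag: "qbinom n n = 1"
  by (induction n) (simp_all add: qbinom_gt)

lemma q_binomial:
  fixes X Y :: lop
  assumes "Y * X = \<zeta> *\<^sub>s (X * Y)"
  shows "(X + Y) ^ n = (\<Sum>k\<le>n. qbinom n k *\<^sub>s (X ^ k * Y ^ (n - k)))"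
proof (induction n)
  case (Suc n)
  have YX: "Y * X ^ k = \<zeta> ^ k *\<^sub>s (X ^ k * Y)" for k using qcomm_pow[OF assms] .
  have "(X + Y) ^ Suc n = X * (\<Sum>k\<le>n. qbinom n k *\<^sub>s (X ^ k * Y ^ (n - k))) + Y * (\<Sum>k\<le>n. qbinom n k *\<^sub>s (X ^ k * Y ^ (n - k)))"
    by (simp add: Suc distrib_right)
  also have "X * (\<Sum>k\<le>n. qbinom n k *\<^sub>s (X ^ k * Y ^ (n - k))) = (\<Sum>k\<le>n. qbinom n k *\<^sub>s (X ^ Suc k * Y ^ (n - k)))"
    by (simp add: sum_distrib_left mult.assoc)
  also have "Y * (\<Sum>k\<le>n. qbinom n k *\<^sub>s (X ^ k * Y ^ (n - k))) = (\<Sum>k\<le>n. (\<zeta> ^ k * qbinom n k) *\<^sub>s (X ^ k * Y ^ (Suc n - k)))"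
    unfolding sum_distrib_left
  proof (rule sum.cong)
    fix k assume "k \<in> {..n}"
    then have "Y * Y ^ (n - k) = Y ^ (Suc n - k)" by (simp add: Suc_diff_le)
    then show "Y * (qbinom n k *\<^sub>s (X ^ k * Y ^ (n - k))) = (\<zeta> ^ k * qbinom n k) *\<^sub>s (X ^ k * Y ^ (Suc n - k))"
      using assoc_ext[OF YX, of k "Y ^ (n - k)"] by (simp add: mult.assoc mult.commute)
  qed simp
  also have "\<dots> = (\<Sum>k\<le>Suc n. (\<zeta> ^ k * qbinom n k) *\<^sub>s (X ^ k * Y ^ (Suc n - k)))" by (simp add: qbinom_gt)
  also have "\<dots> = Y ^ Suc n + (\<Sum>k\<le>n. (\<zeta> ^ Suc k * qbinom n (Suc k)) *\<^sub>s (X ^ Suc k * Y ^ (n - k)))"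
    by (subst sum.atMost_Suc_shift) simp
  finally have "(X + Y) ^ Suc n = Y ^ Suc n + (\<Sum>k\<le>n. qbinom (Suc n) (Suc k) *\<^sub>s (X ^ Suc k * Y ^ (n - k)))"
    by (simp add: scal_add_left sum.distrib algebra_simps)
  also have "\<dots> = (\<Sum>k\<le>Suc n. qbinom (Suc n) k *\<^sub>s (X ^ k * Y ^ (Suc n - k)))"
    by (subst sum.atMost_Suc_shift) simp
  finally show ?case .
qed simp

text \<open>Only the outer terms of the q-binomial expansion survive at a primitive d-th root of
  unity. Applied to the two summands of the coproducts of E and F, it gives E^d = F^d = 0 on tensor
  products.\<close>

lemma q_freshman:
  fixes X Y :: lop
  assumes "Y * X = \<zeta> *\<^sub>s (X * Y)" shows "(X + Y) ^ d = X ^ d + Y ^ d"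
proof -
  have "(X + Y) ^ d = (\<Sum>k\<in>{0, d}. qbinom d k *\<^sub>s (X ^ k * Y ^ (d - k)))"
    unfolding q_binomial[OF assms] by (rule sum.mono_neutral_right) (use qbinom_d in auto)
  then show ?thesis using d2 by (simp add: qbinom_diag add.commute)
qed

lemma ract_mat_op: "M \<in> DD \<Longrightarrow> ract M g = mat_op (rdim M) (rdim M) (act M g)"
  using D_wf[of M] by (simp add: act_def wf_rep_def)

section \<open>The tensor product of two modules and its traces\<close>

context
  fixes M N assumes M: "M \<in> DD" and N: "N \<in> DD"
begin

private abbreviation "t \<equiv> tn (rdim M) (rdim N)"
private abbreviation "LM \<equiv> ZZ M * KK M ^ (d - 1)"
private abbreviation "LN \<equiv> ZZ N * KK N ^ (d - 1)"

private lemma lL: "lin (rdim M) (rdim M) LM" using M act_pow_lin[OF M d0(2)] by blast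

private lemma tensor_acts: "act (D_tensor d M N) GE = t (ide M) (EE N) + t (EE M) (KK N)"
  "act (D_tensor d M N) GF = t (FF M) (ide N) + t LM (FF N)"
  "act (D_tensor d M N) GK = t (KK M) (KK N)" "act (D_tensor d M N) GZ = t (ZZ M) (ZZ N)" "rdim (D_tensor d M N) = rdim M * rdim N"
proof -
  have c: "ract M g \<in> carrier_mat (rdim M) (rdim M)" "ract N g \<in> carrier_mat (rdim N) (rdim N)" for g
    using M N by (auto simp: ract_mat_op)
  have L: "ract M GZ * ract M GK ^\<^sub>m (d - 1) = mat_op (rdim M) (rdim M) LM"
  proof -
    have "op_mat (ract M GZ * ract M GK ^\<^sub>m (d - 1)) = ZZ M * (ide M * KK M ^ (d - 1))"
      using c by (simp add: op_mat_mult[OF c(1) pow_carrier_mat[OF c(1)]] op_mat_pow[OF c(1)] act_def)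
    then have "op_mat (ract M GZ * ract M GK ^\<^sub>m (d - 1)) = LM" by (simp add: linsD[OF D_lin[OF M]])
    then show ?thesis using mat_op_op_mat[OF mult_carrier_mat[OF c(1) pow_carrier_mat[OF c(1)]], of GZ GK "d - 1"] by simp
  qed
  note k = kron_carrier[of _ "rdim M" "rdim M" _ "rdim N" "rdim N"]
  have cL: "ract M GZ * ract M GK ^\<^sub>m (d - 1) \<in> carrier_mat (rdim M) (rdim M)"
    using mult_carrier_mat[OF c(1) pow_carrier_mat[OF c(1)]] .
  have "act (D_tensor d M N) GE = op_mat (kron (1\<^sub>m (rdim M)) (ract N GE) + kron (ract M GE) (ract N GK))"
    by (simp add: act_def D_tensor_def)
  also have "\<dots> = op_mat (kron (1\<^sub>m (rdim M)) (ract N GE)) + op_mat (kron (ract M GE) (ract N GK))"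
    by (rule op_mat_add[OF k[OF one_carrier_mat c(2)] k[OF c]])
  finally show "act (D_tensor d M N) GE = t (ide M) (EE N) + t (EE M) (KK N)"
    by (simp only: tn_def mat_op_idn ract_mat_op[OF M] ract_mat_op[OF N])
  have "act (D_tensor d M N) GF = op_mat (kron (ract M GF) (1\<^sub>m (rdim N)) + kron (ract M GZ * ract M GK ^\<^sub>m (d - 1)) (ract N GF))"
    by (simp add: act_def D_tensor_def)
  also have "\<dots> = op_mat (kron (ract M GF) (1\<^sub>m (rdim N))) + op_mat (kron (ract M GZ * ract M GK ^\<^sub>m (d - 1)) (ract N GF))"
    by (rule op_mat_add[OF k[OF c(1) one_carrier_mat] k[OF cL c(2)]])
  finally show "act (D_tensor d M N) GF = t (FF M) (ide N) + t LM (FF N)"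
    unfolding L by (simp only: tn_def mat_op_idn ract_mat_op[OF M] ract_mat_op[OF N])
  have "act (D_tensor d M N) GK = op_mat (kron (ract M GK) (ract N GK))" "act (D_tensor d M N) GZ = op_mat (kron (ract M GZ) (ract N GZ))"
    by (simp_all add: act_def D_tensor_def)
  then show "act (D_tensor d M N) GK = t (KK M) (KK N)" "act (D_tensor d M N) GZ = t (ZZ M) (ZZ N)"
    by (simp_all only: tn_def ract_mat_op[OF M] ract_mat_op[OF N])
qed (simp add: D_tensor_def)

lemma D_tensor_D: "D_tensor d M N \<in> DD"
proof -
  let ?n = "rdim M * rdim N"
  note R = D_rels[OF M, unfolded rels_def] D_rels[OF N, unfolded rels_def]
  have lM: "lin (rdim M) (rdim M) (act M g)" "lin (rdim N) (rdim N) (act N g)" for g using M N by auto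
  have tm: "lin (rdim M) (rdim M) f \<Longrightarrow> lin (rdim N) (rdim N) g \<Longrightarrow> lin (rdim M) (rdim M) f' \<Longrightarrow> lin (rdim N) (rdim N) g' \<Longrightarrow>
    t f g * t f' g' = t (f * f') (g * g')" for f g f' g' by (rule tn_mult)
  have tp: "t f g ^ k = t (f ^ k) (g ^ k)" if "lin (rdim M) (rdim M) f" "lin (rdim N) (rdim N) g" "k > 0" for f g k
    using tn_power[OF that(1,2), of "k - 1"] that(3) by simp
  note s = tm lM lL linsD[OF lM(1)] linsD[OF lM(2)] linsD[OF lL]
  have ZK: "ZZ M * KK M ^ k = KK M ^ k * ZZ M" "KK M * KK M ^ k = KK M ^ k * KK M" "ZZ N * KK N ^ k = KK N ^ k * ZZ N" for k
    using power_intertwine[of "ZZ M" "KK M" "KK M" k] power_intertwine[of "ZZ N" "KK N" "KK N" k] D_comm(3)[OF M] D_comm(3)[OF N]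
    by (simp_all add: power_commutes)
  have ZL: "ZZ M * LM = LM * ZZ M" "KK M * LM = LM * KK M"
    by (simp_all only: mult.assoc D_comm'(3)[OF M, symmetric] ZK(1)[symmetric] ZK(2))
  have KE: "KK M * EE M = \<zeta> *\<^sub>s (EE M * KK M)" "KK N * EE N = \<zeta> *\<^sub>s (EE N * KK N)"
    "KK M * FF M = inverse \<zeta> *\<^sub>s (FF M * KK M)" "KK N * FF N = inverse \<zeta> *\<^sub>s (FF N * KK N)"
    using D_comm M N by blast+
  define A where "A g = (case g of GE \<Rightarrow> t (ide M) (EE N) + t (EE M) (KK N) | GF \<Rightarrow> t (FF M) (ide N) + t LM (FF N)
    | GK \<Rightarrow> t (KK M) (KK N) | GZ \<Rightarrow> t (ZZ M) (ZZ N))" for g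
  have "act (D_tensor d M N) g = A g" for g by (cases g) (simp_all add: A_def tensor_acts)
  then have act: "act (D_tensor d M N) = A" by blast
  have "rels ?n A" unfolding rels_def
  proof (intro conjI allI)
    show "lin ?n ?n (A g)" for g by (cases g) (auto simp: A_def)
    show "A GK ^ d = idn ?n" "A GZ ^ d = idn ?n" using R d0 by (simp_all add: A_def tp lM)
    have "A GE ^ d = t (ide M) (EE N) ^ d + t (EE M) (KK N) ^ d" unfolding A_def dgen.case
      by (rule q_freshman) (simp add: s KE tn_scal)
    then show "A GE ^ d = 0" using R d0 by (simp add: tp lM)
    have "A GF ^ d = t (FF M) (ide N) ^ d + t LM (FF N) ^ d" unfolding A_def dgen.case
      by (rule q_freshman) (simp only: tm[OF lL lM(2) lM(1) lin_idn] tm[OF lM(1) lin_idn lL lM(2)] D_Ki(2)[OF M] tn_scal linsD[OF lM(2)])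
    then show "A GF ^ d = 0" using R d0 by (simp add: tp[OF lM(1) lin_idn d0(1)] tp[OF lL lM(2) d0(1)] del: One_nat_def)
    show "A GZ * A GE = A GE * A GZ" by (simp add: A_def distrib_left distrib_right s D_comm[OF M] D_comm[OF N])
    show "A GZ * A GF = A GF * A GZ"
      by (simp only: A_def dgen.case distrib_left distrib_right tm[OF lM] tm[OF lM lL lM(2)] tm[OF lL lM(2) lM] tm[OF lM lM(1) lin_idn] tm[OF lM(1) lin_idn lM]
          D_comm[OF M] D_comm[OF N] ZL linsD[OF lM(2)])
    show "A GZ * A GK = A GK * A GZ" by (simp add: A_def s D_comm[OF M] D_comm[OF N])
    show "A GK * A GE = \<zeta> *\<^sub>s (A GE * A GK)"
      by (simp add: A_def distrib_left distrib_right s KE tn_scal scal_add_right)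
    show "A GK * A GF = inverse \<zeta> *\<^sub>s (A GF * A GK)"
      by (simp only: A_def dgen.case distrib_left distrib_right tm[OF lM lL lM(2)] tm[OF lL lM(2) lM] tm[OF lM lM(1) lin_idn] tm[OF lM(1) lin_idn lM]
          KE ZL linsD[OF lM(2)] tn_scal scal_add_right)
    have EF: "A GE * A GF = t (FF M) (EE N) + t LM (EE N * FF N) + t (EE M * FF M) (KK N) + t (EE M * LM) (KK N * FF N)"
      by (simp only: A_def dgen.case distrib_left distrib_right tm[OF lin_idn lM(2) lM(1) lin_idn] tm[OF lin_idn lM(2) lL lM(2)]
          tm[OF lM lM(1) lin_idn] tm[OF lM lL lM(2)] linsD[OF lM(1)] linsD[OF lM(2)] linsD[OF lL] add_ac)
    have FE: "A GF * A GE = t (FF M) (EE N) + t (FF M * EE M) (KK N) + t LM (FF N * EE N) + t (LM * EE M) (FF N * KK N)"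
      by (simp only: A_def dgen.case distrib_left distrib_right tm[OF lM(1) lin_idn lin_idn lM(2)] tm[OF lM(1) lin_idn lM]
          tm[OF lL lM(2) lin_idn lM(2)] tm[OF lL lM(2) lM] linsD[OF lM(1)] linsD[OF lM(2)] linsD[OF lL] add_ac)
    \<comment> \<open>The mixed terms of the commutator cancel: interchanging E with z K^(-1) in the
      first factor and K with F in the second costs the same power of \<zeta>.\<close>
    have cross: "t (EE M * LM) (KK N * FF N) = t (LM * EE M) (FF N * KK N)"
      by (simp only: KE D_Ki(1)[OF M] tn_scal)
    have KL: "A GZ * A GK ^ (d - 1) = t LM LN" unfolding A_def dgen.case tp[OF lM d0(2)]
      by (rule tm) (use lM act_pow_lin[OF M d0(2)] act_pow_lin[OF N d0(2)] in auto)
    have "A GE * A GF - A GF * A GE = (t LM (EE N * FF N) - t LM (FF N * EE N)) + (t (EE M * FF M) (KK N) - t (FF M * EE M) (KK N))"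
      unfolding EF FE cross by (simp add: algebra_simps)
    also have "t LM (EE N * FF N) - t LM (FF N * EE N) = t LM (KK N - LN)"
      unfolding tn_diff(2)[symmetric] by (simp only: D_EF[OF N] add_diff_cancel_left')
    also have "t (EE M * FF M) (KK N) - t (FF M * EE M) (KK N) = t (KK M - LM) (KK N)"
      unfolding tn_diff(1)[symmetric] by (simp only: D_EF[OF M] add_diff_cancel_left')
    also have "t LM (KK N - LN) + t (KK M - LM) (KK N) = t (KK M) (KK N) - t LM LN"
      by (simp only: tn_diff) simp
    finally show "A GE * A GF - A GF * A GE = A GK - A GZ * A GK ^ (d - 1)" unfolding KL by (simp add: A_def)
  qed
  moreover have "wf_rep (D_tensor d M N)"
  proof -
    have c: "ract M g \<in> carrier_mat (rdim M) (rdim M)" "ract N g \<in> carrier_mat (rdim N) (rdim N)" for g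
      using M N by (auto simp: ract_mat_op)
    have "ract M GZ * ract M GK ^\<^sub>m (d - 1) \<in> carrier_mat (rdim M) (rdim M)"
      using mult_carrier_mat[OF c(1) pow_carrier_mat[OF c(1)]] .
    then show ?thesis unfolding wf_rep_def D_tensor_def rep.sel
      using c by (auto split: dgen.splits intro!: kron_carrier add_carrier_mat)
  qed
  ultimately show ?thesis using tensor_acts(5) act by (simp add: D_modules_iff)
qed

lemma theta_tensor:
  assumes "a > 0" shows "theta (D_tensor d M N) a b = theta M a b * theta N a b"
proof -
  have lM: "lin (rdim M) (rdim M) (act M g)" "lin (rdim N) (rdim N) (act N g)" for g using M N by auto
  have tp: "t f g ^ k = t (f ^ k) (g ^ k)" if "lin (rdim M) (rdim M) f" "lin (rdim N) (rdim N) g" "k > 0" for f g k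
    using tn_power[OF that(1,2), of "k - 1"] that(3) by simp
  have "t (KK M) (KK N) ^ a * t (ZZ M) (ZZ N) ^ b = t (KK M ^ a * ZZ M ^ b) (KK N ^ a * ZZ N ^ b)"
  proof (cases "b = 0")
    case False
    then show ?thesis using lM act_pow_lin[OF M] act_pow_lin[OF N] assms by (simp add: tp tn_mult)
  qed (simp add: tp lM assms)
  then show ?thesis unfolding theta_def tensor_acts by (simp only: trc_tn)
qed

end

end

section \<open>Weight modules\<close>

text \<open>Monomial matrices are closed under composition, so that relations between them reduce to
  scalar identities at each basis vector. A column whose target lies out of range is zero, which is
  the source of the side conditions of the form
  \<open>\<alpha> j = 0 \<or> \<sigma> j < m\<close>.\<close>

definition wmono :: "nat \<Rightarrow> nat \<Rightarrow> (nat \<Rightarrow> complex) \<Rightarrow> (nat \<Rightarrow> nat) \<Rightarrow> lop" where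
  "wmono m n \<alpha> \<sigma> = op_mat (mat m n (\<lambda>(i, j). if i = \<sigma> j then \<alpha> j else 0))"

lemma lin_mono [intro, simp]: "lin m n (wmono m n \<alpha> \<sigma>)"
  unfolding wmono_def by (rule lin_op_mat) simp

lemma app_mono: "i < m \<Longrightarrow> j < n \<Longrightarrow> app (wmono m n \<alpha> \<sigma>) (delta j) i = (if i = \<sigma> j then \<alpha> j else 0)"
  unfolding wmono_def by (subst app_op_mat_delta) auto

lemma mono_eqI: "(\<And>j. j < n \<Longrightarrow> \<alpha> j = \<beta> j \<and> (\<alpha> j = 0 \<or> \<sigma> j = \<tau> j)) \<Longrightarrow> wmono m n \<alpha> \<sigma> = wmono m n \<beta> \<tau>"
  by (rule lin_eqI[of m n]) (simp_all add: app_mono del: delta_app, metis)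

lemma mono_delta: "j < n \<Longrightarrow> \<alpha> j = 0 \<or> \<sigma> j < m \<Longrightarrow> app (wmono m n \<alpha> \<sigma>) (delta j) = (\<lambda>i. \<alpha> j * delta (\<sigma> j) i)"
proof
  fix i assume j: "j < n" "\<alpha> j = 0 \<or> \<sigma> j < m"
  show "app (wmono m n \<alpha> \<sigma>) (delta j) i = \<alpha> j * delta (\<sigma> j) i"
  proof (cases "i < m")
    case True
    then show ?thesis using j by (auto simp: app_mono)
  next
    case False
    then show ?thesis using j app_lin_outside[OF lin_mono, of m i n \<alpha> \<sigma>] by auto
  qed
qed

lemma mono_mult:
  assumes "\<And>j. j < n \<Longrightarrow> \<beta> j = 0 \<or> \<tau> j < k"
  shows "wmono m k \<alpha> \<sigma> * wmono k n \<beta> \<tau> = wmono m n (\<lambda>j. \<beta> j * \<alpha> (\<tau> j)) (\<lambda>j. \<sigma> (\<tau> j))"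
proof (rule lin_eqI[of m n])
  fix i j assume ij: "i < m" "j < n"
  have "app (wmono m k \<alpha> \<sigma> * wmono k n \<beta> \<tau>) (delta j) i = \<beta> j * app (wmono m k \<alpha> \<sigma>) (delta (\<tau> j)) i"
    using mono_delta[of j n \<beta> \<tau> k, OF ij(2) assms[OF ij(2)]] by (simp add: app_cmult del: delta_app)
  also have "\<dots> = app (wmono m n (\<lambda>j. \<beta> j * \<alpha> (\<tau> j)) (\<lambda>j. \<sigma> (\<tau> j))) (delta j) i"
    using ij assms[OF ij(2)] by (auto simp: app_mono simp del: delta_app)
  finally show "app (wmono m k \<alpha> \<sigma> * wmono k n \<beta> \<tau>) (delta j) i = app (wmono m n (\<lambda>j. \<beta> j * \<alpha> (\<tau> j)) (\<lambda>j. \<sigma> (\<tau> j))) (delta j) i" .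
qed auto

lemma mono_scal: "c *\<^sub>s wmono m n \<alpha> \<sigma> = wmono m n (\<lambda>j. c * \<alpha> j) \<sigma>"
  and mono_diff: "wmono m n \<alpha> \<sigma> - wmono m n \<beta> \<sigma> = wmono m n (\<lambda>j. \<alpha> j - \<beta> j) \<sigma>"
  and mono_idn: "idn n = wmono n n (\<lambda>j. 1) (\<lambda>j. j)"
  and mono_zero: "0 = wmono m n (\<lambda>j. 0) \<sigma>"
  by (rule lin_eqI[of m n] lin_eqI[of n n]; auto simp: app_mono simp del: delta_app; simp)+

lemma mono_power:
  assumes "\<And>j. j < n \<Longrightarrow> \<sigma> j < n"
  shows "idn n * wmono n n \<alpha> \<sigma> ^ k = wmono n n (\<lambda>j. \<Prod>i<k. \<alpha> ((\<sigma> ^^ i) j)) (\<sigma> ^^ k)"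
proof (induction k)
  case (Suc k)
  have s: "(\<sigma> ^^ k) j < n" if "j < n" for j using that assms by (induction k) auto
  have "idn n * wmono n n \<alpha> \<sigma> ^ Suc k = wmono n n \<alpha> \<sigma> * (idn n * wmono n n \<alpha> \<sigma> ^ k)"
    using lin_left'[OF lin_mono] lin_right'[OF lin_mono] by (metis power_Suc)
  also have "\<dots> = wmono n n (\<lambda>j. (\<Prod>i<k. \<alpha> ((\<sigma> ^^ i) j)) * \<alpha> ((\<sigma> ^^ k) j)) (\<lambda>j. \<sigma> ((\<sigma> ^^ k) j))"
    unfolding Suc by (rule mono_mult) (use s in auto)
  finally show ?case by (simp add: comp_def)
qed (simp add: mono_idn id_def)

lemma mono_power': "k > 0 \<Longrightarrow> (\<And>j. j < n \<Longrightarrow> \<sigma> j < n) \<Longrightarrow> wmono n n \<alpha> \<sigma> ^ k = wmono n n (\<lambda>j. \<Prod>i<k. \<alpha> ((\<sigma> ^^ i) j)) (\<sigma> ^^ k)"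
  using mono_power[of n \<sigma> \<alpha> k] lin_left[OF lin_power[OF lin_mono]] by metis

lemma mono_diag_power: "k > 0 \<Longrightarrow> wmono n n \<alpha> (\<lambda>j. j) ^ k = wmono n n (\<lambda>j. \<alpha> j ^ k) (\<lambda>j. j)"
proof -
  have "((\<lambda>j. j) ^^ i) = (\<lambda>j::nat. j)" for i by (induction i) auto
  then show "k > 0 \<Longrightarrow> ?thesis" by (simp add: mono_power')
qed

text \<open>The index shift of E, closed up to a cycle so that one format covers the simple modules,
  where the coefficient at 0 vanishes, and the glued modules, where E leads from the first vector to
  the last.\<close>

definition cyc :: "nat \<Rightarrow> nat \<Rightarrow> nat" where "cyc n j = (if j = 0 then n - 1 else j - 1)"

lemma cyc_pow: "j < n \<Longrightarrow> k \<le> n \<Longrightarrow> (cyc n ^^ k) j = (if k \<le> j then j - k else j + n - k)"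
  by (induction k) (auto simp: cyc_def)

context taft
begin

definition wact :: "nat \<Rightarrow> (nat \<Rightarrow> complex) \<Rightarrow> (nat \<Rightarrow> complex) \<Rightarrow> (nat \<Rightarrow> complex) \<Rightarrow> complex \<Rightarrow> dgen \<Rightarrow> lop" where
  "wact n \<alpha> \<phi> \<kappa> c g = (case g of GE \<Rightarrow> wmono n n \<alpha> (cyc n) | GF \<Rightarrow> wmono n n \<phi> Suc
     | GK \<Rightarrow> wmono n n \<kappa> (\<lambda>j. j) | GZ \<Rightarrow> c *\<^sub>s idn n)"

text \<open>E^d vanishes because n \<le> d consecutive steps of the cycle meet the index w with zero
  coefficient. The hypothesis \<open>EF\<close> is the relation for [E, F] evaluated on a basis
  vector.\<close>

lemma rels_wact:
  assumes n: "n > 0" "n \<le> d" and \<kappa>: "\<And>j. j < n \<Longrightarrow> \<kappa> j ^ d = 1" and c: "c ^ d = 1"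
    and \<phi>: "\<And>j. Suc j < n \<Longrightarrow> \<phi> j \<noteq> 0 \<Longrightarrow> \<kappa> (Suc j) = inverse \<zeta> * \<kappa> j" "\<phi> (n - 1) = 0"
    and \<alpha>: "\<And>j. j < n \<Longrightarrow> \<alpha> j \<noteq> 0 \<Longrightarrow> \<kappa> (cyc n j) = \<zeta> * \<kappa> j" and nil: "w < n" "\<alpha> w = 0"
    and EF: "\<And>j. j < n \<Longrightarrow> \<phi> j * \<alpha> (Suc j) - (if j = 0 then 0 else \<alpha> j * \<phi> (j - 1)) = \<kappa> j - c * \<kappa> j ^ (d - 1)"
  shows "rels n (wact n \<alpha> \<phi> \<kappa> c)"
proof -
  have fb: "\<phi> j = 0 \<or> Suc j < n" if "j < n" for j using that \<phi>(2) by (cases "Suc j = n") auto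
  have cb: "cyc n j < n" if "j < n" for j using that by (auto simp: cyc_def)
  have mD: "wmono n n a s * wmono n n b (\<lambda>j. j) = wmono n n (\<lambda>j. b j * a j) s" for a b s
    by (subst mono_mult) auto
  have mE: "wmono n n a s * wmono n n b (cyc n) = wmono n n (\<lambda>j. b j * a (cyc n j)) (\<lambda>j. s (cyc n j))" for a b s
    by (rule mono_mult) (simp add: cb)
  have mF: "wmono n n a s * wmono n n \<phi> Suc = wmono n n (\<lambda>j. \<phi> j * a (Suc j)) (\<lambda>j. s (Suc j))" for a s
    by (rule mono_mult) (rule fb)
  show ?thesis unfolding rels_def wact_def dgen.case
  proof (intro conjI allI)
    show "lin n n (case g of GE \<Rightarrow> wmono n n \<alpha> (cyc n) | GF \<Rightarrow> wmono n n \<phi> Suc | GK \<Rightarrow> wmono n n \<kappa> (\<lambda>j. j) | GZ \<Rightarrow> c *\<^sub>s idn n)" for g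
      by (cases g) auto
    show "wmono n n \<kappa> (\<lambda>j. j) ^ d = idn n"
      unfolding mono_idn mono_diag_power[OF d0(1)] by (rule mono_eqI) (simp add: \<kappa>)
    have "(c *\<^sub>s idn n) ^ Suc k = c ^ Suc k *\<^sub>s idn n" for k
    proof (induction k)
      case (Suc k)
      show ?case by (subst power_Suc, subst Suc) (simp add: ac_simps)
    qed simp
    from this[of "d - 1"] show "(c *\<^sub>s idn n) ^ d = idn n" using d0 c by simp
    have "wmono n n (\<lambda>j. \<Prod>i<d. \<alpha> ((cyc n ^^ i) j)) (cyc n ^^ d) = wmono n n (\<lambda>j. 0) (cyc n ^^ d)"
    proof (rule mono_eqI)
      fix j assume j: "j < n"
      define i where "i = (if w \<le> j then j - w else j + n - w)"
      have "i < d" "(cyc n ^^ i) j = w" using j nil n cyc_pow[OF j, of i] by (auto simp: i_def)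
      then have "(\<Prod>i<d. \<alpha> ((cyc n ^^ i) j)) = 0" using nil(2) by auto
      then show "(\<Prod>i<d. \<alpha> ((cyc n ^^ i) j)) = 0 \<and> ((\<Prod>i<d. \<alpha> ((cyc n ^^ i) j)) = 0 \<or> (cyc n ^^ d) j = (cyc n ^^ d) j)" by simp
    qed
    also have "\<dots> = 0" by (rule mono_zero[symmetric])
    finally show "wmono n n \<alpha> (cyc n) ^ d = 0" by (subst mono_power'[OF d0(1) cb])
    show "wmono n n \<phi> Suc ^ d = 0"
    proof -
      \<comment> \<open>\<open>Suc\<close> leaves the range at n - 1, where the coefficient of F is
        zero. Redirecting it to 0 gives a self-map of the index set, to which the power formula
        applies.\<close>
      define st where "st j = (if Suc j < n then Suc j else 0)" for j
      have "wmono n n \<phi> Suc = wmono n n \<phi> st" by (rule mono_eqI) (use fb in \<open>auto simp: st_def\<close>)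
      also have "\<dots> ^ d = wmono n n (\<lambda>j. \<Prod>i<d. \<phi> ((st ^^ i) j)) (st ^^ d)"
        by (rule mono_power'[OF d0(1)]) (use n in \<open>simp add: st_def\<close>)
      also have "\<dots> = wmono n n (\<lambda>j. 0) (st ^^ d)"
      proof (rule mono_eqI)
        fix j assume j: "j < n"
        have "(st ^^ i) j = j + i" if "j + i < n" for i using that by (induction i) (auto simp: st_def)
        from this[of "n - 1 - j"] have "(st ^^ (n - 1 - j)) j = n - 1" using j by simp
        then have "(\<Prod>i<d. \<phi> ((st ^^ i) j)) = 0"
          using \<phi>(2) j n by (intro prod_zero bexI[of _ "n - 1 - j"]) auto
        then show "(\<Prod>i<d. \<phi> ((st ^^ i) j)) = 0 \<and> ((\<Prod>i<d. \<phi> ((st ^^ i) j)) = 0 \<or>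
          (st ^^ d) j = (st ^^ d) j)" by simp
      qed
      also have "\<dots> = 0" by (rule mono_zero[symmetric])
      finally show ?thesis .
    qed
    show "c *\<^sub>s idn n * wmono n n \<alpha> (cyc n) = wmono n n \<alpha> (cyc n) * c *\<^sub>s idn n"
      "c *\<^sub>s idn n * wmono n n \<phi> Suc = wmono n n \<phi> Suc * c *\<^sub>s idn n"
      "c *\<^sub>s idn n * wmono n n \<kappa> (\<lambda>j. j) = wmono n n \<kappa> (\<lambda>j. j) * c *\<^sub>s idn n"
      by (simp_all add: linsD[OF lin_mono])
    show "wmono n n \<kappa> (\<lambda>j. j) * wmono n n \<alpha> (cyc n) = \<zeta> *\<^sub>s (wmono n n \<alpha> (cyc n) * wmono n n \<kappa> (\<lambda>j. j))"
      unfolding mE mD mono_scal by (rule mono_eqI) (use \<alpha> in auto)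
    show "wmono n n \<kappa> (\<lambda>j. j) * wmono n n \<phi> Suc = inverse \<zeta> *\<^sub>s (wmono n n \<phi> Suc * wmono n n \<kappa> (\<lambda>j. j))"
      unfolding mF mD mono_scal by (rule mono_eqI) (use \<phi>(1) fb in force)
    have "wmono n n \<alpha> (cyc n) * wmono n n \<phi> Suc - wmono n n \<phi> Suc * wmono n n \<alpha> (cyc n) =
       wmono n n (\<lambda>j. \<phi> j * \<alpha> (Suc j)) (\<lambda>j. j) - wmono n n (\<lambda>j. if j = 0 then 0 else \<alpha> j * \<phi> (j - 1)) (\<lambda>j. j)"
    proof (rule arg_cong2[where f = "(-)"])
      show "wmono n n \<alpha> (cyc n) * wmono n n \<phi> Suc = wmono n n (\<lambda>j. \<phi> j * \<alpha> (Suc j)) (\<lambda>j. j)"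
        unfolding mF by (rule mono_eqI) (auto simp: cyc_def)
      show "wmono n n \<phi> Suc * wmono n n \<alpha> (cyc n) = wmono n n (\<lambda>j. if j = 0 then 0 else \<alpha> j * \<phi> (j - 1)) (\<lambda>j. j)"
        unfolding mE by (rule mono_eqI) (use \<phi>(2) in \<open>auto simp: cyc_def\<close>)
    qed
    also have "\<dots> = wmono n n \<kappa> (\<lambda>j. j) - c *\<^sub>s wmono n n (\<lambda>j. \<kappa> j ^ (d - 1)) (\<lambda>j. j)"
      unfolding mono_diff mono_scal by (rule mono_eqI) (use EF in auto)
    also have "c *\<^sub>s wmono n n (\<lambda>j. \<kappa> j ^ (d - 1)) (\<lambda>j. j) = c *\<^sub>s idn n * wmono n n \<kappa> (\<lambda>j. j) ^ (d - 1)"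
      unfolding mono_diag_power[OF d0(2)] by (simp add: linsD[OF lin_mono])
    finally show "wmono n n \<alpha> (cyc n) * wmono n n \<phi> Suc - wmono n n \<phi> Suc * wmono n n \<alpha> (cyc n) =
       wmono n n \<kappa> (\<lambda>j. j) - c *\<^sub>s idn n * wmono n n \<kappa> (\<lambda>j. j) ^ (d - 1)" .
  qed
qed

section \<open>The modules M_{l,p} as weight modules\<close>

definition ecoef :: "nat \<Rightarrow> nat \<Rightarrow> nat \<Rightarrow> complex" where
  "ecoef l p j = \<zeta> ^ p * qnum \<zeta> j * (\<zeta> ^ (l - j) - 1)"

lemma ecoef_0 [simp]: "ecoef l p 0 = 0" and ecoef_l [simp]: "ecoef l p l = 0"
  by (simp_all add: ecoef_def)

lemma ecoef_nz: "0 < j \<Longrightarrow> j < l \<Longrightarrow> l \<le> d \<Longrightarrow> ecoef l p j \<noteq> 0"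
proof -
  assume *: "0 < j" "j < l" "l \<le> d"
  then have "j \<in> {1..<d}" "l - j \<in> {1..<d}" by auto
  then show ?thesis using qnum_nz[of j] zeta_pow_neq_1[of "l - j"] zeta_nz by (simp add: ecoef_def)
qed

text \<open>This is [E, F] = K - z K^(-1) on the basis vector of index j: the two powers of \<zeta>
  are the eigenvalues of K and of z K^(-1).\<close>

lemma ecoef_diff: "j < l \<Longrightarrow> ecoef l p (Suc j) - ecoef l p j = \<zeta> ^ (p + (l - 1 - j)) - \<zeta> ^ (p + j)"
proof -
  assume "j < l"
  then obtain k where k: "l = Suc (j + k)" using less_iff_Suc_add by auto
  have "qnum \<zeta> (Suc j) * \<zeta> ^ k = \<zeta> ^ k + qnum \<zeta> j * \<zeta> ^ Suc k" unfolding qnum_Suc' by (simp add: algebra_simps)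
  then have "qnum \<zeta> (Suc j) * (\<zeta> ^ k - 1) - qnum \<zeta> j * (\<zeta> ^ Suc k - 1) = \<zeta> ^ k - \<zeta> ^ j"
    by (simp add: qnum_Suc algebra_simps)
  from arg_cong[OF this, of "\<lambda>x. \<zeta> ^ p * x"] show ?thesis
    by (simp add: ecoef_def k Suc_diff_le power_add algebra_simps)
qed

lemma zeta_inverse: "m + k = q \<Longrightarrow> (\<zeta> ^ m) ^ (d - 1) * \<zeta> ^ q = \<zeta> ^ k"
proof -
  assume "m + k = q"
  moreover have "(\<zeta> ^ m) ^ (d - 1) * \<zeta> ^ m = (\<zeta> ^ m) ^ d" using d0 by (metis Suc_diff_1 power_Suc2)
  moreover have "(\<zeta> ^ m) ^ d = 1" by (simp add: zeta_pow_d mult.commute flip: power_mult) (simp add: power_mult zeta_pow_d)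
  ultimately show ?thesis by (simp add: power_add mult.assoc[symmetric] flip: \<open>m + k = q\<close>)
qed

lemma zeta_pow_pow_d: "(\<zeta> ^ m) ^ d = 1"
  by (subst power_mult[symmetric], subst mult.commute, subst power_mult) (simp add: zeta_pow_d)

lemma zeta_pow_add_d: "\<zeta> ^ (m + d) = \<zeta> ^ m" by (simp add: power_add zeta_pow_d)

lemma zeta_pow_mod: "\<zeta> ^ (m mod d) = \<zeta> ^ m"
proof -
  have "\<zeta> ^ m = \<zeta> ^ (d * (m div d) + m mod d)" by simp
  also have "\<dots> = \<zeta> ^ (m mod d)" by (simp only: power_add power_mult zeta_pow_d) simp
  finally show ?thesis by simp
qed

lemma zeta_pow_cong: "m mod d = k mod d \<Longrightarrow> \<zeta> ^ m = \<zeta> ^ k"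
  by (metis zeta_pow_mod)

definition sphi :: "nat \<Rightarrow> nat \<Rightarrow> complex" where "sphi l j = (if Suc j < l then 1 else 0)"
definition skappa :: "nat \<Rightarrow> nat \<Rightarrow> nat \<Rightarrow> complex" where "skappa l p j = \<zeta> ^ (p + (l - 1 - j))"
definition szed :: "nat \<Rightarrow> nat \<Rightarrow> complex" where "szed l p = \<zeta> ^ (2 * p + l - 1)"

lemma act_D_simple: "act (D_simple \<zeta> (l, p)) = wact l (ecoef l p) (sphi l) (skappa l p) (szed l p)"
  and rdim_D_simple [simp]: "rdim (D_simple \<zeta> (l, p)) = l"
proof
  fix g
  show "act (D_simple \<zeta> (l, p)) g = wact l (ecoef l p) (sphi l) (skappa l p) (szed l p) g"
  proof (cases g)
    case GE
    have "mat l l (\<lambda>(i, j). if j = i + 1 then \<zeta> ^ p * qnum \<zeta> j * (\<zeta> ^ (l - j) - 1) else 0) =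
      mat l l (\<lambda>(i, j). if i = cyc l j then ecoef l p j else 0)"
      by (rule eq_matI) (auto simp: ecoef_def cyc_def)
    then show ?thesis using GE by (simp add: act_def D_simple_def wact_def wmono_def)
  next
    case GF
    have "mat l l (\<lambda>(i, j). if i = j + 1 then 1 else 0) = mat l l (\<lambda>(i, j). if i = Suc j then sphi l j else 0)"
      by (rule eq_matI) (auto simp: sphi_def)
    then show ?thesis using GF by (simp add: act_def D_simple_def wact_def wmono_def)
  next
    case GK
    have "mat l l (\<lambda>(i, j). if i = j then \<zeta> ^ (p + l - (i + 1)) else 0) = mat l l (\<lambda>(i, j). if i = j then skappa l p j else 0)"
      by (rule eq_matI) (auto simp: skappa_def intro!: arg_cong[where f = "\<lambda>x. \<zeta> ^ x"])
    then show ?thesis using GK by (simp add: act_def D_simple_def wact_def wmono_def)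
  next
    case GZ
    then show ?thesis by (simp add: act_def D_simple_def wact_def szed_def op_mat_smult)
  qed
qed (simp add: D_simple_def)

lemma D_simple_D [intro]:
  assumes "0 < l" "l \<le> d" shows "D_simple \<zeta> (l, p) \<in> DD"
proof -
  have "rels l (wact l (ecoef l p) (sphi l) (skappa l p) (szed l p))"
  proof (rule rels_wact[OF assms, where w = 0])
    fix j assume j: "j < l"
    show "skappa l p j ^ d = 1" by (simp add: skappa_def zeta_pow_pow_d)
    show "skappa l p (cyc l j) = \<zeta> * skappa l p j" if nz: "ecoef l p j \<noteq> 0"
    proof -
      have "j \<noteq> 0" using nz by (rule contrapos_nn) simp
      then have "l - 1 - (j - 1) = Suc (l - 1 - j)" using j by simp
      then show ?thesis using \<open>j \<noteq> 0\<close> by (simp add: skappa_def cyc_def)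
    qed
    have "szed l p * skappa l p j ^ (d - 1) = \<zeta> ^ (p + j)"
      using zeta_inverse[of "p + (l - 1 - j)" "p + j" "2 * p + l - 1"] j by (simp add: szed_def skappa_def mult.commute)
    then have A: "szed l p * skappa l p j ^ (d - 1) = \<zeta> ^ (p + j)" .
    have B: "sphi l j * ecoef l p (Suc j) = ecoef l p (Suc j)" using j
      by (cases "Suc j = l") (auto simp: sphi_def)
    have C: "(if j = 0 then 0 else ecoef l p j * sphi l (j - 1)) = ecoef l p j" using j by (auto simp: sphi_def)
    show "sphi l j * ecoef l p (Suc j) - (if j = 0 then 0 else ecoef l p j * sphi l (j - 1)) =
       skappa l p j - szed l p * skappa l p j ^ (d - 1)"
      unfolding A B C using ecoef_diff[OF j, of p] by (simp only: skappa_def)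
  next
    fix j assume j: "Suc j < l"
    then have "l - 1 - j = Suc (l - 1 - Suc j)" by simp
    then show "skappa l p (Suc j) = inverse \<zeta> * skappa l p j" using zeta_nz by (simp add: skappa_def)
  qed (use assms in \<open>auto simp: szed_def zeta_pow_pow_d sphi_def\<close>)
  moreover have "wf_rep (D_simple \<zeta> (l, p))" by (auto simp: wf_rep_def D_simple_def split: dgen.splits)
  ultimately show ?thesis by (simp add: D_modules_iff act_D_simple)
qed

lemma theta_D_simple:
  assumes "a > 0" shows "theta (D_simple \<zeta> (l, p)) a b = szed l p ^ b * (\<Sum>j<l. skappa l p j ^ a)"
proof -
  have "wmono l l (skappa l p) (\<lambda>j. j) ^ a * (szed l p *\<^sub>s idn l) ^ b = szed l p ^ b *\<^sub>s wmono l l (skappa l p) (\<lambda>j. j) ^ a"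
    (is "?K * _ = _")
  proof (induction b)
    case (Suc b)
    have "?K * (szed l p *\<^sub>s idn l) ^ Suc b = (?K * (szed l p *\<^sub>s idn l) ^ b) * (szed l p *\<^sub>s idn l)"
      by (simp add: power_commutes mult.assoc del: power_Suc flip: power_Suc2)
    also have "\<dots> = szed l p ^ Suc b *\<^sub>s ?K" unfolding Suc
      using lin_right[OF lin_power[OF lin_mono assms]] by (simp add: mult.commute)
    finally show ?case .
  qed simp
  then have "theta (D_simple \<zeta> (l, p)) a b = szed l p ^ b * trc l (wmono l l (\<lambda>j. skappa l p j ^ a) (\<lambda>j. j))"
    using assms by (simp add: theta_def act_D_simple wact_def trc_scal mono_diag_power)
  then show ?thesis by (simp add: trc_def app_mono del: delta_app)
qed

text \<open>The cycle is interrupted at the single index e, so E runs from the index after the gap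
  through the whole basis in d - 1 steps. Sending the last vector back to the first, suitably
  normalised, gives t; its trace fixes the first vector and, being E-linear, the entire
  basis.\<close>

lemma ctr_cyclic:
  assumes M: "M \<in> DD" "rdim M = d" and E: "\<And>j. j < d \<Longrightarrow> EE M * eij j 0 = \<alpha> j *\<^sub>s eij (cyc d j) 0"
    and e: "e < d" "\<And>j. j < d \<Longrightarrow> j \<noteq> e \<Longrightarrow> \<alpha> j \<noteq> 0"
  shows "ctr M"
proof -
  define s where "s = cyc d e"
  have s: "s < d" using e by (auto simp: s_def cyc_def)
  define \<gamma> where "\<gamma> k = (\<Prod>i<k. \<alpha> ((cyc d ^^ i) s))" for k
  have cs: "(cyc d ^^ k) s < d" "(cyc d ^^ k) s = e \<longleftrightarrow> k = d - 1" if "k < d" for k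
    using cyc_pow[OF s, of k] that e s by (auto simp: s_def cyc_def split: if_splits)
  have \<gamma>: "\<gamma> k \<noteq> 0" if "k < d" for k unfolding \<gamma>_def
    using cs e(2) that by (auto simp: prod_zero_iff)
  have Ek: "EE M ^ k * eij s 0 = \<gamma> k *\<^sub>s eij ((cyc d ^^ k) s) 0" if "k < d" for k using that
  proof (induction k)
    case (Suc k)
    then show ?case using E[OF cs(1), of k] by (simp add: \<gamma>_def mult.assoc)
  qed (simp add: \<gamma>_def)
  \<comment> \<open>The functional that reads off the coefficient of the last vector of the
    E-string, scaled to take the value 1 on E^(d-1) applied to its first vector.\<close>
  define y where "y = (1 / \<gamma> (d - 1)) *\<^sub>s eij 0 e"
  have yE: "y * (EE M ^ k * eij s 0) = (if k = d - 1 then eij 0 0 else 0)" if "k < d" for k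
    unfolding Ek[OF that] y_def using \<gamma>[of "d - 1"] cs(2)[OF that] d0 by (auto simp: eij_mult)
  define t where "t = eij s 0 * y"
  have tE: "t * (EE M ^ k * eij s 0) = (if k = d - 1 then eij s 0 else 0)" if "k < d" for k
    unfolding t_def mult.assoc yE[OF that] by (simp add: eij_mult)
  have lt: "lin d d t" unfolding t_def y_def using s e by (intro lin_mult[of _ 1] lin_scal lin_eij) auto
  define T where "T = trE (EE M) (EE M) d t"
  have "trE (EE M) (EE M) k t * eij s 0 = 0" if "k \<le> d - 1" for k using that
  proof (induction k)
    case (Suc k)
    then show ?case using tE[of k] by (simp add: distrib_right mult.assoc)
  qed simp
  from this[of "d - 1"] have Ts: "T * eij s 0 = eij s 0"
    using tE[of "d - 1"] d0 trE.simps(2)[of "EE M" "EE M" "d - 1" t] by (simp add: T_def distrib_right mult.assoc del: trE.simps)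
  have elT: "elin M M T" unfolding T_def using elin_trE[OF M(1) M(1)] lt M(2) by simp
  have TE: "T * (EE M ^ k * x) = EE M ^ k * (T * x)" for k x
    using assoc_ext[OF power_intertwine[OF elin_act[OF elT]], of k x] by (simp add: mult.assoc)
  have Tj: "T * eij j 0 = eij j 0" if j: "j < d" for j
  proof -
    define k where "k = (if j \<le> s then s - j else s + d - j)"
    have k: "k < d" "(cyc d ^^ k) s = j" using j s cyc_pow[OF s, of k] by (auto simp: k_def)
    have "\<gamma> k *\<^sub>s (T * eij j 0) = \<gamma> k *\<^sub>s eij j 0"
      using TE[of k "eij s 0"] Ts Ek[OF k(1)] k(2) by simp
    then show ?thesis using scal_cancel \<gamma>[OF k(1)] by blast
  qed
  have "T = idn d"
  proof (rule lin_eqI[of d d])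
    fix i j assume "i < d" "j < d"
    have "app (eij j 0) (delta 0) = delta j" by (auto simp: fun_eq_iff)
    then show "app T (delta j) i = app (idn d) (delta j) i"
      using arg_cong[OF Tj[OF \<open>j < d\<close>], of "\<lambda>f. app f (delta 0) i"] \<open>i < d\<close> by simp
  qed (use elin_lin[OF elT] M in auto)
  then show ?thesis unfolding ctr_def using M(2) lt by (intro enullI[of M M t]) (auto simp: T_def)
qed

lemma mono_eij: "j < n \<Longrightarrow> \<alpha> j = 0 \<or> \<sigma> j < m \<Longrightarrow> wmono m n \<alpha> \<sigma> * eij j 0 = \<alpha> j *\<^sub>s eij (\<sigma> j) 0"
proof (rule lop_eqI)
  fix v i assume *: "j < n" "\<alpha> j = 0 \<or> \<sigma> j < m"
  have "app (eij j 0) v = (\<lambda>i. v 0 * delta j i)" by (auto simp: fun_eq_iff)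
  then show "app (wmono m n \<alpha> \<sigma> * eij j 0) v i = app (\<alpha> j *\<^sub>s eij (\<sigma> j) 0) v i"
    using mono_delta[of j n \<alpha> \<sigma> m] * by (simp add: app_cmult del: delta_app) simp
qed

lemma ctr_D_simple_d: "ctr (D_simple \<zeta> (d, p))"
proof (rule ctr_cyclic[where \<alpha> = "ecoef d p" and e = 0])
  fix j assume "j < d"
  then show "EE (D_simple \<zeta> (d, p)) * eij j 0 = ecoef d p j *\<^sub>s eij (cyc d j) 0"
    unfolding act_D_simple wact_def dgen.case by (intro mono_eij) (auto simp: cyc_def)
qed (use d0 ecoef_nz in auto)

text \<open>The module \<open>W\<^bsub>l,p\<^esub>\<close> glues \<open>M\<^bsub>l,p\<^esub>\<close> on top of \<open>M\<^bsub>\<iota>(l,p)\<^esub>\<close> by letting \<open>E\<close> send the vector \<open>e\<^sub>1\<close> of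
  the former to the last basis vector of the latter; then \<open>E\<close> has a single Jordan block of size \<open>d\<close>.\<close>

lemma iota_sequence:
  assumes l: "0 < l" "l < d"
  obtains W i q r1 r2 where "W \<in> DD" "ctr W" "ses (D_simple \<zeta> (d - l, p + l)) i W q (D_simple \<zeta> (l, p)) r1 r2"
proof -
  \<comment> \<open>The value 1 at index 0 is the glue, since \<open>cyc d 0 = d - 1\<close> is the
    last vector of the submodule. The only remaining zero coefficient is at index l.\<close>
  define \<alpha> where "\<alpha> j = (if j = 0 then 1 else if j < l then ecoef l p j else ecoef (d - l) (p + l) (j - l))" for j
  \<comment> \<open>F stops at the end of each of the two pieces, so only E connects them.\<close>
  define \<phi> :: "nat \<Rightarrow> complex" where "\<phi> j = (if Suc j = l \<or> Suc j = d then 0 else 1)" for j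
  define \<kappa> where "\<kappa> j = \<zeta> ^ (p + l + (d - 1 - j))" for j
  define A where "A = wact d \<alpha> \<phi> \<kappa> (szed l p)"
  have \<kappa>1: "\<kappa> j = skappa l p j" if "j < l" for j
  proof -
    have "p + l + (d - 1 - j) = p + (l - 1 - j) + d" using that l by simp
    then show ?thesis by (simp only: \<kappa>_def skappa_def zeta_pow_add_d)
  qed
  have \<kappa>2: "\<kappa> (j + l) = skappa (d - l) (p + l) j" if "j < d - l" for j
    using that l by (simp add: \<kappa>_def skappa_def)
  \<comment> \<open>Gluing requires that z act by the same scalar on both pieces; this is the reason
    for the shift p + l in \<iota>.\<close>
  have z2: "szed (d - l) (p + l) = szed l p"
  proof -
    have "2 * (p + l) + (d - l) - 1 = 2 * p + l - 1 + d" using l by simp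
    then show ?thesis by (simp only: szed_def zeta_pow_add_d)
  qed
  have R: "rels d A" unfolding A_def
  proof (rule rels_wact[OF d0(1) order_refl, where w = l])
    fix j assume j: "j < d"
    show "\<kappa> j ^ d = 1" by (simp add: \<kappa>_def zeta_pow_pow_d)
    show "\<kappa> (cyc d j) = \<zeta> * \<kappa> j"
    proof (cases "j = 0")
      case True
      have "p + l + d = Suc (p + l + (d - 1))" using d0 by simp
      then have "\<zeta> ^ (p + l) = \<zeta> * \<zeta> ^ (p + l + (d - 1))" by (metis power_Suc zeta_pow_add_d)
      then show ?thesis using True by (simp add: \<kappa>_def cyc_def)
    next
      case False
      then have "d - 1 - (j - 1) = Suc (d - 1 - j)" using j by simp
      then show ?thesis using False by (simp add: \<kappa>_def cyc_def)
    qed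
    have "(\<zeta> ^ (p + l + (d - 1 - j))) ^ (d - 1) * \<zeta> ^ (2 * p + l - 1 + d) = \<zeta> ^ (p + j)"
      by (rule zeta_inverse) (use j l in simp)
    then have zk: "szed l p * \<kappa> j ^ (d - 1) = \<zeta> ^ (p + j)" by (simp add: szed_def \<kappa>_def zeta_pow_add_d mult.commute)
    show "\<phi> j * \<alpha> (Suc j) - (if j = 0 then 0 else \<alpha> j * \<phi> (j - 1)) = \<kappa> j - szed l p * \<kappa> j ^ (d - 1)"
    proof (cases "j < l")
      case True
      have "\<phi> j * \<alpha> (Suc j) = ecoef l p (Suc j)" using True l by (cases "Suc j = l") (auto simp: \<phi>_def \<alpha>_def)
      moreover have "(if j = 0 then 0 else \<alpha> j * \<phi> (j - 1)) = ecoef l p j" using True l by (auto simp: \<phi>_def \<alpha>_def)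
      ultimately show ?thesis using ecoef_diff[OF True, of p] \<kappa>1[OF True] zk by (simp add: skappa_def)
    next
      case False
      define m where "m = j - l"
      have m: "j = m + l" "m < d - l" using False j by (auto simp: m_def)
      have "\<phi> j * \<alpha> (Suc j) = ecoef (d - l) (p + l) (Suc m)"
        using m l ecoef_l[of "d - l" "p + l"] by (cases "Suc j = d") (auto simp: \<phi>_def \<alpha>_def)
      moreover have "(if j = 0 then 0 else \<alpha> j * \<phi> (j - 1)) = ecoef (d - l) (p + l) m" using m l by (auto simp: \<phi>_def \<alpha>_def)
      moreover have "\<zeta> ^ (p + l + m) = \<zeta> ^ (p + j)" using m by (simp add: algebra_simps)
      ultimately show ?thesis using ecoef_diff[OF m(2), of "p + l"] \<kappa>2[OF m(2)] zk m(1) by (simp add: skappa_def)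
    qed
  next
    fix j assume j: "Suc j < d"
    then have "d - 1 - j = Suc (d - 1 - Suc j)" by simp
    then show "\<kappa> (Suc j) = inverse \<zeta> * \<kappa> j" using zeta_nz by (simp add: \<kappa>_def)
  qed (use l in \<open>auto simp: szed_def zeta_pow_pow_d \<phi>_def \<alpha>_def\<close>)
  define W where "W = mk_rep d A"
  have W: "W \<in> DD" "act W = A" "rdim W = d" using mk_rep_D[OF R] by (simp_all add: W_def)
  have "ctr W"
  proof (rule ctr_cyclic[OF W(1,3), where \<alpha> = \<alpha> and e = l])
    fix j assume "j < d"
    then show "EE W * eij j 0 = \<alpha> j *\<^sub>s eij (cyc d j) 0"
      unfolding W A_def wact_def dgen.case by (intro mono_eij) (auto simp: cyc_def)
    show "j \<noteq> l \<Longrightarrow> \<alpha> j \<noteq> 0" using ecoef_nz[of j l p] ecoef_nz[of "j - l" "d - l" "p + l"] l \<open>j < d\<close> by (auto simp: \<alpha>_def)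
  qed (use l in auto)
  define i where "i = wmono d (d - l) (\<lambda>j. 1) (\<lambda>j. j + l)"
  define q where "q = wmono l d (\<lambda>j. if j < l then 1 else 0) (\<lambda>j. j)"
  define r1 where "r1 = wmono (d - l) d (\<lambda>j. if j < l then 0 else 1) (\<lambda>j. j - l)"
  define r2 where "r2 = wmono d l (\<lambda>j. 1) (\<lambda>j. j)"
  let ?X = "D_simple \<zeta> (d - l, p + l)" and ?Z = "D_simple \<zeta> (l, p)"
  have cb: "cyc n j < n" if "j < n" for n j using that by (auto simp: cyc_def)
  have fb: "sphi n j = 0 \<or> Suc j < n" for n j by (simp add: sphi_def)
  have "i * act ?X g = A g * i" for g
  proof (cases g)
    case GE
    have "i * wmono (d - l) (d - l) (ecoef (d - l) (p + l)) (cyc (d - l)) = wmono d d \<alpha> (cyc d) * i" unfolding i_def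
      by (subst mono_mult[OF disjI2[OF cb]], assumption, subst mono_mult, use l in simp, rule mono_eqI)
        (use l in \<open>auto simp: \<alpha>_def cyc_def\<close>)
    then show ?thesis using GE by (simp add: A_def act_D_simple wact_def)
  next
    case GF
    have "i * wmono (d - l) (d - l) (sphi (d - l)) Suc = wmono d d \<phi> Suc * i" unfolding i_def
      by (subst mono_mult[OF fb], subst mono_mult, use l in simp, rule mono_eqI) (use l in \<open>auto simp: \<phi>_def sphi_def\<close>)
    then show ?thesis using GF by (simp add: A_def act_D_simple wact_def)
  next
    case GK
    have "i * wmono (d - l) (d - l) (skappa (d - l) (p + l)) (\<lambda>j. j) = wmono d d \<kappa> (\<lambda>j. j) * i" unfolding i_def
      by (subst mono_mult, simp, subst mono_mult, use l in simp, rule mono_eqI) (use l \<kappa>2 in auto)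
    then show ?thesis using GK by (simp add: A_def act_D_simple wact_def)
  qed (simp add: A_def act_D_simple wact_def z2 i_def linsD[OF lin_mono])
  then have hi: "rhom ?X W i" using W by (simp add: rhom_def i_def)
  have "q * A g = act ?Z g * q" for g
  proof (cases g)
    case GE
    have "q * wmono d d \<alpha> (cyc d) = wmono l l (ecoef l p) (cyc l) * q" unfolding q_def
      by (subst mono_mult[OF disjI2[OF cb]], assumption, subst mono_mult, simp, rule mono_eqI)
        (use l in \<open>auto simp: \<alpha>_def cyc_def\<close>)
    then show ?thesis using GE by (simp add: A_def act_D_simple wact_def)
  next
    case GF
    have "q * wmono d d \<phi> Suc = wmono l l (sphi l) Suc * q" unfolding q_def
      by (subst mono_mult, force simp: \<phi>_def, subst mono_mult, simp, rule mono_eqI) (use l in \<open>auto simp: \<phi>_def sphi_def\<close>)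
    then show ?thesis using GF by (simp add: A_def act_D_simple wact_def)
  next
    case GK
    have "q * wmono d d \<kappa> (\<lambda>j. j) = wmono l l (skappa l p) (\<lambda>j. j) * q" unfolding q_def
      by (subst mono_mult, simp, subst mono_mult, simp, rule mono_eqI) (use \<kappa>1 in auto)
    then show ?thesis using GK by (simp add: A_def act_D_simple wact_def)
  qed (simp add: A_def act_D_simple wact_def q_def linsD[OF lin_mono])
  then have hq: "rhom W ?Z q" using W by (simp add: rhom_def q_def)
  have "r1 * i = idn (d - l)" "q * r2 = idn l" "q * i = 0" "r1 * r2 = 0"
    unfolding r1_def i_def q_def r2_def mono_idn
    by (subst mono_mult, use l in simp, (rule mono_eqI | subst mono_zero[of _ _ "\<lambda>j. j + l"], rule mono_eqI | subst mono_zero[of _ _ "\<lambda>j. j - l"], rule mono_eqI); use l in simp)+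
  moreover have "i * r1 + r2 * q = idn d"
  proof -
    have "i * r1 = wmono d d (\<lambda>j. if j < l then 0 else 1) (\<lambda>j. j)" unfolding i_def r1_def
      by (subst mono_mult, force, rule mono_eqI) (use l in auto)
    moreover have "r2 * q = wmono d d (\<lambda>j. if j < l then 1 else 0) (\<lambda>j. j)" unfolding r2_def q_def
      by (subst mono_mult, use l in simp, rule mono_eqI) (use l in auto)
    ultimately have "idn d - i * r1 = r2 * q" by (simp only: mono_idn mono_diff) (rule mono_eqI, simp)
    then show ?thesis by (simp add: algebra_simps)
  qed
  ultimately have "ses ?X i W q ?Z r1 r2" using hi hq W by (simp add: ses_def r1_def r2_def)
  with W(1) \<open>ctr W\<close> that show ?thesis by blast
qed

end

lemma column_ext:
  assumes "lin m n f" "lin m n g" "\<And>j. j < n \<Longrightarrow> f * eij j 0 = g * eij j 0" shows "f = g"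
proof (rule lin_eqI[OF assms(1,2)])
  fix i j assume "j < n"
  have "app (eij j 0) (delta 0) = delta j" by (auto simp: fun_eq_iff)
  then show "app f (delta j) i = app g (delta j) i"
    using arg_cong[OF assms(3)[OF \<open>j < n\<close>], of "\<lambda>h. app h (delta 0) i"] by simp
qed

lemma idn_eq_sum_eij: "idn n = (\<Sum>i<n. eij i i)"
  by (induction n) (simp_all add: idn_Suc, rule lop_eqI, simp)

lemma rows_zero: "lin l k g \<Longrightarrow> (\<And>i. i < l \<Longrightarrow> eij 0 i * g = 0) \<Longrightarrow> g = 0"
proof -
  assume g: "lin l k g" and z: "\<And>i. i < l \<Longrightarrow> eij 0 i * g = 0"
  have "eij i i * g = 0" if "i < l" for i
    using arg_cong[OF z[OF that], of "\<lambda>x. eij i 0 * x"] by (simp add: eij_mult')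
  then have "idn l * g = 0" unfolding idn_eq_sum_eij sum_distrib_right by simp
  then show "g = 0" using g by (simp add: lin_left)
qed

lemma eij_00: "eij 0 0 = idn 1"
  by (rule lop_eqI) auto

lemma column_mult_zero:
  assumes "lin n 1 u" "u \<noteq> 0" "lin 1 k \<rho>" "u * \<rho> = 0" shows "\<rho> = 0"
proof -
  obtain r where r: "r < n" "app u (delta 0) r \<noteq> 0" using lin_eqI[OF assms(1) lin_0] assms(2) by auto
  have "eij 0 r * (u * (eij 0 0 * \<rho>)) = app u (delta 0) r *\<^sub>s (eij 0 0 * \<rho>)"
    using arg_cong[OF eij_sandwich[OF assms(1), of 0 r 0 0], of "\<lambda>x. x * \<rho>"] by (simp add: mult.assoc)
  then have "app u (delta 0) r *\<^sub>s \<rho> = app u (delta 0) r *\<^sub>s 0"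
    unfolding eij_00 using assms(3,4) by (simp add: lin_left del: One_nat_def)
  then show ?thesis using r scal_cancel by blast
qed

context taft
begin

subsection \<open>Highest weight vectors\<close>

text \<open>The sum is the projection of v to an eigenspace, up to a scalar; over all k these
  projections add up to d v, so one of them is nonzero. The explicit form as a combination of the
  A^a v lets the eigenvector inherit properties of v.\<close>

lemma eigenvector_exists:
  assumes v: "lin n 1 v" "v \<noteq> 0" and A: "lin n n A" "A ^ d * v = v"
  shows "\<exists>k c. lin n 1 (\<Sum>a<d. c a *\<^sub>s (A ^ a * v)) \<and> (\<Sum>a<d. c a *\<^sub>s (A ^ a * v)) \<noteq> 0 \<and>
    A * (\<Sum>a<d. c a *\<^sub>s (A ^ a * v)) = \<zeta> ^ k *\<^sub>s (\<Sum>a<d. c a *\<^sub>s (A ^ a * v))"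
proof -
  define u where "u k = (\<Sum>a<d. (\<zeta> ^ k) ^ (d - a) *\<^sub>s (A ^ a * v))" for k
  have p: "(c *\<^sub>s idn 1) ^ m = c ^ m *\<^sub>s idn 1" if "m > 0" for c m
    using that
  proof (induction m)
    case (Suc m)
    then show ?case by (cases "m = 0") (simp_all add: ac_simps)
  qed simp
  have u: "u k = avg A (\<zeta> ^ k *\<^sub>s idn 1) v" for k
    unfolding u_def avg_def
  proof (rule sum.cong)
    fix a assume "a \<in> {..<d}"
    then have "(\<zeta> ^ k *\<^sub>s idn 1) ^ (d - a) = (\<zeta> ^ k) ^ (d - a) *\<^sub>s idn 1" by (intro p) auto
    then show "(\<zeta> ^ k) ^ (d - a) *\<^sub>s (A ^ a * v) = A ^ a * v * (\<zeta> ^ k *\<^sub>s idn 1) ^ (d - a)"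
      by (simp add: mult.assoc linsD[OF v(1)] del: One_nat_def)
  qed simp
  have lu: "lin n 1 (u k)" for k unfolding u by (rule lin_avg[OF A(1) _ v(1)]) auto
  have Au: "A * u k = \<zeta> ^ k *\<^sub>s u k" for k
  proof -
    have "v * (\<zeta> ^ k *\<^sub>s idn 1) ^ d = v" unfolding p[OF d0(1)] by (simp add: zeta_pow_pow_d linsD[OF v(1)] del: One_nat_def)
    then have "A * u k = u k * (\<zeta> ^ k *\<^sub>s idn 1)" unfolding u using A(2) by (rule avg_commute[rotated])
    then show ?thesis by (simp add: linsD[OF lu] del: One_nat_def)
  qed
  have "\<exists>k<d. u k \<noteq> 0"
  proof (rule ccontr)
    assume "\<not> (\<exists>k<d. u k \<noteq> 0)"
    then have "0 = (\<Sum>k<d. u k)" by simp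
    also have "\<dots> = (\<Sum>a<d. (\<Sum>k<d. (\<zeta> ^ (d - a)) ^ k) *\<^sub>s (A ^ a * v))"
      unfolding u_def scal_sum_left by (subst sum.swap) (simp add: mult.commute flip: power_mult)
    also have "\<dots> = (\<Sum>a\<in>{0}. (\<Sum>k<d. (\<zeta> ^ (d - a)) ^ k) *\<^sub>s (A ^ a * v))"
    proof (rule sum.mono_neutral_right)
      have "(\<Sum>k<d. (\<zeta> ^ (d - a)) ^ k) = 0" if "a \<in> {..<d} - {0}" for a
        by (rule zeta_sum_zero) (use that in auto)
      then show "\<forall>a\<in>{..<d} - {0}. (\<Sum>k<d. (\<zeta> ^ (d - a)) ^ k) *\<^sub>s (A ^ a * v) = 0" by simp
    qed (use d0 in auto)
    also have "\<dots> = of_nat d *\<^sub>s v" by (simp add: zeta_pow_d)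
    finally have "of_nat d *\<^sub>s v = of_nat d *\<^sub>s 0" by simp
    with v(2) d0 show False using scal_cancel by fastforce
  qed
  then obtain k where "u k \<noteq> 0" by blast
  then show ?thesis using lu[of k] Au[of k] unfolding u_def
    by (intro exI[of _ k] exI[of _ "\<lambda>a. (\<zeta> ^ k) ^ (d - a)"]) simp
qed

definition hwv :: "dgen rep \<Rightarrow> nat \<Rightarrow> nat \<Rightarrow> lop \<Rightarrow> bool" where
  "hwv M k c v \<longleftrightarrow> lin (rdim M) 1 v \<and> v \<noteq> 0 \<and> EE M * v = 0 \<and> KK M * v = \<zeta> ^ k *\<^sub>s v \<and> ZZ M * v = \<zeta> ^ c *\<^sub>s v"

text \<open>Nilpotency of E gives a vector in its kernel. That kernel is stable under K and z, and
  their successive eigenprojections stay inside it.\<close>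

lemma hwv_exists:
  assumes M: "M \<in> DD" "rdim M > 0" shows "\<exists>k c v. hwv M k c v"
proof -
  let ?n = "rdim M"
  define v0 where "v0 = eij 0 0"
  have v0: "lin ?n 1 v0" "v0 \<noteq> 0"
  proof -
    show "lin ?n 1 v0" unfolding v0_def by (rule lin_eij) (use M in auto)
    have "app v0 (delta 0) 0 \<noteq> 0" by (simp add: v0_def)
    then show "v0 \<noteq> 0" by auto
  qed
  define m where "m = (LEAST k. EE M ^ k * v0 = 0)"
  have "EE M ^ d * v0 = 0" by (simp add: EE_nilp M)
  then have m: "EE M ^ m * v0 = 0" unfolding m_def by (rule LeastI)
  then have "m \<noteq> 0" using v0 by (cases m) auto
  then obtain m' where m': "m = Suc m'" by (cases m) auto
  define v1 where "v1 = EE M ^ m' * v0"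
  have Ev1: "EE M * v1 = 0" using m by (simp add: v1_def m' mult.assoc)
  have v1: "lin ?n 1 v1" "v1 \<noteq> 0"
  proof -
    show "v1 \<noteq> 0" unfolding v1_def using not_less_Least[of m' "\<lambda>k. EE M ^ k * v0 = 0"] m' by (auto simp: m_def)
    have "v1 = (ide M * EE M ^ m') * v0" using idn_power_commute[OF D_lin[OF M(1)], of GE m'] v0
      by (simp add: v1_def mult.assoc linsD[OF v0(1)] del: One_nat_def)
    then show "lin ?n 1 v1" using v0 M by auto
  qed
  have "KK M ^ d * v1 = v1" using KK_pow[OF M(1)] v1 by (simp add: lin_left del: One_nat_def)
  then obtain k c where u: "lin ?n 1 (\<Sum>a<d. c a *\<^sub>s (KK M ^ a * v1))" "(\<Sum>a<d. c a *\<^sub>s (KK M ^ a * v1)) \<noteq> 0"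
    "KK M * (\<Sum>a<d. c a *\<^sub>s (KK M ^ a * v1)) = \<zeta> ^ k *\<^sub>s (\<Sum>a<d. c a *\<^sub>s (KK M ^ a * v1))"
    using eigenvector_exists[OF v1 D_lin[OF M(1)]] by blast
  define v2 where "v2 = (\<Sum>a<d. c a *\<^sub>s (KK M ^ a * v1))"
  have Ev2: "EE M * v2 = 0"
  proof -
    have "EE M * (KK M ^ a * v1) = 0" for a
    proof -
      have "\<zeta> ^ a *\<^sub>s (EE M * (KK M ^ a * v1)) = KK M ^ a * (EE M * v1)"
        using assoc_ext[OF qcomm_pow'[OF D_comm(4)[OF M(1)], of a], of v1] by (simp add: mult.assoc)
      then have "\<zeta> ^ a *\<^sub>s (EE M * (KK M ^ a * v1)) = \<zeta> ^ a *\<^sub>s 0" by (simp add: Ev1)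
      then show ?thesis using scal_cancel zeta_nz by (metis power_not_zero)
    qed
    then show ?thesis by (simp add: v2_def sum_distrib_left)
  qed
  have "ZZ M ^ d * v2 = v2" using ZZ_pow[OF M(1)] u(1) by (simp add: lin_left v2_def del: One_nat_def)
  then obtain k' c' where w: "lin ?n 1 (\<Sum>a<d. c' a *\<^sub>s (ZZ M ^ a * v2))" "(\<Sum>a<d. c' a *\<^sub>s (ZZ M ^ a * v2)) \<noteq> 0"
    "ZZ M * (\<Sum>a<d. c' a *\<^sub>s (ZZ M ^ a * v2)) = \<zeta> ^ k' *\<^sub>s (\<Sum>a<d. c' a *\<^sub>s (ZZ M ^ a * v2))"
    using eigenvector_exists[OF u(1,2)[folded v2_def] D_lin[OF M(1)]] by blast
  define v3 where "v3 = (\<Sum>a<d. c' a *\<^sub>s (ZZ M ^ a * v2))"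
  have Z: "EE M * (ZZ M ^ a * v2) = 0" "KK M * (ZZ M ^ a * v2) = \<zeta> ^ k *\<^sub>s (ZZ M ^ a * v2)" for a
  proof -
    have "EE M * ZZ M ^ a = ZZ M ^ a * EE M" "KK M * ZZ M ^ a = ZZ M ^ a * KK M"
      using power_intertwine[of "EE M" "ZZ M" "ZZ M" a] power_intertwine[of "KK M" "ZZ M" "ZZ M" a] D_comm[OF M(1)] by simp_all
    from assoc_ext[OF this(1), of v2] assoc_ext[OF this(2), of v2]
    show "EE M * (ZZ M ^ a * v2) = 0" "KK M * (ZZ M ^ a * v2) = \<zeta> ^ k *\<^sub>s (ZZ M ^ a * v2)"
      using Ev2 u(3) by (simp_all add: mult.assoc v2_def)
  qed
  have "EE M * v3 = 0" "KK M * v3 = \<zeta> ^ k *\<^sub>s v3"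
    by (simp_all add: v3_def sum_distrib_left Z scal_sum_right mult.commute)
  then have "hwv M k k' v3" using w by (simp add: hwv_def v3_def)
  then show ?thesis by blast
qed

lemma hwv_powers:
  assumes M: "M \<in> DD" and v: "hwv M k c v"
  shows "lin (rdim M) 1 (FF M ^ i * v)" "KK M * (FF M ^ i * v) = (inverse \<zeta> ^ i * \<zeta> ^ k) *\<^sub>s (FF M ^ i * v)"
    "ZZ M * (FF M ^ i * v) = \<zeta> ^ c *\<^sub>s (FF M ^ i * v)"
    "EE M * (FF M ^ i * v) = (qnum (inverse \<zeta>) i * \<zeta> ^ k - qnum \<zeta> i * (\<zeta> ^ c * (\<zeta> ^ k) ^ (d - 1))) *\<^sub>s (FF M ^ (i - 1) * v)"
proof -
  note V = v[unfolded hwv_def]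
  have "FF M ^ i * v = (ide M * FF M ^ i) * v" using idn_power_commute[OF D_lin[OF M], of GF i] V
    by (simp add: mult.assoc linsD[OF conjunct1[OF V]] del: One_nat_def)
  then show "lin (rdim M) 1 (FF M ^ i * v)" using V M by auto
  show "KK M * (FF M ^ i * v) = (inverse \<zeta> ^ i * \<zeta> ^ k) *\<^sub>s (FF M ^ i * v)"
    using assoc_ext[OF qcomm_pow[OF D_comm(5)[OF M], of i], of v] V by (simp add: mult.assoc)
  have "ZZ M * FF M ^ i = FF M ^ i * ZZ M" using power_intertwine[of "ZZ M" "FF M" "FF M" i] D_comm(2)[OF M] by simp
  from assoc_ext[OF this, of v] show "ZZ M * (FF M ^ i * v) = \<zeta> ^ c *\<^sub>s (FF M ^ i * v)" using V by (simp add: mult.assoc)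
  have Kp: "KK M ^ j * v = (\<zeta> ^ k) ^ j *\<^sub>s v" for j
    by (induction j) (use V in \<open>simp_all add: mult.assoc mult.commute\<close>)
  have KI: "ZZ M * (KK M ^ (d - 1) * v) = (\<zeta> ^ c * (\<zeta> ^ k) ^ (d - 1)) *\<^sub>s v" unfolding Kp using V by (simp add: mult.commute)
  have "EE M * FF M ^ i = FF M ^ i * EE M + FF M ^ (i - 1) * (qnum (inverse \<zeta>) i *\<^sub>s KK M - qnum \<zeta> i *\<^sub>s (ZZ M * KK M ^ (d - 1)))"
    using commute_EF_pow[OF D_comm(5)[OF M] D_Ki(2)[OF M] D_Ki(3)[OF M]] .
  from assoc_ext[OF this, of v] show "EE M * (FF M ^ i * v) =
    (qnum (inverse \<zeta>) i * \<zeta> ^ k - qnum \<zeta> i * (\<zeta> ^ c * (\<zeta> ^ k) ^ (d - 1))) *\<^sub>s (FF M ^ (i - 1) * v)"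
    using V KI by (simp add: distrib_right left_diff_distrib right_diff_distrib mult.assoc scal_diff_left del: One_nat_def)
qed

lemma FF_nilp: "M \<in> DD \<Longrightarrow> FF M ^ d = 0" using D_rels by (simp add: rels_def)

lemma qnum_inverse: "i > 0 \<Longrightarrow> \<zeta> ^ (i - 1) * qnum (inverse \<zeta>) i = qnum \<zeta> i"
proof (induction i)
  case (Suc i)
  show ?case
  proof (cases "i = 0")
    case False
    then have "\<zeta> ^ i = \<zeta> * \<zeta> ^ (i - 1)" by (metis Suc_pred' bot_nat_0.not_eq_extremum power_Suc)
    then have "\<zeta> ^ i * qnum (inverse \<zeta>) i = \<zeta> * qnum \<zeta> i" using Suc.IH False by (simp add: mult.assoc)
    then show ?thesis using zeta_nz unfolding qnum_Suc'[of \<zeta> i] by (simp add: qnum_Suc distrib_left power_inverse)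
  qed (simp add: qnum_Suc)
qed simp

text \<open>Among all highest weight vectors choose one whose \<open>F\<close>-string has minimal length \<open>l\<close>.  Then
  \<open>E F\<^sup>i v \<noteq> 0\<close> for \<open>0 < i < l\<close>, which determines the central character.\<close>

lemma minimal_hwv:
  assumes M: "M \<in> DD" "rdim M > 0"
  obtains k c v l where "hwv M k c v" "0 < l" "l \<le> d" "FF M ^ l * v = 0" "\<And>i. i < l \<Longrightarrow> FF M ^ i * v \<noteq> 0"
    "\<zeta> ^ (l - 1) * \<zeta> ^ c = \<zeta> ^ (2 * k)"
proof -
  define len where "len v = (LEAST i. FF M ^ i * v = 0)" for v
  obtain x where x: "\<exists>k c. hwv M k c x" using hwv_exists[OF M] by blast
  define v where "v = (ARG_MIN len v. \<exists>k c. hwv M k c v)"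
  have vmin: "\<exists>k c. hwv M k c v" "\<And>y. \<exists>k c. hwv M k c y \<Longrightarrow> len v \<le> len y"
    unfolding v_def using arg_min_nat_lemma[where P = "\<lambda>v. \<exists>k c. hwv M k c v" and m = len, OF x] by blast+
  then obtain k c where v: "hwv M k c v" by blast
  note V = v[unfolded hwv_def] and P = hwv_powers[OF M(1) v]
  define l where "l = len v"
  have z: "FF M ^ d * v = 0" by (simp add: FF_nilp M)
  have Fl: "FF M ^ l * v = 0" unfolding l_def len_def by (rule LeastI[of _ d]) (rule z)
  have ld: "l \<le> d" unfolding l_def len_def by (rule Least_le) (rule z)
  have Fi: "FF M ^ i * v \<noteq> 0" if "i < l" for i using not_less_Least that unfolding l_def len_def by blast
  have l0: "l > 0" using Fl V by (cases l) auto
  define g where "g i = qnum (inverse \<zeta>) i * \<zeta> ^ k - qnum \<zeta> i * (\<zeta> ^ c * (\<zeta> ^ k) ^ (d - 1))" for i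
  have gnz: "g i \<noteq> 0" if i: "0 < i" "i < l" for i
  proof
    assume "g i = 0"
    then have "EE M * (FF M ^ i * v) = 0" using P(4)[of i] by (simp add: g_def)
    moreover have "inverse \<zeta> ^ i * \<zeta> ^ k = \<zeta> ^ (k + i * (d - 1))"
    proof -
      have "inverse \<zeta> ^ i = \<zeta> ^ (i * (d - 1))" unfolding zeta_pow_pred[symmetric] by (simp add: mult.commute flip: power_mult)
      then show ?thesis by (simp add: power_add mult.commute)
    qed
    ultimately have "hwv M (k + i * (d - 1)) c (FF M ^ i * v)" using P(1-3)[of i] Fi[OF i(2)] by (simp add: hwv_def)
    \<comment> \<open>If the scalar vanished, F^i v would be a highest weight vector with a string
      shorter by i, against the minimality of l.\<close>
    then have "l \<le> len (FF M ^ i * v)" using vmin(2) unfolding l_def by blast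
    also have "\<dots> \<le> l - i" unfolding len_def
      by (rule Least_le) (use Fl i in \<open>simp flip: power_add mult.assoc\<close>)
    finally show False using i by simp
  qed
  have gl: "g l = 0"
  proof -
    have "g l *\<^sub>s (FF M ^ (l - 1) * v) = 0" using P(4)[of l] Fl by (simp add: g_def)
    then show ?thesis using Fi[of "l - 1"] l0 scal_cancel[of "g l" _ 0] by auto
  qed
  define X where "X = \<zeta> ^ c * (\<zeta> ^ k) ^ (d - 1)"
  have kk: "\<zeta> ^ k * (\<zeta> ^ k) ^ (d - 1) = 1" using zeta_pow_pow_d[of k] d0 by (metis Suc_diff_1 power_Suc)
  have gX: "\<zeta> ^ (i - 1) * g i = qnum \<zeta> i * (\<zeta> ^ k - \<zeta> ^ (i - 1) * X)" if "i > 0" for i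
    using qnum_inverse[OF that] by (simp add: g_def X_def right_diff_distrib flip: mult.assoc)
  have key: "\<zeta> ^ (l - 1) * X = \<zeta> ^ k"
  proof (cases "l = d")
    case False
    then have "qnum \<zeta> l \<noteq> 0" using l0 ld by (intro qnum_nz) auto
    then show ?thesis using gX[OF l0] gl by simp
  next
    case True
    \<comment> \<open>For l = d the vanishing of g at l carries no information, as the q-number of d
      is zero. Instead let i be the index in 1, ..., d at which the desired equation holds; then g i
      = 0, and since g has no zero below l, necessarily i = d.\<close>
    define Y where "Y = c + k * (d - 1) + k * (d - 1)"
    have Y: "X * (\<zeta> ^ k) ^ (d - 1) = \<zeta> ^ Y" by (simp add: X_def Y_def power_add power_mult)
    define i where "i = (d - Y mod d) mod d + 1"
    have i: "0 < i" "i \<le> d" using d0 by (simp_all add: i_def Suc_le_eq)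
    have "\<zeta> ^ (i - 1) * \<zeta> ^ Y = \<zeta> ^ (d - Y mod d) * \<zeta> ^ (Y mod d)" by (simp add: i_def zeta_pow_mod)
    also have "\<dots> = 1" using mod_less_divisor[OF d0(1), of Y] by (simp add: zeta_pow_d flip: power_add)
    finally have "\<zeta> ^ (i - 1) * X * (\<zeta> ^ k) ^ (d - 1) = 1" unfolding Y[symmetric] by (simp add: mult.assoc)
    then have iX: "\<zeta> ^ (i - 1) * X = \<zeta> ^ k" using kk zeta_nz by (metis mult_right_cancel power_not_zero)
    then have "\<zeta> ^ (i - 1) * g i = 0" using gX[OF i(1)] by simp
    then have "\<not> i < l" using gnz i zeta_nz by auto
    then show ?thesis using iX i True by simp
  qed
  have "\<zeta> ^ (l - 1) * \<zeta> ^ c = \<zeta> ^ (2 * k)"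
  proof -
    have "\<zeta> ^ c = X * \<zeta> ^ k" unfolding X_def using kk by (simp add: mult.assoc mult.commute)
    then have "\<zeta> ^ (l - 1) * \<zeta> ^ c = \<zeta> ^ k * \<zeta> ^ k" using key by (simp flip: mult.assoc)
    then show ?thesis by (simp add: mult_2 power_add)
  qed
  then show ?thesis using that[OF v l0 ld Fl] Fi by blast
qed

lemma simple_submodule_exists:
  assumes M: "M \<in> DD" "rdim M > 0"
  obtains l p f r where "0 < l" "l \<le> d" "rhom (D_simple \<zeta> (l, p)) M f" "lin l (rdim M) r" "r * f = idn l"
proof -
  obtain k c v l where v: "hwv M k c v" "0 < l" "l \<le> d" "FF M ^ l * v = 0" and Fi: "\<And>i. i < l \<Longrightarrow> FF M ^ i * v \<noteq> 0"
    and kc: "\<zeta> ^ (l - 1) * \<zeta> ^ c = \<zeta> ^ (2 * k)" using minimal_hwv[OF M] by metis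
  note V = v(1)[unfolded hwv_def] and P = hwv_powers[OF M(1) v(1)]
  let ?n = "rdim M"
  \<comment> \<open>Chosen so that p + l - 1 is congruent to k modulo d: the first basis vector of
    M_{l,p} must have the weight of v.\<close>
  define p where "p = k + (d - (l - 1))"
  have pk: "p + (l - 1) = k + d" using v(2,3) by (simp add: p_def)
  have \<kappa>: "inverse \<zeta> ^ i * \<zeta> ^ k = skappa l p i" if "i < l" for i
  proof -
    have "\<zeta> ^ i * skappa l p i = \<zeta> ^ k" unfolding skappa_def power_add[symmetric]
      using pk that zeta_pow_add_d[of k] by (metis (no_types, lifting) add.assoc add.commute le_add_diff_inverse less_Suc_eq_le Suc_diff_1 v(2))
    then have "inverse \<zeta> ^ i * \<zeta> ^ k = (inverse \<zeta> ^ i * \<zeta> ^ i) * skappa l p i" by (metis mult.assoc)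
    then show ?thesis using zeta_nz by (simp add: power_inverse)
  qed
  have szc: "szed l p = \<zeta> ^ c"
  proof -
    have "\<zeta> ^ (l - 1) * szed l p = \<zeta> ^ (2 * (k + d))" unfolding szed_def power_add[symmetric]
      by (rule arg_cong[where f = "\<lambda>x. \<zeta> ^ x"]) (use pk v(2) in arith)
    also have "\<dots> = \<zeta> ^ (2 * k)" by (rule zeta_pow_cong) (simp add: distrib_left mult.commute[of 2 d])
    finally show ?thesis using kc zeta_nz by (metis mult_left_cancel power_not_zero)
  qed
  have EF: "EE M * (FF M ^ i * v) = (if i = 0 then 0 else ecoef l p i *\<^sub>s (FF M ^ (i - 1) * v))" if "i < l" for i
    using that
  proof (induction i)
    case (Suc i)
    have i: "i < l" using Suc.prems by simp
    have KF: "KK M * (FF M ^ i * v) = skappa l p i *\<^sub>s (FF M ^ i * v)" using P(2)[of i] \<kappa>[OF i] by simp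
    have Kp: "KK M ^ j * (FF M ^ i * v) = skappa l p i ^ j *\<^sub>s (FF M ^ i * v)" for j
      by (induction j) (simp_all add: mult.assoc KF mult.commute)
    have zk: "szed l p * skappa l p i ^ (d - 1) = \<zeta> ^ (p + i)"
      using zeta_inverse[of "p + (l - 1 - i)" "p + i" "2 * p + l - 1"] i by (simp add: szed_def skappa_def mult.commute)
    have co: "ecoef l p i + (skappa l p i - szed l p * skappa l p i ^ (d - 1)) = ecoef l p (Suc i)"
      unfolding zk using ecoef_diff[OF i, of p] by (simp add: skappa_def algebra_simps)
    have "EE M * (FF M * (FF M ^ i * v)) = FF M * (EE M * (FF M ^ i * v)) + (skappa l p i - szed l p * skappa l p i ^ (d - 1)) *\<^sub>s (FF M ^ i * v)"
      using D_EF'[OF M(1), of "FF M ^ i * v"] KF P(3)[of i] Kp[of "d - 1"] szc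
      by (simp add: scal_diff_left mult.commute del: One_nat_def)
    also have "FF M * (EE M * (FF M ^ i * v)) = ecoef l p i *\<^sub>s (FF M ^ i * v)"
    proof (cases i)
      case 0
      then show ?thesis using V by simp
    next
      case (Suc i')
      then show ?thesis using Suc.IH i by (simp flip: mult.assoc)
    qed
    also have "ecoef l p i *\<^sub>s (FF M ^ i * v) + (skappa l p i - szed l p * skappa l p i ^ (d - 1)) *\<^sub>s (FF M ^ i * v) =
      ecoef l p (Suc i) *\<^sub>s (FF M ^ i * v)"
      unfolding scal_add_left[symmetric] co ..
    finally show ?case by (simp add: mult.assoc)
  qed (use V in simp)
  define f where "f = (\<Sum>i<l. FF M ^ i * v * eij 0 i)"
  have fe: "f * eij j 0 = (if j < l then FF M ^ j * v else 0)" for j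
  proof -
    have "f * eij j 0 = (\<Sum>i<l. if i = j then FF M ^ j * v * eij 0 0 else 0)"
      unfolding f_def sum_distrib_right by (intro sum.cong) (auto simp: mult.assoc eij_mult)
    then show ?thesis using linsD(2)[OF P(1)] by (simp add: eij_00)
  qed
  have lf: "lin ?n l f" unfolding f_def by (intro lin_sum lin_mult[OF P(1)] lin_eij) auto
  have rf: "rhom (D_simple \<zeta> (l, p)) M f"
  proof (rule rhomI)
    fix g
    show "f * act (D_simple \<zeta> (l, p)) g = act M g * f"
    proof (rule column_ext[of ?n l])
      fix j assume j: "j < l"
      show "f * act (D_simple \<zeta> (l, p)) g * eij j 0 = act M g * f * eij j 0"
      proof (cases g)
        case GE
        have "wmono l l (ecoef l p) (cyc l) * eij j 0 = ecoef l p j *\<^sub>s eij (cyc l j) 0"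
          by (rule mono_eij) (use j in \<open>auto simp: cyc_def\<close>)
        moreover have "j - 1 < l" using j by simp
        ultimately show ?thesis using GE j EF[OF j]
          by (cases "j = 0") (simp_all add: mult.assoc act_D_simple wact_def fe cyc_def)
      next
        case GF
        have "wmono l l (sphi l) Suc * eij j 0 = sphi l j *\<^sub>s eij (Suc j) 0"
          by (rule mono_eij) (use j in \<open>auto simp: sphi_def\<close>)
        moreover have "FF M * (FF M ^ j * v) = 0" if "Suc j = l" using v(4) that by (auto simp: mult.assoc)
        ultimately show ?thesis using GF j by (auto simp: mult.assoc act_D_simple wact_def fe sphi_def)
      next
        case GK
        have "wmono l l (skappa l p) (\<lambda>j. j) * eij j 0 = skappa l p j *\<^sub>s eij j 0"
          by (rule mono_eij) (use j in auto)
        then show ?thesis using GK j P(2)[of j] \<kappa>[OF j] by (simp add: mult.assoc act_D_simple wact_def fe)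
      next
        case GZ
        have "idn l * eij j 0 = eij j 0" using idn_eij(1)[OF j] .
        then show ?thesis using GZ j P(3)[of j] szc by (simp add: mult.assoc act_D_simple wact_def fe)
      qed
    qed (use lf M v D_simple_D[OF v(2,3), of p] D_lin[OF D_simple_D[OF v(2,3), of p]] in auto)
  qed (use lf in simp)
  \<comment> \<open>Rows of g are eliminated in increasing order: applying F^(l-1-i) to f g kills
    the columns after i, and the rows before i are already known to vanish.\<close>
  have inj: "g = 0" if g: "lin l l g" "f * g = 0" for g
  proof (rule rows_zero[OF g(1)])
    fix i assume "i < l"
    then show "eij 0 i * g = 0"
    proof (induction i rule: less_induct)
      case (less i)
      have "FF M ^ (l - 1 - i) * (FF M ^ j * v * eij 0 j * g) = (if j = i then FF M ^ (l - 1) * v * (eij 0 i * g) else 0)" if "j < l" for j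
      proof -
        have e: "FF M ^ (l - 1 - i) * (FF M ^ j * v * eij 0 j * g) = FF M ^ (l - 1 - i + j) * v * (eij 0 j * g)"
          by (simp add: power_add mult.assoc)
        consider "j < i" | "j = i" | "i < j" by linarith
        then show ?thesis
        proof cases
          case 1
          then show ?thesis using e less.IH[OF 1] that by simp
        next
          case 2
          then show ?thesis using e less.prems by simp
        next
          case 3
          then have "l - 1 - i + j = (l - 1 - i + j - l) + l" using less.prems by simp
          then have "FF M ^ (l - 1 - i + j) * v = FF M ^ (l - 1 - i + j - l) * (FF M ^ l * v)" by (metis power_add mult.assoc)
          then show ?thesis using e v(4) 3 by simp
        qed
      qed
      then have "FF M ^ (l - 1 - i) * (f * g) = (\<Sum>j<l. if j = i then FF M ^ (l - 1) * v * (eij 0 i * g) else 0)"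
        unfolding f_def sum_distrib_right sum_distrib_left by (intro sum.cong) auto
      then have z: "FF M ^ (l - 1) * v * (eij 0 i * g) = 0" using g(2) less.prems by simp
      have lg: "lin 1 l (eij 0 i * g)" using less.prems g by (intro lin_mult[of _ l] lin_eij) auto
      have "l - 1 < l" using v(2) by simp
      then show ?case using column_mult_zero[OF P(1) Fi lg z] by blast
    qed
  qed
  obtain r where "lin l ?n r" "r * f = idn l" using left_inverse_exists[OF lf inj] .
  with that v rf show ?thesis by blast
qed

lemma rdim_ses: assumes "ses X i Y p Z l r" shows "rdim Y = rdim X + rdim Z"
proof -
  note A = sesD[OF assms]
  have "(of_nat (rdim Y) :: complex) = trc (rdim Y) (i * l) + trc (rdim Y) (r * p)"
    using A(11) by (simp add: trc_diff trc_idn)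
  also have "trc (rdim Y) (i * l) = of_nat (rdim X)" using trc_commute[OF A(3,5)] A(7) by (simp add: trc_idn)
  also have "trc (rdim Y) (r * p) = of_nat (rdim Z)" using trc_commute[OF A(6,4)] A(8) by (simp add: trc_idn)
  finally show ?thesis by (metis of_nat_add of_nat_eq_iff)
qed

section \<open>The Grothendieck ring\<close>

text \<open>Exponents are natural numbers, whereas \<iota> reduces the second index modulo d; all
  occurrences are exponents of \<zeta>, so the modules agree literally.\<close>

lemma D_simple_mod: assumes "l > 0" shows "D_simple \<zeta> (l, p mod d) = D_simple \<zeta> (l, p)"
proof -
  have K: "\<zeta> ^ (p mod d + l - (i + 1)) = \<zeta> ^ (p + l - (i + 1))" if "i < l" for i
  proof -
    have "p mod d + l - (i + 1) = p mod d + (l - (i + 1))" "p + l - (i + 1) = p + (l - (i + 1))" using that by auto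
    then show ?thesis by (simp only: power_add zeta_pow_mod)
  qed
  have "2 * (p mod d) + l - 1 = p mod d + (p mod d + (l - 1))" "2 * p + l - 1 = p + (p + (l - 1))" using assms by auto
  then have Z: "\<zeta> ^ (2 * (p mod d) + l - 1) = \<zeta> ^ (2 * p + l - 1)" by (simp only: power_add zeta_pow_mod)
  show ?thesis unfolding D_simple_def split rep.inject
    by (intro conjI refl ext) (auto simp: zeta_pow_mod Z[simplified] K[simplified] split: dgen.splits intro!: cong_mat)
qed

section \<open>Orthogonality of characters and linear independence of the classes\<close>

lemma zeta_inj: "m < d \<Longrightarrow> n < d \<Longrightarrow> \<zeta> ^ m = \<zeta> ^ n \<Longrightarrow> m = n"
proof (induction m n rule: linorder_wlog)
  case (le m n)
  have "\<zeta> ^ m * \<zeta> ^ (n - m) = \<zeta> ^ n" using le(1) by (simp flip: power_add)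
  also have "\<dots> = \<zeta> ^ m * 1" using le(4) by simp
  finally have "\<zeta> ^ (n - m) = 1" using zeta_nz by (metis mult_left_cancel power_not_zero)
  then show ?case using zeta_pow_neq_1[of "n - m"] le by fastforce
qed metis

text \<open>The trace multiplied by \<zeta>^a - 1, which sums the geometric series and leaves the
  difference of two characters of (Z/d)^2. It vanishes at a = 0, so orthogonality over the full
  group applies, and \<iota> exchanges the two characters, which changes the sign.\<close>

definition hnum :: "nat \<Rightarrow> nat \<Rightarrow> nat \<Rightarrow> nat \<Rightarrow> complex" where
  "hnum l p a b = (\<zeta> ^ (2 * p + l - 1)) ^ b * ((\<zeta> ^ (p + l)) ^ a - (\<zeta> ^ p) ^ a)"

lemma theta_hnum:
  assumes "a > 0" shows "(\<zeta> ^ a - 1) * theta (D_simple \<zeta> (l, p)) a b = hnum l p a b"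
proof -
  have "(\<Sum>j<l. skappa l p j ^ a) = (\<Sum>j<l. (\<zeta> ^ p) ^ a * (\<zeta> ^ a) ^ (l - Suc j))"
  proof (intro sum.cong refl)
    fix j
    have "(\<zeta> ^ (l - 1 - j)) ^ a = (\<zeta> ^ a) ^ (l - Suc j)" by (simp add: mult.commute flip: power_mult)
    then show "skappa l p j ^ a = (\<zeta> ^ p) ^ a * (\<zeta> ^ a) ^ (l - Suc j)"
      by (simp only: skappa_def power_add power_mult_distrib)
  qed
  also have "\<dots> = (\<zeta> ^ p) ^ a * (\<Sum>j<l. (\<zeta> ^ a) ^ j)"
    by (simp add: sum.nat_diff_reindex flip: sum_distrib_left)
  finally have "(\<zeta> ^ a - 1) * (\<Sum>j<l. skappa l p j ^ a) = (\<zeta> ^ p) ^ a * ((\<zeta> ^ a) ^ l - 1)"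
    by (simp add: power_diff_1_eq)
  also have "\<dots> = (\<zeta> ^ (p + l)) ^ a - (\<zeta> ^ p) ^ a"
    by (simp add: right_diff_distrib power_add power_mult_distrib mult.commute flip: power_mult)
  finally have F: "(\<zeta> ^ a - 1) * (\<Sum>j<l. skappa l p j ^ a) = (\<zeta> ^ (p + l)) ^ a - (\<zeta> ^ p) ^ a" .
  show ?thesis unfolding theta_D_simple[OF assms] hnum_def szed_def mult.left_commute[of "\<zeta> ^ a - 1"] F ..
qed

lemma theta_eqI:
  assumes "a \<in> {1..<d}" "(\<zeta> ^ a - 1) * x = (\<zeta> ^ a - 1) * y" shows "x = (y :: complex)"
  using assms zeta_pow_neq_1 by simp

text \<open>The orthogonality sum of two characters of Z/d.\<close>

definition dlt :: "nat \<Rightarrow> nat \<Rightarrow> complex" where "dlt m n = (\<Sum>a<d. (\<zeta> ^ m * inverse (\<zeta> ^ n)) ^ a)"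

lemma dlt: "dlt m n = (if \<zeta> ^ m = \<zeta> ^ n then of_nat d else 0)"
proof (cases "\<zeta> ^ m = \<zeta> ^ n")
  case False
  then have "\<zeta> ^ m * inverse (\<zeta> ^ n) \<noteq> 1" using zeta_nz by (simp add: field_simps)
  moreover have "(\<zeta> ^ m * inverse (\<zeta> ^ n)) ^ d = 1" by (simp add: power_mult_distrib zeta_pow_pow_d power_inverse)
  ultimately show ?thesis using geometric_sum_zero False by (simp add: dlt_def)
qed (use zeta_nz in \<open>simp add: dlt_def\<close>)

lemma Lambda_sharp_iff: "(l, p) \<in> Lambda_sharp d \<longleftrightarrow> 0 < l \<and> l < d \<and> p < d"
  by (auto simp: Lambda_sharp_def)

lemma iota_sharp: "0 < l \<Longrightarrow> l < d \<Longrightarrow> iota d (l, p) = (d - l, (p + l) mod d)"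
  by (simp add: iota_def)

context
  fixes S assumes S: "iota_orbit_representatives d S"
begin

lemma reps_sub: "(l, p) \<in> S \<Longrightarrow> 0 < l \<and> l < d \<and> p < d"
  using S Lambda_sharp_iff by (auto simp: iota_orbit_representatives_def)

lemma reps_finite: "finite S"
proof (rule finite_subset)
  show "S \<subseteq> {1..d} \<times> {0..<d}" using S by (auto simp: iota_orbit_representatives_def Lambda_sharp_def)
qed auto

lemma reps_cover: "x \<in> Lambda_sharp d \<Longrightarrow> x \<in> S \<or> iota d x \<in> S"
  using S by (auto simp: iota_orbit_representatives_def)

lemma reps_unique: "x \<in> S \<Longrightarrow> iota d x \<in> S \<Longrightarrow> iota d x = x"
  using S by (auto simp: iota_orbit_representatives_def)

text \<open>A nonzero value requires equal eigenvalues of z and \<zeta>^p0 equal to \<zeta>^p or to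
  \<zeta>^(p+l). The first alternative forces the two indices to coincide, the second makes them
  \<iota>-conjugate, and S contains at most one element of an orbit.\<close>

lemma hnum_orthogonal:
  assumes x: "(l, p) \<in> S" and y: "(l0, p0) \<in> S" and ne: "(l, p) \<noteq> (l0, p0)"
  shows "dlt (2 * p + l - 1) (2 * p0 + l0 - 1) * (dlt (p + l) p0 - dlt p p0) = 0"
proof (cases "\<zeta> ^ (2 * p + l - 1) = \<zeta> ^ (2 * p0 + l0 - 1)")
  case True
  note X = reps_sub[OF x] and Y = reps_sub[OF y]
  have e: "\<zeta> ^ (2 * p + l) = \<zeta> ^ (2 * p0 + l0)"
  proof -
    have "2 * p + l = Suc (2 * p + l - 1)" "2 * p0 + l0 = Suc (2 * p0 + l0 - 1)" using X Y by auto
    then show ?thesis using True by (metis power_Suc)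
  qed
  have 1: "\<zeta> ^ p \<noteq> \<zeta> ^ p0"
  proof
    assume "\<zeta> ^ p = \<zeta> ^ p0"
    then have p: "p = p0" using zeta_inj X Y by blast
    then have "\<zeta> ^ l = \<zeta> ^ l0" using e zeta_nz by (simp add: power_add)
    then show False using zeta_inj X Y ne p by blast
  qed
  have 2: "\<zeta> ^ (p + l) \<noteq> \<zeta> ^ p0"
  proof
    assume pl: "\<zeta> ^ (p + l) = \<zeta> ^ p0"
    then have p0: "p0 = (p + l) mod d" using zeta_inj[of "(p + l) mod d" p0] Y d0 zeta_pow_mod[of "p + l"] by simp
    have "\<zeta> ^ (2 * p + l) * 1 = \<zeta> ^ p0 * \<zeta> ^ p0 * \<zeta> ^ l0" unfolding e by (simp add: power_add mult_2)
    also have "\<dots> = \<zeta> ^ (p + l) * \<zeta> ^ (p + l) * \<zeta> ^ l0" by (simp only: pl)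
    also have "\<dots> = \<zeta> ^ (2 * p + l) * (\<zeta> ^ l * \<zeta> ^ l0)" unfolding mult_2 power_add by (simp only: mult_ac)
    finally have "\<zeta> ^ l * \<zeta> ^ l0 = 1" using zeta_nz by (metis mult_left_cancel power_not_zero)
    moreover have "\<zeta> ^ l * \<zeta> ^ (d - l) = 1" using X by (simp add: zeta_pow_d flip: power_add)
    ultimately have "\<zeta> ^ l0 = \<zeta> ^ (d - l)" using zeta_nz by (metis mult_left_cancel power_not_zero)
    moreover have "d - l < d" using X by simp
    ultimately have "l0 = d - l" using zeta_inj[of l0 "d - l"] Y by blast
    then have "iota d (l, p) = (l0, p0)" using X p0 by (simp add: iota_sharp)
    then show False using reps_unique[OF x] y ne by simp
  qed
  show ?thesis using 1 2 by (simp add: dlt)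
qed (simp add: dlt)

lemma hnum_diagonal:
  assumes y: "(l, p) \<in> S"
  shows "dlt (2 * p + l - 1) (2 * p + l - 1) * (dlt (p + l) p - dlt p p) \<noteq> 0"
proof -
  have "\<zeta> ^ (p + l) \<noteq> \<zeta> ^ p" using zeta_pow_neq_1[of l] reps_sub[OF y] zeta_nz by (simp add: power_add)
  then show ?thesis using d0 by (simp add: dlt)
qed

text \<open>Pairing the relation with one of the two characters attached to y isolates the
  coefficient of y, by the two preceding facts.\<close>

lemma theta_independent:
  assumes z: "\<And>a b. a \<in> {1..<d} \<Longrightarrow> (\<Sum>x\<in>S. of_int (c x) * theta (D_simple \<zeta> x) a b) = 0" and y: "y \<in> S"
  shows "c y = (0 :: int)"
proof -
  obtain l0 p0 where y0: "y = (l0, p0)" by (cases y)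
  define h where "h x = hnum (fst x) (snd x)" for x
  have h0: "(\<Sum>x\<in>S. of_int (c x) * h x a b) = 0" if "a < d" for a b
  proof (cases "a = 0")
    case False
    then have a: "a \<in> {1..<d}" using that by auto
    have "(\<Sum>x\<in>S. of_int (c x) * h x a b) = (\<zeta> ^ a - 1) * (\<Sum>x\<in>S. of_int (c x) * theta (D_simple \<zeta> x) a b)"
      unfolding sum_distrib_left using False
      by (intro sum.cong refl) (auto simp: h_def theta_hnum[symmetric])
    then show ?thesis using z[OF a] by simp
  qed (simp add: h_def hnum_def)
  \<comment> \<open>The inverse of the character with exponents p0 and 2 p0 + l0 - 1, the one that
    occurs with negative sign in the trace of y.\<close>
  define W where "W a b = inverse (\<zeta> ^ p0) ^ a * inverse (\<zeta> ^ (2 * p0 + l0 - 1)) ^ b" for a b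
  define g where "g x = dlt (2 * snd x + fst x - 1) (2 * p0 + l0 - 1) * (dlt (snd x + fst x) p0 - dlt (snd x) p0)" for x
  have hW: "(\<Sum>a<d. \<Sum>b<d. W a b * h x a b) = g x" for x
  proof -
    have "(\<Sum>a<d. \<Sum>b<d. W a b * h x a b) = (\<Sum>a<d. \<Sum>b<d. ((\<zeta> ^ (snd x + fst x) * inverse (\<zeta> ^ p0)) ^ a - (\<zeta> ^ snd x * inverse (\<zeta> ^ p0)) ^ a) *
       (\<zeta> ^ (2 * snd x + fst x - 1) * inverse (\<zeta> ^ (2 * p0 + l0 - 1))) ^ b)"
      by (intro sum.cong refl) (simp add: W_def h_def hnum_def power_mult_distrib algebra_simps)
    also have "\<dots> = (\<Sum>a<d. (\<zeta> ^ (snd x + fst x) * inverse (\<zeta> ^ p0)) ^ a - (\<zeta> ^ snd x * inverse (\<zeta> ^ p0)) ^ a) *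
       (\<Sum>b<d. (\<zeta> ^ (2 * snd x + fst x - 1) * inverse (\<zeta> ^ (2 * p0 + l0 - 1))) ^ b)"
      by (rule sum_product[symmetric])
    also have "\<dots> = g x" unfolding g_def dlt_def sum_subtractf by (rule mult.commute)
    finally show ?thesis .
  qed
  have "0 = (\<Sum>a<d. \<Sum>b<d. W a b * (\<Sum>x\<in>S. of_int (c x) * h x a b))" by (simp add: h0)
  also have "\<dots> = (\<Sum>a<d. \<Sum>b<d. \<Sum>x\<in>S. of_int (c x) * (W a b * h x a b))"
    by (simp add: sum_distrib_left mult.left_commute)
  also have "\<dots> = (\<Sum>a<d. \<Sum>x\<in>S. \<Sum>b<d. of_int (c x) * (W a b * h x a b))"
    by (intro sum.cong refl) (rule sum.swap)
  also have "\<dots> = (\<Sum>x\<in>S. \<Sum>a<d. \<Sum>b<d. of_int (c x) * (W a b * h x a b))" by (rule sum.swap)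
  also have "\<dots> = (\<Sum>x\<in>S. of_int (c x) * g x)" by (simp add: hW flip: sum_distrib_left)
  also have "\<dots> = (\<Sum>x\<in>{y}. of_int (c x) * g x)"
  proof (rule sum.mono_neutral_right[OF reps_finite])
    have "g x = 0" if "x \<in> S - {y}" for x
      using hnum_orthogonal[of "fst x" "snd x" l0 p0] that y unfolding y0 g_def by simp
    then show "\<forall>x\<in>S - {y}. of_int (c x) * g x = 0" by simp
  qed (use y in simp)
  finally have "of_int (c y) * g y = 0" by simp
  then show ?thesis using hnum_diagonal[of l0 p0] y unfolding y0 g_def by simp
qed

lemma D_simple_inj: "inj_on (D_simple \<zeta>) S"
proof (rule inj_onI, rule ccontr)
  fix x y assume xy: "x \<in> S" "y \<in> S" "D_simple \<zeta> x = D_simple \<zeta> y" "x \<noteq> y"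
  define c where "c z = (if z = x then 1 else if z = y then -1 else (0::int))" for z
  have "c x = 0"
  proof (rule theta_independent[OF _ xy(1)])
    fix a b
    have "(\<Sum>z\<in>S. of_int (c z) * theta (D_simple \<zeta> z) a b) = (\<Sum>z\<in>{x, y}. of_int (c z) * theta (D_simple \<zeta> z) a b)"
      by (rule sum.mono_neutral_right) (use reps_finite xy in \<open>auto simp: c_def\<close>)
    also have "\<dots> = 0" using xy(3,4) by (simp add: c_def)
    finally show "(\<Sum>z\<in>S. of_int (c z) * theta (D_simple \<zeta> z) a b) = 0" .
  qed
  then show False by (simp add: c_def)
qed

lemma reps_D: "x \<in> S \<Longrightarrow> D_simple \<zeta> x \<in> DD"
  using reps_sub[of "fst x" "snd x"] D_simple_D[of "fst x" "snd x"] by simp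

section \<open>Spanning of the Grothendieck group by the representatives\<close>

definition spn :: "(dgen rep \<Rightarrow>\<^sub>0 int) \<Rightarrow> bool" where
  "spn f \<longleftrightarrow> (\<exists>g. Poly_Mapping.keys g \<subseteq> D_simple \<zeta> ` S \<and> f - g \<in> I)"

lemma spn_I: "f \<in> I \<Longrightarrow> spn f" unfolding spn_def by (intro exI[of _ 0]) simp

lemma spn_diff: assumes "spn f" "spn f'" shows "spn (f - f')"
proof -
  obtain g g' where g: "Poly_Mapping.keys g \<subseteq> D_simple \<zeta> ` S" "f - g \<in> I" "Poly_Mapping.keys g' \<subseteq> D_simple \<zeta> ` S" "f' - g' \<in> I"
    using assms by (auto simp: spn_def)
  have "(f - f') - (g - g') = (f - g) - (f' - g')" by simp
  then have "(f - f') - (g - g') \<in> I" using I_closed(4) g by metis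
  then show ?thesis unfolding spn_def using g keys_diff[of g g'] by (intro exI[of _ "g - g'"]) auto
qed

lemma spn_uminus: "spn f \<Longrightarrow> spn (- f)" using spn_diff[OF spn_I[OF I_closed(1)], of f] by simp
lemma spn_add: "spn f \<Longrightarrow> spn g \<Longrightarrow> spn (f + g)" using spn_diff[OF _ spn_uminus, of f g] by simp

lemma spn_of: "x \<in> S \<Longrightarrow> spn (frag_of (D_simple \<zeta> x))"
  unfolding spn_def by (intro exI[of _ "frag_of (D_simple \<zeta> x)"]) (simp add: keys_frag_of I_closed)

lemma spn_simple:
  assumes "0 < l" "l \<le> d" shows "spn (frag_of (D_simple \<zeta> (l, p)))"
proof (cases "l = d")
  case True
  then show ?thesis using I_ctr[OF D_simple_D[OF assms]] ctr_D_simple_d by (auto intro: spn_I)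
next
  case False
  then have l: "0 < l" "l < d" using assms by auto
  define x where "x = (l, p mod d)"
  have x: "D_simple \<zeta> x = D_simple \<zeta> (l, p)" using D_simple_mod[OF l(1)] by (simp add: x_def)
  have ix: "D_simple \<zeta> (iota d x) = D_simple \<zeta> (d - l, p + l)"
    using D_simple_mod[of "d - l" "p mod d + l"] D_simple_mod[of "d - l" "p + l"] l
    by (simp add: x_def iota_sharp mod_add_left_eq)
  obtain W i q r1 r2 where W: "W \<in> DD" "ctr W" "ses (D_simple \<zeta> (d - l, p + l)) i W q (D_simple \<zeta> (l, p)) r1 r2"
    using iota_sequence[OF l] .
  have D: "D_simple \<zeta> (d - l, p + l) \<in> DD" "D_simple \<zeta> (l, p) \<in> DD" using l by auto
  have "frag_of W - frag_of (D_simple \<zeta> (d - l, p + l)) - frag_of (D_simple \<zeta> (l, p)) \<in> I"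
    using I_ses[OF D(1) W(1) D(2) W(3)] .
  from I_closed(4)[OF I_ctr[OF W(1,2)] this]
  have sum: "frag_of (D_simple \<zeta> (d - l, p + l)) + frag_of (D_simple \<zeta> (l, p)) \<in> I" by (simp add: algebra_simps)
  have "x \<in> Lambda_sharp d" using l d0 by (simp add: x_def Lambda_sharp_iff)
  then consider "x \<in> S" | "iota d x \<in> S" using reps_cover by blast
  then show ?thesis
  proof cases
    case 1
    then show ?thesis using spn_of x by metis
  next
    case 2
    then have "spn (frag_of (D_simple \<zeta> (d - l, p + l)))" using spn_of ix by metis
    from spn_diff[OF spn_I[OF sum] this] show ?thesis by simp
  qed
qed

lemma spn_module: "M \<in> DD \<Longrightarrow> spn (frag_of M)"
proof (induction "rdim M" arbitrary: M rule: less_induct)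
  case less
  show ?case
  proof (cases "rdim M = 0")
    case True
    then have "ctr M" by (simp add: ctr_def)
    then show ?thesis using I_ctr less.prems spn_I by blast
  next
    case False
    then obtain l p f r where l: "0 < l" "l \<le> d" and f: "rhom (D_simple \<zeta> (l, p)) M f" "lin l (rdim M) r" "r * f = idn l"
      using simple_submodule_exists[OF less.prems] by blast
    obtain Z q s where Z: "Z \<in> DD" "ses (D_simple \<zeta> (l, p)) f M q Z r s"
      using cokernel_exists[OF D_simple_D[OF l] less.prems f(1)] f(2,3) by (metis rdim_D_simple)
    have "spn (frag_of Z)" using less.hyps[OF _ Z(1)] rdim_ses[OF Z(2)] l by simp
    moreover have "spn (frag_of M - frag_of (D_simple \<zeta> (l, p)) - frag_of Z)"
      using spn_I[OF I_ses[OF D_simple_D[OF l] less.prems Z]] .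
    ultimately have "spn (frag_of M - frag_of (D_simple \<zeta> (l, p)) - frag_of Z + frag_of Z + frag_of (D_simple \<zeta> (l, p)))"
      using spn_add spn_simple[OF l] by blast
    then show ?thesis by simp
  qed
qed

lemma spn_all: assumes "f \<in> carrier FG" shows "spn f"
proof -
  have "Poly_Mapping.keys f \<subseteq> DD" using assms by simp
  then show ?thesis by (induction f rule: frag_induction) (auto intro: spn_module spn_diff spn_I I_closed)
qed

lemma Th_reps: "Poly_Mapping.keys g \<subseteq> D_simple \<zeta> ` S \<Longrightarrow>
   Th g a b = (\<Sum>x\<in>S. of_int (Poly_Mapping.lookup g (D_simple \<zeta> x)) * theta (D_simple \<zeta> x) a b)"
  by (subst Th_superset[of "D_simple \<zeta> ` S"]) (simp_all add: reps_finite sum.reindex[OF D_simple_inj])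

text \<open>Modulo the relations every element is a combination of representatives, and vanishing
  traces force its coefficients to vanish. The relations are thereby identified with the common
  kernel of the traces, the form in which they are used below.\<close>

lemma Th_kernel:
  assumes f: "f \<in> carrier FG" "\<And>a b. a \<in> {1..<d} \<Longrightarrow> Th f a b = 0" shows "f \<in> I"
proof -
  obtain g where g: "Poly_Mapping.keys g \<subseteq> D_simple \<zeta> ` S" "f - g \<in> I" using spn_all[OF f(1)] by (auto simp: spn_def)
  have "Th g a b = 0" if "a \<in> {1..<d}" for a b using Th_I[OF g(2) that] f(2)[OF that] by (simp add: Th_diff)
  then have "Poly_Mapping.lookup g (D_simple \<zeta> x) = 0" if "x \<in> S" for x
    using theta_independent[OF _ that, of "\<lambda>x. Poly_Mapping.lookup g (D_simple \<zeta> x)"] Th_reps[OF g(1)] by simp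
  then have "M \<notin> Poly_Mapping.keys g" for M using g(1) by (auto simp: in_keys_iff)
  then have "Poly_Mapping.keys g = {}" by blast
  then show ?thesis using g(2) by simp
qed

end

text \<open>An explicit system of representatives: \<iota> exchanges the indices with p + l < d and
  those with p + l \<ge> d, so it has no fixed points and each orbit has exactly one member of the
  first kind.\<close>

definition reps0 :: "(nat \<times> nat) set" where "reps0 = {(l, p). 0 < l \<and> p + l < d}"

lemma reps0: "iota_orbit_representatives d reps0"
  unfolding iota_orbit_representatives_def
proof (intro conjI ballI)
  show "reps0 \<subseteq> Lambda_sharp d" by (auto simp: reps0_def Lambda_sharp_def)
  fix x assume "x \<in> Lambda_sharp d"
  then obtain l p where x: "x = (l, p)" "0 < l" "l < d" "p < d" by (cases x) (auto simp: Lambda_sharp_iff)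
  have i: "iota d x = (d - l, (p + l) mod d)" using x by (simp add: iota_sharp)
  show "\<exists>!y. y \<in> reps0 \<and> y \<in> {x, iota d x}"
  proof (cases "p + l < d")
    case True
    then show ?thesis using x i by (intro ex1I[of _ x]) (auto simp: reps0_def)
  next
    case False
    then have "(p + l) mod d = p + l - d" using x by (simp add: mod_if)
    then show ?thesis using x i False by (intro ex1I[of _ "iota d x"]) (auto simp: reps0_def)
  qed
qed

lemma card_reps0: "card reps0 = d * (d - 1) div 2"
proof -
  have "reps0 = (SIGMA l:{1..<d}. {..<d - l})" by (auto simp: reps0_def)
  then have "card reps0 = (\<Sum>l\<in>{1..<d}. d - l)" by (simp add: card_SigmaI)
  also have "\<dots> = (\<Sum>l\<in>{1..<d}. l)"
    by (rule sum.reindex_bij_witness[of _ "\<lambda>l. d - l" "\<lambda>l. d - l"]) auto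
  also have "\<dots> = (\<Sum>l<d. l)" by (rule sum.mono_neutral_left) auto
  also have "\<dots> = d * (d - 1) div 2" by (simp add: Sum_Ico_nat atLeast0LessThan[symmetric])
  finally show ?thesis .
qed

lemma I_iff: "f \<in> I \<longleftrightarrow> f \<in> carrier FG \<and> (\<forall>a\<in>{1..<d}. \<forall>b. Th f a b = 0)"
  using Th_kernel[OF reps0, of f] Th_I I_closed(5) by blast

section \<open>The quotient ring described by traces\<close>

abbreviation "OR \<equiv> object_ring DD (D_tensor d) D_unit"
abbreviation "GR \<equiv> Gr_st_B d \<zeta>"

definition cls :: "(dgen rep \<Rightarrow>\<^sub>0 int) \<Rightarrow> (dgen rep \<Rightarrow>\<^sub>0 int) set" where "cls f = I +>\<^bsub>OR\<^esub> f"

definition omul :: "(dgen rep \<Rightarrow>\<^sub>0 int) \<Rightarrow> (dgen rep \<Rightarrow>\<^sub>0 int) \<Rightarrow> dgen rep \<Rightarrow>\<^sub>0 int" where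
  "omul f g = frag_extend (\<lambda>x. frag_extend (\<lambda>y. frag_of (D_tensor d x y)) g) f"

lemma D_unit_eq: "D_unit = D_simple \<zeta> (1, 0)"
  unfolding D_unit_def D_simple_def split rep.inject
  by (intro conjI refl ext) (auto split: dgen.splits intro!: eq_matI)

lemma D_unit_D: "D_unit \<in> DD" unfolding D_unit_eq using d2 by (intro D_simple_D) auto

lemma theta_unit: "a > 0 \<Longrightarrow> theta D_unit a b = 1"
  unfolding D_unit_eq by (subst theta_D_simple) (simp_all add: szed_def skappa_def)

lemma omul_closed: "f \<in> carrier FG \<Longrightarrow> g \<in> carrier FG \<Longrightarrow> omul f g \<in> carrier FG"
  using keys_frag_extend[of "\<lambda>x. frag_extend (\<lambda>y. frag_of (D_tensor d x y)) g" f]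
    keys_frag_extend[of "\<lambda>y. frag_of (D_tensor d x y)" g for x]
  by (force simp: omul_def keys_frag_of intro: D_tensor_D)

lemma Th_omul:
  assumes "f \<in> carrier FG" "g \<in> carrier FG" "a > 0" shows "Th (omul f g) a b = Th f a b * Th g a b"
proof -
  have D: "x \<in> DD" if "x \<in> Poly_Mapping.keys f \<or> x \<in> Poly_Mapping.keys g" for x using that assms by auto
  have "Th (frag_extend (\<lambda>y. frag_of (D_tensor d x y)) g) a b = theta x a b * Th g a b" if "x \<in> Poly_Mapping.keys f" for x
    unfolding Th_extend Th_def[of g] sum_distrib_left
    using D that theta_tensor[OF _ _ assms(3)] by (intro sum.cong) auto
  then show ?thesis unfolding omul_def Th_extend[of _ f] Th_def[of f] sum_distrib_right
    by (intro sum.cong) auto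
qed

lemma FG_add: "f \<in> carrier FG \<Longrightarrow> g \<in> carrier FG \<Longrightarrow> f + g \<in> carrier FG"
  and FG_diff: "f \<in> carrier FG \<Longrightarrow> g \<in> carrier FG \<Longrightarrow> f - g \<in> carrier FG"
  using Poly_Mapping.keys_add[of f g] keys_diff[of f g] by auto

lemma FG_of: "M \<in> DD \<Longrightarrow> frag_of M \<in> carrier FG" by (simp add: keys_frag_of)

lemma OR_sel: "carrier OR = carrier FG" "add OR = (+)" "monoid.mult OR = omul" "zero OR = 0" "one OR = frag_of D_unit"
  by (simp_all add: object_ring_def omul_def[abs_def] fun_eq_iff)

lemma cls_alt: "cls f = {h + f | h. h \<in> I}"
  by (auto simp: cls_def a_r_coset_def r_coset_def OR_sel)

lemma cls_eq_iff:
  assumes "f \<in> carrier FG" "g \<in> carrier FG"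
  shows "cls f = cls g \<longleftrightarrow> (\<forall>a\<in>{1..<d}. \<forall>b. Th f a b = Th g a b)"
proof -
  have "cls f = cls g \<longleftrightarrow> f - g \<in> I"
  proof
    assume "cls f = cls g"
    moreover have "f \<in> cls f" unfolding cls_alt using I_closed(1) by force
    ultimately obtain h where "h \<in> I" "f = h + g" unfolding cls_alt by blast
    then show "f - g \<in> I" by simp
  next
    assume fg: "f - g \<in> I"
    have "h + f = (h + (f - g)) + g" "h + g = (h - (f - g)) + f" for h by simp_all
    then show "cls f = cls g" unfolding cls_alt using I_closed(2,4)[OF _ fg] by blast
  qed
  then show ?thesis using FG_diff[OF assms] by (simp add: I_iff Th_diff del: carrier_free_Abelian_group_iff)
qed

lemma GR_alt: "GR = OR Quot I"
  by (simp add: Gr_st_B_def groth_ring_def)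

lemma GR_carrier: "y \<in> carrier GR \<longleftrightarrow> (\<exists>f\<in>carrier FG. y = cls f)"
  by (auto simp: GR_alt FactRing_def A_RCOSETS_def RCOSETS_def cls_def a_r_coset_def OR_sel)

lemma cls_carrier [simp]: "f \<in> carrier FG \<Longrightarrow> cls f \<in> carrier GR"
  using GR_carrier by blast

lemma GR_add: "add GR (cls f) (cls g) = cls (f + g)"
proof -
  have "add GR (cls f) (cls g) = {x + y | x y. x \<in> cls f \<and> y \<in> cls g}"
    by (auto simp: GR_alt FactRing_def set_add_def set_mult_def OR_sel)
  also have "\<dots> = cls (f + g)"
  proof
    show "{x + y | x y. x \<in> cls f \<and> y \<in> cls g} \<subseteq> cls (f + g)"
    proof clarify
      fix x y assume "x \<in> cls f" "y \<in> cls g"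
      then obtain h k where "h \<in> I" "k \<in> I" "x = h + f" "y = k + g" unfolding cls_alt by blast
      then show "x + y \<in> cls (f + g)" unfolding cls_alt using I_closed(2)[of h k]
        by (intro CollectI exI[of _ "h + k"]) (simp add: algebra_simps)
    qed
    show "cls (f + g) \<subseteq> {x + y | x y. x \<in> cls f \<and> y \<in> cls g}"
    proof
      fix z assume "z \<in> cls (f + g)"
      then obtain h where h: "h \<in> I" "z = (h + f) + (0 + g)" unfolding cls_alt by (auto simp: algebra_simps)
      then show "z \<in> {x + y | x y. x \<in> cls f \<and> y \<in> cls g}" unfolding cls_alt using I_closed(1) by blast
    qed
  qed
  finally show ?thesis .
qed

text \<open>The product of cosets is a union over all pairs of members. Traces are constant on
  cosets and multiplicative, so every pair gives the same coset, which is what an ideal property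
  would provide.\<close>

lemma GR_mult:
  assumes f: "f \<in> carrier FG" and g: "g \<in> carrier FG"
  shows "monoid.mult GR (cls f) (cls g) = cls (omul f g)"
proof -
  have key: "cls (omul x y) = cls (omul f g)" if xy: "x \<in> cls f" "y \<in> cls g" for x y
  proof -
    obtain h k where hk: "h \<in> I" "k \<in> I" "x = h + f" "y = k + g" using xy unfolding cls_alt by blast
    then have c: "x \<in> carrier FG" "y \<in> carrier FG" using I_closed(5) FG_add f g by blast+
    have "Th x a b = Th f a b" "Th y a b = Th g a b" if "a \<in> {1..<d}" for a b
      using Th_I hk that by (simp_all add: Th_add)
    then show ?thesis using c f g by (simp add: cls_eq_iff omul_closed Th_omul del: carrier_free_Abelian_group_iff)
  qed
  have ne: "f \<in> cls f" "g \<in> cls g" unfolding cls_alt using I_closed(1) by force+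
  have "monoid.mult GR (cls f) (cls g) = (\<Union>x\<in>cls f. \<Union>y\<in>cls g. cls (omul x y))"
    by (simp add: GR_alt FactRing_def rcoset_mult_def OR_sel cls_def)
  also have "\<dots> = (\<Union>x\<in>cls f. \<Union>y\<in>cls g. cls (omul f g))" by (intro SUP_cong refl) (rule key)
  also have "\<dots> = cls (omul f g)" using ne by blast
  finally show ?thesis .
qed

lemma GR_one: "one GR = cls (frag_of D_unit)" and GR_zero: "zero GR = cls 0"
  by (simp add: GR_alt FactRing_def cls_def OR_sel) (auto simp: GR_alt FactRing_def cls_alt)

lemma zero_FG: "0 \<in> carrier FG" by simp

lemma FG_sum: "(\<And>x. x \<in> A \<Longrightarrow> F x \<in> carrier FG) \<Longrightarrow> (\<Sum>x\<in>A. F x) \<in> carrier FG"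
  by (induction A rule: infinite_finite_induct) (simp_all add: FG_add zero_FG del: carrier_free_Abelian_group_iff)

lemma unit_FG: "frag_of D_unit \<in> carrier FG" using FG_of D_unit_D by blast

text \<open>The multiplicative axioms and distributivity are compared on traces, where they hold for
  complex numbers; isomorphisms between tensor products of modules do not enter.\<close>

lemma ring_GR: "ring GR"
proof (rule ringI)
  show "abelian_group GR"
  proof (rule abelian_groupI)
    fix x assume "x \<in> carrier GR"
    then obtain f where f: "f \<in> carrier FG" "x = cls f" using GR_carrier by blast
    have mf: "- f \<in> carrier FG" using f by simp
    show "\<exists>y\<in>carrier GR. y \<oplus>\<^bsub>GR\<^esub> x = \<zero>\<^bsub>GR\<^esub>"
      by (rule bexI[of _ "cls (- f)"]) (simp_all add: f(2) GR_add GR_zero cls_carrier[OF mf])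
  qed (auto simp: GR_carrier GR_add GR_zero add_ac simp del: carrier_free_Abelian_group_iff intro: FG_add zero_FG)
  show "monoid GR"
  proof (rule monoidI)
    show "\<one>\<^bsub>GR\<^esub> \<in> carrier GR" unfolding GR_one using cls_carrier unit_FG .
    fix x y assume "x \<in> carrier GR" "y \<in> carrier GR"
    then obtain f g where f: "f \<in> carrier FG" "x = cls f" and g: "g \<in> carrier FG" "y = cls g" using GR_carrier by metis
    show "x \<otimes>\<^bsub>GR\<^esub> y \<in> carrier GR" unfolding f(2) g(2) GR_mult[OF f(1) g(1)] by (rule cls_carrier[OF omul_closed[OF f(1) g(1)]])
    show "\<one>\<^bsub>GR\<^esub> \<otimes>\<^bsub>GR\<^esub> x = x" "x \<otimes>\<^bsub>GR\<^esub> \<one>\<^bsub>GR\<^esub> = x"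
      unfolding f(2) GR_one GR_mult[OF unit_FG f(1)] GR_mult[OF f(1) unit_FG] cls_eq_iff[OF omul_closed[OF unit_FG f(1)] f(1)]
        cls_eq_iff[OF omul_closed[OF f(1) unit_FG] f(1)]
      using Th_omul[OF unit_FG f(1)] Th_omul[OF f(1) unit_FG] theta_unit by simp_all
    fix z assume "z \<in> carrier GR"
    then obtain h where h: "h \<in> carrier FG" "z = cls h" using GR_carrier by metis
    note fg = omul_closed[OF f(1) g(1)] and gh = omul_closed[OF g(1) h(1)]
    show "x \<otimes>\<^bsub>GR\<^esub> y \<otimes>\<^bsub>GR\<^esub> z = x \<otimes>\<^bsub>GR\<^esub> (y \<otimes>\<^bsub>GR\<^esub> z)"
      unfolding f(2) g(2) h(2) GR_mult[OF f(1) g(1)] GR_mult[OF g(1) h(1)] GR_mult[OF fg h(1)] GR_mult[OF f(1) gh]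
        cls_eq_iff[OF omul_closed[OF fg h(1)] omul_closed[OF f(1) gh]]
      using Th_omul[OF fg h(1)] Th_omul[OF f(1) gh] Th_omul[OF f(1) g(1)] Th_omul[OF g(1) h(1)] by (simp add: mult.assoc)
  qed
next
  fix x y z assume "x \<in> carrier GR" "y \<in> carrier GR" "z \<in> carrier GR"
  then obtain f g h where f: "f \<in> carrier FG" "x = cls f" and g: "g \<in> carrier FG" "y = cls g"
    and h: "h \<in> carrier FG" "z = cls h" using GR_carrier by metis
  note fg = FG_add[OF f(1) g(1)] and c = FG_add[OF omul_closed omul_closed, OF f(1) h(1) g(1) h(1)]
    FG_add[OF omul_closed omul_closed, OF h(1) f(1) h(1) g(1)]
  show "(x \<oplus>\<^bsub>GR\<^esub> y) \<otimes>\<^bsub>GR\<^esub> z = x \<otimes>\<^bsub>GR\<^esub> z \<oplus>\<^bsub>GR\<^esub> y \<otimes>\<^bsub>GR\<^esub> z"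
    unfolding f(2) g(2) h(2) GR_add GR_mult[OF fg h(1)] GR_mult[OF f(1) h(1)] GR_mult[OF g(1) h(1)]
      cls_eq_iff[OF omul_closed[OF fg h(1)] c(1)]
    using Th_omul[OF fg h(1)] Th_omul[OF f(1) h(1)] Th_omul[OF g(1) h(1)] by (simp add: Th_add distrib_right)
  show "z \<otimes>\<^bsub>GR\<^esub> (x \<oplus>\<^bsub>GR\<^esub> y) = z \<otimes>\<^bsub>GR\<^esub> x \<oplus>\<^bsub>GR\<^esub> z \<otimes>\<^bsub>GR\<^esub> y"
    unfolding f(2) g(2) h(2) GR_add GR_mult[OF h(1) fg] GR_mult[OF h(1) f(1)] GR_mult[OF h(1) g(1)]
      cls_eq_iff[OF omul_closed[OF h(1) fg] c(2)]
    using Th_omul[OF h(1) fg] Th_omul[OF h(1) f(1)] Th_omul[OF h(1) g(1)] by (simp add: Th_add distrib_left)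
qed

interpretation G: ring GR by (rule ring_GR)

lemma GR_uminus: assumes "f \<in> carrier FG" shows "\<ominus>\<^bsub>GR\<^esub> cls f = cls (- f)"
proof (rule G.minus_equality)
  have mf: "- f \<in> carrier FG" using assms by simp
  show "cls (- f) \<oplus>\<^bsub>GR\<^esub> cls f = \<zero>\<^bsub>GR\<^esub>" by (simp add: GR_add GR_zero)
  show "cls f \<in> carrier GR" "cls (- f) \<in> carrier GR" using assms mf by simp_all
qed

lemma GR_add_pow: assumes f: "f \<in> carrier FG" shows "add_pow GR (k :: int) (cls f) = cls (frag_cmul k f)"
proof -
  have n: "add_pow GR (n :: nat) (cls f) = cls (frag_cmul (int n) f)" for n
  proof (induction n)
    case (Suc n)
    have "frag_cmul (int n) f + f = frag_cmul (int (Suc n)) f" by (simp add: frag_cmul_distrib)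
    then show ?case using Suc by (simp add: G.add.nat_pow_Suc GR_add)
  qed (simp add: GR_zero)
  show ?thesis
  proof (cases "k \<ge> 0")
    case True
    then show ?thesis using n[of "nat k"] by (simp add: add_pow_int_ge)
  next
    case False
    have "frag_cmul (int (nat (- k))) f \<in> carrier FG" using f keys_cmul[of "int (nat (- k))" f] by auto
    from GR_uminus[OF this] show ?thesis using False n[of "nat (- k)"] by (simp add: add_pow_int_lt)
  qed
qed

lemma GR_finsum:
  assumes "finite A" "\<And>x. x \<in> A \<Longrightarrow> F x \<in> carrier FG"
  shows "(\<Oplus>\<^bsub>GR\<^esub>x\<in>A. cls (F x)) = cls (\<Sum>x\<in>A. F x)"
  using assms
proof (induction A rule: finite_induct)
  case (insert x A)
  have "(\<lambda>x. cls (F x)) \<in> A \<rightarrow> carrier GR" "cls (F x) \<in> carrier GR" using insert.prems cls_carrier by blast+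
  then show ?case using insert by (simp add: G.finsum_insert GR_add)
qed (simp add: GR_zero)

section \<open>Basis, rank and generators\<close>

lemma m_st_B_cls: "m_st_B d \<zeta> x = cls (frag_of (D_simple \<zeta> x))"
  by (simp add: m_st_B_def groth_class_def cls_def)

text \<open>Existence is the spanning statement, uniqueness the linear independence of the traces.
  Coefficient families are extensional functions, so that uniqueness is not spoiled by values
  outside S.\<close>

lemma basis_unique_existence:
  assumes S: "iota_orbit_representatives d S" and y: "y \<in> carrier GR"
  shows "\<exists>!c. c \<in> S \<rightarrow>\<^sub>E (UNIV :: int set) \<and> y = (\<Oplus>\<^bsub>GR\<^esub>x\<in>S. add_pow GR (c x) (m_st_B d \<zeta> x))"
proof -
  have D: "frag_of (D_simple \<zeta> x) \<in> carrier FG" if "x \<in> S" for x using FG_of reps_D[OF S that] by blast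
  have cD: "frag_cmul k (frag_of (D_simple \<zeta> x)) \<in> carrier FG" if "x \<in> S" for x k
    using D[OF that] keys_cmul[of k "frag_of (D_simple \<zeta> x)"] by auto
  define L where "L c = (\<Sum>x\<in>S. frag_cmul (c x) (frag_of (D_simple \<zeta> x)))" for c :: "nat \<times> nat \<Rightarrow> int"
  have LF: "L c \<in> carrier FG" for c unfolding L_def using cD by (rule FG_sum)
  have sum: "(\<Oplus>\<^bsub>GR\<^esub>x\<in>S. add_pow GR (c x) (m_st_B d \<zeta> x)) = cls (L c)" for c
  proof -
    have "(\<Oplus>\<^bsub>GR\<^esub>x\<in>S. add_pow GR (c x) (m_st_B d \<zeta> x)) = (\<Oplus>\<^bsub>GR\<^esub>x\<in>S. cls (frag_cmul (c x) (frag_of (D_simple \<zeta> x))))"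
      by (rule G.finsum_cong') (use D cD in \<open>auto simp: m_st_B_cls GR_add_pow simp del: carrier_free_Abelian_group_iff\<close>)
    then show ?thesis unfolding L_def using GR_finsum[OF reps_finite[OF S] cD] by simp
  qed
  have ThL: "Th (L c) a b = (\<Sum>x\<in>S. of_int (c x) * theta (D_simple \<zeta> x) a b)" for c a b
    by (simp add: L_def Th_sum Th_cmul)
  obtain f where f: "f \<in> carrier FG" "y = cls f" using y GR_carrier by blast
  obtain g where g: "Poly_Mapping.keys g \<subseteq> D_simple \<zeta> ` S" "f - g \<in> I" using spn_all[OF S f(1)] by (auto simp: spn_def[OF S])
  have inj: "c x = c' x" if "cls (L c) = cls (L c')" "x \<in> S" for c c' x
  proof -
    have "Th (L c) a b = Th (L c') a b" if "a \<in> {1..<d}" for a b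
      using \<open>cls (L c) = cls (L c')\<close> that cls_eq_iff[OF LF LF] by blast
    then have "(\<lambda>x. c x - c' x) x = 0"
      by (intro theta_independent[OF S _ \<open>x \<in> S\<close>]) (simp add: ThL left_diff_distrib sum_subtractf)
    then show ?thesis by simp
  qed
  define c where "c = restrict (\<lambda>x. Poly_Mapping.lookup g (D_simple \<zeta> x)) S"
  have "Th f a b = Th (L c) a b" if "a \<in> {1..<d}" for a b
    using Th_I[OF g(2) that, of b] Th_reps[OF S g(1)] by (simp add: ThL Th_diff c_def)
  then have yc: "y = cls (L c)" using f cls_eq_iff[OF f(1) LF] by blast
  show ?thesis
  proof (rule ex1I[of _ c])
    show "c \<in> S \<rightarrow>\<^sub>E UNIV \<and> y = (\<Oplus>\<^bsub>GR\<^esub>x\<in>S. add_pow GR (c x) (m_st_B d \<zeta> x))" unfolding sum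
      by (rule conjI, simp add: c_def, rule yc)
    fix c' :: "nat \<times> nat \<Rightarrow> int" assume c': "c' \<in> S \<rightarrow>\<^sub>E UNIV \<and> y = (\<Oplus>\<^bsub>GR\<^esub>x\<in>S. add_pow GR (c' x) (m_st_B d \<zeta> x))"
    then have "cls (L c') = cls (L c)" unfolding sum using yc by simp
    then have "c' x = c x" if "x \<in> S" for x using inj that by blast
    then show "c' = c" using c' by (intro extensionalityI[of _ S]) (auto simp: c_def PiE_def)
  qed
qed

text \<open>The explicit system \<open>reps0\<close>, enumerated by e, provides the count of the
  basis; injectivity and surjectivity of \<Phi> are again independence and spanning.\<close>

lemma free_GR: "add_monoid GR \<cong> free_Abelian_group {..<d * (d - 1) div 2}"
proof -
  let ?N = "d * (d - 1) div 2" and ?F = "free_Abelian_group {..<d * (d - 1) div 2}"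
  note S = reps0
  obtain e where e: "bij_betw e {..<?N} reps0"
    using ex_bij_betw_nat_finite[OF reps_finite[OF S]] card_reps0 by (auto simp: atLeast0LessThan)
  define D where "D i = D_simple \<zeta> (e i)" for i
  have eS: "e i \<in> reps0" if "i < ?N" for i using e that by (auto simp: bij_betw_def)
  have DD: "D i \<in> DD" if "i < ?N" for i unfolding D_def using reps_D[OF S eS[OF that]] .
  have Dinj: "inj_on D {..<?N}"
    unfolding D_def using comp_inj_on[OF bij_betw_imp_inj_on[OF e]] D_simple_inj[OF S] e
    by (simp add: bij_betw_def comp_def)
  define \<Phi> where "\<Phi> c = cls (frag_extend (\<lambda>i. frag_of (D i)) c)" for c
  have FF: "frag_extend (\<lambda>i. frag_of (D i)) c \<in> carrier FG" if "c \<in> carrier ?F" for c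
    using keys_frag_extend[of "\<lambda>i. frag_of (D i)" c] that DD by (fastforce simp: keys_frag_of)
  have "\<Phi> \<in> hom ?F (add_monoid GR)"
    by (rule homI) (use FF in \<open>auto simp: \<Phi>_def frag_extend_add GR_add simp del: carrier_free_Abelian_group_iff\<close>)
  moreover have "inj_on \<Phi> (carrier ?F)"
  proof (rule inj_onI)
    fix c c' assume c: "c \<in> carrier ?F" "c' \<in> carrier ?F" "\<Phi> c = \<Phi> c'"
    define k where "k = c - c'"
    have k: "Poly_Mapping.keys k \<subseteq> {..<?N}" using c(1,2) keys_diff[of c c'] by (auto simp: k_def)
    have "Th (frag_extend (\<lambda>i. frag_of (D i)) k) a b = 0" if "a \<in> {1..<d}" for a b
      using c(3) cls_eq_iff[OF FF[OF c(1)] FF[OF c(2)]] that by (simp add: \<Phi>_def k_def frag_extend_diff Th_diff)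
    moreover have "Th (frag_extend (\<lambda>i. frag_of (D i)) k) a b =
       (\<Sum>x\<in>reps0. of_int (Poly_Mapping.lookup k (inv_into {..<?N} e x)) * theta (D_simple \<zeta> x) a b)" for a b
    proof -
      have "Th (frag_extend (\<lambda>i. frag_of (D i)) k) a b = (\<Sum>i<?N. of_int (Poly_Mapping.lookup k i) * theta (D i) a b)"
        unfolding Th_extend by (rule sum.mono_neutral_cong_left) (use k in \<open>auto simp: in_keys_iff\<close>)
      also have "\<dots> = (\<Sum>i<?N. of_int (Poly_Mapping.lookup k (inv_into {..<?N} e (e i))) * theta (D_simple \<zeta> (e i)) a b)"
        by (intro sum.cong refl) (use bij_betw_inv_into_left[OF e] in \<open>simp add: D_def\<close>)
      also have "\<dots> = (\<Sum>x\<in>reps0. of_int (Poly_Mapping.lookup k (inv_into {..<?N} e x)) * theta (D_simple \<zeta> x) a b)"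
        by (rule sum.reindex_bij_betw[OF e])
      finally show ?thesis .
    qed
    ultimately have "Poly_Mapping.lookup k (inv_into {..<?N} e x) = 0" if "x \<in> reps0" for x
      using theta_independent[OF S _ that, of "\<lambda>x. Poly_Mapping.lookup k (inv_into {..<?N} e x)"] by simp
    from this[OF eS] have z: "Poly_Mapping.lookup k i = 0" if "i < ?N" for i
      using bij_betw_inv_into_left[OF e, of i] that by (metis lessThan_iff)
    have "i \<notin> Poly_Mapping.keys k" for i using z[of i] k by (auto simp: in_keys_iff)
    then have "Poly_Mapping.keys k = {}" by blast
    then show "c = c'" by (simp add: k_def)
  qed
  moreover have "\<Phi> ` carrier ?F = carrier (add_monoid GR)"
  proof
    show "\<Phi> ` carrier ?F \<subseteq> carrier (add_monoid GR)"
      using FF by (auto simp: \<Phi>_def simp del: carrier_free_Abelian_group_iff)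
    show "carrier (add_monoid GR) \<subseteq> \<Phi> ` carrier ?F"
    proof
      fix y assume "y \<in> carrier (add_monoid GR)"
      then obtain f where f: "f \<in> carrier FG" "y = cls f" using GR_carrier by auto
      obtain g where g: "Poly_Mapping.keys g \<subseteq> D_simple \<zeta> ` reps0" "f - g \<in> I" using spn_all[OF S f(1)] by (auto simp: spn_def[OF S])
      define ix where "ix = inv_into {..<?N} D"
      have img: "D_simple \<zeta> ` reps0 = D ` {..<?N}" unfolding bij_betw_imp_surj_on[OF e, symmetric] image_image D_def ..
      define c where "c = frag_extend (frag_of \<circ> ix) g"
      have kc: "Poly_Mapping.keys c \<subseteq> {..<?N}"
        using keys_frag_extend[of "frag_of \<circ> ix" g] g(1) inv_into_into[of _ D "{..<?N}"] unfolding img c_def ix_def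
        by (fastforce simp: keys_frag_of)
      have "frag_extend (\<lambda>i. frag_of (D i)) c = frag_extend ((\<lambda>i. frag_of (D i)) \<circ> ix) g"
        unfolding c_def by (rule frag_extend_compose)
      also have "\<dots> = frag_extend frag_of g"
        by (rule frag_extend_eq) (use g(1) f_inv_into_f[of _ D "{..<?N}"] in \<open>auto simp: ix_def img\<close>)
      also have "\<dots> = g" by (rule frag_expansion[symmetric])
      finally have "\<Phi> c = cls g" by (simp add: \<Phi>_def)
      moreover have gF: "g \<in> carrier FG" using g(1) reps_D[OF S] by auto
      moreover have "cls f = cls g" unfolding cls_eq_iff[OF f(1) gF] using Th_I[OF g(2)] by (simp add: Th_diff)
      ultimately show "y \<in> \<Phi> ` carrier ?F" using kc f(2) by auto
    qed
  qed
  ultimately have "\<Phi> \<in> iso ?F (add_monoid GR)" by (simp add: iso_def bij_betw_def)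
  then have "?F \<cong> add_monoid GR" by (auto simp: is_iso_def)
  then show ?thesis by (rule group.iso_sym[OF group_free_Abelian_group])
qed

text \<open>The Clebsch-Gordan relation solved for its top term. After multiplication by \<zeta>^a -
  1 it becomes a telescoping identity between differences of characters.\<close>

lemma D_simple_succ:
  assumes "0 < l" "l + 2 \<le> d"
  shows "cls (frag_of (D_simple \<zeta> (l + 2, p))) =
    cls (omul (frag_of (D_simple \<zeta> (2, 0))) (frag_of (D_simple \<zeta> (l + 1, p))) - frag_of (D_simple \<zeta> (l, p + 1)))"
proof -
  have D: "frag_of (D_simple \<zeta> (l + 2, p)) \<in> carrier FG" "frag_of (D_simple \<zeta> (2, 0)) \<in> carrier FG"
    "frag_of (D_simple \<zeta> (l + 1, p)) \<in> carrier FG" "frag_of (D_simple \<zeta> (l, p + 1)) \<in> carrier FG"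
    by (rule FG_of, rule D_simple_D, use assms in simp, use assms in simp)+
  show ?thesis unfolding cls_eq_iff[OF D(1) FG_diff[OF omul_closed[OF D(2,3)] D(4)]]
  proof (intro ballI allI)
    fix a b assume a: "a \<in> {1..<d}"
    then have a0: "a > 0" by simp
    have t2: "theta (D_simple \<zeta> (2, 0)) a b = \<zeta> ^ b * (\<zeta> ^ a + 1)"
      by (simp add: theta_D_simple[OF a0] szed_def skappa_def numeral_2_eq_2)
    have e: "2 * (p + 1) + l - 1 = Suc (2 * p + l)" "2 * p + (l + 2) - 1 = Suc (2 * p + l)" "2 * p + (l + 1) - 1 = 2 * p + l" by auto
    have "theta (D_simple \<zeta> (l + 2, p)) a b = theta (D_simple \<zeta> (2, 0)) a b * theta (D_simple \<zeta> (l + 1, p)) a b - theta (D_simple \<zeta> (l, p + 1)) a b"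
    proof (rule theta_eqI[OF a])
      have "(\<zeta> ^ a - 1) * (theta (D_simple \<zeta> (2, 0)) a b * theta (D_simple \<zeta> (l + 1, p)) a b - theta (D_simple \<zeta> (l, p + 1)) a b) =
        \<zeta> ^ b * (\<zeta> ^ a + 1) * hnum (l + 1) p a b - hnum l (p + 1) a b"
        unfolding t2 theta_hnum[OF a0, symmetric] by (simp add: algebra_simps)
      also have "\<dots> = hnum (l + 2) p a b"
        unfolding hnum_def e by (simp add: power_mult_distrib power_add algebra_simps)
      also have "\<dots> = (\<zeta> ^ a - 1) * theta (D_simple \<zeta> (l + 2, p)) a b" by (rule theta_hnum[OF a0, symmetric])
      finally show "(\<zeta> ^ a - 1) * theta (D_simple \<zeta> (l + 2, p)) a b = (\<zeta> ^ a - 1) *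
        (theta (D_simple \<zeta> (2, 0)) a b * theta (D_simple \<zeta> (l + 1, p)) a b - theta (D_simple \<zeta> (l, p + 1)) a b)" by (rule sym)
    qed
    then show "Th (frag_of (D_simple \<zeta> (l + 2, p))) a b =
      Th (omul (frag_of (D_simple \<zeta> (2, 0))) (frag_of (D_simple \<zeta> (l + 1, p))) - frag_of (D_simple \<zeta> (l, p + 1))) a b"
      by (simp only: Th_diff Th_omul[OF D(2,3) a0] Th_of)
  qed
qed

text \<open>Tensoring with the one-dimensional module multiplies each K-weight by \<zeta> and the
  z-eigenvalue by \<zeta>^2, which is the effect of raising p by one.\<close>

lemma D_simple_twist:
  assumes "0 < l" "l \<le> d"
  shows "cls (frag_of (D_simple \<zeta> (l, p + 1))) = cls (omul (frag_of (D_simple \<zeta> (1, 1))) (frag_of (D_simple \<zeta> (l, p))))"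
proof -
  have D: "frag_of (D_simple \<zeta> (l, p + 1)) \<in> carrier FG" "frag_of (D_simple \<zeta> (1, 1)) \<in> carrier FG"
    "frag_of (D_simple \<zeta> (l, p)) \<in> carrier FG"
    by (rule FG_of, rule D_simple_D, use assms d2 in simp, use assms d2 in simp)+
  show ?thesis unfolding cls_eq_iff[OF D(1) omul_closed[OF D(2,3)]]
  proof (intro ballI allI)
    fix a b assume a: "a \<in> {1..<d}"
    then have a0: "a > 0" by simp
    have t1: "theta (D_simple \<zeta> (1, 1)) a b = (\<zeta> ^ 2) ^ b * \<zeta> ^ a"
      by (simp add: theta_D_simple[OF a0] szed_def skappa_def)
    have e: "2 * (p + 1) + l - 1 = 2 * p + l - 1 + 2" "p + 1 + l = p + l + 1" using assms by auto
    have "theta (D_simple \<zeta> (l, p + 1)) a b = theta (D_simple \<zeta> (1, 1)) a b * theta (D_simple \<zeta> (l, p)) a b"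
    proof (rule theta_eqI[OF a])
      have "(\<zeta> ^ a - 1) * (theta (D_simple \<zeta> (1, 1)) a b * theta (D_simple \<zeta> (l, p)) a b) = (\<zeta> ^ 2) ^ b * \<zeta> ^ a * hnum l p a b"
        unfolding t1 theta_hnum[OF a0, symmetric] by (simp add: algebra_simps)
      also have "\<dots> = hnum l (p + 1) a b"
        unfolding hnum_def e power_add power_one_right power_mult_distrib by (simp add: algebra_simps)
      also have "\<dots> = (\<zeta> ^ a - 1) * theta (D_simple \<zeta> (l, p + 1)) a b" by (rule theta_hnum[OF a0, symmetric])
      finally show "(\<zeta> ^ a - 1) * theta (D_simple \<zeta> (l, p + 1)) a b = (\<zeta> ^ a - 1) *
        (theta (D_simple \<zeta> (1, 1)) a b * theta (D_simple \<zeta> (l, p)) a b)" by (rule sym)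
    qed
    then show "Th (frag_of (D_simple \<zeta> (l, p + 1))) a b = Th (omul (frag_of (D_simple \<zeta> (1, 1))) (frag_of (D_simple \<zeta> (l, p)))) a b"
      by (simp only: Th_omul[OF D(2,3) a0] Th_of)
  qed
qed

text \<open>The recursion in l changes p, so the induction treats all p at once; twisting by the
  one-dimensional class reduces the initial cases l = 1 and l = 2 to p = 0.\<close>

lemma generate_GR: "generate_ring GR {m_st_B d \<zeta> (1, 1), m_st_B d \<zeta> (2, 0)} = carrier GR"
proof
  let ?H = "generate_ring GR {m_st_B d \<zeta> (1, 1), m_st_B d \<zeta> (2, 0)}"
  have D: "frag_of (D_simple \<zeta> (l, p)) \<in> carrier FG" if "0 < l" "l \<le> d" for l p
    using FG_of D_simple_D[OF that] by blast
  show "?H \<subseteq> carrier GR"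
    by (rule G.generate_ring_incl) (use D[of 1 1] D[of 2 0] d2 in \<open>simp add: m_st_B_cls del: carrier_free_Abelian_group_iff\<close>)
  have v: "cls (frag_of (D_simple \<zeta> (1, 1))) \<in> ?H" and m2: "cls (frag_of (D_simple \<zeta> (2, 0))) \<in> ?H"
    unfolding m_st_B_cls by (rule generate_ring.incl, simp)+
  have mult: "cls (omul f g) \<in> ?H" if "cls f \<in> ?H" "cls g \<in> ?H" "f \<in> carrier FG" "g \<in> carrier FG" for f g
    using generate_ring.eng_mult[OF that(1,2)] GR_mult[OF that(3,4)] by simp
  have diff: "cls (f - g) \<in> ?H" if "cls f \<in> ?H" "cls g \<in> ?H" "g \<in> carrier FG" for f g
    using generate_ring.eng_add[OF that(1) generate_ring.a_inv[OF that(2)]] GR_uminus[OF that(3)] GR_add[of f "- g"] by simp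
  have twist: "cls (frag_of (D_simple \<zeta> (l, p))) \<in> ?H" if "cls (frag_of (D_simple \<zeta> (l, 0))) \<in> ?H" "0 < l" "l \<le> d" for l p
  proof (induction p)
    case (Suc p)
    then show ?case using D_simple_twist[OF that(2,3), of p] mult[OF v Suc D D[OF that(2,3)]] d2 by simp
  qed (use that in simp)
  have s: "\<forall>p. cls (frag_of (D_simple \<zeta> (l, p))) \<in> ?H" if "0 < l" "l \<le> d" for l
    using that
  proof (induction l rule: less_induct)
    case (less l)
    consider "l = 1" | "l = 2" | "l > 2" using less.prems by linarith
    then show ?case
    proof cases
      case 1
      have "cls (frag_of (D_simple \<zeta> (l, 0))) \<in> ?H"
        using generate_ring.one[of GR] unfolding GR_one D_unit_eq 1 .
      then show ?thesis using twist less.prems by simp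
    next
      case 2
      then show ?thesis using twist[of 2] m2 less.prems by simp
    next
      case 3
      define k where "k = l - 2"
      have k: "l = k + 2" "0 < k" "k + 2 \<le> d" using 3 less.prems by (auto simp: k_def)
      have "cls (frag_of (D_simple \<zeta> (k + 1, p))) \<in> ?H" "cls (frag_of (D_simple \<zeta> (k, p + 1))) \<in> ?H" for p
        using less.IH[of "k + 1"] less.IH[of k] k by auto
      then have "cls (omul (frag_of (D_simple \<zeta> (2, 0))) (frag_of (D_simple \<zeta> (k + 1, p))) - frag_of (D_simple \<zeta> (k, p + 1))) \<in> ?H" for p
        using k d2 by (intro diff mult m2 D) auto
      then show ?thesis unfolding k(1) using D_simple_succ[OF k(2,3)] by simp
    qed
  qed
  show "carrier GR \<subseteq> ?H"
  proof
    fix y assume "y \<in> carrier GR"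
    then obtain f where f: "f \<in> carrier FG" "y = cls f" using GR_carrier by blast
    obtain g where g: "Poly_Mapping.keys g \<subseteq> D_simple \<zeta> ` reps0" "f - g \<in> I" using spn_all[OF reps0 f(1)] by (auto simp: spn_def[OF reps0])
    have "cls g \<in> ?H \<and> g \<in> carrier FG" using g(1)
    proof (induction g rule: frag_induction)
      case zero
      show ?case using G.zero_in_generate by (simp add: GR_zero)
    next
      case (one M)
      then obtain l p where "(l, p) \<in> reps0" "M = D_simple \<zeta> (l, p)" by auto
      moreover from this have "0 < l" "l \<le> d" by (auto simp: reps0_def)
      ultimately show ?case using s D by blast
    next
      case (diff a b)
      then show ?case using \<open>\<And>f g. _ \<Longrightarrow> _ \<Longrightarrow> _ \<Longrightarrow> cls (f - g) \<in> ?H\<close> FG_diff by blast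
    qed
    moreover from this have "cls f = cls g" using cls_eq_iff[OF f(1)] Th_I[OF g(2)] by (simp add: Th_diff)
    ultimately show "y \<in> ?H" using f(2) by simp
  qed
qed

lemma m_st_B_carrier: "iota_orbit_representatives d S \<Longrightarrow> x \<in> S \<Longrightarrow> m_st_B d \<zeta> x \<in> carrier GR"
  unfolding m_st_B_cls by (rule cls_carrier[OF FG_of]) (rule reps_D)

end

theorem theorem5p5:
  fixes d :: nat and \<zeta> :: complex
  assumes "d \<ge> 2" and "primitive_unity_root d \<zeta>"
  shows "ring (Gr_st_B d \<zeta>) \<and>
    generate_ring (Gr_st_B d \<zeta>) {m_st_B d \<zeta> (1, 1), m_st_B d \<zeta> (2, 0)} = carrier (Gr_st_B d \<zeta>) \<and>
    (\<forall>S. iota_orbit_representatives d S \<longrightarrow>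
       (\<forall>x\<in>S. m_st_B d \<zeta> x \<in> carrier (Gr_st_B d \<zeta>)) \<and>
       (\<forall>y\<in>carrier (Gr_st_B d \<zeta>). \<exists>!c. c \<in> S \<rightarrow>\<^sub>E (UNIV :: int set) \<and>
          y = (\<Oplus>\<^bsub>Gr_st_B d \<zeta>\<^esub>x\<in>S. add_pow (Gr_st_B d \<zeta>) (c x) (m_st_B d \<zeta> x)))) \<and>
    add_monoid (Gr_st_B d \<zeta>) \<cong> free_Abelian_group {..<d * (d - 1) div 2}"
proof -
  interpret taft d \<zeta> by unfold_locales (use assms in auto)
  show ?thesis
    by (intro conjI allI impI ballI ring_GR generate_GR m_st_B_carrier basis_unique_existence free_GR)
qed

end
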